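(* Let $A=\mathbb{S}^{nc}(V)$. (1) For every $i\in\mathbb{Z}$, the right $A$-module $e_iA$ is 2-pure, critical and uniform. (2) $A$ is a domain. In particular, $A$ has a ring of fractions.
   Context: $K_0,K_1$ are fields of characteristic $\neq 2$ and $V$ is a $K_0$-$K_1$-bimodule of rank two: $\dim_{K_0}V=\dim V_{K_1}=2$. For $i\in\mathbb{Z}$ put $K_i=K_0$ if $i$ is even, $K_i=K_1$ if $i$ is odd. For fields $L,M$ and an $L$-$M$-bimodule $W$, the right dual $W^*=\operatorname{Hom}_M(W_M,M)$ and left dual ${}^*W=\operatorname{Hom}_L({}_LW,L)$ are $M$-$L$-bimodules via $(a\psi b)(v)=a\psi(bv)$, respectively $(a\phi b)(v)=b\phi(va)$. Put $V^{0*}=V$, $V^{i*}=(V^{(i-1)*})^*$ for $i>0$, $V^{i*}={}^*(V^{(i+1)*})$ for $i<0$; $V^{i*}$ is a $K_i$-$K_{i+1}$-bimodule of rank two, and $V^{(i+1)*}$ is canonically the right dual of $V^{i*}$ for every $i$. A $\mathbb{Z}$-indexed algebra $D$ consists of abelian groups $D_{ij}$ ($i,j\in\mathbb{Z}$) with associative biadditive multiplications $D_{ij}\times D_{jl}\to D_{il}$ and units $e_i\in D_{ii}$. A (graded) right $D$-module is $M=\bigoplus_iM_i$ with multiplications $M_i\times D_{ij}\to M_j$ satisfying the usual axioms; left modules are defined symmetrically. Submodules are graded. Let $T$ be the tensor $\mathbb{Z}$-indexed algebra: $T_{ij}=0$ for $i>j$, $T_{ii}=K_i$, $T_{ij}=V^{i*}\otimes_{K_{i+1}}\cdots\otimes_{K_{j-1}}V^{(j-1)*}$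 for $i<j$. Let $Q_i\subset V^{i*}\otimes V^{(i+1)*}\cong\operatorname{End}_{K_{i+1}}(V^{i*})$ be the image of $K_i$ acting by left multiplication; it is generated by $\sum_s x_s\otimes x_s^*$ for any right basis $\{x_s\}$ of $V^{i*}$ with dual basis $\{x_s^*\}$. The non-commutative symmetric algebra is $A=\mathbb{S}^{nc}(V)=T/R$, $R$ the ideal generated by all $Q_i$. For a noetherian right $A$-module $M$, $f_M(n)=\dim_{K_n}M_n$ is eventually a polynomial $cn+d$, and so $\sum_{i\le n}f_M(i)$ is eventually a polynomial $h_M(n)$; $\dim M:=\deg h_M$. $M$ is critical if $\dim M/N<\dim M$ for every non-zero submodule $N$; $M$ is $d$-pure if $\dim M=d$ and $\dim N=d$ for every non-zero submodule $N\le M$; a module is uniform if any two non-zero submodules have non-zero intersection. A $\mathbb{Z}$-indexed algebra $D$ is a domain if (i) for all $i,j$ and non-zero $a\in D_{ij}$, and non-zero $b\in D_{jl}$, $c\in D_{hi}$, one has $ab\neq0$ and $ca\neq0$; and (ii) $D_{i,i+1}\neq0$ for all $i$. $D$ has a ring of fractions if it is a domain and all $e_iD$ are uniform right modules and all $De_i$ are uniform left modules (the ring of fractions is then the $\mathbb{Z}$-indexed algebra obtained by inverting all non-zero elements of the $D_{ij}$, which form a left and right Ore set). *)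

theory Defs
  imports
    "HOL-Algebra.Free_Abelian_Groups"
    "HOL-Algebra.Generated_Groups"
    "HOL-Computational_Algebra.Polynomial"
    "HOL-Library.Extended_Real"
    "HOL-Algebra.Module"
begin

section \<open>Bimodules over two fields and their duals\<close>

definition is_basis ::
  "('k, 'c) ring_scheme \<Rightarrow> ('k, 'v, 'd) module_scheme \<Rightarrow> nat \<Rightarrow> (nat \<Rightarrow> 'v) \<Rightarrow> bool" where
  "is_basis R M n x \<longleftrightarrow>
     x \<in> {..<n} \<rightarrow> carrier M \<and>
     (\<forall>v\<in>carrier M. \<exists>!c. c \<in> {..<n} \<rightarrow>\<^sub>E carrier R \<and>
        v = (\<Oplus>\<^bsub>M\<^esub>s\<in>{..<n}. c s \<odot>\<^bsub>M\<^esub> x s))"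

definition has_dimension ::
  "('k, 'c) ring_scheme \<Rightarrow> ('k, 'v, 'd) module_scheme \<Rightarrow> nat \<Rightarrow> bool" where
  "has_dimension R M n \<longleftrightarrow> (\<exists>x. is_basis R M n x)"

text \<open>
  As in the library's record for modules, the multiplication and the unit that a bimodule
  inherits from the ring record are never used. A right module over a field is the same thing
  as a left module, which is how the right-hand structure reuses the library's locale.
\<close>

record ('k, 'v) bimodule = "('k, 'v) module" +
  rsmult :: "'v \<Rightarrow> 'k \<Rightarrow> 'v"

definition right_mod :: "('k, 'v) bimodule \<Rightarrow> ('k, 'v) module" where
  "right_mod V = \<lparr>carrier = carrier V, monoid.mult = monoid.mult V, one = one V,
     zero = zero V, add = add V, module.smult = (\<lambda>a v. rsmult V v a)\<rparr>"

locale bimodule =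
  fixes L M :: "'k ring" and V :: "('k, 'v) bimodule"
  assumes left_module: "module L V"
    and right_module: "module M (right_mod V)"
    and smult_rsmult: "\<lbrakk>a \<in> carrier L; b \<in> carrier M; v \<in> carrier V\<rbrakk> \<Longrightarrow>
      rsmult V (a \<odot>\<^bsub>V\<^esub> v) b = a \<odot>\<^bsub>V\<^esub> rsmult V v b"

locale rank_two_bimodule = bimodule +
  assumes left_dimension: "has_dimension L V 2"
    and right_dimension: "has_dimension M (right_mod V) 2"

definition right_dual :: "'k ring \<Rightarrow> 'k ring \<Rightarrow> ('k, 'v) bimodule \<Rightarrow> ('k, 'v \<Rightarrow> 'k) bimodule" where
  "right_dual L M V = \<lparr>
     carrier = {\<psi> \<in> carrier V \<rightarrow>\<^sub>E carrier M.
        (\<forall>v\<in>carrier V. \<forall>w\<in>carrier V. \<psi> (v \<oplus>\<^bsub>V\<^esub> w) = \<psi> v \<oplus>\<^bsub>M\<^esub> \<psi> w) \<and>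
        (\<forall>v\<in>carrier V. \<forall>c\<in>carrier M. \<psi> (rsmult V v c) = \<psi> v \<otimes>\<^bsub>M\<^esub> c)},
     monoid.mult = undefined, one = undefined,
     zero = (\<lambda>v\<in>carrier V. \<zero>\<^bsub>M\<^esub>),
     add = (\<lambda>\<psi> \<psi>'. \<lambda>v\<in>carrier V. \<psi> v \<oplus>\<^bsub>M\<^esub> \<psi>' v),
     module.smult = (\<lambda>a \<psi>. \<lambda>v\<in>carrier V. a \<otimes>\<^bsub>M\<^esub> \<psi> v),
     rsmult = (\<lambda>\<psi> b. \<lambda>v\<in>carrier V. \<psi> (b \<odot>\<^bsub>V\<^esub> v))\<rparr>"

definition left_dual :: "'k ring \<Rightarrow> 'k ring \<Rightarrow> ('k, 'v) bimodule \<Rightarrow> ('k, 'v \<Rightarrow> 'k) bimodule" where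
  "left_dual L M V = \<lparr>
     carrier = {\<phi> \<in> carrier V \<rightarrow>\<^sub>E carrier L.
        (\<forall>v\<in>carrier V. \<forall>w\<in>carrier V. \<phi> (v \<oplus>\<^bsub>V\<^esub> w) = \<phi> v \<oplus>\<^bsub>L\<^esub> \<phi> w) \<and>
        (\<forall>v\<in>carrier V. \<forall>c\<in>carrier L. \<phi> (c \<odot>\<^bsub>V\<^esub> v) = c \<otimes>\<^bsub>L\<^esub> \<phi> v)},
     monoid.mult = undefined, one = undefined,
     zero = (\<lambda>v\<in>carrier V. \<zero>\<^bsub>L\<^esub>),
     add = (\<lambda>\<phi> \<phi>'. \<lambda>v\<in>carrier V. \<phi> v \<oplus>\<^bsub>L\<^esub> \<phi>' v),
     module.smult = (\<lambda>a \<phi>. \<lambda>v\<in>carrier V. \<phi> (rsmult V v a)),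
     rsmult = (\<lambda>\<phi> b. \<lambda>v\<in>carrier V. b \<otimes>\<^bsub>L\<^esub> \<phi> v)\<rparr>"

definition bimodule_iso ::
  "'k ring \<Rightarrow> 'k ring \<Rightarrow> ('k, 'v) bimodule \<Rightarrow> ('k, 'w) bimodule \<Rightarrow> ('v \<Rightarrow> 'w) \<Rightarrow> bool" where
  "bimodule_iso L M V W f \<longleftrightarrow>
     bij_betw f (carrier V) (carrier W) \<and>
     (\<forall>v\<in>carrier V. \<forall>w\<in>carrier V. f (v \<oplus>\<^bsub>V\<^esub> w) = f v \<oplus>\<^bsub>W\<^esub> f w) \<and>
     (\<forall>a\<in>carrier L. \<forall>v\<in>carrier V. f (a \<odot>\<^bsub>V\<^esub> v) = a \<odot>\<^bsub>W\<^esub> f v) \<and>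
     (\<forall>b\<in>carrier M. \<forall>v\<in>carrier V. f (rsmult V v b) = rsmult W (f v) b)"

definition field_seq :: "'k ring \<Rightarrow> 'k ring \<Rightarrow> int \<Rightarrow> 'k ring" where
  "field_seq K0 K1 i = (if even i then K0 else K1)"

text \<open>
  The literal iterated duals live in ever larger function types. They are therefore represented
  on one fixed type: \<open>W i\<close> is a bimodule equipped, for \<open>i > 0\<close>, with an isomorphism
  \<open>\<theta> (i - 1)\<close> onto the right dual of \<open>W (i - 1)\<close> and, for \<open>i < 0\<close>, with an isomorphism \<open>\<theta> i\<close>
  onto the left dual of \<open>W (i + 1)\<close>. Any such system is the sequence of duals of \<open>V\<close>
  up to a unique compatible isomorphism.
\<close>

locale dual_sequence =
  fixes K :: "int \<Rightarrow> 'k ring" and V :: "('k, 'w) bimodule"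
    and W :: "int \<Rightarrow> ('k, 'w) bimodule" and \<theta> :: "int \<Rightarrow> 'w \<Rightarrow> 'w \<Rightarrow> 'k"
  assumes bimodules: "bimodule (K i) (K (i + 1)) (W i)"
    and start: "W 0 = V"
    and right_duals: "i \<ge> 0 \<Longrightarrow>
      bimodule_iso (K (i + 1)) (K i) (W (i + 1)) (right_dual (K i) (K (i + 1)) (W i)) (\<theta> i)"
    and left_duals: "i < 0 \<Longrightarrow>
      bimodule_iso (K i) (K (i + 1)) (W i) (left_dual (K (i + 1)) (K i) (W (i + 1))) (\<theta> i)"

text \<open>
  The pairing between \<open>W i\<close> and \<open>W (i + 1)\<close> through which \<open>W (i + 1)\<close> is the right dual
  of \<open>W i\<close>. For \<open>i < 0\<close> it is evaluation of functionals in \<open>W i\<close> on elements of \<open>W (i + 1)\<close>.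
\<close>

definition pairing :: "(int \<Rightarrow> 'w \<Rightarrow> 'w \<Rightarrow> 'k) \<Rightarrow> int \<Rightarrow> 'w \<Rightarrow> 'w \<Rightarrow> 'k" where
  "pairing \<theta> i v \<psi> = (if i \<ge> 0 then \<theta> i \<psi> v else \<theta> i v \<psi>)"


section \<open>Algebras indexed by the integers\<close>

text \<open>
  The abelian groups are commutative groups in the multiplicative notation of the library,
  so \<open>\<otimes>\<close> is their addition and \<open>\<one>\<close> their zero element.
\<close>

record 'a zalg =
  component :: "int \<Rightarrow> int \<Rightarrow> 'a monoid"
  zmult :: "int \<Rightarrow> int \<Rightarrow> int \<Rightarrow> 'a \<Rightarrow> 'a \<Rightarrow> 'a"
  zunit :: "int \<Rightarrow> 'a"

locale z_algebra =
  fixes D :: "'a zalg"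
  assumes comm_group_component: "comm_group (component D i j)"
    and zmult_closed: "\<lbrakk>a \<in> carrier (component D i j); b \<in> carrier (component D j l)\<rbrakk> \<Longrightarrow>
      zmult D i j l a b \<in> carrier (component D i l)"
    and zmult_add_left: "\<lbrakk>a \<in> carrier (component D i j); a' \<in> carrier (component D i j);
        b \<in> carrier (component D j l)\<rbrakk> \<Longrightarrow>
      zmult D i j l (a \<otimes>\<^bsub>component D i j\<^esub> a') b =
        zmult D i j l a b \<otimes>\<^bsub>component D i l\<^esub> zmult D i j l a' b"
    and zmult_add_right: "\<lbrakk>a \<in> carrier (component D i j); b \<in> carrier (component D j l);
        b' \<in> carrier (component D j l)\<rbrakk> \<Longrightarrow>
      zmult D i j l a (b \<otimes>\<^bsub>component D j l\<^esub> b') =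
        zmult D i j l a b \<otimes>\<^bsub>component D i l\<^esub> zmult D i j l a b'"
    and zmult_assoc: "\<lbrakk>a \<in> carrier (component D i j); b \<in> carrier (component D j l);
        c \<in> carrier (component D l m)\<rbrakk> \<Longrightarrow>
      zmult D i l m (zmult D i j l a b) c = zmult D i j m a (zmult D j l m b c)"
    and zunit_closed: "zunit D i \<in> carrier (component D i i)"
    and zunit_left: "a \<in> carrier (component D i j) \<Longrightarrow> zmult D i i j (zunit D i) a = a"
    and zunit_right: "a \<in> carrier (component D i j) \<Longrightarrow> zmult D i j j a (zunit D j) = a"

definition opposite :: "'a zalg \<Rightarrow> 'a zalg" where
  "opposite D = \<lparr>component = (\<lambda>i j. component D j i),
     zmult = (\<lambda>i j l a b. zmult D l j i b a), zunit = zunit D\<rparr>"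

definition zideal :: "'a zalg \<Rightarrow> (int \<Rightarrow> int \<Rightarrow> 'a set) \<Rightarrow> bool" where
  "zideal D I \<longleftrightarrow>
     (\<forall>i j. subgroup (I i j) (component D i j)) \<and>
     (\<forall>i j l. \<forall>x\<in>I i j. \<forall>d\<in>carrier (component D j l). zmult D i j l x d \<in> I i l) \<and>
     (\<forall>i j l. \<forall>d\<in>carrier (component D i j). \<forall>x\<in>I j l. zmult D i j l d x \<in> I i l)"

definition generated_zideal ::
  "'a zalg \<Rightarrow> (int \<Rightarrow> int \<Rightarrow> 'a set) \<Rightarrow> int \<Rightarrow> int \<Rightarrow> 'a set" where
  "generated_zideal D S i j = \<Inter>{I i j | I. zideal D I \<and> (\<forall>k l. S k l \<subseteq> I k l)}"

definition quotient_zalg :: "'a zalg \<Rightarrow> (int \<Rightarrow> int \<Rightarrow> 'a set) \<Rightarrow> 'a set zalg" where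
  "quotient_zalg D I = \<lparr>
     component = (\<lambda>i j. component D i j Mod I i j),
     zmult = (\<lambda>i j l X Y.
        I i l <#>\<^bsub>component D i l\<^esub> {zmult D i j l x y | x y. x \<in> X \<and> y \<in> Y}),
     zunit = (\<lambda>i. I i i #>\<^bsub>component D i i\<^esub> zunit D i)\<rparr>"


section \<open>Graded modules\<close>

record ('a, 'm) zmodule =
  part :: "int \<Rightarrow> 'm monoid"
  act :: "int \<Rightarrow> int \<Rightarrow> 'm \<Rightarrow> 'a \<Rightarrow> 'm"

locale right_zmodule =
  fixes D :: "'a zalg" and M :: "('a, 'm) zmodule"
  assumes comm_group_part: "comm_group (part M i)"
    and act_closed: "\<lbrakk>x \<in> carrier (part M i); a \<in> carrier (component D i j)\<rbrakk> \<Longrightarrow>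
      act M i j x a \<in> carrier (part M j)"
    and act_add_left: "\<lbrakk>x \<in> carrier (part M i); y \<in> carrier (part M i);
        a \<in> carrier (component D i j)\<rbrakk> \<Longrightarrow>
      act M i j (x \<otimes>\<^bsub>part M i\<^esub> y) a = act M i j x a \<otimes>\<^bsub>part M j\<^esub> act M i j y a"
    and act_add_right: "\<lbrakk>x \<in> carrier (part M i); a \<in> carrier (component D i j);
        b \<in> carrier (component D i j)\<rbrakk> \<Longrightarrow>
      act M i j x (a \<otimes>\<^bsub>component D i j\<^esub> b) = act M i j x a \<otimes>\<^bsub>part M j\<^esub> act M i j x b"
    and act_assoc: "\<lbrakk>x \<in> carrier (part M i); a \<in> carrier (component D i j);
        b \<in> carrier (component D j l)\<rbrakk> \<Longrightarrow>
      act M j l (act M i j x a) b = act M i l x (zmult D i j l a b)"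
    and act_unit: "x \<in> carrier (part M i) \<Longrightarrow> act M i i x (zunit D i) = x"

definition zsubmodule :: "'a zalg \<Rightarrow> ('a, 'm) zmodule \<Rightarrow> (int \<Rightarrow> 'm set) \<Rightarrow> bool" where
  "zsubmodule D M N \<longleftrightarrow>
     (\<forall>i. subgroup (N i) (part M i)) \<and>
     (\<forall>i j. \<forall>x\<in>N i. \<forall>a\<in>carrier (component D i j). act M i j x a \<in> N j)"

definition nonzero :: "('a, 'm) zmodule \<Rightarrow> (int \<Rightarrow> 'm set) \<Rightarrow> bool" where
  "nonzero M N \<longleftrightarrow> (\<exists>i. \<exists>x\<in>N i. x \<noteq> \<one>\<^bsub>part M i\<^esub>)"

definition restrict_zmodule :: "('a, 'm) zmodule \<Rightarrow> (int \<Rightarrow> 'm set) \<Rightarrow> ('a, 'm) zmodule" where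
  "restrict_zmodule M N = M\<lparr>part := (\<lambda>i. (part M i)\<lparr>carrier := N i\<rparr>)\<rparr>"

definition quotient_zmodule :: "('a, 'm) zmodule \<Rightarrow> (int \<Rightarrow> 'm set) \<Rightarrow> ('a, 'm set) zmodule" where
  "quotient_zmodule M N = \<lparr>
     part = (\<lambda>i. part M i Mod N i),
     act = (\<lambda>i j X a. N j <#>\<^bsub>part M j\<^esub> {act M i j x a | x. x \<in> X})\<rparr>"

text \<open>The right module \<open>e\<^sub>iD\<close>.\<close>

definition principal_zmodule :: "'a zalg \<Rightarrow> int \<Rightarrow> ('a, 'a) zmodule" where
  "principal_zmodule D i = \<lparr>part = component D i, act = zmult D i\<rparr>"

text \<open>
  Left modules over \<open>D\<close> are right modules over \<open>opposite D\<close>, so the left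
  module \<open>De\<^sub>i\<close> is \<open>principal_zmodule (opposite D) i\<close>.
\<close>

definition uniform_zmodule :: "'a zalg \<Rightarrow> ('a, 'm) zmodule \<Rightarrow> bool" where
  "uniform_zmodule D M \<longleftrightarrow> right_zmodule D M \<and>
     (\<forall>N N'. zsubmodule D M N \<and> nonzero M N \<and> zsubmodule D M N' \<and> nonzero M N' \<longrightarrow>
        nonzero M (\<lambda>i. N i \<inter> N' i))"

definition diagonal_ring :: "'a zalg \<Rightarrow> int \<Rightarrow> 'a ring" where
  "diagonal_ring D n = \<lparr>carrier = carrier (component D n n), monoid.mult = zmult D n n n,
     one = zunit D n, zero = \<one>\<^bsub>component D n n\<^esub>, add = monoid.mult (component D n n)\<rparr>"

definition part_module :: "('a, 'm) zmodule \<Rightarrow> int \<Rightarrow> ('a, 'm) module" where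
  "part_module M n = \<lparr>carrier = carrier (part M n), monoid.mult = undefined, one = undefined,
     zero = \<one>\<^bsub>part M n\<^esub>, add = monoid.mult (part M n),
     module.smult = (\<lambda>a x. act M n n x a)\<rparr>"

text \<open>
  The dimension of \<open>M\<close> is \<open>d\<close>. The Hilbert function \<open>f\<close> is taken over the
  rings \<open>D\<^sub>n\<^sub>n\<close>, which for the non-commutative symmetric algebra below are the fields \<open>K\<^sub>n\<close>.
  The zero polynomial, hence the zero module, has degree \<open>-\<infinity>\<close> here, unlike in the library;
  otherwise a finite-dimensional module and its zero quotient would have the same dimension.
  Vanishing terms are discarded because sums over infinite sets are \<open>0\<close> by convention.
\<close>

definition zmodule_dim :: "'a zalg \<Rightarrow> ('a, 'm) zmodule \<Rightarrow> ereal \<Rightarrow> bool" where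
  "zmodule_dim D M d \<longleftrightarrow> (\<exists>(f :: int \<Rightarrow> nat) (h :: real poly).
     (\<forall>n. has_dimension (diagonal_ring D n) (part_module M n) (f n)) \<and>
     (\<forall>n. finite {i. i \<le> n \<and> f i \<noteq> 0}) \<and>
     (\<forall>\<^sub>F n in at_top. real (\<Sum>i | i \<le> n \<and> f i \<noteq> 0. f i) = poly h (real_of_int n)) \<and>
     d = (if h = 0 then -\<infinity> else ereal (real (Polynomial.degree h))))"

definition critical_zmodule :: "'a zalg \<Rightarrow> ('a, 'm) zmodule \<Rightarrow> bool" where
  "critical_zmodule D M \<longleftrightarrow> right_zmodule D M \<and>
     (\<exists>d. zmodule_dim D M d \<and>
       (\<forall>N. zsubmodule D M N \<and> nonzero M N \<longrightarrow>
          (\<exists>d'. zmodule_dim D (quotient_zmodule M N) d' \<and> d' < d)))"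

definition pure_zmodule :: "'a zalg \<Rightarrow> ('a, 'm) zmodule \<Rightarrow> nat \<Rightarrow> bool" where
  "pure_zmodule D M d \<longleftrightarrow> right_zmodule D M \<and> zmodule_dim D M (ereal (real d)) \<and>
     (\<forall>N. zsubmodule D M N \<and> nonzero M N \<longrightarrow>
        zmodule_dim D (restrict_zmodule M N) (ereal (real d)))"

text \<open>
  Stated once with the indices universally quantified, the absence of zero divisors covers
  multiplication by non-zero elements on either side.
\<close>

locale z_domain = z_algebra +
  assumes no_zero_divisors: "\<lbrakk>a \<in> carrier (component D i j); a \<noteq> \<one>\<^bsub>component D i j\<^esub>;
        b \<in> carrier (component D j l); b \<noteq> \<one>\<^bsub>component D j l\<^esub>\<rbrakk> \<Longrightarrow>
      zmult D i j l a b \<noteq> \<one>\<^bsub>component D i l\<^esub>"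
    and nonzero_step: "carrier (component D i (i + 1)) \<noteq> {\<one>\<^bsub>component D i (i + 1)\<^esub>}"

definition has_ring_of_fractions :: "'a zalg \<Rightarrow> bool" where
  "has_ring_of_fractions D \<longleftrightarrow> z_domain D \<and>
     (\<forall>i. uniform_zmodule D (principal_zmodule D i)) \<and>
     (\<forall>i. uniform_zmodule (opposite D) (principal_zmodule (opposite D) i))"


section \<open>The tensor algebra and the non-commutative symmetric algebra\<close>

definition words :: "(int \<Rightarrow> ('k, 'w) bimodule) \<Rightarrow> int \<Rightarrow> int \<Rightarrow> 'w list set" where
  "words W i j = {ws. int (length ws) = j - i \<and>
     (\<forall>n<length ws. ws ! n \<in> carrier (W (i + int n)))}"

definition tensor_relations ::
  "(int \<Rightarrow> 'k ring) \<Rightarrow> (int \<Rightarrow> ('k, 'w) bimodule) \<Rightarrow> int \<Rightarrow> int \<Rightarrow> ('w list \<Rightarrow>\<^sub>0 int) set" where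
  "tensor_relations K W i j =
     {frag_of (us @ (v \<oplus>\<^bsub>W (i + int (length us))\<^esub> v') # ts)
        - frag_of (us @ v # ts) - frag_of (us @ v' # ts) | us v v' ts.
        us @ v # ts \<in> words W i j \<and> us @ v' # ts \<in> words W i j} \<union>
     {frag_of (us @ rsmult (W (i + int (length us))) v b # w # ts)
        - frag_of (us @ v # (b \<odot>\<^bsub>W (i + int (length us) + 1)\<^esub> w) # ts) | us v b w ts.
        us @ v # w # ts \<in> words W i j \<and> b \<in> carrier (K (i + int (length us) + 1))}"

definition tensor_kernel ::
  "(int \<Rightarrow> 'k ring) \<Rightarrow> (int \<Rightarrow> ('k, 'w) bimodule) \<Rightarrow> int \<Rightarrow> int \<Rightarrow> ('w list \<Rightarrow>\<^sub>0 int) set" where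
  "tensor_kernel K W i j = generate (free_Abelian_group (words W i j)) (tensor_relations K W i j)"

text \<open>
  Elements of \<open>T\<^sub>i\<^sub>i = K\<^sub>i\<close> are scalars, all others are classes in the quotient of a free
  abelian group on words. There are no words for \<open>i > j\<close>, so this quotient is then trivial.
\<close>

datatype ('k, 'w) tensor = Scalar (scalar: 'k) | Tensor (tensor_class: "('w list \<Rightarrow>\<^sub>0 int) set")

definition tensor_component ::
  "(int \<Rightarrow> 'k ring) \<Rightarrow> (int \<Rightarrow> ('k, 'w) bimodule) \<Rightarrow> int \<Rightarrow> int \<Rightarrow> ('k, 'w) tensor monoid" where
  "tensor_component K W i j =
     (if i = j then
        \<lparr>carrier = Scalar ` carrier (K i),
         monoid.mult = (\<lambda>x y. Scalar (scalar x \<oplus>\<^bsub>K i\<^esub> scalar y)),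
         one = Scalar \<zero>\<^bsub>K i\<^esub>\<rparr>
      else
        (let G = free_Abelian_group (words W i j) Mod tensor_kernel K W i j in
        \<lparr>carrier = Tensor ` carrier G,
         monoid.mult = (\<lambda>x y. Tensor (tensor_class x \<otimes>\<^bsub>G\<^esub> tensor_class y)),
         one = Tensor \<one>\<^bsub>G\<^esub>\<rparr>))"

definition pure_tensor ::
  "(int \<Rightarrow> 'k ring) \<Rightarrow> (int \<Rightarrow> ('k, 'w) bimodule) \<Rightarrow> int \<Rightarrow> int \<Rightarrow> 'w list \<Rightarrow> ('k, 'w) tensor" where
  "pure_tensor K W i j ws =
     Tensor (tensor_kernel K W i j #>\<^bsub>free_Abelian_group (words W i j)\<^esub> frag_of ws)"

fun scale_first :: "('k, 'w) bimodule \<Rightarrow> 'k \<Rightarrow> 'w list \<Rightarrow> 'w list" where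
  "scale_first U a [] = []"
| "scale_first U a (v # ts) = (a \<odot>\<^bsub>U\<^esub> v) # ts"

definition scale_last :: "('k, 'w) bimodule \<Rightarrow> 'w list \<Rightarrow> 'k \<Rightarrow> 'w list" where
  "scale_last U ws b = butlast ws @ [rsmult U (last ws) b]"

text \<open>
  Products are computed on all representatives. A product of two classes can only land in a
  diagonal component if one of the factors lies in a trivial component.
\<close>

fun tensor_mult ::
  "(int \<Rightarrow> 'k ring) \<Rightarrow> (int \<Rightarrow> ('k, 'w) bimodule) \<Rightarrow> int \<Rightarrow> int \<Rightarrow> int \<Rightarrow>
   ('k, 'w) tensor \<Rightarrow> ('k, 'w) tensor \<Rightarrow> ('k, 'w) tensor" where
  "tensor_mult K W i j l (Scalar a) (Scalar b) = Scalar (a \<otimes>\<^bsub>K i\<^esub> b)"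
| "tensor_mult K W i j l (Scalar a) (Tensor Y) =
     Tensor (tensor_kernel K W i l <#>\<^bsub>free_Abelian_group (words W i l)\<^esub>
       {frag_extend (\<lambda>ws. frag_of (scale_first (W i) a ws)) g | g. g \<in> Y})"
| "tensor_mult K W i j l (Tensor X) (Scalar b) =
     Tensor (tensor_kernel K W i l <#>\<^bsub>free_Abelian_group (words W i l)\<^esub>
       {frag_extend (\<lambda>ws. frag_of (scale_last (W (l - 1)) ws b)) f | f. f \<in> X})"
| "tensor_mult K W i j l (Tensor X) (Tensor Y) =
     (if i = l then Scalar \<zero>\<^bsub>K i\<^esub>
      else Tensor (tensor_kernel K W i l <#>\<^bsub>free_Abelian_group (words W i l)\<^esub>
        {frag_extend (\<lambda>us. frag_extend (\<lambda>ws. frag_of (us @ ws)) g) f | f g. f \<in> X \<and> g \<in> Y}))"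

definition tensor_zalg ::
  "(int \<Rightarrow> 'k ring) \<Rightarrow> (int \<Rightarrow> ('k, 'w) bimodule) \<Rightarrow> ('k, 'w) tensor zalg" where
  "tensor_zalg K W = \<lparr>component = tensor_component K W, zmult = tensor_mult K W,
     zunit = (\<lambda>i. Scalar \<one>\<^bsub>K i\<^esub>)\<rparr>"

text \<open>
  Under \<open>v \<otimes> \<psi> \<mapsto> (u \<mapsto> v \<psi>(u))\<close>, the sum of \<open>a x\<^sub>s \<otimes> x\<^sub>s\<^sup>*\<close> over a right basis \<open>x\<close> of
  \<open>W i\<close> with dual basis \<open>x'\<close> corresponds to left multiplication by \<open>a\<close>, whatever the basis.
\<close>

definition quadratic_relations ::
  "(int \<Rightarrow> 'k ring) \<Rightarrow> (int \<Rightarrow> ('k, 'w) bimodule) \<Rightarrow> (int \<Rightarrow> 'w \<Rightarrow> 'w \<Rightarrow> 'k) \<Rightarrow> int \<Rightarrow>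
   ('k, 'w) tensor set" where
  "quadratic_relations K W \<theta> i =
     {(\<Otimes>\<^bsub>tensor_component K W i (i + 2)\<^esub>s\<in>{..<n}.
         pure_tensor K W i (i + 2) [a \<odot>\<^bsub>W i\<^esub> x s, x' s]) | a n x x'.
        a \<in> carrier (K i) \<and>
        is_basis (K (i + 1)) (right_mod (W i)) n x \<and>
        x' \<in> {..<n} \<rightarrow> carrier (W (i + 1)) \<and>
        (\<forall>s<n. \<forall>t<n. pairing \<theta> i (x s) (x' t) =
           (if s = t then \<one>\<^bsub>K (i + 1)\<^esub> else \<zero>\<^bsub>K (i + 1)\<^esub>))}"

definition nc_symmetric_algebra ::
  "(int \<Rightarrow> 'k ring) \<Rightarrow> (int \<Rightarrow> ('k, 'w) bimodule) \<Rightarrow> (int \<Rightarrow> 'w \<Rightarrow> 'w \<Rightarrow> 'k) \<Rightarrow>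
   ('k, 'w) tensor set zalg" where
  "nc_symmetric_algebra K W \<theta> = quotient_zalg (tensor_zalg K W)
     (generated_zideal (tensor_zalg K W)
       (\<lambda>i j. if j = i + 2 then quadratic_relations K W \<theta> i else {}))"

end

theory Submission
  imports Defs "HOL-Algebra.QuotRing"
begin

text \<open>
  For a subspace \<open>U\<close> of \<open>A\<^sub>i\<^sub>n\<close> let \<open>U V\<^sub>n \<subseteq> A\<^sub>i\<^sub>,\<^sub>n\<^sub>+\<^sub>1\<close> be its product with the two-dimensional component
  \<open>V\<^sub>n = A\<^sub>n\<^sub>,\<^sub>n\<^sub>+\<^sub>1\<close>. A relation \<open>a x' + b y' = 0\<close> with \<open>a, b\<close> in \<open>A\<^sub>i\<^sub>n\<close> and \<open>x', y'\<close> a left basis of \<open>V\<^sub>n\<close>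
  is a left multiple of the canonical element of \<open>V\<^sub>n\<^sub>-\<^sub>1 \<otimes> V\<^sub>n\<close>. Hence \<open>dim U V\<^sub>n = 2 dim U - dim U'\<close>,
  where \<open>U' \<subseteq> A\<^sub>i\<^sub>,\<^sub>n\<^sub>-\<^sub>1\<close> consists of all \<open>z\<close> with \<open>z V\<^sub>n\<^sub>-\<^sub>1 \<subseteq> U\<close>. By induction \<open>dim U' < dim U' V\<^sub>n\<^sub>-\<^sub>1 \<le> dim U\<close>
  if \<open>U' \<noteq> 0\<close>, so that \<open>dim U V\<^sub>n > dim U\<close> whenever \<open>U \<noteq> 0\<close>. As \<open>dim A\<^sub>i\<^sub>n = n - i + 1\<close>, this makes \<open>A\<close> a domain,
  and in a non-zero submodule of \<open>e\<^sub>iA\<close> the codimension eventually decreases to a constant; two such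
  submodules therefore meet. The left modules are handled by reversing \<open>A\<close>.

  Freeness of the tensor algebra gives the exactness above once every \<open>V\<^sup>i\<^sup>*\<close> has dimension two on
  both sides. The non-obvious case is the dimension of the right dual over the right-hand field.
\<close>

section \<open>Dimension of subspaces\<close>

text \<open>The identity \<open>dim U V = 2 dim U - dim U'\<close> compares spaces over the fields
  of three different vertices. It is proved by adjoining one vector \<open>e\<close> to
  \<open>U\<close> at a time: the overlap of the new part \<open>e V\<close> with \<open>U V\<close>
  must have the dimension by which \<open>U'\<close> grows. The map that compares the two starts at
  a space over the field of vertex \<open>n - 1\<close> and ends at one over the field of vertex
  \<open>n + 1\<close>, and scalars can be matched only vector by vector. This is why linearity is
  weakened to \<open>semilinear_on\<close>, and why dimension is measured by flags, where adjoining
  a vector is the basic operation. Zero divisors are then excluded by counting: for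
  \<open>a \<noteq> 0\<close> the spaces \<open>a A_jl\<close> start as a line at
  \<open>l = j\<close> and gain at least one dimension per degree, so they are as large as
  \<open>A_jl\<close>. Dual bases spread from \<open>V\<close> in both directions. Dualizing yields
  one of the two bases of the next bimodule at once; the other action sees no coordinates, and its
  basis is found by asking whether some line is stable under both fields.\<close>

definition subsp :: "('k, 'c) ring_scheme \<Rightarrow> ('k, 'v, 'd) module_scheme \<Rightarrow> 'v set \<Rightarrow> bool" where
  "subsp R M U \<longleftrightarrow> U \<subseteq> carrier M \<and> \<zero>\<^bsub>M\<^esub> \<in> U \<and> (\<forall>u\<in>U. \<forall>v\<in>U. u \<oplus>\<^bsub>M\<^esub> v \<in> U) \<and>
     (\<forall>a\<in>carrier R. \<forall>u\<in>U. a \<odot>\<^bsub>M\<^esub> u \<in> U)"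

definition adjoin ::
  "('k, 'c) ring_scheme \<Rightarrow> ('k, 'v, 'd) module_scheme \<Rightarrow> 'v set \<Rightarrow> 'v \<Rightarrow> 'v set" where
  "adjoin R M U e = {u \<oplus>\<^bsub>M\<^esub> a \<odot>\<^bsub>M\<^esub> e | u a. u \<in> U \<and> a \<in> carrier R}"

text \<open>Dimension as the length of a flag that grows by one vector at a time. Proofs can then
  follow the flag instead of handling families of coefficients; that all flags of a space have the
  same length is \<open>len_unique\<close>, and the coordinate form \<open>has_dimension\<close> is
  recovered in \<open>len_has_dimension\<close>.\<close>

inductive len ::
  "('k, 'c) ring_scheme \<Rightarrow> ('k, 'v, 'd) module_scheme \<Rightarrow> 'v set \<Rightarrow> nat \<Rightarrow> bool"
  for R M where
  zero: "len R M {\<zero>\<^bsub>M\<^esub>} 0"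
| step: "len R M U m \<Longrightarrow> e \<in> carrier M \<Longrightarrow> e \<notin> U \<Longrightarrow> len R M (adjoin R M U e) (Suc m)"

text \<open>The matching scalar may depend on the vector as well as on the scalar, and no
  isomorphism of fields is chosen. The last two clauses together say that \<open>f\<close> maps each
  line onto the line of the image vector, which is all that a dimension count needs.\<close>

definition semilinear_on ::
  "('k, 'c) ring_scheme \<Rightarrow> ('k, 'v, 'd) module_scheme \<Rightarrow> ('l, 'e) ring_scheme \<Rightarrow>
   ('l, 'w, 'f) module_scheme \<Rightarrow> 'v set \<Rightarrow> ('v \<Rightarrow> 'w) \<Rightarrow> bool" where
  "semilinear_on R M R' M' U f \<longleftrightarrow> f \<in> U \<rightarrow> carrier M' \<and>
     (\<forall>u\<in>U. \<forall>v\<in>U. f (u \<oplus>\<^bsub>M\<^esub> v) = f u \<oplus>\<^bsub>M'\<^esub> f v) \<and>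
     (\<forall>a\<in>carrier R. \<forall>u\<in>U. \<exists>b\<in>carrier R'. f (a \<odot>\<^bsub>M\<^esub> u) = b \<odot>\<^bsub>M'\<^esub> f u) \<and>
     (\<forall>b\<in>carrier R'. \<forall>u\<in>U. \<exists>a\<in>carrier R. b \<odot>\<^bsub>M'\<^esub> f u = f (a \<odot>\<^bsub>M\<^esub> u))"

lemma subspD:
  assumes "subsp R M U"
  shows "\<And>u. u \<in> U \<Longrightarrow> u \<in> carrier M" "\<zero>\<^bsub>M\<^esub> \<in> U"
    "\<And>u v. \<lbrakk>u \<in> U; v \<in> U\<rbrakk> \<Longrightarrow> u \<oplus>\<^bsub>M\<^esub> v \<in> U"
    "\<And>a u. \<lbrakk>a \<in> carrier R; u \<in> U\<rbrakk> \<Longrightarrow> a \<odot>\<^bsub>M\<^esub> u \<in> U"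
  using assms unfolding subsp_def by auto

locale fspace = module R M + field R for R (structure) and M (structure)
begin

lemma smult_cancel:
  assumes "a \<in> carrier R" "a \<noteq> \<zero>" "x \<in> carrier M"
  shows "inv a \<odot>\<^bsub>M\<^esub> (a \<odot>\<^bsub>M\<^esub> x) = x"
  using assms field_Units by (simp add: smult_assoc1[symmetric])

lemma subsp_neg: "subsp R M U \<Longrightarrow> u \<in> U \<Longrightarrow> \<ominus>\<^bsub>M\<^esub> u \<in> U"
  by (metis R.add.inv_closed R.one_closed smult_l_minus smult_one subspD(1) subspD(4))

lemma subsp_diff: "subsp R M U \<Longrightarrow> u \<in> U \<Longrightarrow> v \<in> U \<Longrightarrow> u \<ominus>\<^bsub>M\<^esub> v \<in> U"
  by (simp add: a_minus_def subsp_neg subspD)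

lemma subsp_cancel:
  assumes "subsp R M U" "u \<in> U" "x \<in> carrier M" "u \<oplus>\<^bsub>M\<^esub> x \<in> U"
  shows "x \<in> U"
proof -
  have "\<ominus>\<^bsub>M\<^esub> u \<oplus>\<^bsub>M\<^esub> (u \<oplus>\<^bsub>M\<^esub> x) \<in> U"
    using subspD(3)[OF assms(1) subsp_neg[OF assms(1,2)] assms(4)] .
  then show ?thesis using assms(3) subspD(1)[OF assms(1,2)] by (simp add: M.r_neg1)
qed

lemma subsp_smultD:
  assumes "subsp R M U" "a \<in> carrier R" "a \<noteq> \<zero>" "x \<in> carrier M" "a \<odot>\<^bsub>M\<^esub> x \<in> U"
  shows "x \<in> U"
proof -
  have "inv a \<in> carrier R" using assms field_Units by auto
  then show ?thesis using smult_cancel[of a x] assms subspD(4)[OF assms(1), of "inv a" "a \<odot>\<^bsub>M\<^esub> x"] by simp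
qed

lemma subsp_zero: "subsp R M {\<zero>\<^bsub>M\<^esub>}"
  by (auto simp: subsp_def)

lemma subsp_carrier: "subsp R M (carrier M)"
  by (auto simp: subsp_def)

lemma subsp_inter: "subsp R M U \<Longrightarrow> subsp R M W \<Longrightarrow> subsp R M (U \<inter> W)"
  by (auto simp: subsp_def)

lemma adjoin_subsp:
  assumes U: "subsp R M U" and e: "e \<in> carrier M"
  shows "subsp R M (adjoin R M U e)"
  unfolding subsp_def
proof (intro conjI ballI)
  note [simp] = subspD[OF U]
  show "adjoin R M U e \<subseteq> carrier M" using e by (auto simp: adjoin_def)
  have "\<zero>\<^bsub>M\<^esub> = \<zero>\<^bsub>M\<^esub> \<oplus>\<^bsub>M\<^esub> \<zero> \<odot>\<^bsub>M\<^esub> e" using e by simp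
  then show "\<zero>\<^bsub>M\<^esub> \<in> adjoin R M U e" unfolding adjoin_def using subspD(2)[OF U] by blast
next
  note [simp] = subspD[OF U]
  fix u v assume "u \<in> adjoin R M U e" "v \<in> adjoin R M U e"
  then obtain u' a v' b where *: "u = u' \<oplus>\<^bsub>M\<^esub> a \<odot>\<^bsub>M\<^esub> e" "v = v' \<oplus>\<^bsub>M\<^esub> b \<odot>\<^bsub>M\<^esub> e"
    "u' \<in> U" "v' \<in> U" "a \<in> carrier R" "b \<in> carrier R" by (auto simp: adjoin_def)
  then have "u \<oplus>\<^bsub>M\<^esub> v = (u' \<oplus>\<^bsub>M\<^esub> v') \<oplus>\<^bsub>M\<^esub> (a \<oplus> b) \<odot>\<^bsub>M\<^esub> e"
    using e by (simp add: smult_l_distr M.a_ac)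
  then show "u \<oplus>\<^bsub>M\<^esub> v \<in> adjoin R M U e" unfolding adjoin_def using * by force
next
  note [simp] = subspD[OF U]
  fix a u assume a: "a \<in> carrier R" and "u \<in> adjoin R M U e"
  then obtain u' b where *: "u = u' \<oplus>\<^bsub>M\<^esub> b \<odot>\<^bsub>M\<^esub> e" "u' \<in> U" "b \<in> carrier R"
    by (auto simp: adjoin_def)
  then have "a \<odot>\<^bsub>M\<^esub> u = a \<odot>\<^bsub>M\<^esub> u' \<oplus>\<^bsub>M\<^esub> (a \<otimes> b) \<odot>\<^bsub>M\<^esub> e"
    using e a by (simp add: smult_r_distr smult_assoc1)
  then show "a \<odot>\<^bsub>M\<^esub> u \<in> adjoin R M U e" unfolding adjoin_def using * a by force
qed

lemma adjoin_iff:
  "v \<in> adjoin R M U e \<longleftrightarrow> (\<exists>u\<in>U. \<exists>a\<in>carrier R. v = u \<oplus>\<^bsub>M\<^esub> a \<odot>\<^bsub>M\<^esub> e)"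
  by (auto simp: adjoin_def)

lemma adjoin_mem:
  assumes "subsp R M U" "e \<in> carrier M"
  shows "e \<in> adjoin R M U e"
  unfolding adjoin_iff by (intro bexI[of _ "\<zero>\<^bsub>M\<^esub>"] bexI[of _ \<one>]) (use assms subspD in auto)

lemma adjoin_sup:
  assumes "subsp R M U" "e \<in> carrier M"
  shows "U \<subseteq> adjoin R M U e"
proof
  fix u assume "u \<in> U"
  then have "u = u \<oplus>\<^bsub>M\<^esub> \<zero> \<odot>\<^bsub>M\<^esub> e" using assms subspD(1)[OF assms(1)] by auto
  then show "u \<in> adjoin R M U e" unfolding adjoin_iff using \<open>u \<in> U\<close> by blast
qed

lemma adjoin_least:
  assumes "subsp R M W" "U \<subseteq> W" "e \<in> W"
  shows "adjoin R M U e \<subseteq> W"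
  using assms subspD(3,4)[OF assms(1)] by (fastforce simp: adjoin_iff)

lemma len_subsp: "len R M U m \<Longrightarrow> subsp R M U"
  by (induction rule: len.induct) (auto intro: subsp_zero adjoin_subsp)

text \<open>A subspace of \<open>U + Re\<close> not contained in \<open>U\<close> meets \<open>U\<close> in a hyperplane.\<close>

lemma subsp_of_adjoin:
  assumes U: "subsp R M U" and e: "e \<in> carrier M" and V: "subsp R M V"
    and sub: "V \<subseteq> adjoin R M U e" and f: "f \<in> V" "f \<notin> U"
  shows "V = adjoin R M (V \<inter> U) f"
proof
  show "adjoin R M (V \<inter> U) f \<subseteq> V" using V f by (intro adjoin_least) auto
  have "f \<in> adjoin R M U e" using f sub by auto
  then obtain u a where ua: "u \<in> U" "a \<in> carrier R" "f = u \<oplus>\<^bsub>M\<^esub> a \<odot>\<^bsub>M\<^esub> e"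
    unfolding adjoin_iff by blast
  have a0: "a \<noteq> \<zero>" using f(2) ua e subspD(1)[OF U] by auto
  then have ia: "inv a \<in> carrier R" "a \<otimes> inv a = \<one>" "inv a \<otimes> a = \<one>" using field_Units ua by auto
  show "V \<subseteq> adjoin R M (V \<inter> U) f"
  proof
    fix v assume v: "v \<in> V"
    then have "v \<in> adjoin R M U e" using sub by auto
    then obtain w b where wb: "w \<in> U" "b \<in> carrier R" "v = w \<oplus>\<^bsub>M\<^esub> b \<odot>\<^bsub>M\<^esub> e"
      unfolding adjoin_iff by blast
    \<comment> \<open>With this \<open>c\<close> the \<open>e\<close>-components of \<open>v\<close>
      and \<open>c f\<close> agree, so that the difference \<open>w'\<close> falls into
      \<open>U\<close>.\<close>
    define c where "c = b \<otimes> inv a"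
    have c: "c \<in> carrier R" using wb ia by (simp add: c_def)
    define w' where "w' = w \<ominus>\<^bsub>M\<^esub> c \<odot>\<^bsub>M\<^esub> u"
    have mem: "w \<in> carrier M" "u \<in> carrier M" using wb ua subspD(1)[OF U] by auto
    have "c \<odot>\<^bsub>M\<^esub> f = c \<odot>\<^bsub>M\<^esub> u \<oplus>\<^bsub>M\<^esub> b \<odot>\<^bsub>M\<^esub> e"
      using ua wb mem e ia c by (simp add: smult_r_distr smult_assoc1[symmetric] c_def R.m_assoc)
    then have eq: "v = w' \<oplus>\<^bsub>M\<^esub> c \<odot>\<^bsub>M\<^esub> f"
      using mem c e wb(2) unfolding wb(3) w'_def
      by (simp add: a_minus_def M.a_assoc M.r_neg1)
    have fM: "f \<in> carrier M" using f(1) subspD(1)[OF V] by auto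
    have w'U: "w' \<in> U" unfolding w'_def using U wb ua c by (intro subsp_diff) (auto intro: subspD)
    have "w' = v \<ominus>\<^bsub>M\<^esub> c \<odot>\<^bsub>M\<^esub> f"
      using eq fM c w'U subspD(1)[OF U] by (simp add: a_minus_def M.a_assoc M.r_neg)
    then have "w' \<in> V" using v f c V subsp_diff subspD(4) by metis
    then show "v \<in> adjoin R M (V \<inter> U) f" unfolding adjoin_iff using eq w'U c by blast
  qed
qed

text \<open>Intersecting \<open>V\<close> with the flag of \<open>U\<close> gives a flag of
  \<open>V\<close>: by \<open>subsp_of_adjoin\<close> each step contributes one vector or
  none.\<close>

lemma len_subsp_ex:
  assumes "len R M U m" "subsp R M V" "V \<subseteq> U"
  shows "\<exists>p\<le>m. len R M V p"
  using assms
proof (induction arbitrary: V rule: len.induct)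
  case zero
  then have "V = {\<zero>\<^bsub>M\<^esub>}" using subspD(2) by blast
  then show ?case using len.zero by auto
next
  case (step U m e)
  note U = len_subsp[OF step.hyps(1)]
  show ?case
  proof (cases "V \<subseteq> U")
    case True
    then show ?thesis using step.IH[OF step.prems(1)] by (meson le_SucI)
  next
    case False
    then obtain f where f: "f \<in> V" "f \<notin> U" by auto
    obtain p where p: "p \<le> m" "len R M (V \<inter> U) p"
      using step.IH[of "V \<inter> U"] subsp_inter[OF step.prems(1) U] by auto
    have "len R M (adjoin R M (V \<inter> U) f) (Suc p)"
      using p(2) f subspD(1)[OF step.prems(1)] by (intro len.step) auto
    then show ?thesis using subsp_of_adjoin[OF U step.hyps(2) step.prems(1,2) f] p(1) by auto
  qed
qed

text \<open>The exchange argument behind invariance of dimension. If the hyperplane \<open>W\<close>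
  differs from the hyperplane \<open>U\<close> of the given flag, then \<open>U \<inter> W\<close>
  is a hyperplane of both. The induction hypothesis shortens the flag of \<open>U\<close> to one of
  \<open>U \<inter> W\<close>, and one vector of \<open>W\<close> outside \<open>U\<close> extends
  that to a flag of \<open>W\<close> of the length of \<open>U\<close>.\<close>

lemma len_hyperplane:
  assumes "len R M V n" "subsp R M W" "e \<in> carrier M" "e \<notin> W" "V = adjoin R M W e"
  shows "\<exists>k. n = Suc k \<and> len R M W k"
  using assms
proof (induction arbitrary: W e rule: len.induct)
  case (zero W e)
  then have "e \<in> {\<zero>\<^bsub>M\<^esub>}" using adjoin_mem by metis
  then show ?case using zero subspD(2) by blast
next
  case (step U m f W e)
  note U = len_subsp[OF step.hyps(1)]
  have V: "subsp R M (adjoin R M W e)" using adjoin_subsp step.prems by blast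
  have sub: "W \<subseteq> adjoin R M U f" "U \<subseteq> adjoin R M W e"
    using step.prems adjoin_sup[OF step.prems(1,2)] adjoin_sup[OF U step.hyps(2)] by auto
  show ?case
  proof (cases "W \<subseteq> U")
    case True
    \<comment> \<open>Nothing lies strictly between a hyperplane and the whole space: for
      \<open>u\<close> in \<open>U\<close> but not in \<open>W\<close> one has
      \<open>W + R e = W + R u\<close>, which is contained in \<open>U\<close> and would contain
      \<open>f\<close>.\<close>
    have "U = W"
    proof (rule ccontr)
      assume "U \<noteq> W"
      then obtain u where u: "u \<in> U" "u \<notin> W" using True by auto
      have "adjoin R M W e = adjoin R M W u"
        using subsp_of_adjoin[OF step.prems(1,2) V order_refl, of u] u sub(2) adjoin_sup[OF step.prems(1,2)]
        by (metis Int_absorb1 subsetD)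
      also have "\<dots> \<subseteq> U" using True u U by (intro adjoin_least) auto
      finally show False using adjoin_mem[OF U step.hyps(2)] step.hyps(3) step.prems(4) by auto
    qed
    then show ?thesis using step.hyps by auto
  next
    case False
    then obtain g where g: "g \<in> W" "g \<notin> U" by auto
    have gM: "g \<in> carrier M" using g subspD(1)[OF step.prems(1)] by auto
    have W: "W = adjoin R M (W \<inter> U) g"
      using subsp_of_adjoin[OF U step.hyps(2) step.prems(1) sub(1) g] .
    \<comment> \<open>Otherwise the whole space, being \<open>U + R g\<close> with \<open>g\<close>
      in \<open>W\<close>, would lie in \<open>W\<close> and contain \<open>e\<close>.\<close>
    have "\<not> U \<subseteq> W"
    proof
      assume "U \<subseteq> W"
      have "adjoin R M U f = adjoin R M U g"
        using subsp_of_adjoin[OF U step.hyps(2) adjoin_subsp[OF U step.hyps(2)] order_refl, of g] g sub(1)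
          adjoin_sup[OF U step.hyps(2)]
        by (metis Int_absorb1 subsetD)
      also have "\<dots> \<subseteq> W" using \<open>U \<subseteq> W\<close> g step.prems(1) by (intro adjoin_least) auto
      finally show False using adjoin_mem[OF step.prems(1,2)] step.prems(3,4) by auto
    qed
    then obtain u where u: "u \<in> U" "u \<notin> W" by auto
    have "U = adjoin R M (U \<inter> W) u"
      using subsp_of_adjoin[OF step.prems(1,2) U sub(2) u] .
    then obtain k where k: "m = Suc k" "len R M (U \<inter> W) k"
      using step.IH[of "U \<inter> W" u] subsp_inter[OF U step.prems(1)] u subspD(1)[OF U] by auto
    have "len R M (adjoin R M (W \<inter> U) g) (Suc k)"
      using k(2) g gM by (intro len.step) (auto simp: Int_commute)
    then show ?thesis using W k(1) by auto
  qed
qed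

text \<open>Both flags are shortened together: the one of \<open>U\<close> loses its last vector,
  and the one of \<open>V\<close> is replaced by a flag of \<open>V \<inter> U\<close> through
  \<open>len_hyperplane\<close>.\<close>

lemma len_mono:
  assumes "len R M U m" "len R M V n" "V \<subseteq> U"
  shows "n \<le> m"
  using assms
proof (induction arbitrary: V n rule: len.induct)
  case zero
  then have V: "V = {\<zero>\<^bsub>M\<^esub>}" using subspD(2)[OF len_subsp] by blast
  from zero.prems(1) show ?case
  proof cases
    case (step U' m e)
    then have "e = \<zero>\<^bsub>M\<^esub>" "\<zero>\<^bsub>M\<^esub> \<in> U'"
      using V step(1) adjoin_mem[OF len_subsp[OF step(3)] step(4)] subspD(2)[OF len_subsp[OF step(3)]]
      by (metis singletonD, metis)
    then show ?thesis using step(5) by simp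
  qed simp
next
  case (step U m e)
  note U = len_subsp[OF step.hyps(1)] and V = len_subsp[OF step.prems(1)]
  show ?case
  proof (cases "V \<subseteq> U")
    case True
    then show ?thesis using step.IH[OF step.prems(1)] by auto
  next
    case False
    then obtain f where f: "f \<in> V" "f \<notin> U" by auto
    have "V = adjoin R M (V \<inter> U) f" using subsp_of_adjoin[OF U step.hyps(2) V step.prems(2) f] .
    then obtain k where "n = Suc k" "len R M (V \<inter> U) k"
      using len_hyperplane[OF step.prems(1) subsp_inter[OF V U], of f] f subspD(1)[OF V] by auto
    then show ?thesis using step.IH[of "V \<inter> U" k] by auto
  qed
qed

lemma len_unique: "len R M U m \<Longrightarrow> len R M U n \<Longrightarrow> n = m"
  by (meson dual_order.refl le_antisym len_mono)

lemma len_0D: "len R M U 0 \<Longrightarrow> U = {\<zero>\<^bsub>M\<^esub>}"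
  by (erule len.cases) auto

lemma len_nonzero: "len R M U m \<Longrightarrow> u \<in> U \<Longrightarrow> u \<noteq> \<zero>\<^bsub>M\<^esub> \<Longrightarrow> 1 \<le> m"
  using len_0D by (cases m) auto

lemma len_line:
  assumes "e \<in> carrier M" "e \<noteq> \<zero>\<^bsub>M\<^esub>"
  shows "len R M {a \<odot>\<^bsub>M\<^esub> e | a. a \<in> carrier R} 1"
proof -
  have "adjoin R M {\<zero>\<^bsub>M\<^esub>} e = {a \<odot>\<^bsub>M\<^esub> e | a. a \<in> carrier R}"
    using assms(1) by (force simp: adjoin_def)
  then show ?thesis using len.step[OF len.zero, of e M R] assms by auto
qed

end

text \<open>One count for several purposes: \<open>W = {0}\<close> is the usual rank formula, the
  identity map gives the formula for sums and intersections, and a general \<open>W\<close> measures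
  \<open>f\<close> modulo \<open>W\<close>. When \<open>e\<close> is adjoined to \<open>U\<close>,
  either \<open>f e\<close> already lies in \<open>W + f(U)\<close> and the preimage of
  \<open>W\<close> gains a dimension, or it does not and the sum gains one.\<close>

lemma (in fspace) len_rank_nullity:
  fixes R' (structure) and M' (structure)
  assumes M': "fspace R' M'" and f: "semilinear_on R M R' M' T f" and W: "len R' M' W q"
    and "len R M U m" and "U \<subseteq> T" and T: "subsp R M T"
  shows "\<exists>r s. len R M {u\<in>U. f u \<in> W} r \<and>
           len R' M' {w \<oplus>\<^bsub>M'\<^esub> f u | w u. w \<in> W \<and> u \<in> U} (q + s) \<and> r + s = m"
  using assms(4,5)
proof (induction rule: len.induct)
  interpret M': fspace R' M' by (rule M')
  note WS = M'.len_subsp[OF W]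
  have fc: "\<And>u. u \<in> T \<Longrightarrow> f u \<in> carrier M'" using f by (auto simp: semilinear_on_def)
  have f0: "f \<zero>\<^bsub>M\<^esub> = \<zero>\<^bsub>M'\<^esub>"
  proof -
    have "\<zero>\<^bsub>M\<^esub> \<in> T" using subspD(2)[OF T] .
    then have "f \<zero>\<^bsub>M\<^esub> = f \<zero>\<^bsub>M\<^esub> \<oplus>\<^bsub>M'\<^esub> f \<zero>\<^bsub>M\<^esub>" "f \<zero>\<^bsub>M\<^esub> \<in> carrier M'"
      using f unfolding semilinear_on_def by (metis M.l_zero M.zero_closed) (use fc \<open>\<zero>\<^bsub>M\<^esub> \<in> T\<close> in auto)
    then show ?thesis using M'.M.add.r_cancel_one' by metis
  qed
  case zero
  have "{u \<in> {\<zero>\<^bsub>M\<^esub>}. f u \<in> W} = {\<zero>\<^bsub>M\<^esub>}" using f0 subspD(2)[OF WS] by auto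
  moreover have "{w \<oplus>\<^bsub>M'\<^esub> f u | w u. w \<in> W \<and> u \<in> {\<zero>\<^bsub>M\<^esub>}} = W"
    using f0 subspD(1)[OF WS] by force
  ultimately show ?case using len.zero W by (metis add.right_neutral)
next
  interpret M': fspace R' M' by (rule M')
  note WS = M'.len_subsp[OF W]
  case (step U m e)
  note U = len_subsp[OF step.hyps(1)]
  have UT: "U \<subseteq> T" using adjoin_sup[OF U step.hyps(2)] step.prems by auto
  have eT: "e \<in> T" using adjoin_mem[OF U step.hyps(2)] step.prems by auto
  note Td = subspD[OF T] and Ud = subspD[OF U] and Wd = subspD[OF WS]
  have fc[simp]: "\<And>u. u \<in> T \<Longrightarrow> f u \<in> carrier M'" using f by (auto simp: semilinear_on_def)
  have UTD[simp]: "\<And>u. u \<in> U \<Longrightarrow> u \<in> T" using UT by auto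
  have fadd: "\<And>u v. u \<in> T \<Longrightarrow> v \<in> T \<Longrightarrow> f (u \<oplus>\<^bsub>M\<^esub> v) = f u \<oplus>\<^bsub>M'\<^esub> f v"
    using f by (auto simp: semilinear_on_def)
  have f1: "\<And>a u. a \<in> carrier R \<Longrightarrow> u \<in> T \<Longrightarrow> \<exists>b\<in>carrier R'. f (a \<odot>\<^bsub>M\<^esub> u) = b \<odot>\<^bsub>M'\<^esub> f u"
    and f2: "\<And>b u. b \<in> carrier R' \<Longrightarrow> u \<in> T \<Longrightarrow> \<exists>a\<in>carrier R. b \<odot>\<^bsub>M'\<^esub> f u = f (a \<odot>\<^bsub>M\<^esub> u)"
    using f by (auto simp: semilinear_on_def)
  have f0: "f \<zero>\<^bsub>M\<^esub> = \<zero>\<^bsub>M'\<^esub>"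
    using f1[OF R.zero_closed Td(2)] f2[OF M'.R.zero_closed Td(2)]
    by (metis M'.smult_l_null Td(1) Td(2) fc smult_r_null)
  obtain r s where rs: "len R M {u\<in>U. f u \<in> W} r"
    "len R' M' {w \<oplus>\<^bsub>M'\<^esub> f u | w u. w \<in> W \<and> u \<in> U} (q + s)" "r + s = m"
    using step.IH[OF UT] by auto
  let ?I = "{w \<oplus>\<^bsub>M'\<^esub> f u | w u. w \<in> W \<and> u \<in> U}"
  let ?I' = "{w \<oplus>\<^bsub>M'\<^esub> f u | w u. w \<in> W \<and> u \<in> adjoin R M U e}"
  note Is = M'.len_subsp[OF rs(2)]
  have kerS: "subsp R M {u\<in>U. f u \<in> W}" using len_subsp[OF rs(1)] .
  have II: "?I \<subseteq> ?I'" using adjoin_sup[OF U step.hyps(2)] by auto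
  have WI: "W \<subseteq> ?I"
    using f0 Wd(1) Ud(2) by (force intro!: exI[of _ "\<zero>\<^bsub>M\<^esub>"])
  have fI: "f u \<in> ?I" if "u \<in> U" for u
  proof -
    have "f u = \<zero>\<^bsub>M'\<^esub> \<oplus>\<^bsub>M'\<^esub> f u" using that by simp
    then show ?thesis using that Wd(2) by blast
  qed
  show ?case
  proof (cases "f e \<in> ?I")
    case True
    then obtain w u0 where wu: "f e = w \<oplus>\<^bsub>M'\<^esub> f u0" "w \<in> W" "u0 \<in> U" by auto
    \<comment> \<open>Since \<open>f e = w + f u0\<close> with \<open>w\<close> in \<open>W\<close>,
      this is the vector by which the preimage of \<open>W\<close> grows.\<close>
    define e' where "e' = e \<ominus>\<^bsub>M\<^esub> u0"
    have c: "e \<in> carrier M" "u0 \<in> carrier M" using step.hyps(2) wu Ud by auto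
    have e'T: "e' \<in> T" unfolding e'_def using T eT wu by (intro subsp_diff) auto
    then have e'c: "e' \<in> carrier M" using Td by auto
    have ee: "e = e' \<oplus>\<^bsub>M\<^esub> u0" using c by (simp add: e'_def a_minus_def M.a_assoc M.l_neg)
    then have "f e' \<oplus>\<^bsub>M'\<^esub> f u0 = w \<oplus>\<^bsub>M'\<^esub> f u0" using wu fadd e'T by auto
    then have fe': "f e' = w" using wu Wd(1) e'T by (meson M'.M.add.right_cancel UTD fc)
    have e'U: "e' \<notin> U" using ee wu(3) Ud(3) step.hyps(3) by blast
    have "{u \<in> adjoin R M U e. f u \<in> W} = adjoin R M {u\<in>U. f u \<in> W} e'"
    proof
      show "adjoin R M {u\<in>U. f u \<in> W} e' \<subseteq> {u \<in> adjoin R M U e. f u \<in> W}"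
      proof
        fix x assume "x \<in> adjoin R M {u\<in>U. f u \<in> W} e'"
        then obtain u a where ua: "u \<in> U" "f u \<in> W" "a \<in> carrier R" "x = u \<oplus>\<^bsub>M\<^esub> a \<odot>\<^bsub>M\<^esub> e'"
          by (auto simp: adjoin_iff)
        obtain b where b: "b \<in> carrier R'" "f (a \<odot>\<^bsub>M\<^esub> e') = b \<odot>\<^bsub>M'\<^esub> w" using f1[OF ua(3) e'T] fe' by auto
        have "f x = f u \<oplus>\<^bsub>M'\<^esub> b \<odot>\<^bsub>M'\<^esub> w" using ua fadd[of u "a \<odot>\<^bsub>M\<^esub> e'"] b Td(4) e'T by auto
        then have "f x \<in> W" using ua b wu Wd by auto
        moreover have "x \<in> adjoin R M U e"
        proof -
          have "e' \<in> adjoin R M U e" unfolding e'_def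
            using adjoin_sup[OF U] adjoin_mem[OF U] wu c by (intro subsp_diff adjoin_subsp[OF U]) auto
          then show ?thesis using ua adjoin_subsp[OF U c(1)] adjoin_sup[OF U c(1)]
            by (meson subspD(3) subspD(4) subsetD)
        qed
        ultimately show "x \<in> {u \<in> adjoin R M U e. f u \<in> W}" by auto
      qed
      show "{u \<in> adjoin R M U e. f u \<in> W} \<subseteq> adjoin R M {u\<in>U. f u \<in> W} e'"
      proof
        fix x assume "x \<in> {u \<in> adjoin R M U e. f u \<in> W}"
        then obtain u a where ua: "u \<in> U" "f x \<in> W" "a \<in> carrier R" "x = u \<oplus>\<^bsub>M\<^esub> a \<odot>\<^bsub>M\<^esub> e"
          by (auto simp: adjoin_iff)
        define v where "v = u \<oplus>\<^bsub>M\<^esub> a \<odot>\<^bsub>M\<^esub> u0"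
        have v: "v \<in> U" unfolding v_def using ua wu Ud by auto
        have x: "x = v \<oplus>\<^bsub>M\<^esub> a \<odot>\<^bsub>M\<^esub> e'"
          unfolding ua(4) v_def ee using ua e'c c Ud(1) by (simp add: smult_r_distr M.a_ac)
        obtain b where b: "b \<in> carrier R'" "f (a \<odot>\<^bsub>M\<^esub> e') = b \<odot>\<^bsub>M'\<^esub> w" using f1[OF ua(3) e'T] fe' by auto
        have bw: "b \<odot>\<^bsub>M'\<^esub> w \<in> W" using b wu Wd by auto
        have "b \<odot>\<^bsub>M'\<^esub> w \<oplus>\<^bsub>M'\<^esub> f v \<in> W"
          using ua(2) x fadd[of v "a \<odot>\<^bsub>M\<^esub> e'"] b v Td(4)[OF ua(3) e'T] Wd(1)[OF bw] M'.M.a_comm by auto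
        then have "f v \<in> W" using M'.subsp_cancel[OF WS bw] v by auto
        then show "x \<in> adjoin R M {u\<in>U. f u \<in> W} e'" unfolding adjoin_iff using x v ua by blast
      qed
    qed
    moreover have "?I' = ?I"
    proof
      show "?I' \<subseteq> ?I"
      proof
        fix x assume "x \<in> ?I'"
        then obtain w1 u a where x: "w1 \<in> W" "u \<in> U" "a \<in> carrier R" "x = w1 \<oplus>\<^bsub>M'\<^esub> f (u \<oplus>\<^bsub>M\<^esub> a \<odot>\<^bsub>M\<^esub> e)"
          by (auto simp: adjoin_iff)
        obtain b where b: "b \<in> carrier R'" "f (a \<odot>\<^bsub>M\<^esub> e) = b \<odot>\<^bsub>M'\<^esub> f e" using f1[OF x(3) eT] by auto
        have "x = w1 \<oplus>\<^bsub>M'\<^esub> (f u \<oplus>\<^bsub>M'\<^esub> b \<odot>\<^bsub>M'\<^esub> f e)"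
          using x fadd[of u "a \<odot>\<^bsub>M\<^esub> e"] b Td(4) eT by auto
        then show "x \<in> ?I" using fI[OF x(2)] WI x(1) subspD(3,4)[OF Is] True b(1) by (simp add: subset_iff)
      qed
    qed (rule II)
    moreover have "len R M (adjoin R M {u\<in>U. f u \<in> W} e') (Suc r)"
      using rs(1) e'c e'U by (intro len.step) auto
    ultimately show ?thesis using rs(2,3) by (intro exI[of _ "Suc r"] exI[of _ s]) simp
  next
    case False
    have fe: "f e \<in> carrier M'" using eT by simp
    have "{u \<in> adjoin R M U e. f u \<in> W} = {u\<in>U. f u \<in> W}"
    proof
      show "{u \<in> adjoin R M U e. f u \<in> W} \<subseteq> {u\<in>U. f u \<in> W}"
      proof
        fix x assume "x \<in> {u \<in> adjoin R M U e. f u \<in> W}"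
        then obtain u a where ua: "u \<in> U" "f x \<in> W" "a \<in> carrier R" "x = u \<oplus>\<^bsub>M\<^esub> a \<odot>\<^bsub>M\<^esub> e"
          by (auto simp: adjoin_iff)
        have aeT: "a \<odot>\<^bsub>M\<^esub> e \<in> T" using Td(4) ua(3) eT by blast
        obtain b where b: "b \<in> carrier R'" "f (a \<odot>\<^bsub>M\<^esub> e) = b \<odot>\<^bsub>M'\<^esub> f e" using f1[OF ua(3) eT] by auto
        have "f u \<oplus>\<^bsub>M'\<^esub> b \<odot>\<^bsub>M'\<^esub> f e \<in> ?I"
          using ua fadd[of u "a \<odot>\<^bsub>M\<^esub> e"] b aeT WI by auto
        then have "b \<odot>\<^bsub>M'\<^esub> f e \<in> ?I"
          using M'.subsp_cancel[OF Is fI[OF ua(1)]] b fe by blast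
        then have "b = \<zero>\<^bsub>R'\<^esub>" using M'.subsp_smultD[OF Is b(1) _ fe] False by blast
        then have fae: "f (a \<odot>\<^bsub>M\<^esub> e) = \<zero>\<^bsub>M'\<^esub>" using b fe by auto
        \<comment> \<open>Semilinearity does not tie \<open>a\<close> to \<open>b\<close> directly.
          Scaling back by \<open>inv a\<close> would present \<open>f e\<close> as a multiple of
          \<open>f (a e) = 0\<close>.\<close>
        have "a = \<zero>"
        proof (rule ccontr)
          assume "a \<noteq> \<zero>"
          then have "inv a \<in> carrier R" "inv a \<odot>\<^bsub>M\<^esub> (a \<odot>\<^bsub>M\<^esub> e) = e"
            using smult_cancel ua step.hyps(2) field_Units by auto
          then obtain c where "c \<in> carrier R'" "f e = c \<odot>\<^bsub>M'\<^esub> f (a \<odot>\<^bsub>M\<^esub> e)"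
            using f1[OF _ aeT] by metis
          then have "f e = \<zero>\<^bsub>M'\<^esub>" using fae by auto
          then show False using False subspD(2)[OF Is] by auto
        qed
        then have "x = u" using ua Ud(1) step.hyps(2) by auto
        then show "x \<in> {u\<in>U. f u \<in> W}" using ua by auto
      qed
    qed (use adjoin_sup[OF U step.hyps(2)] in auto)
    moreover have "?I' = adjoin R' M' ?I (f e)"
    proof
      show "?I' \<subseteq> adjoin R' M' ?I (f e)"
      proof
        fix x assume "x \<in> ?I'"
        then obtain w1 u a where x: "w1 \<in> W" "u \<in> U" "a \<in> carrier R" "x = w1 \<oplus>\<^bsub>M'\<^esub> f (u \<oplus>\<^bsub>M\<^esub> a \<odot>\<^bsub>M\<^esub> e)"
          by (auto simp: adjoin_iff)
        obtain b where b: "b \<in> carrier R'" "f (a \<odot>\<^bsub>M\<^esub> e) = b \<odot>\<^bsub>M'\<^esub> f e" using f1[OF x(3) eT] by auto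
        have "x = (w1 \<oplus>\<^bsub>M'\<^esub> f u) \<oplus>\<^bsub>M'\<^esub> b \<odot>\<^bsub>M'\<^esub> f e"
          using x fadd[of u "a \<odot>\<^bsub>M\<^esub> e"] b Td(4) eT Wd(1) by (auto simp: M'.M.a_assoc)
        then show "x \<in> adjoin R' M' ?I (f e)" unfolding M'.adjoin_iff using x b by blast
      qed
      show "adjoin R' M' ?I (f e) \<subseteq> ?I'"
      proof
        fix x assume "x \<in> adjoin R' M' ?I (f e)"
        then obtain w1 u b where x: "w1 \<in> W" "u \<in> U" "b \<in> carrier R'" "x = (w1 \<oplus>\<^bsub>M'\<^esub> f u) \<oplus>\<^bsub>M'\<^esub> b \<odot>\<^bsub>M'\<^esub> f e"
          by (auto simp: M'.adjoin_iff)
        obtain a where a: "a \<in> carrier R" "b \<odot>\<^bsub>M'\<^esub> f e = f (a \<odot>\<^bsub>M\<^esub> e)" using f2[OF x(3) eT] by auto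
        have "x = w1 \<oplus>\<^bsub>M'\<^esub> f (u \<oplus>\<^bsub>M\<^esub> a \<odot>\<^bsub>M\<^esub> e)"
          using x a fadd[of u "a \<odot>\<^bsub>M\<^esub> e"] Td(4)[OF a(1) eT] Wd(1) by (auto simp: M'.M.a_assoc)
        then show "x \<in> ?I'" using x a by (auto simp: adjoin_iff)
      qed
    qed
    moreover have "len R' M' (adjoin R' M' ?I (f e)) (Suc (q + s))"
      using rs(2) fe False by (intro len.step) auto
    ultimately show ?thesis using rs(1,3) by (intro exI[of _ r] exI[of _ "Suc s"]) simp
  qed
qed

section \<open>Coordinate bases obtained from flags\<close>

context fspace
begin

lemma subsp_module:
  assumes "subsp R M U"
  shows "fspace R (M\<lparr>carrier := U\<rparr>)"
proof -
  note Ud = subspD[OF assms]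
  have "abelian_group (M\<lparr>carrier := U\<rparr>)"
  proof (rule abelian_groupI)
    fix x assume "x \<in> carrier (M\<lparr>carrier := U\<rparr>)"
    then show "\<exists>y\<in>carrier (M\<lparr>carrier := U\<rparr>). y \<oplus>\<^bsub>M\<lparr>carrier := U\<rparr>\<^esub> x = \<zero>\<^bsub>M\<lparr>carrier := U\<rparr>\<^esub>"
      using subsp_neg[OF assms] Ud(1) by (auto intro!: bexI[of _ "\<ominus>\<^bsub>M\<^esub> x"] simp: M.l_neg)
  qed (use Ud in \<open>auto simp: M.a_ac\<close>)
  then have "module R (M\<lparr>carrier := U\<rparr>)"
    by (intro moduleI) (use Ud in \<open>auto simp: smult_l_distr smult_r_distr smult_assoc1 is_cring\<close>)
  then show ?thesis by (simp add: fspace_def field_axioms)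
qed

text \<open>\<open>finsum\<close> depends on the carrier of its structure, so a sum formed in a
  subspace has to be identified with the sum formed in the surrounding space.\<close>

lemma finsum_subsp:
  assumes "subsp R M U" "finite A" "g \<in> A \<rightarrow> U"
  shows "finsum (M\<lparr>carrier := U\<rparr>) g A = finsum M g A"
  using assms(2,3)
proof (induction rule: finite_induct)
  interpret U: fspace R "M\<lparr>carrier := U\<rparr>" by (rule subsp_module[OF assms(1)])
  case empty
  show ?case by simp
next
  interpret U: fspace R "M\<lparr>carrier := U\<rparr>" by (rule subsp_module[OF assms(1)])
  case (insert x F)
  have "finsum (M\<lparr>carrier := U\<rparr>) g (insert x F) = g x \<oplus>\<^bsub>M\<^esub> finsum (M\<lparr>carrier := U\<rparr>) g F"
    using insert by (subst U.M.finsum_insert) auto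
  moreover have "finsum M g (insert x F) = g x \<oplus>\<^bsub>M\<^esub> finsum M g F"
    using insert subspD(1)[OF assms(1)] by (subst M.finsum_insert) auto
  ultimately show ?case using insert by auto
qed

lemma finsum_scaled_closed:
  assumes "subsp R M U" "finite A" "c \<in> A \<rightarrow> carrier R" "x \<in> A \<rightarrow> U"
  shows "(\<Oplus>\<^bsub>M\<^esub>s\<in>A. c s \<odot>\<^bsub>M\<^esub> x s) \<in> U"
proof -
  interpret U: fspace R "M\<lparr>carrier := U\<rparr>" by (rule subsp_module[OF assms(1)])
  have *: "(\<lambda>s. c s \<odot>\<^bsub>M\<^esub> x s) \<in> A \<rightarrow> U" using assms(3,4) subspD(4)[OF assms(1)] by auto
  have "finsum (M\<lparr>carrier := U\<rparr>) (\<lambda>s. c s \<odot>\<^bsub>M\<^esub> x s) A \<in> carrier (M\<lparr>carrier := U\<rparr>)"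
    using * by (intro U.M.finsum_closed) auto
  then show ?thesis using finsum_subsp[OF assms(1,2) *] by auto
qed

text \<open>The vectors adjoined along the flag form the basis. This is the bridge to
  \<open>zmodule_dim\<close>, whose Hilbert function is phrased with
  \<open>has_dimension\<close>.\<close>

lemma len_has_dimension:
  assumes "len R M U m"
  shows "has_dimension R (M\<lparr>carrier := U\<rparr>) m"
proof -
  have "\<exists>x. x \<in> {..<m} \<rightarrow> U \<and> (\<forall>v\<in>U. \<exists>!c. c \<in> {..<m} \<rightarrow>\<^sub>E carrier R \<and>
     v = (\<Oplus>\<^bsub>M\<^esub>s\<in>{..<m}. c s \<odot>\<^bsub>M\<^esub> x s))"
    using assms
  proof (induction rule: len.induct)
    case zero
    show ?case by (auto intro!: exI[of _ "\<lambda>s. undefined"])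
  next
    case (step U m e)
    note U = len_subsp[OF step.hyps(1)]
    obtain x where x: "x \<in> {..<m} \<rightarrow> U" "\<And>v. v\<in>U \<Longrightarrow> \<exists>!c. c \<in> {..<m} \<rightarrow>\<^sub>E carrier R \<and>
      v = (\<Oplus>\<^bsub>M\<^esub>s\<in>{..<m}. c s \<odot>\<^bsub>M\<^esub> x s)" using step.IH by auto
    have eM: "e \<in> carrier M" by (rule step.hyps(2))
    have xM: "\<And>s. s < m \<Longrightarrow> x s \<in> carrier M" using x(1) subspD(1)[OF U] by auto
    define y where "y = x(m := e)"
    have sum: "(\<Oplus>\<^bsub>M\<^esub>s\<in>{..<Suc m}. c s \<odot>\<^bsub>M\<^esub> y s) = (\<Oplus>\<^bsub>M\<^esub>s\<in>{..<m}. c s \<odot>\<^bsub>M\<^esub> x s) \<oplus>\<^bsub>M\<^esub> c m \<odot>\<^bsub>M\<^esub> e"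
      if c: "c \<in> {..<Suc m} \<rightarrow> carrier R" for c
    proof -
      have "(\<Oplus>\<^bsub>M\<^esub>s\<in>{..<Suc m}. c s \<odot>\<^bsub>M\<^esub> y s) = c m \<odot>\<^bsub>M\<^esub> y m \<oplus>\<^bsub>M\<^esub> (\<Oplus>\<^bsub>M\<^esub>s\<in>{..<m}. c s \<odot>\<^bsub>M\<^esub> y s)"
        unfolding lessThan_Suc by (subst M.finsum_insert) (use c xM eM in \<open>auto simp: y_def Pi_def\<close>)
      also have "(\<Oplus>\<^bsub>M\<^esub>s\<in>{..<m}. c s \<odot>\<^bsub>M\<^esub> y s) = (\<Oplus>\<^bsub>M\<^esub>s\<in>{..<m}. c s \<odot>\<^bsub>M\<^esub> x s)"
        by (rule M.finsum_cong') (use c xM in \<open>auto simp: y_def Pi_def\<close>)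
      moreover have "(\<Oplus>\<^bsub>M\<^esub>s\<in>{..<m}. c s \<odot>\<^bsub>M\<^esub> x s) \<in> carrier M"
        using c xM by (intro M.finsum_closed) (auto simp: Pi_def)
      ultimately show ?thesis using c eM M.a_comm by (auto simp: y_def Pi_def)
    qed
    show ?case
    proof (intro exI[of _ y] conjI ballI)
      show "y \<in> {..<Suc m} \<rightarrow> adjoin R M U e"
        using x(1) adjoin_sup[OF U eM] adjoin_mem[OF U eM] by (auto simp: y_def Pi_def less_Suc_eq)
      fix v assume "v \<in> adjoin R M U e"
      then obtain u a where ua: "u \<in> U" "a \<in> carrier R" "v = u \<oplus>\<^bsub>M\<^esub> a \<odot>\<^bsub>M\<^esub> e" by (auto simp: adjoin_iff)
      obtain c where c: "c \<in> {..<m} \<rightarrow>\<^sub>E carrier R" "u = (\<Oplus>\<^bsub>M\<^esub>s\<in>{..<m}. c s \<odot>\<^bsub>M\<^esub> x s)" using x(2)[OF ua(1)] by auto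
      have cong: "(\<Oplus>\<^bsub>M\<^esub>s\<in>{..<m}. (c(m:=a)) s \<odot>\<^bsub>M\<^esub> x s) = (\<Oplus>\<^bsub>M\<^esub>s\<in>{..<m}. c s \<odot>\<^bsub>M\<^esub> x s)"
        by (rule M.finsum_cong') (use c xM in \<open>auto simp: PiE_def Pi_def\<close>)
      show "\<exists>!c. c \<in> {..<Suc m} \<rightarrow>\<^sub>E carrier R \<and> v = (\<Oplus>\<^bsub>M\<^esub>s\<in>{..<Suc m}. c s \<odot>\<^bsub>M\<^esub> y s)"
      proof (intro ex1I[of _ "c(m := a)"] conjI)
        show c1: "c(m := a) \<in> {..<Suc m} \<rightarrow>\<^sub>E carrier R"
          using c(1) ua(2) by (auto simp: PiE_def Pi_def extensional_def less_Suc_eq)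
        show "v = (\<Oplus>\<^bsub>M\<^esub>s\<in>{..<Suc m}. (c(m := a)) s \<odot>\<^bsub>M\<^esub> y s)"
          using sum[of "c(m:=a)"] c1 cong ua c by (simp add: PiE_def)
        fix d assume d: "d \<in> {..<Suc m} \<rightarrow>\<^sub>E carrier R \<and> v = (\<Oplus>\<^bsub>M\<^esub>s\<in>{..<Suc m}. d s \<odot>\<^bsub>M\<^esub> y s)"
        define u' where "u' = (\<Oplus>\<^bsub>M\<^esub>s\<in>{..<m}. d s \<odot>\<^bsub>M\<^esub> x s)"
        have dR: "\<And>s. s < Suc m \<Longrightarrow> d s \<in> carrier R" using d by (auto simp: PiE_def Pi_def)
        have u': "u' \<in> U" unfolding u'_def using dR x(1) by (intro finsum_scaled_closed[OF U]) auto
        have v': "v = u' \<oplus>\<^bsub>M\<^esub> d m \<odot>\<^bsub>M\<^esub> e" using sum[of d] d by (simp add: PiE_def u'_def)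
        have cc: "u \<in> carrier M" "u' \<in> carrier M" using ua u' subspD(1)[OF U] by auto
        \<comment> \<open>If the last coordinates differed, a non-zero multiple of \<open>e\<close>
          would be a difference of elements of \<open>U\<close>, against
          \<open>e \<notin> U\<close>.\<close>
        have dm: "d m = a"
        proof (rule ccontr)
          assume "d m \<noteq> a"
          moreover have "d m = (d m \<ominus> a) \<oplus> a"
            using dR[of m] ua by (simp add: R.minus_eq R.a_assoc R.l_neg)
          ultimately have ne: "d m \<ominus> a \<noteq> \<zero>" using ua by auto
          have "u' \<oplus>\<^bsub>M\<^esub> (d m \<ominus> a) \<odot>\<^bsub>M\<^esub> e = (u' \<oplus>\<^bsub>M\<^esub> d m \<odot>\<^bsub>M\<^esub> e) \<oplus>\<^bsub>M\<^esub> \<ominus>\<^bsub>M\<^esub> (a \<odot>\<^bsub>M\<^esub> e)"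
            using cc dR ua eM by (simp add: R.minus_eq smult_l_distr smult_l_minus M.a_assoc)
          also have "\<dots> = (u \<oplus>\<^bsub>M\<^esub> a \<odot>\<^bsub>M\<^esub> e) \<oplus>\<^bsub>M\<^esub> \<ominus>\<^bsub>M\<^esub> (a \<odot>\<^bsub>M\<^esub> e)"
            using v' ua(3) by simp
          also have "\<dots> = u" using ua(2) cc eM by (simp add: M.a_assoc M.r_neg)
          finally have "(d m \<ominus> a) \<odot>\<^bsub>M\<^esub> e \<in> U"
            using subsp_cancel[OF U u', of "(d m \<ominus> a) \<odot>\<^bsub>M\<^esub> e"] ua dR eM by auto
          then show False using subsp_smultD[OF U _ ne eM] dR ua step.hyps(3) by auto
        qed
        then have "u' = u" using v' ua cc eM by (simp add: M.add.right_cancel)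
        let ?d = "restrict d {..<m}"
        have "(\<Oplus>\<^bsub>M\<^esub>s\<in>{..<m}. ?d s \<odot>\<^bsub>M\<^esub> x s) = u'"
          unfolding u'_def by (rule M.finsum_cong') (use dR xM in auto)
        then have "?d = c" using x(2)[OF ua(1)] c \<open>u' = u\<close> dR by auto
        have "d s = (c(m := a)) s" for s
          using fun_cong[OF \<open>?d = c\<close>, of s] dm d by (cases s m rule: linorder_cases) (auto simp: PiE_def extensional_def)
        then show "d = c(m := a)" by auto
      qed
    qed
  qed
  note U = len_subsp[OF assms]
  then obtain x where x: "x \<in> {..<m} \<rightarrow> U" "\<And>v. v\<in>U \<Longrightarrow> \<exists>!c. c \<in> {..<m} \<rightarrow>\<^sub>E carrier R \<and>
     v = (\<Oplus>\<^bsub>M\<^esub>s\<in>{..<m}. c s \<odot>\<^bsub>M\<^esub> x s)"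
    using \<open>\<exists>x. x \<in> {..<m} \<rightarrow> U \<and> _\<close> by auto
  have eq: "(\<Oplus>\<^bsub>M\<lparr>carrier := U\<rparr>\<^esub>s\<in>{..<m}. c s \<odot>\<^bsub>M\<^esub> x s) = (\<Oplus>\<^bsub>M\<^esub>s\<in>{..<m}. c s \<odot>\<^bsub>M\<^esub> x s)"
    if "c \<in> {..<m} \<rightarrow>\<^sub>E carrier R" for c
    using that x(1) subspD(4)[OF U] by (simp add: finsum_subsp[OF U] PiE_def Pi_def)
  show ?thesis unfolding has_dimension_def is_basis_def
    by (intro exI[of _ x]) (use x in \<open>simp add: eq cong: conj_cong\<close>)
qed

end

section \<open>Graded algebras with exact quadratic relations\<close>

text \<open>The same abelian group as the component, read additively and with the right action of
  \<open>D_jj\<close> as scalar multiplication, so that the library's notation for sums, negatives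
  and subspaces becomes available.\<close>

definition zmod :: "'a zalg \<Rightarrow> int \<Rightarrow> int \<Rightarrow> ('a, 'a) module" where
  "zmod D i j = part_module (principal_zmodule D i) j"

lemma zmod_simps:
  "carrier (zmod D i j) = carrier (component D i j)"
  "a \<oplus>\<^bsub>zmod D i j\<^esub> b = a \<otimes>\<^bsub>component D i j\<^esub> b"
  "\<zero>\<^bsub>zmod D i j\<^esub> = \<one>\<^bsub>component D i j\<^esub>"
  by (simp_all add: zmod_def part_module_def principal_zmodule_def)

lemma smult_zmod [simp]: "k \<odot>\<^bsub>zmod D i j\<^esub> a = zmult D i j j a k"
  by (simp add: zmod_def part_module_def principal_zmodule_def)

lemma diagonal_ring_simps [simp]:
  "carrier (diagonal_ring D n) = carrier (zmod D n n)"
  "a \<otimes>\<^bsub>diagonal_ring D n\<^esub> b = zmult D n n n a b"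
  "a \<oplus>\<^bsub>diagonal_ring D n\<^esub> b = a \<oplus>\<^bsub>zmod D n n\<^esub> b"
  "\<zero>\<^bsub>diagonal_ring D n\<^esub> = \<zero>\<^bsub>zmod D n n\<^esub>"
  "\<one>\<^bsub>diagonal_ring D n\<^esub> = zunit D n"
  by (simp_all add: zmod_simps diagonal_ring_def)

section \<open>Additive calculus in the components of an indexed algebra\<close>

context z_algebra
begin

abbreviation E where "E \<equiv> zmod D"
abbreviation mu where "mu \<equiv> zmult D"

lemma zmod_abelian: "abelian_group (E i j)"
proof -
  interpret comm_group "component D i j" by (rule comm_group_component)
  show ?thesis
  proof (rule abelian_groupI)
    fix x assume "x \<in> carrier (E i j)"
    then show "\<exists>y\<in>carrier (E i j). y \<oplus>\<^bsub>E i j\<^esub> x = \<zero>\<^bsub>E i j\<^esub>"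
      by (auto simp: zmod_simps intro!: bexI[of _ "inv\<^bsub>component D i j\<^esub> x"])
  qed (auto simp: zmod_simps m_ac)
qed

lemmas zmod_monoid = abelian_group.axioms(1)[OF zmod_abelian]

lemma add_closed [simp, intro]:
  "a \<in> carrier (E i j) \<Longrightarrow> b \<in> carrier (E i j) \<Longrightarrow> a \<oplus>\<^bsub>E i j\<^esub> b \<in> carrier (E i j)"
  by (rule abelian_monoid.a_closed[OF zmod_monoid])

lemma zero_closed [simp, intro]: "\<zero>\<^bsub>E i j\<^esub> \<in> carrier (E i j)"
  by (rule abelian_monoid.zero_closed[OF zmod_monoid])

lemma neg_closed [simp, intro]: "a \<in> carrier (E i j) \<Longrightarrow> \<ominus>\<^bsub>E i j\<^esub> a \<in> carrier (E i j)"
  by (rule abelian_group.a_inv_closed[OF zmod_abelian])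

lemma add_zero [simp]:
  "a \<in> carrier (E i j) \<Longrightarrow> a \<oplus>\<^bsub>E i j\<^esub> \<zero>\<^bsub>E i j\<^esub> = a"
  "a \<in> carrier (E i j) \<Longrightarrow> \<zero>\<^bsub>E i j\<^esub> \<oplus>\<^bsub>E i j\<^esub> a = a"
  by (simp_all add: abelian_monoid.r_zero[OF zmod_monoid] abelian_monoid.l_zero[OF zmod_monoid])

lemma add_neg [simp]:
  "a \<in> carrier (E i j) \<Longrightarrow> a \<oplus>\<^bsub>E i j\<^esub> \<ominus>\<^bsub>E i j\<^esub> a = \<zero>\<^bsub>E i j\<^esub>"
  "a \<in> carrier (E i j) \<Longrightarrow> \<ominus>\<^bsub>E i j\<^esub> a \<oplus>\<^bsub>E i j\<^esub> a = \<zero>\<^bsub>E i j\<^esub>"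
  by (simp_all add: abelian_group.r_neg[OF zmod_abelian] abelian_group.l_neg[OF zmod_abelian])

lemmas add_assoc = abelian_monoid.a_assoc[OF zmod_monoid]
lemmas add_comm = abelian_monoid.a_comm[OF zmod_monoid]
lemmas add_lcomm = abelian_monoid.a_lcomm[OF zmod_monoid]
lemmas add_ac = add_assoc add_comm add_lcomm

lemma add_neg_cancel [simp]:
  assumes "a \<in> carrier (E i j)" "b \<in> carrier (E i j)"
  shows "a \<oplus>\<^bsub>E i j\<^esub> (\<ominus>\<^bsub>E i j\<^esub> a \<oplus>\<^bsub>E i j\<^esub> b) = b"
    "\<ominus>\<^bsub>E i j\<^esub> a \<oplus>\<^bsub>E i j\<^esub> (a \<oplus>\<^bsub>E i j\<^esub> b) = b"
  using assms by (simp_all add: add_assoc[symmetric])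

lemma add_eqD:
  assumes "a \<oplus>\<^bsub>E i j\<^esub> b = c" "a \<in> carrier (E i j)" "b \<in> carrier (E i j)"
  shows "b = c \<oplus>\<^bsub>E i j\<^esub> \<ominus>\<^bsub>E i j\<^esub> a" "a = c \<oplus>\<^bsub>E i j\<^esub> \<ominus>\<^bsub>E i j\<^esub> b"
proof -
  show "a = c \<oplus>\<^bsub>E i j\<^esub> \<ominus>\<^bsub>E i j\<^esub> b"
    using assms(2,3) unfolding assms(1)[symmetric] by (simp add: add_assoc)
  show "b = c \<oplus>\<^bsub>E i j\<^esub> \<ominus>\<^bsub>E i j\<^esub> a"
    using assms(2,3) unfolding assms(1)[symmetric] add_comm[OF assms(2,3)] by (simp add: add_assoc)
qed

lemma diff_zeroD:
  assumes "a \<oplus>\<^bsub>E i j\<^esub> \<ominus>\<^bsub>E i j\<^esub> b = \<zero>\<^bsub>E i j\<^esub>" "a \<in> carrier (E i j)" "b \<in> carrier (E i j)"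
  shows "a = b"
  using add_eqD(2)[OF assms(1,2)] assms(2,3) abelian_group.minus_minus[OF zmod_abelian] by simp

lemma neg_add:
  "a \<in> carrier (E i j) \<Longrightarrow> b \<in> carrier (E i j) \<Longrightarrow>
    \<ominus>\<^bsub>E i j\<^esub> (a \<oplus>\<^bsub>E i j\<^esub> b) = \<ominus>\<^bsub>E i j\<^esub> a \<oplus>\<^bsub>E i j\<^esub> \<ominus>\<^bsub>E i j\<^esub> b"
  by (rule abelian_group.minus_add[OF zmod_abelian])

lemma mu_closed [simp, intro]:
  "a \<in> carrier (E i j) \<Longrightarrow> b \<in> carrier (E j l) \<Longrightarrow> mu i j l a b \<in> carrier (E i l)"
  by (simp add: zmod_simps zmult_closed)

lemma mu_add:
  "a \<in> carrier (E i j) \<Longrightarrow> a' \<in> carrier (E i j) \<Longrightarrow> b \<in> carrier (E j l) \<Longrightarrow>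
    mu i j l (a \<oplus>\<^bsub>E i j\<^esub> a') b = mu i j l a b \<oplus>\<^bsub>E i l\<^esub> mu i j l a' b"
  "a \<in> carrier (E i j) \<Longrightarrow> b \<in> carrier (E j l) \<Longrightarrow> b' \<in> carrier (E j l) \<Longrightarrow>
    mu i j l a (b \<oplus>\<^bsub>E j l\<^esub> b') = mu i j l a b \<oplus>\<^bsub>E i l\<^esub> mu i j l a b'"
  by (simp_all add: zmod_simps zmult_add_left zmult_add_right)

lemma mu_assoc:
  "a \<in> carrier (E i j) \<Longrightarrow> b \<in> carrier (E j l) \<Longrightarrow> c \<in> carrier (E l m) \<Longrightarrow>
    mu i l m (mu i j l a b) c = mu i j m a (mu j l m b c)"
  by (simp add: zmod_simps zmult_assoc)

lemma unit_closed [simp, intro]: "zunit D i \<in> carrier (E i i)"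
  by (simp add: zmod_simps zunit_closed)

lemma mu_unit [simp]:
  "a \<in> carrier (E i j) \<Longrightarrow> mu i i j (zunit D i) a = a"
  "a \<in> carrier (E i j) \<Longrightarrow> mu i j j a (zunit D j) = a"
  by (simp_all add: zmod_simps zunit_left zunit_right)

lemma add_cancel_zero:
  assumes "a \<in> carrier (E i j)" "a = a \<oplus>\<^bsub>E i j\<^esub> a"
  shows "a = \<zero>\<^bsub>E i j\<^esub>"
  using add_neg_cancel(2)[OF assms(1,1)] assms by (metis add_neg(2))

lemma mu_zero [simp]:
  "b \<in> carrier (E j l) \<Longrightarrow> mu i j l \<zero>\<^bsub>E i j\<^esub> b = \<zero>\<^bsub>E i l\<^esub>"
  "a \<in> carrier (E i j) \<Longrightarrow> mu i j l a \<zero>\<^bsub>E j l\<^esub> = \<zero>\<^bsub>E i l\<^esub>"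
proof -
  show "mu i j l \<zero>\<^bsub>E i j\<^esub> b = \<zero>\<^bsub>E i l\<^esub>" if "b \<in> carrier (E j l)"
    by (rule add_cancel_zero) (use that mu_add(1)[of "\<zero>\<^bsub>E i j\<^esub>" i j "\<zero>\<^bsub>E i j\<^esub>" b l] in auto)
  show "mu i j l a \<zero>\<^bsub>E j l\<^esub> = \<zero>\<^bsub>E i l\<^esub>" if "a \<in> carrier (E i j)"
    by (rule add_cancel_zero) (use that mu_add(2)[of a i j "\<zero>\<^bsub>E j l\<^esub>" l "\<zero>\<^bsub>E j l\<^esub>"] in auto)
qed

lemma neg_unique:
  assumes "a \<oplus>\<^bsub>E i j\<^esub> b = \<zero>\<^bsub>E i j\<^esub>" "a \<in> carrier (E i j)" "b \<in> carrier (E i j)"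
  shows "b = \<ominus>\<^bsub>E i j\<^esub> a"
  using add_eqD(1)[OF assms] assms by simp

lemma mu_neg:
  "a \<in> carrier (E i j) \<Longrightarrow> b \<in> carrier (E j l) \<Longrightarrow>
    mu i j l (\<ominus>\<^bsub>E i j\<^esub> a) b = \<ominus>\<^bsub>E i l\<^esub> (mu i j l a b)"
  "a \<in> carrier (E i j) \<Longrightarrow> b \<in> carrier (E j l) \<Longrightarrow>
    mu i j l a (\<ominus>\<^bsub>E j l\<^esub> b) = \<ominus>\<^bsub>E i l\<^esub> (mu i j l a b)"
  by (rule neg_unique; simp add: mu_add[symmetric])+

lemma right_zmodule_principal: "right_zmodule D (principal_zmodule D i)"
  by (rule right_zmodule.intro)
    (simp_all add: principal_zmodule_def comm_group_component zmult_closed zmult_add_left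
      zmult_add_right zmult_assoc zunit_right)

text \<open>Commutativity of \<open>D_nn\<close> is what allows its right action to be treated as a
  left module structure: \<open>(u b) a\<close> has to equal \<open>u (a b)\<close>.\<close>

lemma zmod_fspace:
  assumes "field (diagonal_ring D n)"
  shows "fspace (diagonal_ring D n) (E i n)"
proof -
  interpret F: field "diagonal_ring D n" by (rule assms)
  have comm: "mu n n n a b = mu n n n b a" if "a \<in> carrier (E n n)" "b \<in> carrier (E n n)" for a b
    using F.m_comm[of a b] that by simp
  have "module (diagonal_ring D n) (E i n)"
    by (rule moduleI) (simp_all add: F.is_cring zmod_abelian mu_add mu_assoc comm)
  then show ?thesis by (simp add: fspace_def assms)
qed

end

text \<open>
  At every vertex \<open>n\<close> there are a right basis \<open>x n, y n\<close> of the component ending there and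
  the dual left basis \<open>x' n, y' n\<close> of the component starting there. The exactness axioms say
  that the only relations are the multiples of the canonical element, so that \<open>A\<^sub>i\<^sub>*\<close>
  is resolved by \<open>0 \<rightarrow> A\<^sub>i\<^sub>,\<^sub>n\<^sub>-\<^sub>1 \<rightarrow> A\<^sub>i\<^sub>n \<otimes> V \<rightarrow> A\<^sub>i\<^sub>,\<^sub>n\<^sub>+\<^sub>1 \<rightarrow> 0\<close>.
\<close>

locale ncs_algebra = z_algebra A for A :: "'a zalg" +
  fixes x y x' y' :: "int \<Rightarrow> 'a"
  assumes field_diag: "field (diagonal_ring A n)"
    and below: "j < i \<Longrightarrow> carrier (zmod A i j) = {\<zero>\<^bsub>zmod A i j\<^esub>}"
    and gens_closed [simp]: "x n \<in> carrier (zmod A (n - 1) n)" "y n \<in> carrier (zmod A (n - 1) n)"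
      "x' n \<in> carrier (zmod A n (n + 1))" "y' n \<in> carrier (zmod A n (n + 1))"
    and rel: "zmult A (n - 1) n (n + 1) (x n) (x' n) \<oplus>\<^bsub>zmod A (n - 1) (n + 1)\<^esub>
      zmult A (n - 1) n (n + 1) (y n) (y' n) = \<zero>\<^bsub>zmod A (n - 1) (n + 1)\<^esub>"
    and right_gen: "\<lbrakk>i \<le> n; c \<in> carrier (zmod A i (n + 1))\<rbrakk> \<Longrightarrow>
      \<exists>a\<in>carrier (zmod A i n). \<exists>b\<in>carrier (zmod A i n).
        c = zmult A i n (n + 1) a (x' n) \<oplus>\<^bsub>zmod A i (n + 1)\<^esub> zmult A i n (n + 1) b (y' n)"
    and right_exact: "\<lbrakk>a \<in> carrier (zmod A i n); b \<in> carrier (zmod A i n);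
        zmult A i n (n + 1) a (x' n) \<oplus>\<^bsub>zmod A i (n + 1)\<^esub> zmult A i n (n + 1) b (y' n)
          = \<zero>\<^bsub>zmod A i (n + 1)\<^esub>\<rbrakk> \<Longrightarrow>
      \<exists>z\<in>carrier (zmod A i (n - 1)).
        a = zmult A i (n - 1) n z (x n) \<and> b = zmult A i (n - 1) n z (y n)"
    and left_gen: "\<lbrakk>n \<le> m; c \<in> carrier (zmod A (n - 1) m)\<rbrakk> \<Longrightarrow>
      \<exists>a\<in>carrier (zmod A n m). \<exists>b\<in>carrier (zmod A n m).
        c = zmult A (n - 1) n m (x n) a \<oplus>\<^bsub>zmod A (n - 1) m\<^esub> zmult A (n - 1) n m (y n) b"
    and left_exact: "\<lbrakk>a \<in> carrier (zmod A n m); b \<in> carrier (zmod A n m);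
        zmult A (n - 1) n m (x n) a \<oplus>\<^bsub>zmod A (n - 1) m\<^esub> zmult A (n - 1) n m (y n) b
          = \<zero>\<^bsub>zmod A (n - 1) m\<^esub>\<rbrakk> \<Longrightarrow>
      \<exists>z\<in>carrier (zmod A (n + 1) m).
        a = zmult A n (n + 1) m (x' n) z \<and> b = zmult A n (n + 1) m (y' n) z"
begin

section \<open>Products of subspaces with the generators, and the passage of scalars across a
  relation\<close>

abbreviation sub where "sub i n U \<equiv> subsp (diagonal_ring A n) (E i n) U"
abbreviation ln where "ln i n U m \<equiv> len (diagonal_ring A n) (E i n) U m"

text \<open>This is \<open>U V_n\<close>. Two summands suffice because \<open>x' n\<close>,
  \<open>y' n\<close> generate \<open>V_n\<close> on the left and a subspace \<open>U\<close>
  absorbs the coefficients.\<close>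

definition nxt :: "int \<Rightarrow> int \<Rightarrow> 'a set \<Rightarrow> 'a set" where
  "nxt i n U = {mu i n (n + 1) a (x' n) \<oplus>\<^bsub>E i (n + 1)\<^esub> mu i n (n + 1) b (y' n) | a b. a \<in> U \<and> b \<in> U}"

definition prv :: "int \<Rightarrow> int \<Rightarrow> 'a set \<Rightarrow> 'a set" where
  "prv i n U = {z \<in> carrier (E i (n - 1)). \<forall>v\<in>carrier (E (n - 1) n). mu i (n - 1) n z v \<in> U}"

lemma fsp: "fspace (diagonal_ring A n) (E i n)"
  by (rule zmod_fspace[OF field_diag])

lemma one_neq_zero: "zunit A n \<noteq> \<zero>\<^bsub>E n n\<^esub>"
proof -
  interpret F: field "diagonal_ring A n" by (rule field_diag)
  show ?thesis using F.one_not_zero by simp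
qed

text \<open>Exactness makes the coefficients multiples of some \<open>z\<close> in
  \<open>A_(n,n-1)\<close>, and that component is zero.\<close>

lemma right_indep:
  assumes "a \<in> carrier (E n n)" "b \<in> carrier (E n n)"
    "mu n n (n + 1) a (x' n) \<oplus>\<^bsub>E n (n + 1)\<^esub> mu n n (n + 1) b (y' n) = \<zero>\<^bsub>E n (n + 1)\<^esub>"
  shows "a = \<zero>\<^bsub>E n n\<^esub>" "b = \<zero>\<^bsub>E n n\<^esub>"
  using right_exact[OF assms] below[of "n - 1" n] by auto

lemma left_indep:
  assumes "a \<in> carrier (E n n)" "b \<in> carrier (E n n)"
    "mu (n - 1) n n (x n) a \<oplus>\<^bsub>E (n - 1) n\<^esub> mu (n - 1) n n (y n) b = \<zero>\<^bsub>E (n - 1) n\<^esub>"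
  shows "a = \<zero>\<^bsub>E n n\<^esub>" "b = \<zero>\<^bsub>E n n\<^esub>"
  using left_exact[OF assms] below[of n "n + 1"] by auto

lemma subI:
  assumes "U \<subseteq> carrier (E i n)" "\<zero>\<^bsub>E i n\<^esub> \<in> U" "\<And>u v. u \<in> U \<Longrightarrow> v \<in> U \<Longrightarrow> u \<oplus>\<^bsub>E i n\<^esub> v \<in> U"
    "\<And>u k. u \<in> U \<Longrightarrow> k \<in> carrier (E n n) \<Longrightarrow> mu i n n u k \<in> U"
  shows "sub i n U"
  using assms by (simp add: subsp_def)

lemma subD:
  assumes "sub i n U"
  shows "\<And>u. u \<in> U \<Longrightarrow> u \<in> carrier (E i n)" "\<zero>\<^bsub>E i n\<^esub> \<in> U"
    "\<And>u v. u \<in> U \<Longrightarrow> v \<in> U \<Longrightarrow> u \<oplus>\<^bsub>E i n\<^esub> v \<in> U"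
    "\<And>u k. u \<in> U \<Longrightarrow> k \<in> carrier (E n n) \<Longrightarrow> mu i n n u k \<in> U"
    "\<And>u. u \<in> U \<Longrightarrow> \<ominus>\<^bsub>E i n\<^esub> u \<in> U"
  using subspD[OF assms] fspace.subsp_neg[OF fsp assms] by simp_all

lemma nxt_mu:
  assumes U: "sub i n U" and u: "u \<in> U" and v: "v \<in> carrier (E n (n + 1))"
  shows "mu i n (n + 1) u v \<in> nxt i n U"
proof -
  obtain a b where ab: "a \<in> carrier (E n n)" "b \<in> carrier (E n n)"
    "v = mu n n (n + 1) a (x' n) \<oplus>\<^bsub>E n (n + 1)\<^esub> mu n n (n + 1) b (y' n)"
    using right_gen[OF order_refl v] by blast
  have "mu i n (n + 1) u v = mu i n (n + 1) (mu i n n u a) (x' n) \<oplus>\<^bsub>E i (n + 1)\<^esub>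
      mu i n (n + 1) (mu i n n u b) (y' n)"
    using ab subD(1)[OF U u] by (simp add: mu_add mu_assoc)
  moreover have "mu i n n u a \<in> U" "mu i n n u b \<in> U" using ab subD(4)[OF U u] by auto
  ultimately show ?thesis unfolding nxt_def by blast
qed

lemma nxt_least:
  assumes "\<And>u v. u \<in> Z \<Longrightarrow> v \<in> Z \<Longrightarrow> u \<oplus>\<^bsub>E i (n + 1)\<^esub> v \<in> Z"
    and "\<And>u v. u \<in> U \<Longrightarrow> v \<in> carrier (E n (n + 1)) \<Longrightarrow> mu i n (n + 1) u v \<in> Z"
  shows "nxt i n U \<subseteq> Z"
  using assms by (auto simp: nxt_def)

lemma nxt_sub:
  assumes U: "sub i n U"
  shows "sub i (n + 1) (nxt i n U)"
proof (rule subI)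
  note c [simp] = subD(1)[OF U]
  show "nxt i n U \<subseteq> carrier (E i (n + 1))" by (auto simp: nxt_def)
  have "\<zero>\<^bsub>E i (n + 1)\<^esub> = mu i n (n + 1) \<zero>\<^bsub>E i n\<^esub> (x' n)" by simp
  then show "\<zero>\<^bsub>E i (n + 1)\<^esub> \<in> nxt i n U" using nxt_mu[OF U subD(2)[OF U], of "x' n"] by simp
  have add: "u \<oplus>\<^bsub>E i (n + 1)\<^esub> v \<in> nxt i n U" if uv: "u \<in> nxt i n U" "v \<in> nxt i n U" for u v
  proof -
    obtain a b a' b' where *: "a \<in> U" "b \<in> U" "a' \<in> U" "b' \<in> U"
      "u = mu i n (n + 1) a (x' n) \<oplus>\<^bsub>E i (n + 1)\<^esub> mu i n (n + 1) b (y' n)"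
      "v = mu i n (n + 1) a' (x' n) \<oplus>\<^bsub>E i (n + 1)\<^esub> mu i n (n + 1) b' (y' n)"
      using uv by (auto simp: nxt_def)
    then have "u \<oplus>\<^bsub>E i (n + 1)\<^esub> v = mu i n (n + 1) (a \<oplus>\<^bsub>E i n\<^esub> a') (x' n) \<oplus>\<^bsub>E i (n + 1)\<^esub>
        mu i n (n + 1) (b \<oplus>\<^bsub>E i n\<^esub> b') (y' n)"
      by (simp add: mu_add add_ac)
    then show ?thesis unfolding nxt_def using * subD(3)[OF U] by blast
  qed
  show "u \<oplus>\<^bsub>E i (n + 1)\<^esub> v \<in> nxt i n U" if "u \<in> nxt i n U" "v \<in> nxt i n U" for u v
    using add that .
  fix u k assume "u \<in> nxt i n U" and k: "k \<in> carrier (E (n + 1) (n + 1))"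
  then obtain a b where ab: "a \<in> U" "b \<in> U"
    "u = mu i n (n + 1) a (x' n) \<oplus>\<^bsub>E i (n + 1)\<^esub> mu i n (n + 1) b (y' n)" by (auto simp: nxt_def)
  then have "mu i (n + 1) (n + 1) u k = mu i n (n + 1) a (mu n (n + 1) (n + 1) (x' n) k) \<oplus>\<^bsub>E i (n + 1)\<^esub>
      mu i n (n + 1) b (mu n (n + 1) (n + 1) (y' n) k)"
    using k by (simp add: mu_add mu_assoc)
  then show "mu i (n + 1) (n + 1) u k \<in> nxt i n U" using add nxt_mu[OF U] ab k by simp
qed

lemma prv_sub:
  assumes U: "sub i n U"
  shows "sub i (n - 1) (prv i n U)"
  by (rule subI) (use subD[OF U] in \<open>auto simp: prv_def mu_add mu_assoc\<close>)

text \<open>The right basis \<open>x n\<close>, \<open>y n\<close> generates \<open>V_(n-1)\<close>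
  over \<open>A_nn\<close>, and \<open>U\<close> is stable under \<open>A_nn\<close>, so two test
  vectors are enough.\<close>

lemma prvI:
  assumes U: "sub i n U" and "z \<in> carrier (E i (n - 1))"
    "mu i (n - 1) n z (x n) \<in> U" "mu i (n - 1) n z (y n) \<in> U"
  shows "z \<in> prv i n U"
  unfolding prv_def
proof (intro CollectI conjI ballI)
  fix v assume "v \<in> carrier (E (n - 1) n)"
  then obtain a b where ab: "a \<in> carrier (E n n)" "b \<in> carrier (E n n)"
    "v = mu (n - 1) n n (x n) a \<oplus>\<^bsub>E (n - 1) n\<^esub> mu (n - 1) n n (y n) b"
    using left_gen[OF order_refl] by blast
  have "mu i (n - 1) n z v = mu i n n (mu i (n - 1) n z (x n)) a \<oplus>\<^bsub>E i n\<^esub>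
      mu i n n (mu i (n - 1) n z (y n)) b"
    using ab assms(2) by (simp add: mu_add mu_assoc)
  then show "mu i (n - 1) n z v \<in> U" using ab assms(3,4) subD[OF U] by simp
qed (rule assms(2))

lemma nxt_prv:
  assumes U: "sub i n U"
  shows "nxt i (n - 1) (prv i n U) \<subseteq> U"
  by (rule nxt_least) (use subD[OF U] in \<open>auto simp: prv_def\<close>)

lemma ln_step: "ln (n - 1) n (carrier (E (n - 1) n)) 2"
proof -
  interpret F: fspace "diagonal_ring A n" "E (n - 1) n" by (rule fsp)
  have xn: "x n \<noteq> \<zero>\<^bsub>E (n - 1) n\<^esub>"
  proof
    assume "x n = \<zero>\<^bsub>E (n - 1) n\<^esub>"
    then show False
      using left_indep(1)[of "zunit A n" n "\<zero>\<^bsub>E n n\<^esub>"] one_neq_zero by simp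
  qed
  let ?L = "{a \<odot>\<^bsub>E (n - 1) n\<^esub> x n | a. a \<in> carrier (diagonal_ring A n)}"
  have L: "ln (n - 1) n ?L 1" by (rule F.len_line) (simp_all add: xn)
  have "y n \<notin> ?L"
  proof
    assume "y n \<in> ?L"
    then obtain a where a: "a \<in> carrier (E n n)" "y n = mu (n - 1) n n (x n) a" by auto
    have "mu (n - 1) n n (x n) (\<ominus>\<^bsub>E n n\<^esub> a) \<oplus>\<^bsub>E (n - 1) n\<^esub> mu (n - 1) n n (y n) (zunit A n)
        = \<zero>\<^bsub>E (n - 1) n\<^esub>"
      using a(1) by (simp add: mu_neg a(2)[symmetric])
    then show False using left_indep(2) a one_neq_zero by blast
  qed
  then have "ln (n - 1) n (adjoin (diagonal_ring A n) (E (n - 1) n) ?L (y n)) (Suc 1)"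
    by (intro len.step L) simp
  moreover have "adjoin (diagonal_ring A n) (E (n - 1) n) ?L (y n) = carrier (E (n - 1) n)"
  proof
    show "carrier (E (n - 1) n) \<subseteq> adjoin (diagonal_ring A n) (E (n - 1) n) ?L (y n)"
    proof
      fix v assume "v \<in> carrier (E (n - 1) n)"
      then obtain a b where "a \<in> carrier (E n n)" "b \<in> carrier (E n n)"
        "v = mu (n - 1) n n (x n) a \<oplus>\<^bsub>E (n - 1) n\<^esub> mu (n - 1) n n (y n) b"
        using left_gen[OF order_refl] by blast
      then show "v \<in> adjoin (diagonal_ring A n) (E (n - 1) n) ?L (y n)"
        unfolding F.adjoin_iff by auto
    qed
  qed (auto simp: adjoin_def)
  ultimately show ?thesis by (simp add: numeral_2_eq_2)
qed

text \<open>Multiply \<open>x x' + y y' = 0\<close> by \<open>a\<close> from the left and expand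
  \<open>a x\<close>, \<open>a y\<close> in the basis \<open>x\<close>, \<open>y\<close>. The result
  is again a relation with first factors \<open>x\<close>, \<open>y\<close>, so
  \<open>left_exact\<close> writes its second factors as \<open>x' b\<close>, \<open>y' b\<close>.
  The matrix by which \<open>a\<close> acts on \<open>x\<close>, \<open>y\<close> is thus,
  transposed, the one by which \<open>b\<close> acts on \<open>x'\<close>, \<open>y'\<close>; this
  couples scalars at the vertices \<open>n - 1\<close> and \<open>n + 1\<close>.\<close>

lemma scalar_right:
  assumes a: "a \<in> carrier (E (n - 1) (n - 1))"
  shows "\<exists>\<alpha>\<in>carrier (E n n). \<exists>\<beta>\<in>carrier (E n n). \<exists>\<gamma>\<in>carrier (E n n). \<exists>\<delta>\<in>carrier (E n n).
    \<exists>b\<in>carrier (E (n + 1) (n + 1)).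
      mu (n - 1) (n - 1) n a (x n) = mu (n - 1) n n (x n) \<alpha> \<oplus>\<^bsub>E (n - 1) n\<^esub> mu (n - 1) n n (y n) \<beta> \<and>
      mu (n - 1) (n - 1) n a (y n) = mu (n - 1) n n (x n) \<gamma> \<oplus>\<^bsub>E (n - 1) n\<^esub> mu (n - 1) n n (y n) \<delta> \<and>
      mu n (n + 1) (n + 1) (x' n) b = mu n n (n + 1) \<alpha> (x' n) \<oplus>\<^bsub>E n (n + 1)\<^esub> mu n n (n + 1) \<gamma> (y' n) \<and>
      mu n (n + 1) (n + 1) (y' n) b = mu n n (n + 1) \<beta> (x' n) \<oplus>\<^bsub>E n (n + 1)\<^esub> mu n n (n + 1) \<delta> (y' n)"
proof -
  obtain \<alpha> \<beta> where 1: "\<alpha> \<in> carrier (E n n)" "\<beta> \<in> carrier (E n n)"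
    "mu (n - 1) (n - 1) n a (x n) = mu (n - 1) n n (x n) \<alpha> \<oplus>\<^bsub>E (n - 1) n\<^esub> mu (n - 1) n n (y n) \<beta>"
    using left_gen[OF order_refl, of "mu (n - 1) (n - 1) n a (x n)" n] a by auto
  obtain \<gamma> \<delta> where 2: "\<gamma> \<in> carrier (E n n)" "\<delta> \<in> carrier (E n n)"
    "mu (n - 1) (n - 1) n a (y n) = mu (n - 1) n n (x n) \<gamma> \<oplus>\<^bsub>E (n - 1) n\<^esub> mu (n - 1) n n (y n) \<delta>"
    using left_gen[OF order_refl, of "mu (n - 1) (n - 1) n a (y n)" n] a by auto
  let ?u = "mu n n (n + 1) \<alpha> (x' n) \<oplus>\<^bsub>E n (n + 1)\<^esub> mu n n (n + 1) \<gamma> (y' n)"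
  let ?v = "mu n n (n + 1) \<beta> (x' n) \<oplus>\<^bsub>E n (n + 1)\<^esub> mu n n (n + 1) \<delta> (y' n)"
  have "mu (n - 1) n (n + 1) (x n) ?u \<oplus>\<^bsub>E (n - 1) (n + 1)\<^esub> mu (n - 1) n (n + 1) (y n) ?v =
    mu (n - 1) n (n + 1) (mu (n - 1) n n (x n) \<alpha> \<oplus>\<^bsub>E (n - 1) n\<^esub> mu (n - 1) n n (y n) \<beta>) (x' n)
    \<oplus>\<^bsub>E (n - 1) (n + 1)\<^esub>
    mu (n - 1) n (n + 1) (mu (n - 1) n n (x n) \<gamma> \<oplus>\<^bsub>E (n - 1) n\<^esub> mu (n - 1) n n (y n) \<delta>) (y' n)"
    using 1(1,2) 2(1,2) by (simp add: mu_add mu_assoc add_ac)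
  also have "\<dots> = mu (n - 1) (n - 1) (n + 1) a
      (mu (n - 1) n (n + 1) (x n) (x' n) \<oplus>\<^bsub>E (n - 1) (n + 1)\<^esub> mu (n - 1) n (n + 1) (y n) (y' n))"
    using a unfolding 1(3)[symmetric] 2(3)[symmetric] by (simp add: mu_add mu_assoc)
  also have "\<dots> = \<zero>\<^bsub>E (n - 1) (n + 1)\<^esub>" using a by (simp add: rel)
  finally obtain b where "b \<in> carrier (E (n + 1) (n + 1))" "?u = mu n (n + 1) (n + 1) (x' n) b"
    "?v = mu n (n + 1) (n + 1) (y' n) b"
    using left_exact[of ?u n "n + 1" ?v] 1(1,2) 2(1,2) by auto
  then show ?thesis using 1 2 by metis
qed

text \<open>The same coupling read from the other end: expand \<open>x' b\<close>,
  \<open>y' b\<close> and use \<open>right_exact\<close>. The two scalar clauses of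
  \<open>semilinear_on\<close> need one direction each.\<close>

lemma scalar_left:
  assumes b: "b \<in> carrier (E (n + 1) (n + 1))"
  shows "\<exists>\<alpha>\<in>carrier (E n n). \<exists>\<beta>\<in>carrier (E n n). \<exists>\<gamma>\<in>carrier (E n n). \<exists>\<delta>\<in>carrier (E n n).
    \<exists>a\<in>carrier (E (n - 1) (n - 1)).
      mu (n - 1) (n - 1) n a (x n) = mu (n - 1) n n (x n) \<alpha> \<oplus>\<^bsub>E (n - 1) n\<^esub> mu (n - 1) n n (y n) \<beta> \<and>
      mu (n - 1) (n - 1) n a (y n) = mu (n - 1) n n (x n) \<gamma> \<oplus>\<^bsub>E (n - 1) n\<^esub> mu (n - 1) n n (y n) \<delta> \<and>
      mu n (n + 1) (n + 1) (x' n) b = mu n n (n + 1) \<alpha> (x' n) \<oplus>\<^bsub>E n (n + 1)\<^esub> mu n n (n + 1) \<gamma> (y' n) \<and>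
      mu n (n + 1) (n + 1) (y' n) b = mu n n (n + 1) \<beta> (x' n) \<oplus>\<^bsub>E n (n + 1)\<^esub> mu n n (n + 1) \<delta> (y' n)"
proof -
  obtain \<alpha> \<gamma> where 1: "\<alpha> \<in> carrier (E n n)" "\<gamma> \<in> carrier (E n n)"
    "mu n (n + 1) (n + 1) (x' n) b = mu n n (n + 1) \<alpha> (x' n) \<oplus>\<^bsub>E n (n + 1)\<^esub> mu n n (n + 1) \<gamma> (y' n)"
    using right_gen[of n n "mu n (n + 1) (n + 1) (x' n) b"] b by auto
  obtain \<beta> \<delta> where 2: "\<beta> \<in> carrier (E n n)" "\<delta> \<in> carrier (E n n)"
    "mu n (n + 1) (n + 1) (y' n) b = mu n n (n + 1) \<beta> (x' n) \<oplus>\<^bsub>E n (n + 1)\<^esub> mu n n (n + 1) \<delta> (y' n)"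
    using right_gen[of n n "mu n (n + 1) (n + 1) (y' n) b"] b by auto
  let ?u = "mu (n - 1) n n (x n) \<alpha> \<oplus>\<^bsub>E (n - 1) n\<^esub> mu (n - 1) n n (y n) \<beta>"
  let ?v = "mu (n - 1) n n (x n) \<gamma> \<oplus>\<^bsub>E (n - 1) n\<^esub> mu (n - 1) n n (y n) \<delta>"
  have "mu (n - 1) n (n + 1) ?u (x' n) \<oplus>\<^bsub>E (n - 1) (n + 1)\<^esub> mu (n - 1) n (n + 1) ?v (y' n) =
    mu (n - 1) n (n + 1) (x n) (mu n n (n + 1) \<alpha> (x' n) \<oplus>\<^bsub>E n (n + 1)\<^esub> mu n n (n + 1) \<gamma> (y' n))
    \<oplus>\<^bsub>E (n - 1) (n + 1)\<^esub>
    mu (n - 1) n (n + 1) (y n) (mu n n (n + 1) \<beta> (x' n) \<oplus>\<^bsub>E n (n + 1)\<^esub> mu n n (n + 1) \<delta> (y' n))"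
    using 1(1,2) 2(1,2) by (simp add: mu_add mu_assoc add_ac)
  also have "\<dots> = mu (n - 1) (n + 1) (n + 1)
      (mu (n - 1) n (n + 1) (x n) (x' n) \<oplus>\<^bsub>E (n - 1) (n + 1)\<^esub> mu (n - 1) n (n + 1) (y n) (y' n)) b"
    using b unfolding 1(3)[symmetric] 2(3)[symmetric] by (simp add: mu_add mu_assoc)
  also have "\<dots> = \<zero>\<^bsub>E (n - 1) (n + 1)\<^esub>" using b by (simp add: rel)
  finally obtain a where "a \<in> carrier (E (n - 1) (n - 1))" "?u = mu (n - 1) (n - 1) n a (x n)"
    "?v = mu (n - 1) (n - 1) n a (y n)"
    using right_exact[of ?u "n - 1" n ?v] 1(1,2) 2(1,2) by auto
  then show ?thesis using 1 2 by metis
qed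

end

lemma (in z_algebra) neg_zero [simp]: "\<ominus>\<^bsub>E i j\<^esub> \<zero>\<^bsub>E i j\<^esub> = \<zero>\<^bsub>E i j\<^esub>"
  by (rule neg_unique[symmetric]) auto

section \<open>The dimension of the product of a subspace with the generators\<close>

context ncs_algebra
begin

lemma sub_carrier: "sub i n (carrier (E i n))"
  using fspace.subsp_carrier[OF fsp] .

lemma prv_zero:
  assumes "\<And>z. z \<in> carrier (E i (n - 1)) \<Longrightarrow> \<forall>v\<in>carrier (E (n - 1) n). mu i (n - 1) n z v = \<zero>\<^bsub>E i n\<^esub>
    \<Longrightarrow> z = \<zero>\<^bsub>E i (n - 1)\<^esub>"
  shows "prv i n {\<zero>\<^bsub>E i n\<^esub>} = {\<zero>\<^bsub>E i (n - 1)\<^esub>}"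
  using assms by (auto simp: prv_def)

text \<open>
  Adjoining \<open>e\<close> to \<open>U\<close> enlarges \<open>U V\<close> by \<open>e V\<close>. The overlap \<open>{v. e v \<in> U V}\<close> is the
  image, under a semilinear map with kernel \<open>prv i n U\<close>, of \<open>prv i n (U + e K)\<close>, because a
  relation in degree \<open>n + 1\<close> is a multiple of the canonical element.
\<close>

lemma ln_nxt:
  assumes i: "i \<le> n" and fin: "ln i (n - 1) (carrier (E i (n - 1))) N"
    and inj: "prv i n {\<zero>\<^bsub>E i n\<^esub>} = {\<zero>\<^bsub>E i (n - 1)\<^esub>}"
    and "ln i n U m"
  shows "\<exists>r s. ln i (n - 1) (prv i n U) r \<and> ln i (n + 1) (nxt i n U) s \<and> r + s = 2 * m"
  using assms(4)
proof (induction rule: len.induct)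
  case zero
  have "nxt i n {\<zero>\<^bsub>E i n\<^esub>} = {\<zero>\<^bsub>E i (n + 1)\<^esub>}" by (auto simp: nxt_def)
  \<comment> \<open>The base case is where injectivity enters: for \<open>U = 0\<close> both terms
    must vanish, so no non-zero \<open>z\<close> may annihilate \<open>V_(n-1)\<close>.\<close>
  then show ?case unfolding inj using len.zero by fastforce
next
  case (step U m e)
  let ?F = "diagonal_ring A"
  interpret In: fspace "?F n" "E i n" by (rule fsp)
  interpret Im: fspace "?F (n - 1)" "E i (n - 1)" by (rule fsp)
  interpret Ip: fspace "?F (n + 1)" "E i (n + 1)" by (rule fsp)
  interpret Np: fspace "?F (n + 1)" "E n (n + 1)" by (rule fsp)
  have U: "sub i n U" by (rule In.len_subsp[OF step.hyps(1)])
  have e [simp]: "e \<in> carrier (E i n)" and eU: "e \<notin> U" using step.hyps by auto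
  note Ud = subD[OF U]
  note [simp] = Ud(1)
  let ?U' = "adjoin (?F n) (E i n) U e"
  have U': "sub i n ?U'" by (rule In.adjoin_subsp[OF U e])
  have U'_iff: "u \<in> ?U' \<longleftrightarrow> (\<exists>w\<in>U. \<exists>k\<in>carrier (E n n). u = w \<oplus>\<^bsub>E i n\<^esub> mu i n n e k)" for u
    by (simp add: In.adjoin_iff)
  have UU': "U \<subseteq> ?U'" and eU': "e \<in> ?U'"
    by (rule In.adjoin_sup[OF U e], rule In.adjoin_mem[OF U e])
  obtain r s where rs: "ln i (n - 1) (prv i n U) r" "ln i (n + 1) (nxt i n U) s" "r + s = 2 * m"
    using step.IH by auto
  have Z: "sub i (n + 1) (nxt i n U)" by (rule nxt_sub[OF U])
  note Zd = subD[OF Z]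
  \<comment> \<open>Counting \<open>v \<mapsto> e v\<close> on the two-dimensional
    \<open>V_n\<close> modulo \<open>nxt i n U\<close> shows that the product grows by
    \<open>2 - dim N\<close>. It remains to see that \<open>prv\<close> grows by
    \<open>dim N\<close>.\<close>
  define N where "N = {v \<in> carrier (E n (n + 1)). mu i n (n + 1) e v \<in> nxt i n U}"
  have "semilinear_on (?F (n + 1)) (E n (n + 1)) (?F (n + 1)) (E i (n + 1)) (carrier (E n (n + 1)))
      (mu i n (n + 1) e)"
    unfolding semilinear_on_def by (auto simp: mu_add mu_assoc)
  moreover have "ln n (n + 1) (carrier (E n (n + 1))) 2" using ln_step[of "n + 1"] by simp
  ultimately obtain r0 s0 where N: "ln n (n + 1) N r0"
    "ln i (n + 1) {w \<oplus>\<^bsub>E i (n + 1)\<^esub> mu i n (n + 1) e v | w v. w \<in> nxt i n U \<and> v \<in> carrier (E n (n + 1))} (s + s0)"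
    "r0 + s0 = 2"
    using Np.len_rank_nullity[OF fsp _ rs(2) _ order_refl Np.subsp_carrier] unfolding N_def by blast
  have nxt': "{w \<oplus>\<^bsub>E i (n + 1)\<^esub> mu i n (n + 1) e v | w v. w \<in> nxt i n U \<and> v \<in> carrier (E n (n + 1))}
      = nxt i n ?U'"
  proof
    have Z': "sub i (n + 1) (nxt i n ?U')" by (rule nxt_sub[OF U'])
    have "nxt i n U \<subseteq> nxt i n ?U'" using UU' by (auto simp: nxt_def)
    then show "{w \<oplus>\<^bsub>E i (n + 1)\<^esub> mu i n (n + 1) e v | w v. w \<in> nxt i n U \<and> v \<in> carrier (E n (n + 1))}
        \<subseteq> nxt i n ?U'"
      using subD(3)[OF Z'] nxt_mu[OF U' eU'] by auto
    show "nxt i n ?U' \<subseteq>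
        {w \<oplus>\<^bsub>E i (n + 1)\<^esub> mu i n (n + 1) e v | w v. w \<in> nxt i n U \<and> v \<in> carrier (E n (n + 1))}"
    proof
      fix t assume "t \<in> nxt i n ?U'"
      then obtain a b where "a \<in> ?U'" "b \<in> ?U'"
        and t: "t = mu i n (n + 1) a (x' n) \<oplus>\<^bsub>E i (n + 1)\<^esub> mu i n (n + 1) b (y' n)"
        by (auto simp: nxt_def)
      then obtain u k u' k' where *: "u \<in> U" "u' \<in> U" "k \<in> carrier (E n n)" "k' \<in> carrier (E n n)"
        "a = u \<oplus>\<^bsub>E i n\<^esub> mu i n n e k" "b = u' \<oplus>\<^bsub>E i n\<^esub> mu i n n e k'"
        unfolding U'_iff by auto
      let ?v = "mu n n (n + 1) k (x' n) \<oplus>\<^bsub>E n (n + 1)\<^esub> mu n n (n + 1) k' (y' n)"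
      let ?w = "mu i n (n + 1) u (x' n) \<oplus>\<^bsub>E i (n + 1)\<^esub> mu i n (n + 1) u' (y' n)"
      have "t = ?w \<oplus>\<^bsub>E i (n + 1)\<^esub> mu i n (n + 1) e ?v"
        unfolding t *(5,6) using *(1-4) by (simp add: mu_add mu_assoc add_ac)
      moreover have "?w \<in> nxt i n U" using * by (auto simp: nxt_def)
      moreover have "?v \<in> carrier (E n (n + 1))" using * by auto
      ultimately show "t \<in> {w \<oplus>\<^bsub>E i (n + 1)\<^esub> mu i n (n + 1) e v | w v. w \<in> nxt i n U \<and>
          v \<in> carrier (E n (n + 1))}" by blast
    qed
  qed
  \<comment> \<open>\<open>G z k k'\<close> says \<open>z x = e k\<close> and
    \<open>z y = e k'\<close> modulo \<open>U\<close>. As \<open>e \<notin> U\<close>, the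
    coefficients are determined by \<open>z\<close> (this is \<open>coef\<close>), so
    \<open>g z = k x' + k' y'\<close> is well defined. Then \<open>e g(z)\<close> agrees with
    \<open>z (x x' + y y') = 0\<close> modulo \<open>U V\<close>.\<close>
  define G where "G z k k' \<longleftrightarrow> k \<in> carrier (E n n) \<and> k' \<in> carrier (E n n) \<and>
      mu i (n - 1) n z (x n) \<oplus>\<^bsub>E i n\<^esub> \<ominus>\<^bsub>E i n\<^esub> mu i n n e k \<in> U \<and>
      mu i (n - 1) n z (y n) \<oplus>\<^bsub>E i n\<^esub> \<ominus>\<^bsub>E i n\<^esub> mu i n n e k' \<in> U" for z k k'
  define vec where "vec k k' = mu n n (n + 1) k (x' n) \<oplus>\<^bsub>E n (n + 1)\<^esub> mu n n (n + 1) k' (y' n)" for k k'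
  define g where "g z = (THE v. \<exists>k k'. G z k k' \<and> v = vec k k')" for z
  have coef: "k = k'" if "c \<in> carrier (E i n)" "k \<in> carrier (E n n)" "k' \<in> carrier (E n n)"
    "c \<oplus>\<^bsub>E i n\<^esub> \<ominus>\<^bsub>E i n\<^esub> mu i n n e k \<in> U" "c \<oplus>\<^bsub>E i n\<^esub> \<ominus>\<^bsub>E i n\<^esub> mu i n n e k' \<in> U" for c k k'
  proof (rule ccontr)
    assume "k \<noteq> k'"
    let ?d = "k \<oplus>\<^bsub>E n n\<^esub> \<ominus>\<^bsub>E n n\<^esub> k'"
    have d: "?d \<in> carrier (E n n)" "?d \<noteq> \<zero>\<^bsub>E n n\<^esub>" using that diff_zeroD \<open>k \<noteq> k'\<close> by auto
    have "(c \<oplus>\<^bsub>E i n\<^esub> \<ominus>\<^bsub>E i n\<^esub> mu i n n e k') \<oplus>\<^bsub>E i n\<^esub> \<ominus>\<^bsub>E i n\<^esub> (c \<oplus>\<^bsub>E i n\<^esub> \<ominus>\<^bsub>E i n\<^esub> mu i n n e k) \<in> U"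
      by (rule Ud(3)[OF that(5) Ud(5)[OF that(4)]])
    moreover have "(c \<oplus>\<^bsub>E i n\<^esub> \<ominus>\<^bsub>E i n\<^esub> mu i n n e k') \<oplus>\<^bsub>E i n\<^esub> \<ominus>\<^bsub>E i n\<^esub> (c \<oplus>\<^bsub>E i n\<^esub> \<ominus>\<^bsub>E i n\<^esub> mu i n n e k)
        = mu i n n e ?d"
      using that(1-3) by (simp add: neg_add mu_add mu_neg add_ac abelian_group.minus_minus[OF zmod_abelian])
    ultimately have "mu i n n e ?d \<in> U" by simp
    then show False using In.subsp_smultD[OF U, of ?d e] d eU by simp
  qed
  have g_eq: "g z = vec k k'" if "G z k k'" "z \<in> carrier (E i (n - 1))" for z k k'
    unfolding g_def
  proof (rule the_equality)
    fix v assume "\<exists>k k'. G z k k' \<and> v = vec k k'"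
    then obtain l l' where "G z l l'" "v = vec l l'" by auto
    then show "v = vec k k'"
      using that coef[of "mu i (n - 1) n z (x n)" k l] coef[of "mu i (n - 1) n z (y n)" k' l']
      by (auto simp: G_def)
  qed (use that in blast)
  have P': "sub i (n - 1) (prv i n ?U')" by (rule prv_sub[OF U'])
  note P'd = subD[OF P']
  have G_ex: "\<exists>k k'. G z k k'" if z: "z \<in> prv i n ?U'" for z
  proof -
    have zc: "z \<in> carrier (E i (n - 1))" "mu i (n - 1) n z (x n) \<in> ?U'" "mu i (n - 1) n z (y n) \<in> ?U'"
      using z by (auto simp: prv_def)
    then obtain u k u' k' where *: "u \<in> U" "u' \<in> U" "k \<in> carrier (E n n)" "k' \<in> carrier (E n n)"
        "mu i (n - 1) n z (x n) = u \<oplus>\<^bsub>E i n\<^esub> mu i n n e k"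
        "mu i (n - 1) n z (y n) = u' \<oplus>\<^bsub>E i n\<^esub> mu i n n e k'"
        unfolding U'_iff by auto
    then have "G z k k'" unfolding G_def by (simp add: add_assoc)
    then show ?thesis by blast
  qed
  have vec_c [simp]: "vec k k' \<in> carrier (E n (n + 1))" if "k \<in> carrier (E n n)" "k' \<in> carrier (E n n)" for k k'
    using that by (simp add: vec_def)
  \<comment> \<open>Replacing \<open>z\<close> by \<open>z a\<close> transforms the pair
    \<open>k\<close>, \<open>k'\<close> by the matrix of \<open>a\<close> on \<open>x\<close>,
    \<open>y\<close>. Since \<open>b\<close> acts on \<open>x'\<close>, \<open>y'\<close> by the
    transposed matrix, \<open>g (z a) = g z b\<close> follows.\<close>
  have G_smult: "G (mu i (n - 1) (n - 1) z a) (mu n n n k \<alpha> \<oplus>\<^bsub>E n n\<^esub> mu n n n k' \<beta>)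
        (mu n n n k \<gamma> \<oplus>\<^bsub>E n n\<^esub> mu n n n k' \<delta>) \<and>
      vec (mu n n n k \<alpha> \<oplus>\<^bsub>E n n\<^esub> mu n n n k' \<beta>) (mu n n n k \<gamma> \<oplus>\<^bsub>E n n\<^esub> mu n n n k' \<delta>) =
        mu n (n + 1) (n + 1) (vec k k') b"
    if *: "G z k k'" "z \<in> carrier (E i (n - 1))"
      "\<alpha> \<in> carrier (E n n)" "\<beta> \<in> carrier (E n n)" "\<gamma> \<in> carrier (E n n)" "\<delta> \<in> carrier (E n n)"
      "a \<in> carrier (E (n - 1) (n - 1))" "b \<in> carrier (E (n + 1) (n + 1))"
      "mu (n - 1) (n - 1) n a (x n) = mu (n - 1) n n (x n) \<alpha> \<oplus>\<^bsub>E (n - 1) n\<^esub> mu (n - 1) n n (y n) \<beta>"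
      "mu (n - 1) (n - 1) n a (y n) = mu (n - 1) n n (x n) \<gamma> \<oplus>\<^bsub>E (n - 1) n\<^esub> mu (n - 1) n n (y n) \<delta>"
      "mu n (n + 1) (n + 1) (x' n) b = mu n n (n + 1) \<alpha> (x' n) \<oplus>\<^bsub>E n (n + 1)\<^esub> mu n n (n + 1) \<gamma> (y' n)"
      "mu n (n + 1) (n + 1) (y' n) b = mu n n (n + 1) \<beta> (x' n) \<oplus>\<^bsub>E n (n + 1)\<^esub> mu n n (n + 1) \<delta> (y' n)"
    for z k k' \<alpha> \<beta> \<gamma> \<delta> a b
  proof
    have kk: "k \<in> carrier (E n n)" "k' \<in> carrier (E n n)" using *(1) by (auto simp: G_def)
    let ?zx = "mu i (n - 1) n z (x n)" and ?zy = "mu i (n - 1) n z (y n)"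
    let ?p = "?zx \<oplus>\<^bsub>E i n\<^esub> \<ominus>\<^bsub>E i n\<^esub> mu i n n e k" and ?q = "?zy \<oplus>\<^bsub>E i n\<^esub> \<ominus>\<^bsub>E i n\<^esub> mu i n n e k'"
    have pq: "?p \<in> U" "?q \<in> U" using *(1) by (auto simp: G_def)
    have 1: "mu i (n - 1) n (mu i (n - 1) (n - 1) z a) (x n) = mu i n n ?zx \<alpha> \<oplus>\<^bsub>E i n\<^esub> mu i n n ?zy \<beta>"
      using *(2-8) by (simp add: mu_assoc *(9) mu_add)
    have 2: "mu i (n - 1) n (mu i (n - 1) (n - 1) z a) (y n) = mu i n n ?zx \<gamma> \<oplus>\<^bsub>E i n\<^esub> mu i n n ?zy \<delta>"
      using *(2-8) by (simp add: mu_assoc *(10) mu_add)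
    have "mu i n n ?p \<alpha> \<oplus>\<^bsub>E i n\<^esub> mu i n n ?q \<beta> \<in> U" "mu i n n ?p \<gamma> \<oplus>\<^bsub>E i n\<^esub> mu i n n ?q \<delta> \<in> U"
      by (intro Ud(3) Ud(4) pq *(3-6))+
    moreover have "mu i n n ?p \<alpha> \<oplus>\<^bsub>E i n\<^esub> mu i n n ?q \<beta> =
      (mu i n n ?zx \<alpha> \<oplus>\<^bsub>E i n\<^esub> mu i n n ?zy \<beta>) \<oplus>\<^bsub>E i n\<^esub> \<ominus>\<^bsub>E i n\<^esub> mu i n n e (mu n n n k \<alpha> \<oplus>\<^bsub>E n n\<^esub> mu n n n k' \<beta>)"
      using kk *(2-6) by (simp add: mu_add mu_assoc mu_neg neg_add add_ac)
    moreover have "mu i n n ?p \<gamma> \<oplus>\<^bsub>E i n\<^esub> mu i n n ?q \<delta> =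
      (mu i n n ?zx \<gamma> \<oplus>\<^bsub>E i n\<^esub> mu i n n ?zy \<delta>) \<oplus>\<^bsub>E i n\<^esub> \<ominus>\<^bsub>E i n\<^esub> mu i n n e (mu n n n k \<gamma> \<oplus>\<^bsub>E n n\<^esub> mu n n n k' \<delta>)"
      using kk *(2-6) by (simp add: mu_add mu_assoc mu_neg neg_add add_ac)
    ultimately show "G (mu i (n - 1) (n - 1) z a) (mu n n n k \<alpha> \<oplus>\<^bsub>E n n\<^esub> mu n n n k' \<beta>)
        (mu n n n k \<gamma> \<oplus>\<^bsub>E n n\<^esub> mu n n n k' \<delta>)"
      unfolding G_def 1 2 using kk *(3-6) by simp
    show "vec (mu n n n k \<alpha> \<oplus>\<^bsub>E n n\<^esub> mu n n n k' \<beta>) (mu n n n k \<gamma> \<oplus>\<^bsub>E n n\<^esub> mu n n n k' \<delta>) =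
        mu n (n + 1) (n + 1) (vec k k') b"
      using kk *(3-8) by (simp add: vec_def mu_add mu_assoc *(11,12) add_ac)
  qed
  have "semilinear_on (?F (n - 1)) (E i (n - 1)) (?F (n + 1)) (E n (n + 1)) (prv i n ?U') g"
    unfolding semilinear_on_def
  proof (intro conjI ballI)
    show "g \<in> prv i n ?U' \<rightarrow> carrier (E n (n + 1))"
    proof
      fix z assume z: "z \<in> prv i n ?U'"
      then obtain k k' where "G z k k'" using G_ex by blast
      then show "g z \<in> carrier (E n (n + 1))" using g_eq[of z k k'] P'd(1)[OF z] by (auto simp: G_def)
    qed
  next
    fix z w assume z: "z \<in> prv i n ?U'" and w: "w \<in> prv i n ?U'"
    then obtain k k' l l' where kl: "G z k k'" "G w l l'" using G_ex by meson
    have c: "z \<in> carrier (E i (n - 1))" "w \<in> carrier (E i (n - 1))" using P'd(1) z w by auto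
    have klc: "k \<in> carrier (E n n)" "k' \<in> carrier (E n n)" "l \<in> carrier (E n n)" "l' \<in> carrier (E n n)"
      using kl by (auto simp: G_def)
    have eq: "(mu i (n - 1) n z t \<oplus>\<^bsub>E i n\<^esub> \<ominus>\<^bsub>E i n\<^esub> mu i n n e j) \<oplus>\<^bsub>E i n\<^esub>
        (mu i (n - 1) n w t \<oplus>\<^bsub>E i n\<^esub> \<ominus>\<^bsub>E i n\<^esub> mu i n n e j') =
        mu i (n - 1) n (z \<oplus>\<^bsub>E i (n - 1)\<^esub> w) t \<oplus>\<^bsub>E i n\<^esub> \<ominus>\<^bsub>E i n\<^esub> mu i n n e (j \<oplus>\<^bsub>E n n\<^esub> j')"
      if "t \<in> carrier (E (n - 1) n)" "j \<in> carrier (E n n)" "j' \<in> carrier (E n n)" for t j j'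
      using that c by (simp add: mu_add neg_add add_ac)
    have "G (z \<oplus>\<^bsub>E i (n - 1)\<^esub> w) (k \<oplus>\<^bsub>E n n\<^esub> l) (k' \<oplus>\<^bsub>E n n\<^esub> l')"
      unfolding G_def eq[OF gens_closed(1) klc(1,3), symmetric] eq[OF gens_closed(2) klc(2,4), symmetric]
      using kl klc by (auto simp: G_def intro!: Ud(3))
    then have "g (z \<oplus>\<^bsub>E i (n - 1)\<^esub> w) = vec (k \<oplus>\<^bsub>E n n\<^esub> l) (k' \<oplus>\<^bsub>E n n\<^esub> l')"
      using g_eq c by blast
    also have "\<dots> = vec k k' \<oplus>\<^bsub>E n (n + 1)\<^esub> vec l l'"
      using klc by (simp add: vec_def mu_add add_ac)
    finally show "g (z \<oplus>\<^bsub>E i (n - 1)\<^esub> w) = g z \<oplus>\<^bsub>E n (n + 1)\<^esub> g w"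
      using g_eq kl c by simp
  next
    fix a z assume a: "a \<in> carrier (?F (n - 1))" and z: "z \<in> prv i n ?U'"
    then obtain k k' where G: "G z k k'" using G_ex by meson
    have c: "z \<in> carrier (E i (n - 1))" using P'd(1) z by auto
    have a': "a \<in> carrier (E (n - 1) (n - 1))" using a by simp
    obtain \<alpha> \<beta> \<gamma> \<delta> b where ab: "\<alpha> \<in> carrier (E n n)" "\<beta> \<in> carrier (E n n)" "\<gamma> \<in> carrier (E n n)"
      "\<delta> \<in> carrier (E n n)" "b \<in> carrier (E (n + 1) (n + 1))"
      "mu (n - 1) (n - 1) n a (x n) = mu (n - 1) n n (x n) \<alpha> \<oplus>\<^bsub>E (n - 1) n\<^esub> mu (n - 1) n n (y n) \<beta>"
      "mu (n - 1) (n - 1) n a (y n) = mu (n - 1) n n (x n) \<gamma> \<oplus>\<^bsub>E (n - 1) n\<^esub> mu (n - 1) n n (y n) \<delta>"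
      "mu n (n + 1) (n + 1) (x' n) b = mu n n (n + 1) \<alpha> (x' n) \<oplus>\<^bsub>E n (n + 1)\<^esub> mu n n (n + 1) \<gamma> (y' n)"
      "mu n (n + 1) (n + 1) (y' n) b = mu n n (n + 1) \<beta> (x' n) \<oplus>\<^bsub>E n (n + 1)\<^esub> mu n n (n + 1) \<delta> (y' n)"
      using scalar_right[OF a'] by auto
    have "g (mu i (n - 1) (n - 1) z a) = mu n (n + 1) (n + 1) (g z) b"
      using G_smult[OF G c ab(1-4) a' ab(5-9)] g_eq[OF G c] g_eq c a' by (metis mu_closed)
    then show "\<exists>b\<in>carrier (?F (n + 1)). g (a \<odot>\<^bsub>E i (n - 1)\<^esub> z) = b \<odot>\<^bsub>E n (n + 1)\<^esub> g z"
      using ab(5) by auto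
  next
    fix b z assume b: "b \<in> carrier (?F (n + 1))" and z: "z \<in> prv i n ?U'"
    then obtain k k' where G: "G z k k'" using G_ex by meson
    have c: "z \<in> carrier (E i (n - 1))" using P'd(1) z by auto
    have b': "b \<in> carrier (E (n + 1) (n + 1))" using b by simp
    obtain \<alpha> \<beta> \<gamma> \<delta> a where ab: "\<alpha> \<in> carrier (E n n)" "\<beta> \<in> carrier (E n n)" "\<gamma> \<in> carrier (E n n)"
      "\<delta> \<in> carrier (E n n)" "a \<in> carrier (E (n - 1) (n - 1))"
      "mu (n - 1) (n - 1) n a (x n) = mu (n - 1) n n (x n) \<alpha> \<oplus>\<^bsub>E (n - 1) n\<^esub> mu (n - 1) n n (y n) \<beta>"
      "mu (n - 1) (n - 1) n a (y n) = mu (n - 1) n n (x n) \<gamma> \<oplus>\<^bsub>E (n - 1) n\<^esub> mu (n - 1) n n (y n) \<delta>"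
      "mu n (n + 1) (n + 1) (x' n) b = mu n n (n + 1) \<alpha> (x' n) \<oplus>\<^bsub>E n (n + 1)\<^esub> mu n n (n + 1) \<gamma> (y' n)"
      "mu n (n + 1) (n + 1) (y' n) b = mu n n (n + 1) \<beta> (x' n) \<oplus>\<^bsub>E n (n + 1)\<^esub> mu n n (n + 1) \<delta> (y' n)"
      using scalar_left[OF b'] by auto
    have "g (mu i (n - 1) (n - 1) z a) = mu n (n + 1) (n + 1) (g z) b"
      using G_smult[OF G c ab(1-5) b' ab(6-9)] g_eq[OF G c] g_eq c ab(5) by (metis mu_closed)
    then show "\<exists>a\<in>carrier (?F (n - 1)). b \<odot>\<^bsub>E n (n + 1)\<^esub> g z = g (a \<odot>\<^bsub>E i (n - 1)\<^esub> z)"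
      using ab(5) by (auto intro!: bexI[of _ a])
  qed
  \<comment> \<open>The finite dimension of \<open>A_(i,n-1)\<close> is used here, to give
    \<open>prv\<close> of the enlarged subspace a dimension at all.\<close>
  moreover obtain t where t: "ln i (n - 1) (prv i n ?U') t"
    using Im.len_subsp_ex[OF fin P'] P'd(1) by auto
  ultimately obtain r1 s1 where r1: "ln i (n - 1) {z \<in> prv i n ?U'. g z \<in> {\<zero>\<^bsub>E n (n + 1)\<^esub>}} r1"
    "ln n (n + 1) {w \<oplus>\<^bsub>E n (n + 1)\<^esub> g z | w z. w \<in> {\<zero>\<^bsub>E n (n + 1)\<^esub>} \<and> z \<in> prv i n ?U'} (0 + s1)" "r1 + s1 = t"
    using Im.len_rank_nullity[OF fsp _ len.zero t order_refl P'] by blast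
  have ker: "{z \<in> prv i n ?U'. g z \<in> {\<zero>\<^bsub>E n (n + 1)\<^esub>}} = prv i n U"
  proof (intro Set.set_eqI iffI)
    fix z assume "z \<in> {z \<in> prv i n ?U'. g z \<in> {\<zero>\<^bsub>E n (n + 1)\<^esub>}}"
    then have z: "z \<in> prv i n ?U'" "g z = \<zero>\<^bsub>E n (n + 1)\<^esub>" by auto
    then obtain k k' where G: "G z k k'" using G_ex by meson
    have c: "z \<in> carrier (E i (n - 1))" using P'd(1) z by auto
    have "vec k k' = \<zero>\<^bsub>E n (n + 1)\<^esub>" using g_eq[OF G c] z by simp
    then have "k = \<zero>\<^bsub>E n n\<^esub>" "k' = \<zero>\<^bsub>E n n\<^esub>"
      using right_indep[of k n k'] G by (auto simp: vec_def G_def)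
    then have "mu i (n - 1) n z (x n) \<in> U" "mu i (n - 1) n z (y n) \<in> U"
      using G c unfolding G_def by (simp_all add: neg_zero)
    then show "z \<in> prv i n U" by (rule prvI[OF U c])
  next
    fix z assume z: "z \<in> prv i n U"
    then have z': "z \<in> prv i n ?U'" using UU' by (auto simp: prv_def)
    have c: "z \<in> carrier (E i (n - 1))" using P'd(1) z' by auto
    have "G z \<zero>\<^bsub>E n n\<^esub> \<zero>\<^bsub>E n n\<^esub>"
      using z c by (simp add: G_def prv_def neg_zero)
    then show "z \<in> {z \<in> prv i n ?U'. g z \<in> {\<zero>\<^bsub>E n (n + 1)\<^esub>}}"
      using g_eq[OF _ c] z' by (simp add: vec_def)
  qed
  have im: "{w \<oplus>\<^bsub>E n (n + 1)\<^esub> g z | w z. w \<in> {\<zero>\<^bsub>E n (n + 1)\<^esub>} \<and> z \<in> prv i n ?U'} = N"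
  proof (intro Set.set_eqI iffI)
    fix v assume "v \<in> {w \<oplus>\<^bsub>E n (n + 1)\<^esub> g z | w z. w \<in> {\<zero>\<^bsub>E n (n + 1)\<^esub>} \<and> z \<in> prv i n ?U'}"
    then obtain z where z: "z \<in> prv i n ?U'" "v = \<zero>\<^bsub>E n (n + 1)\<^esub> \<oplus>\<^bsub>E n (n + 1)\<^esub> g z" by auto
    then obtain k k' where G: "G z k k'" using G_ex by meson
    have c: "z \<in> carrier (E i (n - 1))" using P'd(1) z by auto
    have kk: "k \<in> carrier (E n n)" "k' \<in> carrier (E n n)" using G by (auto simp: G_def)
    have v: "v = vec k k'" using z(2) g_eq[OF G c] kk by simp
    let ?p = "mu i (n - 1) n z (x n) \<oplus>\<^bsub>E i n\<^esub> \<ominus>\<^bsub>E i n\<^esub> mu i n n e k"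
    let ?q = "mu i (n - 1) n z (y n) \<oplus>\<^bsub>E i n\<^esub> \<ominus>\<^bsub>E i n\<^esub> mu i n n e k'"
    have pq: "?p \<in> U" "?q \<in> U" using G by (auto simp: G_def)
    have "mu i n (n + 1) ?p (x' n) \<oplus>\<^bsub>E i (n + 1)\<^esub> mu i n (n + 1) ?q (y' n) =
      mu i (n - 1) (n + 1) z (mu (n - 1) n (n + 1) (x n) (x' n) \<oplus>\<^bsub>E (n - 1) (n + 1)\<^esub> mu (n - 1) n (n + 1) (y n) (y' n))
      \<oplus>\<^bsub>E i (n + 1)\<^esub> \<ominus>\<^bsub>E i (n + 1)\<^esub> mu i n (n + 1) e (vec k k')"
      using c kk by (simp add: vec_def mu_add mu_neg neg_add mu_assoc add_ac)
    also have "\<dots> = \<ominus>\<^bsub>E i (n + 1)\<^esub> mu i n (n + 1) e v" unfolding rel v using c kk by simp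
    finally have eq: "mu i n (n + 1) ?p (x' n) \<oplus>\<^bsub>E i (n + 1)\<^esub> mu i n (n + 1) ?q (y' n) =
      \<ominus>\<^bsub>E i (n + 1)\<^esub> mu i n (n + 1) e v" .
    have "mu i n (n + 1) ?p (x' n) \<oplus>\<^bsub>E i (n + 1)\<^esub> mu i n (n + 1) ?q (y' n) \<in> nxt i n U"
      using pq unfolding nxt_def by blast
    then have "\<ominus>\<^bsub>E i (n + 1)\<^esub> mu i n (n + 1) e v \<in> nxt i n U" unfolding eq .
    then have "\<ominus>\<^bsub>E i (n + 1)\<^esub> (\<ominus>\<^bsub>E i (n + 1)\<^esub> mu i n (n + 1) e v) \<in> nxt i n U" by (rule Zd(5))
    then show "v \<in> N" unfolding N_def using v kk by (simp add: abelian_group.minus_minus[OF zmod_abelian])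
  next
    fix v assume "v \<in> N"
    then have v: "v \<in> carrier (E n (n + 1))" "mu i n (n + 1) e v \<in> nxt i n U" by (auto simp: N_def)
    obtain k k' where kk: "k \<in> carrier (E n n)" "k' \<in> carrier (E n n)" and vk: "v = vec k k'"
      unfolding vec_def using right_gen[OF order_refl v(1)] by blast
    obtain u u' where u: "u \<in> U" "u' \<in> U"
      "mu i n (n + 1) e v = mu i n (n + 1) u (x' n) \<oplus>\<^bsub>E i (n + 1)\<^esub> mu i n (n + 1) u' (y' n)"
      using v(2) by (auto simp: nxt_def)
    \<comment> \<open>From \<open>e v = u x' + u' y'\<close> the elements \<open>?p\<close>,
      \<open>?q\<close> satisfy \<open>?p x' + ?q y' = 0\<close>. Exactness supplies
      \<open>z\<close> with \<open>z x = ?p\<close> and \<open>z y = ?q\<close>, and this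
      \<open>z\<close> is a preimage of \<open>v\<close> under \<open>g\<close>.\<close>
    let ?p = "mu i n n e k \<oplus>\<^bsub>E i n\<^esub> \<ominus>\<^bsub>E i n\<^esub> u" and ?q = "mu i n n e k' \<oplus>\<^bsub>E i n\<^esub> \<ominus>\<^bsub>E i n\<^esub> u'"
    have "mu i n (n + 1) ?p (x' n) \<oplus>\<^bsub>E i (n + 1)\<^esub> mu i n (n + 1) ?q (y' n) =
      mu i n (n + 1) e v \<oplus>\<^bsub>E i (n + 1)\<^esub> \<ominus>\<^bsub>E i (n + 1)\<^esub> (mu i n (n + 1) u (x' n) \<oplus>\<^bsub>E i (n + 1)\<^esub> mu i n (n + 1) u' (y' n))"
      using u(1,2) kk by (simp add: vk vec_def mu_add mu_neg neg_add mu_assoc add_ac)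
    also have "\<dots> = \<zero>\<^bsub>E i (n + 1)\<^esub>" unfolding u(3)[symmetric] using v(1) by simp
    finally obtain z where z: "z \<in> carrier (E i (n - 1))" "?p = mu i (n - 1) n z (x n)" "?q = mu i (n - 1) n z (y n)"
      using right_exact[of ?p i n ?q] u(1,2) kk by auto
    have "mu i n n e j \<oplus>\<^bsub>E i n\<^esub> \<ominus>\<^bsub>E i n\<^esub> w \<in> ?U'" if "j \<in> carrier (E n n)" "w \<in> U" for j w
      unfolding U'_iff using that
      by (intro bexI[of _ "\<ominus>\<^bsub>E i n\<^esub> w"] bexI[of _ j]) (simp_all add: add_comm Ud(5))
    then have "?p \<in> ?U'" "?q \<in> ?U'" using kk u(1,2) by blast+
    then have z': "z \<in> prv i n ?U'" unfolding z(2,3) by (rule prvI[OF U' z(1)])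
    have cancel: "(c \<oplus>\<^bsub>E i n\<^esub> \<ominus>\<^bsub>E i n\<^esub> w) \<oplus>\<^bsub>E i n\<^esub> \<ominus>\<^bsub>E i n\<^esub> c = \<ominus>\<^bsub>E i n\<^esub> w"
      if c: "c \<in> carrier (E i n)" and w: "w \<in> carrier (E i n)" for c w
      using c w unfolding add_comm[OF c neg_closed[OF w]] by (simp add: add_assoc)
    have "?p \<oplus>\<^bsub>E i n\<^esub> \<ominus>\<^bsub>E i n\<^esub> mu i n n e k = \<ominus>\<^bsub>E i n\<^esub> u" "?q \<oplus>\<^bsub>E i n\<^esub> \<ominus>\<^bsub>E i n\<^esub> mu i n n e k' = \<ominus>\<^bsub>E i n\<^esub> u'"
      using kk u(1,2) cancel by simp_all
    then have "G z k k'" unfolding G_def z(2,3)[symmetric] using kk Ud(5) u by simp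
    then have "v = g z" using g_eq z(1) vk by simp
    then show "v \<in> {w \<oplus>\<^bsub>E n (n + 1)\<^esub> g z | w z. w \<in> {\<zero>\<^bsub>E n (n + 1)\<^esub>} \<and> z \<in> prv i n ?U'}"
      using z' v(1) by force
  qed
  have "r1 = r" using Im.len_unique[OF rs(1)] r1(1) unfolding ker by blast
  moreover have "s1 = r0" using Np.len_unique[OF N(1)] r1(2) unfolding im by simp
  \<comment> \<open>Here \<open>t = r + r0\<close> and \<open>s0 = 2 - r0\<close>, so
    \<open>t + (s + s0) = 2 m + 2\<close>.\<close>
  ultimately show ?case using t N(2,3) rs(3) r1(3) unfolding nxt' by (intro exI[of _ t] exI[of _ "s + s0"]) simp
qed

end

text \<open>Meant for quotient modules: operations on cosets are known through representatives, and
  every axiom is inherited along the surjection.\<close>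

lemma (in fspace) surj_fspace:
  fixes M' (structure)
  assumes surj: "h ` carrier M = carrier M'" and zero: "h \<zero>\<^bsub>M\<^esub> = \<zero>\<^bsub>M'\<^esub>"
    and add: "\<And>u v. u \<in> carrier M \<Longrightarrow> v \<in> carrier M \<Longrightarrow> h (u \<oplus>\<^bsub>M\<^esub> v) = h u \<oplus>\<^bsub>M'\<^esub> h v"
    and smult: "\<And>a u. a \<in> carrier R \<Longrightarrow> u \<in> carrier M \<Longrightarrow> h (a \<odot>\<^bsub>M\<^esub> u) = a \<odot>\<^bsub>M'\<^esub> h u"
  shows "fspace R M'"
proof -
  note c = surj[symmetric]
  have "abelian_group M'"
  proof (rule abelian_groupI)
    fix u v assume "u \<in> carrier M'" "v \<in> carrier M'"
    then show "u \<oplus>\<^bsub>M'\<^esub> v \<in> carrier M'" by (auto simp: c add[symmetric])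
  next
    show "\<zero>\<^bsub>M'\<^esub> \<in> carrier M'" by (auto simp: c zero[symmetric])
  next
    fix u v w assume "u \<in> carrier M'" "v \<in> carrier M'" "w \<in> carrier M'"
    then show "u \<oplus>\<^bsub>M'\<^esub> v \<oplus>\<^bsub>M'\<^esub> w = u \<oplus>\<^bsub>M'\<^esub> (v \<oplus>\<^bsub>M'\<^esub> w)"
      by (auto simp: c add[symmetric] M.a_assoc)
  next
    fix u v assume "u \<in> carrier M'" "v \<in> carrier M'"
    then show "u \<oplus>\<^bsub>M'\<^esub> v = v \<oplus>\<^bsub>M'\<^esub> u" by (auto simp: c add[symmetric] M.a_comm)
  next
    fix u assume "u \<in> carrier M'"
    then show "\<zero>\<^bsub>M'\<^esub> \<oplus>\<^bsub>M'\<^esub> u = u" by (auto simp: c add[symmetric] zero[symmetric])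
  next
    fix u assume "u \<in> carrier M'"
    then obtain v where v: "v \<in> carrier M" "u = h v" by (auto simp: c)
    then show "\<exists>y\<in>carrier M'. y \<oplus>\<^bsub>M'\<^esub> u = \<zero>\<^bsub>M'\<^esub>"
      by (intro bexI[of _ "h (\<ominus>\<^bsub>M\<^esub> v)"]) (auto simp: c add[symmetric] zero[symmetric] M.l_neg)
  qed
  moreover have "module_axioms R M'"
  proof (rule module_axioms.intro)
    fix a u assume "a \<in> carrier R" "u \<in> carrier M'"
    then show "a \<odot>\<^bsub>M'\<^esub> u \<in> carrier M'" by (auto simp: c smult[symmetric])
  next
    fix a b u assume "a \<in> carrier R" "b \<in> carrier R" "u \<in> carrier M'"
    then show "(a \<oplus> b) \<odot>\<^bsub>M'\<^esub> u = a \<odot>\<^bsub>M'\<^esub> u \<oplus>\<^bsub>M'\<^esub> b \<odot>\<^bsub>M'\<^esub> u"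
      by (auto simp: c smult[symmetric] add[symmetric] smult_l_distr)
  next
    fix a u v assume "a \<in> carrier R" "u \<in> carrier M'" "v \<in> carrier M'"
    then show "a \<odot>\<^bsub>M'\<^esub> (u \<oplus>\<^bsub>M'\<^esub> v) = a \<odot>\<^bsub>M'\<^esub> u \<oplus>\<^bsub>M'\<^esub> a \<odot>\<^bsub>M'\<^esub> v"
      by (auto simp: c smult[symmetric] add[symmetric] smult_r_distr)
  next
    fix a b u assume "a \<in> carrier R" "b \<in> carrier R" "u \<in> carrier M'"
    then show "(a \<otimes> b) \<odot>\<^bsub>M'\<^esub> u = a \<odot>\<^bsub>M'\<^esub> (b \<odot>\<^bsub>M'\<^esub> u)"
      by (auto simp: c smult[symmetric] smult_assoc1)
  next
    fix u assume "u \<in> carrier M'"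
    then show "\<one> \<odot>\<^bsub>M'\<^esub> u = u" by (auto simp: c smult[symmetric])
  qed
  ultimately show ?thesis by (simp add: fspace_def module_def R.is_cring field_axioms)
qed

section \<open>Summed Hilbert functions that are eventually linear\<close>

lemma finite_support:
  fixes f :: "int \<Rightarrow> nat"
  assumes "\<And>n. n < i \<Longrightarrow> f n = 0"
  shows "finite {k. k \<le> n \<and> f k \<noteq> 0}"
proof (rule finite_subset)
  show "{k. k \<le> n \<and> f k \<noteq> 0} \<subseteq> {i..n}"
  proof
    fix k assume "k \<in> {k. k \<le> n \<and> f k \<noteq> 0}"
    then show "k \<in> {i..n}" using assms[of k] by (cases "k < i") auto
  qed
qed simp

text \<open>The polynomial is the one whose difference from \<open>n\<close> to \<open>n + 1\<close>
  equals \<open>\<alpha> (n + 1) + \<beta>\<close>. The constant \<open>\<gamma>\<close> absorbs the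
  irregular values up to \<open>n0\<close>, so the degree is two exactly when
  \<open>\<alpha> \<noteq> 0\<close>.\<close>

lemma eventually_linear_sum_poly:
  fixes f :: "int \<Rightarrow> nat" and \<alpha> \<beta> :: real
  assumes zero: "\<And>n. n < i \<Longrightarrow> f n = 0" and lin: "\<And>n. n0 \<le> n \<Longrightarrow> real (f n) = \<alpha> * real_of_int n + \<beta>"
  shows "\<exists>\<gamma>. \<forall>n\<ge>n0. real (\<Sum>k | k \<le> n \<and> f k \<noteq> 0. f k) =
    poly [:\<gamma>, \<beta> + \<alpha> / 2, \<alpha> / 2:] (real_of_int n)"
proof -
  have fin: "finite {k. k \<le> n \<and> f k \<noteq> 0}" for n
    using finite_support[of i f] zero by blast
  let ?F = "\<lambda>n. \<Sum>k | k \<le> n \<and> f k \<noteq> 0. f k"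
  have step: "?F (n + 1) = ?F n + f (n + 1)" for n
  proof (cases "f (n + 1) = 0")
    case True
    then have "{k. k \<le> n + 1 \<and> f k \<noteq> 0} = {k. k \<le> n \<and> f k \<noteq> 0}"
      by (auto simp: le_less zless_add1_eq)
    then show ?thesis using True by simp
  next
    case False
    then have "{k. k \<le> n + 1 \<and> f k \<noteq> 0} = insert (n + 1) {k. k \<le> n \<and> f k \<noteq> 0}"
      by (auto simp: le_less zless_add1_eq)
    then show ?thesis using fin by simp
  qed
  define \<gamma> where "\<gamma> = real (?F n0) - ((\<beta> + \<alpha> / 2) * real_of_int n0 + \<alpha> / 2 * (real_of_int n0)\<^sup>2)"
  have "real (?F n) = poly [:\<gamma>, \<beta> + \<alpha> / 2, \<alpha> / 2:] (real_of_int n)" if "n0 \<le> n" for n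
    using that
  proof (induction n rule: int_ge_induct)
    case base
    show ?case by (simp add: \<gamma>_def power2_eq_square algebra_simps)
  next
    case (step n)
    have "real (?F (n + 1)) = real (?F n) + (\<alpha> * real_of_int (n + 1) + \<beta>)"
      using lin[of "n + 1"] step.hyps \<open>?F (n + 1) = ?F n + f (n + 1)\<close> by simp
    then show ?case using step.IH by (simp add: algebra_simps add_divide_distrib)
  qed
  then show ?thesis by blast
qed

lemma nonincreasing_eventually_const:
  fixes g :: "int \<Rightarrow> nat"
  assumes "\<And>n. j \<le> n \<Longrightarrow> g (n + 1) \<le> g n"
  shows "\<exists>n0\<ge>j. \<forall>n\<ge>n0. g n = g n0"
proof -
  obtain n0 where n0: "j \<le> n0" "\<And>n. j \<le> n \<Longrightarrow> g n0 \<le> g n"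
    using ex_has_least_nat[of "\<lambda>n. j \<le> n" j g] by blast
  have "g n \<le> g n0" if "n0 \<le> n" for n
    using that
  proof (induction n rule: int_ge_induct)
    case (step n)
    then show ?case using assms[of n] n0(1) by linarith
  qed simp
  then show ?thesis using n0 by (intro exI[of _ n0]) (auto intro!: antisym)
qed

section \<open>Strict growth and the absence of zero divisors\<close>

context ncs_algebra
begin

lemma ln_unit: "ln i i (carrier (E i i)) 1"
proof -
  interpret F: fspace "diagonal_ring A i" "E i i" by (rule fsp)
  have "{a \<odot>\<^bsub>E i i\<^esub> zunit A i | a. a \<in> carrier (diagonal_ring A i)} = carrier (E i i)"
    by auto (metis mu_unit(1))
  then show ?thesis using F.len_line[of "zunit A i"] one_neq_zero by simp
qed

text \<open>The claims are interlocked, hence one induction: \<open>ln_nxt\<close> in degree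
  \<open>n + 1\<close> needs the finite dimension of \<open>A_in\<close> and the fact that no
  non-zero element of \<open>A_in\<close> annihilates \<open>V_n\<close>, and the latter is growth
  in degree \<open>n\<close> applied to a line. The induction starts at \<open>n = i - 1\<close>,
  where the component is zero and growth is vacuous, so that two consecutive components are
  available from the beginning.\<close>

lemma ln_growth:
  assumes "i - 1 \<le> n"
  shows "ln i n (carrier (E i n)) (nat (n - i + 1)) \<and>
    ln i (n + 1) (carrier (E i (n + 1))) (nat (n - i + 2)) \<and>
    (\<forall>U m. ln i n U m \<and> 1 \<le> m \<longrightarrow> (\<exists>s. m + 1 \<le> s \<and> ln i (n + 1) (nxt i n U) s))"
  using assms
proof (induction n rule: int_ge_induct)
  case base
  have z: "carrier (E i (i - 1)) = {\<zero>\<^bsub>E i (i - 1)\<^esub>}" by (rule below) simp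
  have l: "ln i (i - 1) (carrier (E i (i - 1))) 0" unfolding z by (rule len.zero)
  moreover have "m \<le> 0" if "ln i (i - 1) U m" for U m
  proof -
    interpret F: fspace "diagonal_ring A (i - 1)" "E i (i - 1)" by (rule fsp)
    show ?thesis using F.len_mono[OF l that] subD(1)[OF F.len_subsp[OF that]] by blast
  qed
  ultimately show ?case using ln_unit[of i] by fastforce
next
  case (step n)
  then have ni: "i \<le> n + 1" by simp
  interpret F: fspace "diagonal_ring A n" "E i n" by (rule fsp)
  interpret F1: fspace "diagonal_ring A (n + 1)" "E i (n + 1)" by (rule fsp)
  have c: "ln i n (carrier (E i n)) (nat (n - i + 1))"
    and c1: "ln i (n + 1) (carrier (E i (n + 1))) (nat (n - i + 2))" using step.IH by auto
  have grow: "\<exists>s. m + 1 \<le> s \<and> ln i (n + 1) (nxt i n U) s" if "ln i n U m" "1 \<le> m" for U m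
    using step.IH that by blast
  \<comment> \<open>If \<open>z \<noteq> 0\<close> annihilated \<open>V_n\<close>, the line through
    \<open>z\<close> would have product zero, although a line must grow to dimension at least
    two.\<close>
  have inj: "prv i (n + 1) {\<zero>\<^bsub>E i (n + 1)\<^esub>} = {\<zero>\<^bsub>E i (n + 1 - 1)\<^esub>}"
  proof (rule prv_zero, rule ccontr)
    fix z assume z': "z \<in> carrier (E i (n + 1 - 1))"
      and zv': "\<forall>v\<in>carrier (E (n + 1 - 1) (n + 1)). mu i (n + 1 - 1) (n + 1) z v = \<zero>\<^bsub>E i (n + 1)\<^esub>"
      and z0: "z \<noteq> \<zero>\<^bsub>E i (n + 1 - 1)\<^esub>"
    have z: "z \<in> carrier (E i n)" and zv: "\<And>v. v\<in>carrier (E n (n + 1)) \<Longrightarrow> mu i n (n + 1) z v = \<zero>\<^bsub>E i (n + 1)\<^esub>"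
      using z' zv' by simp_all
    let ?L = "{a \<odot>\<^bsub>E i n\<^esub> z | a. a \<in> carrier (diagonal_ring A n)}"
    obtain s where s: "1 + 1 \<le> s" "ln i (n + 1) (nxt i n ?L) s"
      using grow[OF F.len_line[OF z]] z0 by auto
    have "nxt i n ?L \<subseteq> {\<zero>\<^bsub>E i (n + 1)\<^esub>}"
      by (rule nxt_least) (use z zv in \<open>auto simp: mu_assoc\<close>)
    then have "s \<le> 0" using F1.len_mono[OF len.zero s(2)] by blast
    then show False using s by simp
  qed
  have key: "\<exists>r s. ln i n (prv i (n + 1) U) r \<and> ln i (n + 2) (nxt i (n + 1) U) s \<and> r + s = 2 * m"
    if "ln i (n + 1) U m" for U m
    using ln_nxt[OF ni _ inj that] c by (simp add: add.commute[of n 2])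
  have "\<exists>s. m + 1 \<le> s \<and> ln i (n + 2) (nxt i (n + 1) U) s" if U: "ln i (n + 1) U m" and m: "1 \<le> m" for U m
  proof -
    obtain r s where rs: "ln i n (prv i (n + 1) U) r" "ln i (n + 2) (nxt i (n + 1) U) s" "r + s = 2 * m"
      using key[OF U] by blast
    show ?thesis
    proof (cases "1 \<le> r")
      case True
      then obtain s' where s': "r + 1 \<le> s'" "ln i (n + 1) (nxt i n (prv i (n + 1) U)) s'"
        using grow[OF rs(1)] by blast
      have "nxt i n (prv i (n + 1) U) \<subseteq> U" using nxt_prv[OF F1.len_subsp[OF U]] by simp
      then have "s' \<le> m" using F1.len_mono[OF U s'(2)] by blast
      then show ?thesis using rs s' by (intro exI[of _ s]) simp
    next
      case False
      then show ?thesis using rs m by (intro exI[of _ s]) simp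
    qed
  qed
  moreover have "ln i (n + 2) (carrier (E i (n + 2))) (nat (n - i + 3))"
  proof -
    obtain r s where rs: "ln i n (prv i (n + 1) (carrier (E i (n + 1)))) r"
      "ln i (n + 2) (nxt i (n + 1) (carrier (E i (n + 1)))) s" "r + s = 2 * nat (n - i + 2)"
      using key[OF c1] by blast
    have "prv i (n + 1) (carrier (E i (n + 1))) = carrier (E i n)" by (auto simp: prv_def)
    then have "r = nat (n - i + 1)" using F.len_unique[OF c] rs(1) by simp
    then have "s = nat (n - i + 3)" using rs(3) ni by simp
    moreover have "nxt i (n + 1) (carrier (E i (n + 1))) = carrier (E i (n + 2))"
    proof
      show "carrier (E i (n + 2)) \<subseteq> nxt i (n + 1) (carrier (E i (n + 1)))"
        using right_gen[OF ni] by (fastforce simp: nxt_def add.assoc)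
      show "nxt i (n + 1) (carrier (E i (n + 1))) \<subseteq> carrier (E i (n + 2))"
        using subD(1)[OF nxt_sub[OF sub_carrier[where i=i and n="n + 1"]]] by (auto simp: add.assoc)
    qed
    ultimately show ?thesis using rs(2) by simp
  qed
  ultimately show ?case using c1 by (simp add: algebra_simps)
qed

lemma ln_carrier: "ln i n (carrier (E i n)) (nat (n - i + 1))"
proof (cases "i - 1 \<le> n")
  case False
  then have "carrier (E i n) = {\<zero>\<^bsub>E i n\<^esub>}" by (intro below) simp
  then show ?thesis using False len.zero[of "diagonal_ring A n" "E i n"] by simp
qed (use ln_growth in blast)

lemma ln_sub: "sub i n U \<Longrightarrow> \<exists>m\<le>nat (n - i + 1). ln i n U m"
  using fspace.len_subsp_ex[OF fsp ln_carrier] subD(1) by blast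

lemma ln_nxt_grow:
  assumes "ln i n U m" "1 \<le> m"
  shows "\<exists>s. m + 1 \<le> s \<and> ln i (n + 1) (nxt i n U) s"
proof (cases "i - 1 \<le> n")
  case True
  then show ?thesis using ln_growth assms by blast
next
  case False
  have "m \<le> nat (n - i + 1)"
    using fspace.len_mono[OF fsp ln_carrier assms(1)] subD(1)[OF fspace.len_subsp[OF fsp assms(1)]] by blast
  then show ?thesis using False assms by simp
qed

lemma multiples_sub:
  assumes "a \<in> carrier (E i j)"
  shows "sub i k {mu i j k a c | c. c \<in> carrier (E j k)}"
proof (rule subI)
  show "\<zero>\<^bsub>E i k\<^esub> \<in> {mu i j k a c | c. c \<in> carrier (E j k)}"
    using assms by (auto intro!: exI[of _ "\<zero>\<^bsub>E j k\<^esub>"])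
next
  fix u v assume "u \<in> {mu i j k a c | c. c \<in> carrier (E j k)}" "v \<in> {mu i j k a c | c. c \<in> carrier (E j k)}"
  then obtain c d where "c \<in> carrier (E j k)" "d \<in> carrier (E j k)" "u = mu i j k a c" "v = mu i j k a d" by auto
  then show "u \<oplus>\<^bsub>E i k\<^esub> v \<in> {mu i j k a c | c. c \<in> carrier (E j k)}"
    using assms by (auto simp: mu_add intro!: exI[of _ "c \<oplus>\<^bsub>E j k\<^esub> d"])
next
  fix u b assume "u \<in> {mu i j k a c | c. c \<in> carrier (E j k)}" and b: "b \<in> carrier (E k k)"
  then obtain c where "c \<in> carrier (E j k)" "u = mu i j k a c" by auto
  then show "mu i k k u b \<in> {mu i j k a c | c. c \<in> carrier (E j k)}"
    using assms b by (auto simp: mu_assoc intro!: exI[of _ "mu j k k c b"])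
qed (use assms in auto)

text \<open>\<open>a A_jk V_k\<close> is contained in \<open>a A_(j,k+1)\<close>, so the spaces of
  multiples gain at least one dimension per degree, beginning with a line at \<open>k = j\<close>.
  The bound obtained is the dimension of \<open>A_jk\<close> itself.\<close>

lemma ln_multiples:
  assumes a: "a \<in> carrier (E i j)" "a \<noteq> \<zero>\<^bsub>E i j\<^esub>" and "j \<le> k"
  shows "\<exists>s. nat (k - j + 1) \<le> s \<and> ln i k {mu i j k a c | c. c \<in> carrier (E j k)} s"
  using assms(3)
proof (induction k rule: int_ge_induct)
  case base
  have "ln i j {mu i j j a c | c. c \<in> carrier (E j j)} 1"
    using fspace.len_line[OF fsp a] by simp
  then show ?case by (intro exI[of _ 1]) simp
next
  case (step k)
  obtain s where s: "nat (k - j + 1) \<le> s" "ln i k {mu i j k a c | c. c \<in> carrier (E j k)} s"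
    using step.IH by blast
  then have "1 \<le> s" using step.hyps by auto
  then obtain s' where s': "s + 1 \<le> s'" "ln i (k + 1) (nxt i k {mu i j k a c | c. c \<in> carrier (E j k)}) s'"
    using ln_nxt_grow[OF s(2)] by blast
  have "nxt i k {mu i j k a c | c. c \<in> carrier (E j k)} \<subseteq> {mu i j (k+1) a c | c. c \<in> carrier (E j (k+1))}"
  proof (rule nxt_least)
    fix u v assume "u \<in> {mu i j k a c | c. c \<in> carrier (E j k)}" "v \<in> carrier (E k (k + 1))"
    then show "mu i k (k + 1) u v \<in> {mu i j (k+1) a c | c. c \<in> carrier (E j (k+1))}"
      using a(1) by (auto simp: mu_assoc)
  qed (use subD(3)[OF multiples_sub[OF a(1)]] in blast)
  moreover obtain t where t: "ln i (k+1) {mu i j (k+1) a c | c. c \<in> carrier (E j (k+1))} t"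
    using ln_sub[OF multiples_sub[OF a(1)]] by blast
  ultimately have "s' \<le> t" using fspace.len_mono[OF fsp t s'(2)] by blast
  then show ?case using t s s' step.hyps by (intro exI[of _ t]) auto
qed

text \<open>Left multiplication by \<open>a\<close> on \<open>A_jl\<close> is linear over
  \<open>A_ll\<close>, and by \<open>ln_multiples\<close> its image is as large as its source. Its
  kernel is therefore zero.\<close>

lemma mu_nonzero:
  assumes a: "a \<in> carrier (E i j)" "a \<noteq> \<zero>\<^bsub>E i j\<^esub>" and b: "b \<in> carrier (E j l)" "b \<noteq> \<zero>\<^bsub>E j l\<^esub>"
  shows "mu i j l a b \<noteq> \<zero>\<^bsub>E i l\<^esub>"
proof
  assume ab: "mu i j l a b = \<zero>\<^bsub>E i l\<^esub>"
  have jl: "j \<le> l" using below[of l j] b by (cases "l < j") auto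
  interpret F: fspace "diagonal_ring A l" "E j l" by (rule fsp)
  obtain s where s: "nat (l - j + 1) \<le> s" "ln i l {mu i j l a c | c. c \<in> carrier (E j l)} s"
    using ln_multiples[OF a jl] by blast
  have "semilinear_on (diagonal_ring A l) (E j l) (diagonal_ring A l) (E i l) (carrier (E j l)) (mu i j l a)"
    unfolding semilinear_on_def using a by (auto simp: mu_add mu_assoc)
  from F.len_rank_nullity[OF fsp this len.zero ln_carrier order_refl F.subsp_carrier]
  obtain r t where rt: "ln j l {u \<in> carrier (E j l). mu i j l a u \<in> {\<zero>\<^bsub>E i l\<^esub>}} r"
    "ln i l {w \<oplus>\<^bsub>E i l\<^esub> mu i j l a u | w u. w \<in> {\<zero>\<^bsub>E i l\<^esub>} \<and> u \<in> carrier (E j l)} (0 + t)"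
    "r + t = nat (l - j + 1)" by blast
  have "{w \<oplus>\<^bsub>E i l\<^esub> mu i j l a u | w u. w \<in> {\<zero>\<^bsub>E i l\<^esub>} \<and> u \<in> carrier (E j l)} =
      {mu i j l a c | c. c \<in> carrier (E j l)}" using a by force
  then have "t = s" using fspace.len_unique[OF fsp s(2)] rt(2) by simp
  then have "r = 0" using rt(3) s(1) by simp
  then have "{u \<in> carrier (E j l). mu i j l a u \<in> {\<zero>\<^bsub>E i l\<^esub>}} = {\<zero>\<^bsub>E j l\<^esub>}" using F.len_0D rt(1) by blast
  then show False using ab b by blast
qed

lemma domain: "z_domain A"
proof (intro z_domain.intro z_algebra_axioms z_domain_axioms.intro)
  show "zmult A i j l a b \<noteq> \<one>\<^bsub>component A i l\<^esub>"
    if "a \<in> carrier (component A i j)" "a \<noteq> \<one>\<^bsub>component A i j\<^esub>"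
      "b \<in> carrier (component A j l)" "b \<noteq> \<one>\<^bsub>component A j l\<^esub>" for a b i j l
    using mu_nonzero[of a i j b l] that by (simp add: zmod_simps)
  show "carrier (component A i (i + 1)) \<noteq> {\<one>\<^bsub>component A i (i + 1)\<^esub>}" for i
  proof
    assume "carrier (component A i (i + 1)) = {\<one>\<^bsub>component A i (i + 1)\<^esub>}"
    then have "ln i (i + 1) (carrier (E i (i + 1))) 0"
      using len.zero[of "diagonal_ring A (i + 1)" "E i (i + 1)"] by (simp add: zmod_simps)
    then show False using fspace.len_unique[OF fsp ln_carrier] by fastforce
  qed
qed

section \<open>Hilbert functions of submodules and quotients\<close>

lemma zsubmodule_sub:
  assumes "zsubmodule A (principal_zmodule A i) N"
  shows "sub i n (N n)" "nxt i n (N n) \<subseteq> N (n + 1)"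
proof -
  have sg: "subgroup (N n) (component A i n)" for n
    using assms by (auto simp: zsubmodule_def principal_zmodule_def)
  have act: "mu i n m u a \<in> N m" if "u \<in> N n" "a \<in> carrier (E n m)" for n m u a
    using assms that by (auto simp: zsubmodule_def principal_zmodule_def zmod_simps)
  show sub: "sub i n (N n)" for n
    by (rule subI) (use subgroup.subset[OF sg] subgroup.one_closed[OF sg] subgroup.m_closed[OF sg] act in
      \<open>auto simp: zmod_simps\<close>)
  show "nxt i n (N n) \<subseteq> N (n + 1)" by (rule nxt_least) (use act subD(3)[OF sub] in auto)
qed

text \<open>\<open>j\<close> is any degree in which \<open>N\<close> does not vanish. From there on
  \<open>N_n V_n \<subseteq> N_(n+1)\<close> and strict growth propagate both positivity and the
  increase.\<close>

lemma zsubmodule_nonzero: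
  assumes N: "zsubmodule A (principal_zmodule A i) N" "nonzero (principal_zmodule A i) N"
  obtains j f where "i \<le> j" "\<And>n. ln i n (N n) (f n)" "\<And>n. j \<le> n \<Longrightarrow> 1 \<le> f n"
    "\<And>n. j \<le> n \<Longrightarrow> f n + 1 \<le> f (n + 1)" "\<And>n. f n \<le> nat (n - i + 1)"
proof -
  note s = zsubmodule_sub[OF N(1)]
  define f where "f n = (SOME m. m \<le> nat (n - i + 1) \<and> ln i n (N n) m)" for n
  have f: "f n \<le> nat (n - i + 1)" "ln i n (N n) (f n)" for n
    unfolding f_def using someI_ex[OF ln_sub[OF s(1), of n]] by auto
  obtain j a where a: "a \<in> N j" "a \<noteq> \<zero>\<^bsub>E i j\<^esub>"
    using N(2) by (auto simp: nonzero_def principal_zmodule_def zmod_simps)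
  have ij: "i \<le> j" using below[of j i] a subD(1)[OF s(1)] by (cases "j < i") auto
  have grow: "f n + 1 \<le> f (n + 1)" if pos: "1 \<le> f n" for n
  proof -
    obtain t where t: "f n + 1 \<le> t" "ln i (n + 1) (nxt i n (N n)) t" using ln_nxt_grow[OF f(2) pos] by blast
    then show ?thesis using fspace.len_mono[OF fsp f(2) t(2) s(2)] by simp
  qed
  have one: "1 \<le> f n" if "j \<le> n" for n
    using that
  proof (induction n rule: int_ge_induct)
    case base
    show ?case using fspace.len_nonzero[OF fsp f(2) a] .
  next
    case (step n)
    then show ?case using grow[of n] by simp
  qed
  show thesis by (rule that[of j f]) (use ij f one grow in auto)
qed

text \<open>\<open>dim A_in\<close> increases by exactly one per degree and \<open>dim N_n\<close>
  by at least one, so the codimension is a non-increasing sequence of natural numbers;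
  \<open>c\<close> is its final value. The additive form avoids truncated subtraction in later
  uses.\<close>

lemma zsubmodule_codim:
  assumes N: "zsubmodule A (principal_zmodule A i) N" "nonzero (principal_zmodule A i) N"
  shows "\<exists>n0 f c. i \<le> n0 \<and> (\<forall>n. ln i n (N n) (f n)) \<and> (\<forall>n\<ge>n0. f n + c = nat (n - i + 1)) \<and>
    (\<forall>n. f n \<le> nat (n - i + 1))"
proof -
  obtain j f where j: "i \<le> j" and f: "\<And>n. ln i n (N n) (f n)"
    and grow: "\<And>n. j \<le> n \<Longrightarrow> f n + 1 \<le> f (n + 1)" and le: "\<And>n. f n \<le> nat (n - i + 1)"
    using zsubmodule_nonzero[OF N] by metis
  have "nat (n + 1 - i + 1) - f (n + 1) \<le> nat (n - i + 1) - f n" if "j \<le> n" for n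
    using grow[OF that] j that by simp
  then obtain n0 where n0: "j \<le> n0" "\<And>n. n \<ge> n0 \<Longrightarrow> nat (n - i + 1) - f n = nat (n0 - i + 1) - f n0"
    using nonincreasing_eventually_const[of j "\<lambda>n. nat (n - i + 1) - f n"] by blast
  show ?thesis
  proof (intro exI[of _ n0] exI[of _ f] exI[of _ "nat (n0 - i + 1) - f n0"] conjI allI impI f le)
    show "i \<le> n0" using n0(1) j by simp
    show "f n + (nat (n0 - i + 1) - f n0) = nat (n - i + 1)" if "n0 \<le> n" for n
      using n0(2)[OF that] le[of n] by simp
  qed
qed

text \<open>Only two slopes occur: \<open>1\<close> for non-zero submodules and \<open>0\<close> for
  their quotients. In the second case the sum is eventually at most linear; it may also be the zero
  polynomial, whose degree \<open>-\<infinity>\<close> is still below 2.\<close>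

lemma zmodule_dim_poly:
  assumes dim: "\<And>n. has_dimension (diagonal_ring A n) (part_module M n) (f n)"
    and zero: "\<And>n. n < i \<Longrightarrow> f n = 0" and lin: "\<And>n. n0 \<le> n \<Longrightarrow> real (f n) = \<alpha> * real_of_int n + \<beta>"
  shows "\<alpha> \<noteq> 0 \<Longrightarrow> zmodule_dim A M 2" "\<alpha> = 0 \<Longrightarrow> \<exists>d<2. zmodule_dim A M d"
proof -
  obtain \<gamma> where \<gamma>: "\<And>n. n \<ge> n0 \<Longrightarrow> real (\<Sum>k | k \<le> n \<and> f k \<noteq> 0. f k) =
      poly [:\<gamma>, \<beta> + \<alpha> / 2, \<alpha> / 2:] (real_of_int n)"
    using eventually_linear_sum_poly[of i f n0 \<alpha> \<beta>] zero lin by blast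
  let ?h = "[:\<gamma>, \<beta> + \<alpha> / 2, \<alpha> / 2:]"
  have fin: "finite {k. k \<le> n \<and> f k \<noteq> 0}" for n
    using finite_support[of i f] zero by blast
  have d: "zmodule_dim A M (if ?h = 0 then -\<infinity> else ereal (real (Polynomial.degree ?h)))"
    unfolding zmodule_dim_def using dim fin \<gamma>
    by (intro exI[of _ f] exI[of _ ?h]) (auto simp: eventually_at_top_linorder intro!: exI[of _ n0])
  show "zmodule_dim A M 2" if "\<alpha> \<noteq> 0" using d that by simp
  show "\<exists>d<2. zmodule_dim A M d" if "\<alpha> = 0"
    using d that by (intro exI[of _ "if ?h = 0 then -\<infinity> else ereal (real (Polynomial.degree ?h))"])
      (auto split: if_splits)
qed

lemma pure: "pure_zmodule A (principal_zmodule A i) 2"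
  unfolding pure_zmodule_def
proof (intro conjI allI impI right_zmodule_principal)
  have hd: "has_dimension (diagonal_ring A n) (part_module (principal_zmodule A i) n) (nat (n - i + 1))" for n
    using fspace.len_has_dimension[OF fsp ln_carrier[where i=i and n=n]]
    by (simp add: zmod_def part_module_def principal_zmodule_def)
  have "zmodule_dim A (principal_zmodule A i) 2"
    by (rule zmodule_dim_poly(1)[of "principal_zmodule A i" "\<lambda>n. nat (n - i + 1)" i i 1 "1 - real_of_int i", OF hd]) auto
  then show "zmodule_dim A (principal_zmodule A i) (ereal (real 2))" by simp
next
  fix N assume "zsubmodule A (principal_zmodule A i) N \<and> nonzero (principal_zmodule A i) N"
  then have N': "zsubmodule A (principal_zmodule A i) N" "nonzero (principal_zmodule A i) N" by auto
  obtain n0 f c where *: "i \<le> n0" "\<And>n. ln i n (N n) (f n)"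
    "\<And>n. n0 \<le> n \<Longrightarrow> f n + c = nat (n - i + 1)" "\<And>n. f n \<le> nat (n - i + 1)"
    using zsubmodule_codim[OF N'] by blast
  have hd: "has_dimension (diagonal_ring A n) (part_module (restrict_zmodule (principal_zmodule A i) N) n) (f n)" for n
    using fspace.len_has_dimension[OF fsp *(2)[of n]]
    by (simp add: zmod_def part_module_def principal_zmodule_def restrict_zmodule_def)
  have "zmodule_dim A (restrict_zmodule (principal_zmodule A i) N) 2"
  \<comment> \<open>The Hilbert function of \<open>N\<close> is eventually
    \<open>n - i + 1 - c\<close>.\<close>
  proof (rule zmodule_dim_poly(1)[of _ _ i n0 1 "1 - real_of_int i - real c"])
    show "f n = 0" if "n < i" for n using *(4)[of n] that by simp
    show "real (f n) = 1 * real_of_int n + (1 - real_of_int i - real c)" if "n0 \<le> n" for n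
    proof -
      have "int (f n) + int c = n - i + 1" using *(3)[OF that] *(1) that by linarith
      then have "real_of_int (int (f n) + int c) = real_of_int (n - i + 1)" by (rule arg_cong)
      then show ?thesis by simp
    qed
  qed (use hd in auto)
  then show "zmodule_dim A (restrict_zmodule (principal_zmodule A i) N) (ereal (real 2))" by simp
qed

text \<open>The rank formula for the map from \<open>A_in\<close> to its cosets, whose kernel is
  \<open>N_n\<close>. Most of the work identifies the scalar action on cosets, defined by
  multiplying all representatives and adding \<open>N_n\<close>, with the coset of a single
  product.\<close>

lemma quotient_dimension:
  assumes N: "zsubmodule A (principal_zmodule A i) N" and f: "ln i n (N n) k"
  shows "has_dimension (diagonal_ring A n) (part_module (quotient_zmodule (principal_zmodule A i) N) n)
    (nat (n - i + 1) - k)"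
proof -
  let ?C = "component A i n" and ?Q = "part_module (quotient_zmodule (principal_zmodule A i) N) n"
  interpret C: comm_group ?C by (rule comm_group_component)
  interpret F: fspace "diagonal_ring A n" "E i n" by (rule fsp)
  have sg: "subgroup (N n) ?C" using N by (auto simp: zsubmodule_def principal_zmodule_def)
  interpret Nn: normal "N n" ?C by (rule C.subgroup_imp_normal[OF sg])
  note Ns = zsubmodule_sub(1)[OF N, of n]
  define h where "h u = N n #>\<^bsub>?C\<^esub> u" for u
  have surj: "h ` carrier (E i n) = carrier ?Q"
    by (auto simp: h_def part_module_def quotient_zmodule_def principal_zmodule_def FactGroup_def RCOSETS_def zmod_simps)
  have zero: "h \<zero>\<^bsub>E i n\<^esub> = \<zero>\<^bsub>?Q\<^esub>"
    by (simp add: h_def part_module_def quotient_zmodule_def principal_zmodule_def FactGroup_def zmod_simps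
        C.coset_mult_one Nn.subset)
  have add: "h (u \<oplus>\<^bsub>E i n\<^esub> v) = h u \<oplus>\<^bsub>?Q\<^esub> h v" if "u \<in> carrier (E i n)" "v \<in> carrier (E i n)" for u v
    using that by (simp add: h_def part_module_def quotient_zmodule_def principal_zmodule_def FactGroup_def
        zmod_simps Nn.rcos_sum)
  have smult: "h (a \<odot>\<^bsub>E i n\<^esub> u) = a \<odot>\<^bsub>?Q\<^esub> h u"
    if a: "a \<in> carrier (diagonal_ring A n)" and u: "u \<in> carrier (E i n)" for a u
  proof -
    have "N n <#>\<^bsub>?C\<^esub> {mu i n n t a | t. t \<in> h u} = h (mu i n n u a)"
    proof
      show "N n <#>\<^bsub>?C\<^esub> {mu i n n t a | t. t \<in> h u} \<subseteq> h (mu i n n u a)"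
      proof
        fix z assume "z \<in> N n <#>\<^bsub>?C\<^esub> {mu i n n t a | t. t \<in> h u}"
        then obtain b c where bc: "b \<in> N n" "c \<in> N n" "z = b \<oplus>\<^bsub>E i n\<^esub> mu i n n (c \<oplus>\<^bsub>E i n\<^esub> u) a"
          by (auto simp: set_mult_def h_def r_coset_def zmod_simps)
        then have "z = (b \<oplus>\<^bsub>E i n\<^esub> mu i n n c a) \<oplus>\<^bsub>E i n\<^esub> mu i n n u a"
          using a u subD(1)[OF Ns] by (simp add: mu_add add_assoc)
        moreover have "b \<oplus>\<^bsub>E i n\<^esub> mu i n n c a \<in> N n" using bc a subD(3,4)[OF Ns] by simp
        ultimately show "z \<in> h (mu i n n u a)" by (auto simp: h_def r_coset_def zmod_simps)
      qed
      show "h (mu i n n u a) \<subseteq> N n <#>\<^bsub>?C\<^esub> {mu i n n t a | t. t \<in> h u}"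
      proof
        fix z assume "z \<in> h (mu i n n u a)"
        then obtain b where b: "b \<in> N n" "z = b \<oplus>\<^bsub>E i n\<^esub> mu i n n u a" by (auto simp: h_def r_coset_def zmod_simps)
        have "u \<in> h u" using C.rcos_self[OF _ sg] u by (simp add: h_def zmod_simps)
        then show "z \<in> N n <#>\<^bsub>?C\<^esub> {mu i n n t a | t. t \<in> h u}" using b by (auto simp: set_mult_def zmod_simps)
      qed
    qed
    then show ?thesis by (simp add: part_module_def quotient_zmodule_def principal_zmodule_def)
  qed
  have Q: "fspace (diagonal_ring A n) ?Q" by (rule F.surj_fspace[OF surj zero add smult])
  interpret Q: fspace "diagonal_ring A n" ?Q by (rule Q)
  have "semilinear_on (diagonal_ring A n) (E i n) (diagonal_ring A n) ?Q (carrier (E i n)) h"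
    unfolding semilinear_on_def using surj smult add by (auto simp del: smult_zmod)
  from F.len_rank_nullity[OF Q this len.zero ln_carrier order_refl F.subsp_carrier]
  obtain r t where rt: "ln i n {u \<in> carrier (E i n). h u \<in> {\<zero>\<^bsub>?Q\<^esub>}} r"
    "len (diagonal_ring A n) ?Q {w \<oplus>\<^bsub>?Q\<^esub> h u | w u. w \<in> {\<zero>\<^bsub>?Q\<^esub>} \<and> u \<in> carrier (E i n)} (0 + t)"
    "r + t = nat (n - i + 1)" by blast
  have "{u \<in> carrier (E i n). h u \<in> {\<zero>\<^bsub>?Q\<^esub>}} = N n"
  proof -
    have "h u = N n \<longleftrightarrow> u \<in> N n" if "u \<in> carrier (E i n)" for u
      using that C.coset_join1[OF _ _ sg] C.coset_join2[OF _ sg] by (auto simp: h_def zmod_simps)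
    moreover have "\<zero>\<^bsub>?Q\<^esub> = N n" by (simp add: part_module_def quotient_zmodule_def principal_zmodule_def FactGroup_def)
    ultimately show ?thesis using subD(1)[OF Ns] by auto
  qed
  then have "r = k" using F.len_unique[OF f] rt(1) by simp
  moreover have "{w \<oplus>\<^bsub>?Q\<^esub> h u | w u. w \<in> {\<zero>\<^bsub>?Q\<^esub>} \<and> u \<in> carrier (E i n)} = carrier ?Q"
  proof -
    have "\<zero>\<^bsub>?Q\<^esub> \<oplus>\<^bsub>?Q\<^esub> v = v" if "v \<in> carrier ?Q" for v using that by (rule Q.M.l_zero)
    then have "\<zero>\<^bsub>?Q\<^esub> \<oplus>\<^bsub>?Q\<^esub> h u = h u" if "u \<in> carrier (E i n)" for u using that surj by blast
    then show ?thesis unfolding surj[symmetric] image_def by auto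
  qed
  ultimately have "len (diagonal_ring A n) ?Q (carrier ?Q) (nat (n - i + 1) - k)" using rt(2,3) by (metis add_0 add_diff_cancel_left')
  from Q.len_has_dimension[OF this] show ?thesis by simp
qed

lemma critical: "critical_zmodule A (principal_zmodule A i)"
  unfolding critical_zmodule_def
proof (intro conjI right_zmodule_principal, rule exI[of _ 2], intro conjI allI impI)
  show "zmodule_dim A (principal_zmodule A i) 2" using pure[of i] by (simp add: pure_zmodule_def)
  fix N assume N: "zsubmodule A (principal_zmodule A i) N \<and> nonzero (principal_zmodule A i) N"
  then have N': "zsubmodule A (principal_zmodule A i) N" "nonzero (principal_zmodule A i) N" by auto
  obtain n0 f c where *: "i \<le> n0" "\<And>n. ln i n (N n) (f n)"
    "\<And>n. n0 \<le> n \<Longrightarrow> f n + c = nat (n - i + 1)" "\<And>n. f n \<le> nat (n - i + 1)"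
    using zsubmodule_codim[OF N'] by blast
  have "\<exists>d<2. zmodule_dim A (quotient_zmodule (principal_zmodule A i) N) d"
  \<comment> \<open>The Hilbert function of the quotient is the codimension of \<open>N\<close>,
    which is eventually the constant \<open>c\<close>.\<close>
  proof (rule zmodule_dim_poly(2)[of _ "\<lambda>n. nat (n - i + 1) - f n" i n0 0 "real c"])
    show "has_dimension (diagonal_ring A n) (part_module (quotient_zmodule (principal_zmodule A i) N) n)
        (nat (n - i + 1) - f n)" for n
      using quotient_dimension N *(2) by blast
    show "real (nat (n - i + 1) - f n) = 0 * real_of_int n + real c" if "n0 \<le> n" for n
      using *(3)[OF that] by (metis add_diff_cancel_left' mult_zero_left add_0)
  qed simp_all
  then show "\<exists>d'. zmodule_dim A (quotient_zmodule (principal_zmodule A i) N) d' \<and> d' < 2" by blast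
qed

lemma uniform: "uniform_zmodule A (principal_zmodule A i)"
  unfolding uniform_zmodule_def
proof (intro conjI right_zmodule_principal allI impI)
  fix N N' assume *: "zsubmodule A (principal_zmodule A i) N \<and> nonzero (principal_zmodule A i) N \<and>
    zsubmodule A (principal_zmodule A i) N' \<and> nonzero (principal_zmodule A i) N'"
  then have N: "zsubmodule A (principal_zmodule A i) N" "nonzero (principal_zmodule A i) N"
    and N': "zsubmodule A (principal_zmodule A i) N'" "nonzero (principal_zmodule A i) N'" by auto
  obtain n0 f c where f: "i \<le> n0" "\<And>n. ln i n (N n) (f n)" "\<And>n. n0 \<le> n \<Longrightarrow> f n + c = nat (n - i + 1)"
    using zsubmodule_codim[OF N] by blast
  obtain n0' f' c' where f': "i \<le> n0'" "\<And>n. ln i n (N' n) (f' n)" "\<And>n. n0' \<le> n \<Longrightarrow> f' n + c' = nat (n - i + 1)"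
    using zsubmodule_codim[OF N'] by blast
  \<comment> \<open>In this degree both codimensions have reached their final values and
    \<open>dim A_in = n - i + 1\<close> exceeds \<open>c + c'\<close>, so \<open>N_n\<close> and
    \<open>N'_n\<close> must meet. The count is the rank formula for the identity map with
    \<open>W = N'_n\<close>.\<close>
  define n where "n = max n0 n0' + int c + int c'"
  interpret F: fspace "diagonal_ring A n" "E i n" by (rule fsp)
  have s: "sub i n (N n)" "sub i n (N' n)" using zsubmodule_sub(1)[OF N(1)] zsubmodule_sub(1)[OF N'(1)] by simp_all
  have "semilinear_on (diagonal_ring A n) (E i n) (diagonal_ring A n) (E i n) (carrier (E i n)) (\<lambda>u. u)"
    unfolding semilinear_on_def by auto
  from F.len_rank_nullity[OF fsp this f'(2) f(2) _ F.subsp_carrier]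
  obtain r t where rt: "ln i n {u \<in> N n. u \<in> N' n} r"
    "ln i n {w \<oplus>\<^bsub>E i n\<^esub> u | w u. w \<in> N' n \<and> u \<in> N n} (f' n + t)" "r + t = f n"
    using subD(1)[OF s(1)] by blast
  have "f' n + t \<le> nat (n - i + 1)"
    by (rule F.len_mono[OF ln_carrier rt(2)]) (use subD(1)[OF s(1)] subD(1)[OF s(2)] in auto)
  moreover have "n0 \<le> n" "n0' \<le> n" by (simp_all add: n_def)
  moreover have "int (nat (n - i + 1)) = n - i + 1" "int c + int c' < n - i + 1"
    using f(1) f'(1) by (auto simp: n_def max_def)
  ultimately have "r \<noteq> 0" using rt(3) f(3)[of n] f'(3)[of n] by linarith
  have "{u \<in> N n. u \<in> N' n} \<noteq> {\<zero>\<^bsub>E i n\<^esub>}"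
  proof
    assume "{u \<in> N n. u \<in> N' n} = {\<zero>\<^bsub>E i n\<^esub>}"
    then show False using F.len_unique[OF len.zero] rt(1) \<open>r \<noteq> 0\<close> by simp
  qed
  then obtain u where "u \<in> N n" "u \<in> N' n" "u \<noteq> \<zero>\<^bsub>E i n\<^esub>" using subD(2)[OF s(1)] subD(2)[OF s(2)] by blast
  then show "nonzero (principal_zmodule A i) (\<lambda>i. N i \<inter> N' i)"
    by (auto simp: nonzero_def principal_zmodule_def zmod_simps)
qed

end

section \<open>Reversal, and quotients of free graded algebras\<close>

text \<open>Besides reversing products, as \<open>opposite\<close> does, this negates the indices.
  The components with \<open>i > j\<close> thus remain the trivial ones, and the reversed algebra
  can satisfy the same axioms as the original.\<close>

definition rev_zalg :: "'a zalg \<Rightarrow> 'a zalg" where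
  "rev_zalg D = \<lparr>component = (\<lambda>i j. component D (- j) (- i)),
     zmult = (\<lambda>i j l a b. zmult D (- l) (- j) (- i) b a), zunit = (\<lambda>i. zunit D (- i))\<rparr>"

lemma rev_zalg_simps [simp]:
  "component (rev_zalg D) i j = component D (- j) (- i)"
  "zmult (rev_zalg D) i j l a b = zmult D (- l) (- j) (- i) b a"
  "zunit (rev_zalg D) i = zunit D (- i)"
  by (simp_all add: rev_zalg_def)

lemma zmod_rev_zalg [simp]:
  "carrier (zmod (rev_zalg D) i j) = carrier (zmod D (- j) (- i))"
  "a \<oplus>\<^bsub>zmod (rev_zalg D) i j\<^esub> b = a \<oplus>\<^bsub>zmod D (- j) (- i)\<^esub> b"
  "\<zero>\<^bsub>zmod (rev_zalg D) i j\<^esub> = \<zero>\<^bsub>zmod D (- j) (- i)\<^esub>"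
  by (simp_all add: zmod_simps)

lemma rev_rev_zalg [simp]: "rev_zalg (rev_zalg D) = D"
  by (simp add: rev_zalg_def)

lemma (in z_algebra) zidealD:
  assumes "zideal D J"
  shows "J i j \<subseteq> carrier (E i j)" "\<zero>\<^bsub>E i j\<^esub> \<in> J i j"
    "\<And>a b. a \<in> J i j \<Longrightarrow> b \<in> J i j \<Longrightarrow> a \<oplus>\<^bsub>E i j\<^esub> b \<in> J i j"
    "\<And>a d. a \<in> J i j \<Longrightarrow> d \<in> carrier (E j l) \<Longrightarrow> mu i j l a d \<in> J i l"
    "\<And>a c. a \<in> J i j \<Longrightarrow> c \<in> carrier (E h i) \<Longrightarrow> mu h i j c a \<in> J h j"
  using assms subgroup.subset[of "J i j" "component D i j"] subgroup.one_closed[of "J i j" "component D i j"]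
    subgroup.m_closed[of "J i j" "component D i j"]
  by (auto simp: zideal_def zmod_simps)

lemma (in z_algebra) z_algebra_rev: "z_algebra (rev_zalg D)"
  by (rule z_algebra.intro)
    (simp_all add: comm_group_component zmult_closed zmult_add_left zmult_add_right zmult_assoc
      zunit_closed zunit_left zunit_right)

text \<open>Since the diagonal ring is commutative, reversing its product changes nothing and the
  identity is an isomorphism.\<close>

lemma (in z_algebra) field_diagonal_rev:
  assumes "field (diagonal_ring D (- n))"
  shows "field (diagonal_ring (rev_zalg D) n)"
proof -
  interpret F: field "diagonal_ring D (- n)" by (rule assms)
  have comm: "mu (- n) (- n) (- n) a b = mu (- n) (- n) (- n) b a"
    if "a \<in> carrier (E (- n) (- n))" "b \<in> carrier (E (- n) (- n))" for a b
    using F.m_comm[of a b] that by simp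
  have "(\<lambda>u. u) \<in> ring_iso (diagonal_ring D (- n)) (diagonal_ring (rev_zalg D) n)"
    by (rule ring_iso_memI) (auto simp: comm bij_betw_def inj_on_def)
  from F.ring_iso_imp_img_field[OF this] show ?thesis
    by (simp add: diagonal_ring_def)
qed

text \<open>Each axiom on one side becomes the axiom on the other side, with \<open>x\<close>,
  \<open>y\<close> and \<open>x'\<close>, \<open>y'\<close> exchanged and the vertex negated. Every
  statement about right modules thereby acquires its left version.\<close>

lemma (in ncs_algebra) ncs_algebra_rev:
  "ncs_algebra (rev_zalg A) (\<lambda>n. x' (- n)) (\<lambda>n. y' (- n)) (\<lambda>n. x (- n)) (\<lambda>n. y (- n))"
proof (intro ncs_algebra.intro z_algebra_rev ncs_algebra_axioms.intro)
  show "field (diagonal_ring (rev_zalg A) n)" for n by (rule field_diagonal_rev[OF field_diag])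
next
  fix i n c assume "i \<le> n" "c \<in> carrier (zmod (rev_zalg A) i (n + 1))"
  then show "\<exists>a\<in>carrier (zmod (rev_zalg A) i n). \<exists>b\<in>carrier (zmod (rev_zalg A) i n).
     c = zmult (rev_zalg A) i n (n + 1) a (x (- n)) \<oplus>\<^bsub>zmod (rev_zalg A) i (n + 1)\<^esub>
         zmult (rev_zalg A) i n (n + 1) b (y (- n))"
    using left_gen[of "- n" "- i" c] by simp
next
  fix i n a b assume "a \<in> carrier (zmod (rev_zalg A) i n)" "b \<in> carrier (zmod (rev_zalg A) i n)"
    "zmult (rev_zalg A) i n (n + 1) a (x (- n)) \<oplus>\<^bsub>zmod (rev_zalg A) i (n + 1)\<^esub>
     zmult (rev_zalg A) i n (n + 1) b (y (- n)) = \<zero>\<^bsub>zmod (rev_zalg A) i (n + 1)\<^esub>"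
  then show "\<exists>z\<in>carrier (zmod (rev_zalg A) i (n - 1)).
      a = zmult (rev_zalg A) i (n - 1) n z (x' (- n)) \<and> b = zmult (rev_zalg A) i (n - 1) n z (y' (- n))"
    using left_exact[of a "- n" "- i" b] by simp
next
  fix n m c assume "n \<le> m" "c \<in> carrier (zmod (rev_zalg A) (n - 1) m)"
  then show "\<exists>a\<in>carrier (zmod (rev_zalg A) n m). \<exists>b\<in>carrier (zmod (rev_zalg A) n m).
     c = zmult (rev_zalg A) (n - 1) n m (x' (- n)) a \<oplus>\<^bsub>zmod (rev_zalg A) (n - 1) m\<^esub>
         zmult (rev_zalg A) (n - 1) n m (y' (- n)) b"
    using right_gen[of "- m" "- n" c] by simp
next
  fix n m a b assume "a \<in> carrier (zmod (rev_zalg A) n m)" "b \<in> carrier (zmod (rev_zalg A) n m)"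
    "zmult (rev_zalg A) (n - 1) n m (x' (- n)) a \<oplus>\<^bsub>zmod (rev_zalg A) (n - 1) m\<^esub>
     zmult (rev_zalg A) (n - 1) n m (y' (- n)) b = \<zero>\<^bsub>zmod (rev_zalg A) (n - 1) m\<^esub>"
  then show "\<exists>z\<in>carrier (zmod (rev_zalg A) (n + 1) m).
      a = zmult (rev_zalg A) n (n + 1) m (x (- n)) z \<and> b = zmult (rev_zalg A) n (n + 1) m (y (- n)) z"
    using right_exact[of a "- m" "- n" b] by simp
qed (use below rel[of "- n" for n] gens_closed[of "- n" for n] in \<open>simp_all\<close>)

lemma (in z_algebra) z_algebra_opposite: "z_algebra (opposite D)"
  by (rule z_algebra.intro)
    (simp_all add: opposite_def comm_group_component zmult_closed zmult_add_left zmult_add_right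
      zmult_assoc zunit_closed zunit_left zunit_right)

text \<open>Submodules over \<open>opposite D\<close> and over \<open>rev_zalg D\<close> correspond
  by relabelling degree \<open>j\<close> as \<open>-j\<close>; intersections and non-vanishing are
  preserved.\<close>

lemma (in z_algebra) uniform_opposite:
  assumes "uniform_zmodule (rev_zalg D) (principal_zmodule (rev_zalg D) (- i))"
  shows "uniform_zmodule (opposite D) (principal_zmodule (opposite D) i)"
proof -
  let ?O = "principal_zmodule (opposite D) i" and ?R = "principal_zmodule (rev_zalg D) (- i)"
  have sub: "zsubmodule (rev_zalg D) ?R (\<lambda>j. N (- j))" if N: "zsubmodule (opposite D) ?O N" for N
  proof -
    have 1: "subgroup (N k) (component D k i)" for k
      using N by (simp add: zsubmodule_def principal_zmodule_def opposite_def)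
    have 2: "zmult D l k i a u \<in> N l" if "u \<in> N k" "a \<in> carrier (component D l k)" for k l u a
      using N that by (simp add: zsubmodule_def principal_zmodule_def opposite_def)
    show ?thesis using 1 2 by (simp add: zsubmodule_def principal_zmodule_def)
  qed
  have nz: "nonzero ?R (\<lambda>j. N (- j)) \<longleftrightarrow> nonzero ?O N" for N
    by (simp add: nonzero_def principal_zmodule_def opposite_def) (metis minus_minus)
  have "nonzero ?O (\<lambda>j. N j \<inter> N' j)"
    if "zsubmodule (opposite D) ?O N" "nonzero ?O N" "zsubmodule (opposite D) ?O N'" "nonzero ?O N'" for N N'
  proof -
    have "nonzero ?R (\<lambda>j. N (- j) \<inter> N' (- j))"
      using assms sub[OF that(1)] sub[OF that(3)] that(2,4) unfolding uniform_zmodule_def nz[symmetric]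
      by blast
    then show ?thesis using nz[of "\<lambda>j. N j \<inter> N' j"] by simp
  qed
  then show ?thesis
    using z_algebra.right_zmodule_principal[OF z_algebra_opposite] by (simp add: uniform_zmodule_def)
qed

lemma (in ncs_algebra) ring_of_fractions: "has_ring_of_fractions A"
  unfolding has_ring_of_fractions_def
  using domain uniform uniform_opposite[OF ncs_algebra.uniform[OF ncs_algebra_rev]] by blast

text \<open>The tensor algebra, before the canonical elements \<open>w n\<close> are divided out.\<close>

locale tensor_like = z_algebra T for T :: "'a zalg" +
  fixes x y x' y' :: "int \<Rightarrow> 'a" and w :: "int \<Rightarrow> 'a"
  defines "w \<equiv> \<lambda>n. zmult T (n - 1) n (n + 1) (x n) (x' n) \<oplus>\<^bsub>zmod T (n - 1) (n + 1)\<^esub>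
      zmult T (n - 1) n (n + 1) (y n) (y' n)"
  assumes field_diag: "field (diagonal_ring T n)"
    and below: "j < i \<Longrightarrow> carrier (zmod T i j) = {\<zero>\<^bsub>zmod T i j\<^esub>}"
    and gens_closed [simp]: "x n \<in> carrier (zmod T (n - 1) n)" "y n \<in> carrier (zmod T (n - 1) n)"
      "x' n \<in> carrier (zmod T n (n + 1))" "y' n \<in> carrier (zmod T n (n + 1))"
    and right_gen: "\<lbrakk>i \<le> n; c \<in> carrier (zmod T i (n + 1))\<rbrakk> \<Longrightarrow>
      \<exists>a\<in>carrier (zmod T i n). \<exists>b\<in>carrier (zmod T i n).
        c = zmult T i n (n + 1) a (x' n) \<oplus>\<^bsub>zmod T i (n + 1)\<^esub> zmult T i n (n + 1) b (y' n)"
    and right_free: "\<lbrakk>a \<in> carrier (zmod T i n); b \<in> carrier (zmod T i n);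
        zmult T i n (n + 1) a (x' n) \<oplus>\<^bsub>zmod T i (n + 1)\<^esub> zmult T i n (n + 1) b (y' n)
          = \<zero>\<^bsub>zmod T i (n + 1)\<^esub>\<rbrakk> \<Longrightarrow> a = \<zero>\<^bsub>zmod T i n\<^esub> \<and> b = \<zero>\<^bsub>zmod T i n\<^esub>"
    and left_gen: "\<lbrakk>n \<le> m; c \<in> carrier (zmod T (n - 1) m)\<rbrakk> \<Longrightarrow>
      \<exists>a\<in>carrier (zmod T n m). \<exists>b\<in>carrier (zmod T n m).
        c = zmult T (n - 1) n m (x n) a \<oplus>\<^bsub>zmod T (n - 1) m\<^esub> zmult T (n - 1) n m (y n) b"
    and left_free: "\<lbrakk>a \<in> carrier (zmod T n m); b \<in> carrier (zmod T n m);
        zmult T (n - 1) n m (x n) a \<oplus>\<^bsub>zmod T (n - 1) m\<^esub> zmult T (n - 1) n m (y n) b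
          = \<zero>\<^bsub>zmod T (n - 1) m\<^esub>\<rbrakk> \<Longrightarrow> a = \<zero>\<^bsub>zmod T n m\<^esub> \<and> b = \<zero>\<^bsub>zmod T n m\<^esub>"
    and central_left: "a \<in> carrier (zmod T (n - 1) (n - 1)) \<Longrightarrow>
      \<exists>b\<in>carrier (zmod T (n + 1) (n + 1)).
        zmult T (n - 1) (n - 1) (n + 1) a (w n) = zmult T (n - 1) (n + 1) (n + 1) (w n) b"
    and central_right: "b \<in> carrier (zmod T (n + 1) (n + 1)) \<Longrightarrow>
      \<exists>a\<in>carrier (zmod T (n - 1) (n - 1)).
        zmult T (n - 1) (n - 1) (n + 1) a (w n) = zmult T (n - 1) (n + 1) (n + 1) (w n) b"

lemma (in tensor_like) tensor_like_rev:
  "tensor_like (rev_zalg T) (\<lambda>n. x' (- n)) (\<lambda>n. y' (- n)) (\<lambda>n. x (- n)) (\<lambda>n. y (- n))"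
proof (intro tensor_like.intro z_algebra_rev tensor_like_axioms.intro)
  show "field (diagonal_ring (rev_zalg T) n)" for n by (rule field_diagonal_rev[OF field_diag])
next
  fix i n c assume "i \<le> n" "c \<in> carrier (zmod (rev_zalg T) i (n + 1))"
  then show "\<exists>a\<in>carrier (zmod (rev_zalg T) i n). \<exists>b\<in>carrier (zmod (rev_zalg T) i n).
     c = zmult (rev_zalg T) i n (n + 1) a (x (- n)) \<oplus>\<^bsub>zmod (rev_zalg T) i (n + 1)\<^esub>
         zmult (rev_zalg T) i n (n + 1) b (y (- n))"
    using left_gen[of "- n" "- i" c] by simp
next
  fix i n a b assume "a \<in> carrier (zmod (rev_zalg T) i n)" "b \<in> carrier (zmod (rev_zalg T) i n)"
    "zmult (rev_zalg T) i n (n + 1) a (x (- n)) \<oplus>\<^bsub>zmod (rev_zalg T) i (n + 1)\<^esub>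
     zmult (rev_zalg T) i n (n + 1) b (y (- n)) = \<zero>\<^bsub>zmod (rev_zalg T) i (n + 1)\<^esub>"
  then show "a = \<zero>\<^bsub>zmod (rev_zalg T) i n\<^esub> \<and> b = \<zero>\<^bsub>zmod (rev_zalg T) i n\<^esub>"
    using left_free[of a "- n" "- i" b] by simp
next
  fix n m c assume "n \<le> m" "c \<in> carrier (zmod (rev_zalg T) (n - 1) m)"
  then show "\<exists>a\<in>carrier (zmod (rev_zalg T) n m). \<exists>b\<in>carrier (zmod (rev_zalg T) n m).
     c = zmult (rev_zalg T) (n - 1) n m (x' (- n)) a \<oplus>\<^bsub>zmod (rev_zalg T) (n - 1) m\<^esub>
         zmult (rev_zalg T) (n - 1) n m (y' (- n)) b"
    using right_gen[of "- m" "- n" c] by simp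
next
  fix n m a b assume "a \<in> carrier (zmod (rev_zalg T) n m)" "b \<in> carrier (zmod (rev_zalg T) n m)"
    "zmult (rev_zalg T) (n - 1) n m (x' (- n)) a \<oplus>\<^bsub>zmod (rev_zalg T) (n - 1) m\<^esub>
     zmult (rev_zalg T) (n - 1) n m (y' (- n)) b = \<zero>\<^bsub>zmod (rev_zalg T) (n - 1) m\<^esub>"
  then show "a = \<zero>\<^bsub>zmod (rev_zalg T) n m\<^esub> \<and> b = \<zero>\<^bsub>zmod (rev_zalg T) n m\<^esub>"
    using right_free[of a "- m" "- n" b] by simp
next
  fix n a assume "a \<in> carrier (zmod (rev_zalg T) (n - 1) (n - 1))"
  then show "\<exists>b\<in>carrier (zmod (rev_zalg T) (n + 1) (n + 1)).
    zmult (rev_zalg T) (n - 1) (n - 1) (n + 1) a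
      (zmult (rev_zalg T) (n - 1) n (n + 1) (x' (- n)) (x (- n)) \<oplus>\<^bsub>zmod (rev_zalg T) (n - 1) (n + 1)\<^esub>
       zmult (rev_zalg T) (n - 1) n (n + 1) (y' (- n)) (y (- n))) =
    zmult (rev_zalg T) (n - 1) (n + 1) (n + 1)
      (zmult (rev_zalg T) (n - 1) n (n + 1) (x' (- n)) (x (- n)) \<oplus>\<^bsub>zmod (rev_zalg T) (n - 1) (n + 1)\<^esub>
       zmult (rev_zalg T) (n - 1) n (n + 1) (y' (- n)) (y (- n))) b"
  proof -
    obtain c where "c \<in> carrier (E (- n - 1) (- n - 1))" "mu (- n - 1) (- n - 1) (- n + 1) c (w (- n)) = mu (- n - 1) (- n + 1) (- n + 1) (w (- n)) a"
      using central_right[of a "- n"] \<open>a \<in> _\<close> by auto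
    then show ?thesis by (intro bexI[of _ c]) (simp_all add: w_def)
  qed
next
  fix n b assume "b \<in> carrier (zmod (rev_zalg T) (n + 1) (n + 1))"
  then show "\<exists>a\<in>carrier (zmod (rev_zalg T) (n - 1) (n - 1)).
    zmult (rev_zalg T) (n - 1) (n - 1) (n + 1) a
      (zmult (rev_zalg T) (n - 1) n (n + 1) (x' (- n)) (x (- n)) \<oplus>\<^bsub>zmod (rev_zalg T) (n - 1) (n + 1)\<^esub>
       zmult (rev_zalg T) (n - 1) n (n + 1) (y' (- n)) (y (- n))) =
    zmult (rev_zalg T) (n - 1) (n + 1) (n + 1)
      (zmult (rev_zalg T) (n - 1) n (n + 1) (x' (- n)) (x (- n)) \<oplus>\<^bsub>zmod (rev_zalg T) (n - 1) (n + 1)\<^esub>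
       zmult (rev_zalg T) (n - 1) n (n + 1) (y' (- n)) (y (- n))) b"
  proof -
    obtain c where "c \<in> carrier (E (- n + 1) (- n + 1))" "mu (- n - 1) (- n - 1) (- n + 1) b (w (- n)) = mu (- n - 1) (- n + 1) (- n + 1) (w (- n)) c"
      using central_left[of b "- n"] \<open>b \<in> _\<close> by auto
    then show ?thesis by (intro bexI[of _ c]) (simp_all add: w_def)
  qed
qed (use below gens_closed[of "- n" for n] in \<open>simp_all\<close>)

section \<open>The ideal generated by the canonical elements\<close>

context tensor_like
begin

lemma w_closed [simp]: "w n \<in> carrier (E (n - 1) (n + 1))"
  by (simp add: w_def)

text \<open>The ideal of the canonical elements, built up from the right end: a member in degree
  \<open>n + 1\<close> is one of degree \<open>n\<close> times \<open>V_n\<close>, plus a left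
  multiple of \<open>w n\<close>. This shape exposes the last factor, where freeness can be applied;
  that it is a two-sided ideal has to be proved.\<close>

inductive rels :: "int \<Rightarrow> int \<Rightarrow> 'a \<Rightarrow> bool" for i where
  zero: "rels i j \<zero>\<^bsub>E i j\<^esub>"
| step: "rels i n r \<Longrightarrow> rels i n s \<Longrightarrow> z \<in> carrier (E i (n - 1)) \<Longrightarrow>
    rels i (n + 1) ((mu i n (n + 1) r (x' n) \<oplus>\<^bsub>E i (n + 1)\<^esub> mu i n (n + 1) s (y' n)) \<oplus>\<^bsub>E i (n + 1)\<^esub>
      mu i (n - 1) (n + 1) z (w n))"

lemma rels_closed [simp]: "rels i j a \<Longrightarrow> a \<in> carrier (E i j)"
  by (induction rule: rels.induct) auto

text \<open>Zero too can be written in the shape of the rule \<open>step\<close>, so members in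
  degree \<open>n + 1\<close> have a single form.\<close>

lemma rels_inv:
  assumes "rels i (n + 1) a"
  shows "\<exists>r s z. rels i n r \<and> rels i n s \<and> z \<in> carrier (E i (n - 1)) \<and>
    a = (mu i n (n + 1) r (x' n) \<oplus>\<^bsub>E i (n + 1)\<^esub> mu i n (n + 1) s (y' n)) \<oplus>\<^bsub>E i (n + 1)\<^esub>
      mu i (n - 1) (n + 1) z (w n)"
  using assms
proof cases
  case zero
  then show ?thesis using rels.zero[of i n]
    by (intro exI[of _ "\<zero>\<^bsub>E i n\<^esub>"] exI[of _ "\<zero>\<^bsub>E i (n - 1)\<^esub>"]) auto
next
  case (step n r s z)
  then show ?thesis by auto
qed

lemma rels_add: "rels i j a \<Longrightarrow> rels i j b \<Longrightarrow> rels i j (a \<oplus>\<^bsub>E i j\<^esub> b)"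
proof (induction arbitrary: b rule: rels.induct)
  case (zero j)
  then show ?case by simp
next
  case (step n r s z)
  obtain r' s' z' where *: "rels i n r'" "rels i n s'" "z' \<in> carrier (E i (n - 1))"
    "b = (mu i n (n + 1) r' (x' n) \<oplus>\<^bsub>E i (n + 1)\<^esub> mu i n (n + 1) s' (y' n)) \<oplus>\<^bsub>E i (n + 1)\<^esub>
      mu i (n - 1) (n + 1) z' (w n)"
    using rels_inv[OF step.prems] by blast
  have "rels i (n + 1) ((mu i n (n + 1) (r \<oplus>\<^bsub>E i n\<^esub> r') (x' n) \<oplus>\<^bsub>E i (n + 1)\<^esub>
      mu i n (n + 1) (s \<oplus>\<^bsub>E i n\<^esub> s') (y' n)) \<oplus>\<^bsub>E i (n + 1)\<^esub>
      mu i (n - 1) (n + 1) (z \<oplus>\<^bsub>E i (n - 1)\<^esub> z') (w n))"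
    using step * by (intro rels.step) auto
  then show ?case unfolding *(4) using step.hyps *(1-3) by (simp add: mu_add add_ac)
qed

lemma rels_neg: "rels i j a \<Longrightarrow> rels i j (\<ominus>\<^bsub>E i j\<^esub> a)"
proof (induction rule: rels.induct)
  case (zero j)
  then show ?case using rels.zero by simp
next
  case (step n r s z)
  have "rels i (n + 1) ((mu i n (n + 1) (\<ominus>\<^bsub>E i n\<^esub> r) (x' n) \<oplus>\<^bsub>E i (n + 1)\<^esub>
      mu i n (n + 1) (\<ominus>\<^bsub>E i n\<^esub> s) (y' n)) \<oplus>\<^bsub>E i (n + 1)\<^esub>
      mu i (n - 1) (n + 1) (\<ominus>\<^bsub>E i (n - 1)\<^esub> z) (w n))"
    using step by (intro rels.step) auto
  then show ?case using step.hyps by (simp add: mu_neg neg_add)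
qed

lemma rels_mult_left: "rels i j a \<Longrightarrow> c \<in> carrier (E h i) \<Longrightarrow> rels h j (mu h i j c a)"
proof (induction rule: rels.induct)
  case (zero j)
  then show ?case using rels.zero by simp
next
  case (step n r s z)
  have "rels h (n + 1) ((mu h n (n + 1) (mu h i n c r) (x' n) \<oplus>\<^bsub>E h (n + 1)\<^esub>
      mu h n (n + 1) (mu h i n c s) (y' n)) \<oplus>\<^bsub>E h (n + 1)\<^esub>
      mu h (n - 1) (n + 1) (mu h i (n - 1) c z) (w n))"
    using step by (intro rels.step) auto
  then show ?case using step.hyps step.prems by (simp add: mu_add mu_assoc)
qed

text \<open>A scalar on the right must be carried past the last factor. Past \<open>x'\<close>,
  \<open>y'\<close> this is an expansion in the left basis, and past \<open>w n\<close> it is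
  \<open>central_right\<close>; in both cases it ends on elements already treated or on the free
  factor \<open>z\<close>.\<close>

lemma rels_scalar_right: "rels i j a \<Longrightarrow> k \<in> carrier (E j j) \<Longrightarrow> rels i j (mu i j j a k)"
proof (induction arbitrary: k rule: rels.induct)
  case (zero j)
  then show ?case using rels.zero by simp
next
  case (step n r s z)
  note k = step.prems
  obtain \<alpha> \<gamma> where 1: "\<alpha> \<in> carrier (E n n)" "\<gamma> \<in> carrier (E n n)"
    "mu n (n + 1) (n + 1) (x' n) k = mu n n (n + 1) \<alpha> (x' n) \<oplus>\<^bsub>E n (n + 1)\<^esub> mu n n (n + 1) \<gamma> (y' n)"
    using right_gen[of n n "mu n (n + 1) (n + 1) (x' n) k"] k by auto
  obtain \<beta> \<delta> where 2: "\<beta> \<in> carrier (E n n)" "\<delta> \<in> carrier (E n n)"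
    "mu n (n + 1) (n + 1) (y' n) k = mu n n (n + 1) \<beta> (x' n) \<oplus>\<^bsub>E n (n + 1)\<^esub> mu n n (n + 1) \<delta> (y' n)"
    using right_gen[of n n "mu n (n + 1) (n + 1) (y' n) k"] k by auto
  obtain a where a: "a \<in> carrier (E (n - 1) (n - 1))"
    "mu (n - 1) (n + 1) (n + 1) (w n) k = mu (n - 1) (n - 1) (n + 1) a (w n)"
    using central_right[OF k] by auto
  have "rels i (n + 1) ((mu i n (n + 1) (mu i n n r \<alpha> \<oplus>\<^bsub>E i n\<^esub> mu i n n s \<beta>) (x' n) \<oplus>\<^bsub>E i (n + 1)\<^esub>
      mu i n (n + 1) (mu i n n r \<gamma> \<oplus>\<^bsub>E i n\<^esub> mu i n n s \<delta>) (y' n)) \<oplus>\<^bsub>E i (n + 1)\<^esub>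
      mu i (n - 1) (n + 1) (mu i (n - 1) (n - 1) z a) (w n))"
    using step 1 2 a by (intro rels.step rels_add) auto
  moreover have "mu i (n + 1) (n + 1) (mu i n (n + 1) r (x' n)) k =
      mu i n (n + 1) (mu i n n r \<alpha>) (x' n) \<oplus>\<^bsub>E i (n + 1)\<^esub> mu i n (n + 1) (mu i n n r \<gamma>) (y' n)"
    "mu i (n + 1) (n + 1) (mu i n (n + 1) s (y' n)) k =
      mu i n (n + 1) (mu i n n s \<beta>) (x' n) \<oplus>\<^bsub>E i (n + 1)\<^esub> mu i n (n + 1) (mu i n n s \<delta>) (y' n)"
    "mu i (n + 1) (n + 1) (mu i (n - 1) (n + 1) z (w n)) k =
      mu i (n - 1) (n + 1) (mu i (n - 1) (n - 1) z a) (w n)"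
    using step.hyps k 1(1,2) 2(1,2) a(1) by (simp_all add: mu_assoc 1(3) 2(3) a(2) mu_add)
  ultimately show ?case using step.hyps k 1(1,2) 2(1,2) a(1) by (simp add: mu_add add_ac)
qed

lemma rels_mult_right:
  assumes a: "rels i j a" and d: "d \<in> carrier (E j l)"
  shows "rels i l (mu i j l a d)"
proof (cases "l < j")
  case True
  then have "d = \<zero>\<^bsub>E j l\<^esub>" using below d by auto
  then show ?thesis using a rels.zero by simp
next
  case False
  then have "j \<le> l" by simp
  then show ?thesis using d
  proof (induction l arbitrary: d rule: int_ge_induct)
    case base
    then show ?case using rels_scalar_right[OF a] by simp
  next
    case (step l)
    obtain d0 d1 where d: "d0 \<in> carrier (E j l)" "d1 \<in> carrier (E j l)"
      "d = mu j l (l + 1) d0 (x' l) \<oplus>\<^bsub>E j (l + 1)\<^esub> mu j l (l + 1) d1 (y' l)"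
      using right_gen[OF step.hyps step.prems] by blast
    \<comment> \<open>Once \<open>d\<close> is split as \<open>d0 x' + d1 y'\<close>, the rule
      \<open>step\<close> applies with \<open>z = 0\<close>.\<close>
    have "rels i (l + 1) ((mu i l (l + 1) (mu i j l a d0) (x' l) \<oplus>\<^bsub>E i (l + 1)\<^esub>
      mu i l (l + 1) (mu i j l a d1) (y' l)) \<oplus>\<^bsub>E i (l + 1)\<^esub>
      mu i (l - 1) (l + 1) \<zero>\<^bsub>E i (l - 1)\<^esub> (w l))"
      using step.IH d by (intro rels.step) auto
    then show ?case using rels_closed[OF a] d by (simp add: mu_add mu_assoc)
  qed
qed

lemma rels_ideal: "zideal T (\<lambda>i j. {a. rels i j a})"
proof -
  have "subgroup {a. rels i j a} (component T i j)" for i j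
  proof -
    interpret C: comm_group "component T i j" by (rule comm_group_component)
    have inv: "inv\<^bsub>component T i j\<^esub> a = \<ominus>\<^bsub>E i j\<^esub> a" if "a \<in> carrier (component T i j)" for a
      by (rule neg_unique) (use that in \<open>simp_all add: zmod_simps\<close>)
    have "\<exists>a. rels i j a" using rels.zero by blast
    then show ?thesis
      by (intro C.subgroupI)
        (use rels_closed rels.zero rels_add rels_neg in \<open>auto simp: zmod_simps inv\<close>)
  qed
  then show ?thesis
    unfolding zideal_def using rels_mult_right rels_mult_left by (auto simp: zmod_simps)
qed

lemma rels_least:
  assumes J: "zideal T J" and w: "\<And>n. w n \<in> J (n - 1) (n + 1)" and "rels i j a"
  shows "a \<in> J i j"
  using assms(3)
proof (induction rule: rels.induct)
  case (zero j)
  show ?case by (rule zidealD(2)[OF J])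
next
  case (step n r s z)
  then show ?case
    by (intro zidealD(3)[OF J] zidealD(4)[OF J, OF _ gens_closed(3)] zidealD(4)[OF J, OF _ gens_closed(4)]
      zidealD(5)[OF J w])
qed

lemma rels_w: "rels (n - 1) (n + 1) (w n)"
proof -
  have "rels (n - 1) (n + 1) ((mu (n - 1) n (n + 1) \<zero>\<^bsub>E (n - 1) n\<^esub> (x' n) \<oplus>\<^bsub>E (n - 1) (n + 1)\<^esub>
    mu (n - 1) n (n + 1) \<zero>\<^bsub>E (n - 1) n\<^esub> (y' n)) \<oplus>\<^bsub>E (n - 1) (n + 1)\<^esub>
    mu (n - 1) (n - 1) (n + 1) (zunit T (n - 1)) (w n))"
    by (intro rels.step rels.zero unit_closed)
  then show ?thesis by simp
qed

text \<open>Writing \<open>a x' + b y' = r x' + s y' + z w\<close> with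
  \<open>w = x x' + y y'\<close>, freeness over the last factor permits comparing coefficients:
  \<open>a = r + z x\<close> and \<open>b = s + z y\<close>.\<close>

lemma rels_exact:
  assumes a: "a \<in> carrier (E i n)" and b: "b \<in> carrier (E i n)"
    and r: "rels i (n + 1) (mu i n (n + 1) a (x' n) \<oplus>\<^bsub>E i (n + 1)\<^esub> mu i n (n + 1) b (y' n))"
  shows "\<exists>z\<in>carrier (E i (n - 1)). rels i n (a \<oplus>\<^bsub>E i n\<^esub> \<ominus>\<^bsub>E i n\<^esub> mu i (n - 1) n z (x n)) \<and>
    rels i n (b \<oplus>\<^bsub>E i n\<^esub> \<ominus>\<^bsub>E i n\<^esub> mu i (n - 1) n z (y n))"
proof -
  obtain r s z where *: "rels i n r" "rels i n s" and z: "z \<in> carrier (E i (n - 1))"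
    and eq: "mu i n (n + 1) a (x' n) \<oplus>\<^bsub>E i (n + 1)\<^esub> mu i n (n + 1) b (y' n) =
      (mu i n (n + 1) r (x' n) \<oplus>\<^bsub>E i (n + 1)\<^esub> mu i n (n + 1) s (y' n)) \<oplus>\<^bsub>E i (n + 1)\<^esub>
      mu i (n - 1) (n + 1) z (w n)"
    using rels_inv[OF r] by blast
  have c: "r \<in> carrier (E i n)" "s \<in> carrier (E i n)" using * by auto
  let ?a = "a \<oplus>\<^bsub>E i n\<^esub> \<ominus>\<^bsub>E i n\<^esub> (r \<oplus>\<^bsub>E i n\<^esub> mu i (n - 1) n z (x n))"
  let ?b = "b \<oplus>\<^bsub>E i n\<^esub> \<ominus>\<^bsub>E i n\<^esub> (s \<oplus>\<^bsub>E i n\<^esub> mu i (n - 1) n z (y n))"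
  have "mu i n (n + 1) ?a (x' n) \<oplus>\<^bsub>E i (n + 1)\<^esub> mu i n (n + 1) ?b (y' n) =
    (mu i n (n + 1) a (x' n) \<oplus>\<^bsub>E i (n + 1)\<^esub> mu i n (n + 1) b (y' n)) \<oplus>\<^bsub>E i (n + 1)\<^esub>
    \<ominus>\<^bsub>E i (n + 1)\<^esub> ((mu i n (n + 1) r (x' n) \<oplus>\<^bsub>E i (n + 1)\<^esub> mu i n (n + 1) s (y' n)) \<oplus>\<^bsub>E i (n + 1)\<^esub>
      mu i (n - 1) (n + 1) z (w n))"
    using a b c z by (simp add: w_def mu_add mu_neg neg_add mu_assoc add_ac)
  also have "\<dots> = \<zero>\<^bsub>E i (n + 1)\<^esub>" unfolding eq using c z by simp
  finally have "?a = \<zero>\<^bsub>E i n\<^esub>" "?b = \<zero>\<^bsub>E i n\<^esub>" using right_free[of ?a i n ?b] a b c z by auto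
  then have "a = r \<oplus>\<^bsub>E i n\<^esub> mu i (n - 1) n z (x n)" "b = s \<oplus>\<^bsub>E i n\<^esub> mu i (n - 1) n z (y n)"
    using diff_zeroD a b c z by auto
  then have "a \<oplus>\<^bsub>E i n\<^esub> \<ominus>\<^bsub>E i n\<^esub> mu i (n - 1) n z (x n) = r" "b \<oplus>\<^bsub>E i n\<^esub> \<ominus>\<^bsub>E i n\<^esub> mu i (n - 1) n z (y n) = s"
    using c z by (simp_all add: add_assoc)
  then show ?thesis using * z by auto
qed

text \<open>Both descriptions give the least ideal that contains all canonical elements, and this
  ideal does not depend on the end from which it is built. Each is contained in the other by
  minimality.\<close>

lemma rels_rev:
  "rels i j a \<longleftrightarrow> tensor_like.rels (rev_zalg T) (\<lambda>n. x' (- n)) (\<lambda>n. y' (- n)) (\<lambda>n. x (- n)) (\<lambda>n. y (- n)) (- j) (- i) a"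
proof -
  interpret R: tensor_like "rev_zalg T" "\<lambda>n. x' (- n)" "\<lambda>n. y' (- n)" "\<lambda>n. x (- n)" "\<lambda>n. y (- n)"
    "\<lambda>n. w (- n)"
    by (rule tensor_like_rev) (simp add: w_def)
  have ideal: "zideal (rev_zalg D) (\<lambda>i j. J (- j) (- i))" if "zideal D J" for D :: "'a zalg" and J
    using that by (auto simp: zideal_def)
  show ?thesis
  proof
    assume "rels i j a"
    have "zideal T (\<lambda>i j. {a. R.rels (- j) (- i) a})"
      using ideal[OF R.rels_ideal] by simp
    moreover have "w n \<in> {a. R.rels (- (n + 1)) (- (n - 1)) a}" for n
      using R.rels_w[of "- n"] by simp
    ultimately show "R.rels (- j) (- i) a" using rels_least \<open>rels i j a\<close> by blast
  next
    assume "R.rels (- j) (- i) a"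
    moreover have "w (- n) \<in> {a. rels (- (n + 1)) (- (n - 1)) a}" for n
      using rels_w[of "- n"] by simp
    ultimately have "a \<in> {a. rels (- (- i)) (- (- j)) a}" by (rule R.rels_least[OF ideal[OF rels_ideal], rotated])
    then show "rels i j a" by simp
  qed
qed

text \<open>By \<open>rels_rev\<close> this is \<open>rels_exact\<close> for the reversed
  algebra.\<close>

lemma rels_left_exact:
  assumes a: "a \<in> carrier (E n m)" and b: "b \<in> carrier (E n m)"
    and r: "rels (n - 1) m (mu (n - 1) n m (x n) a \<oplus>\<^bsub>E (n - 1) m\<^esub> mu (n - 1) n m (y n) b)"
  shows "\<exists>z\<in>carrier (E (n + 1) m). rels n m (a \<oplus>\<^bsub>E n m\<^esub> \<ominus>\<^bsub>E n m\<^esub> mu n (n + 1) m (x' n) z) \<and>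
    rels n m (b \<oplus>\<^bsub>E n m\<^esub> \<ominus>\<^bsub>E n m\<^esub> mu n (n + 1) m (y' n) z)"
proof -
  interpret R: tensor_like "rev_zalg T" "\<lambda>n. x' (- n)" "\<lambda>n. y' (- n)" "\<lambda>n. x (- n)" "\<lambda>n. y (- n)"
    "\<lambda>n. w (- n)"
    by (rule tensor_like_rev) (simp add: w_def)
  have neg: "\<ominus>\<^bsub>zmod (rev_zalg T) (- m) (- n)\<^esub> c = \<ominus>\<^bsub>E n m\<^esub> c" if "c \<in> carrier (E n m)" for c
    by (rule neg_unique) (use that R.add_neg(1)[of c "- m" "- n"] R.neg_closed[of c "- m" "- n"] in simp_all)
  from R.rels_exact[of a "- m" "- n" b]
  show ?thesis using a b r by (auto simp: rels_rev neg add.commute[of 1 n])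
qed

end

section \<open>Quotients by graded ideals\<close>

locale zquotient = z_algebra D for D :: "'a zalg" +
  fixes J :: "int \<Rightarrow> int \<Rightarrow> 'a set"
  assumes ideal: "zideal D J"
begin

abbreviation Q where "Q \<equiv> quotient_zalg D J"

definition cl :: "int \<Rightarrow> int \<Rightarrow> 'a \<Rightarrow> 'a set" where
  "cl i j a = J i j #>\<^bsub>component D i j\<^esub> a"

lemmas Jd = zidealD[OF ideal]

lemma J_subgroup: "subgroup (J i j) (component D i j)"
  using ideal by (simp add: zideal_def)

lemma J_normal: "normal (J i j) (component D i j)"
  by (rule comm_group.subgroup_imp_normal[OF comm_group_component J_subgroup])

lemma J_neg: "a \<in> J i j \<Longrightarrow> \<ominus>\<^bsub>E i j\<^esub> a \<in> J i j"
proof -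
  assume a: "a \<in> J i j"
  interpret C: comm_group "component D i j" by (rule comm_group_component)
  have c: "a \<in> carrier (E i j)" using Jd(1) a by auto
  have "inv\<^bsub>component D i j\<^esub> a = \<ominus>\<^bsub>E i j\<^esub> a"
    by (rule neg_unique) (use c in \<open>simp_all add: zmod_simps\<close>)
  then show ?thesis using subgroup.m_inv_closed[OF J_subgroup a] by simp
qed

lemma cl_mem: "u \<in> cl i j a \<longleftrightarrow> (\<exists>r\<in>J i j. u = r \<oplus>\<^bsub>E i j\<^esub> a)"
  by (auto simp: cl_def r_coset_def zmod_simps)

lemma component_quotient: "component Q i j = component D i j Mod J i j"
  by (simp add: quotient_zalg_def)

lemma carrier_quotient: "carrier (component Q i j) = cl i j ` carrier (E i j)"
  by (auto simp: component_quotient FactGroup_def RCOSETS_def cl_def zmod_simps)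

lemma carrier_zmod_quotient: "carrier (zmod Q i j) = cl i j ` carrier (E i j)"
  by (simp add: zmod_simps(1)[of Q] carrier_quotient)

lemma cl_closed [simp, intro]: "a \<in> carrier (E i j) \<Longrightarrow> cl i j a \<in> carrier (zmod Q i j)"
  by (simp add: carrier_zmod_quotient)

lemma cl_add:
  "a \<in> carrier (E i j) \<Longrightarrow> b \<in> carrier (E i j) \<Longrightarrow>
    cl i j a \<oplus>\<^bsub>zmod Q i j\<^esub> cl i j b = cl i j (a \<oplus>\<^bsub>E i j\<^esub> b)"
  by (simp add: zmod_simps component_quotient FactGroup_def cl_def normal.rcos_sum[OF J_normal])

lemma zero_quotient: "\<zero>\<^bsub>zmod Q i j\<^esub> = cl i j \<zero>\<^bsub>E i j\<^esub>"
proof -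
  interpret C: comm_group "component D i j" by (rule comm_group_component)
  show ?thesis using subgroup.subset[OF J_subgroup]
    by (simp add: zmod_simps component_quotient FactGroup_def cl_def C.coset_mult_one)
qed

lemma cl_eqI:
  assumes "a \<in> carrier (E i j)" "b \<in> carrier (E i j)" "a \<oplus>\<^bsub>E i j\<^esub> \<ominus>\<^bsub>E i j\<^esub> b \<in> J i j"
  shows "cl i j a = cl i j b"
proof -
  have *: "cl i j a \<subseteq> cl i j b"
    if ab: "a \<in> carrier (E i j)" "b \<in> carrier (E i j)" "a \<oplus>\<^bsub>E i j\<^esub> \<ominus>\<^bsub>E i j\<^esub> b \<in> J i j" for a b
  proof
    fix u assume "u \<in> cl i j a"
    then obtain r where r: "r \<in> J i j" "u = r \<oplus>\<^bsub>E i j\<^esub> a" by (auto simp: cl_mem)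
    moreover have "r \<in> carrier (E i j)" using r(1) Jd(1)[of i j] by blast
    ultimately have "u = (r \<oplus>\<^bsub>E i j\<^esub> (a \<oplus>\<^bsub>E i j\<^esub> \<ominus>\<^bsub>E i j\<^esub> b)) \<oplus>\<^bsub>E i j\<^esub> b"
      using ab(1,2) by (simp add: add_assoc)
    then show "u \<in> cl i j b" unfolding cl_mem using Jd(3) r(1) ab(3) by blast
  qed
  have "\<ominus>\<^bsub>E i j\<^esub> (a \<oplus>\<^bsub>E i j\<^esub> \<ominus>\<^bsub>E i j\<^esub> b) = b \<oplus>\<^bsub>E i j\<^esub> \<ominus>\<^bsub>E i j\<^esub> a"
    using assms(1,2) by (simp add: neg_add abelian_group.minus_minus[OF zmod_abelian] add_comm)
  then show ?thesis using *[OF assms] *[OF assms(2,1)] J_neg[OF assms(3)] by auto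
qed

lemma cl_eqD:
  assumes "a \<in> carrier (E i j)" "b \<in> carrier (E i j)" "cl i j a = cl i j b"
  shows "a \<oplus>\<^bsub>E i j\<^esub> \<ominus>\<^bsub>E i j\<^esub> b \<in> J i j"
proof -
  have "a \<in> cl i j a" unfolding cl_mem using Jd(2) assms(1) by (intro bexI[of _ "\<zero>\<^bsub>E i j\<^esub>"]) auto
  then obtain r where r: "r \<in> J i j" "a = r \<oplus>\<^bsub>E i j\<^esub> b" unfolding assms(3) cl_mem by blast
  then have "r \<in> carrier (E i j)" using Jd(1) by auto
  then show ?thesis using r assms(2) by (simp add: add_assoc)
qed

lemma cl_zero_iff: "a \<in> carrier (E i j) \<Longrightarrow> cl i j a = \<zero>\<^bsub>zmod Q i j\<^esub> \<longleftrightarrow> a \<in> J i j"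
  unfolding zero_quotient using cl_eqI[of a i j "\<zero>\<^bsub>E i j\<^esub>"] cl_eqD[of a i j "\<zero>\<^bsub>E i j\<^esub>"] by auto

text \<open>The product of two cosets is defined from all representatives. Two-sidedness of
  \<open>J\<close> keeps it a single coset: \<open>(r + a) (s + b)\<close> differs from
  \<open>a b\<close> by \<open>r (s + b) + a s\<close>.\<close>

lemma cl_mult:
  assumes a: "a \<in> carrier (E i j)" and b: "b \<in> carrier (E j l)"
  shows "zmult Q i j l (cl i j a) (cl j l b) = cl i l (mu i j l a b)"
proof -
  have "J i l <#>\<^bsub>component D i l\<^esub> {mu i j l u v | u v. u \<in> cl i j a \<and> v \<in> cl j l b} = cl i l (mu i j l a b)"
  proof
    show "J i l <#>\<^bsub>component D i l\<^esub> {mu i j l u v | u v. u \<in> cl i j a \<and> v \<in> cl j l b} \<subseteq> cl i l (mu i j l a b)"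
    proof
      fix z assume "z \<in> J i l <#>\<^bsub>component D i l\<^esub> {mu i j l u v | u v. u \<in> cl i j a \<and> v \<in> cl j l b}"
      then obtain t r s where *: "t \<in> J i l" "r \<in> J i j" "s \<in> J j l"
        "z = t \<oplus>\<^bsub>E i l\<^esub> mu i j l (r \<oplus>\<^bsub>E i j\<^esub> a) (s \<oplus>\<^bsub>E j l\<^esub> b)"
        by (auto simp: set_mult_def cl_mem zmod_simps)
      have c: "t \<in> carrier (E i l)" "r \<in> carrier (E i j)" "s \<in> carrier (E j l)" using * Jd(1) by auto
      have "z = (t \<oplus>\<^bsub>E i l\<^esub> (mu i j l r (s \<oplus>\<^bsub>E j l\<^esub> b) \<oplus>\<^bsub>E i l\<^esub> mu i j l a s)) \<oplus>\<^bsub>E i l\<^esub> mu i j l a b"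
        using *(4) a b c by (simp add: mu_add add_ac)
      moreover have "t \<oplus>\<^bsub>E i l\<^esub> (mu i j l r (s \<oplus>\<^bsub>E j l\<^esub> b) \<oplus>\<^bsub>E i l\<^esub> mu i j l a s) \<in> J i l"
        by (intro Jd(3) Jd(4)[of r i j] Jd(5)[of s j l] * a) (use b c in auto)
      ultimately show "z \<in> cl i l (mu i j l a b)" unfolding cl_mem by blast
    qed
    show "cl i l (mu i j l a b) \<subseteq> J i l <#>\<^bsub>component D i l\<^esub> {mu i j l u v | u v. u \<in> cl i j a \<and> v \<in> cl j l b}"
    proof
      fix z assume "z \<in> cl i l (mu i j l a b)"
      then obtain t where t: "t \<in> J i l" "z = t \<oplus>\<^bsub>E i l\<^esub> mu i j l a b" by (auto simp: cl_mem)
      have "a \<in> cl i j a" "b \<in> cl j l b" unfolding cl_mem using Jd(2) a b by (metis add_zero(2))+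
      then show "z \<in> J i l <#>\<^bsub>component D i l\<^esub> {mu i j l u v | u v. u \<in> cl i j a \<and> v \<in> cl j l b}"
        using t unfolding set_mult_def by (auto simp: zmod_simps)
    qed
  qed
  then show ?thesis by (simp add: quotient_zalg_def)
qed

lemma unit_quotient: "zunit Q i = cl i i (zunit D i)"
  by (simp add: quotient_zalg_def cl_def)

lemma z_algebra_quotient: "z_algebra Q"
proof (rule z_algebra.intro)
  fix i j
  show "comm_group (component Q i j)"
    unfolding component_quotient
    using comm_group.abelian_FactGroup[OF comm_group_component J_subgroup] .
next
  fix a i j b l assume "a \<in> carrier (component Q i j)" "b \<in> carrier (component Q j l)"
  then show "zmult Q i j l a b \<in> carrier (component Q i l)"
    by (auto simp: carrier_quotient cl_mult)
next
  fix a i j a' b l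
  assume "a \<in> carrier (component Q i j)" "a' \<in> carrier (component Q i j)" "b \<in> carrier (component Q j l)"
  then show "zmult Q i j l (a \<otimes>\<^bsub>component Q i j\<^esub> a') b =
      zmult Q i j l a b \<otimes>\<^bsub>component Q i l\<^esub> zmult Q i j l a' b"
    by (auto simp: carrier_quotient zmod_simps(2)[of Q, symmetric] cl_add cl_mult mu_add)
next
  fix a i j b l b'
  assume "a \<in> carrier (component Q i j)" "b \<in> carrier (component Q j l)" "b' \<in> carrier (component Q j l)"
  then show "zmult Q i j l a (b \<otimes>\<^bsub>component Q j l\<^esub> b') =
      zmult Q i j l a b \<otimes>\<^bsub>component Q i l\<^esub> zmult Q i j l a b'"
    by (auto simp: carrier_quotient zmod_simps(2)[of Q, symmetric] cl_add cl_mult mu_add)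
next
  fix a i j b l c m
  assume "a \<in> carrier (component Q i j)" "b \<in> carrier (component Q j l)" "c \<in> carrier (component Q l m)"
  then show "zmult Q i l m (zmult Q i j l a b) c = zmult Q i j m a (zmult Q j l m b c)"
    by (auto simp: carrier_quotient cl_mult mu_assoc)
next
  show "zunit Q i \<in> carrier (component Q i i)" for i by (auto simp: unit_quotient carrier_quotient)
next
  fix a i j assume "a \<in> carrier (component Q i j)"
  then show "zmult Q i i j (zunit Q i) a = a" "zmult Q i j j a (zunit Q j) = a"
    by (auto simp: unit_quotient carrier_quotient cl_mult)
qed

lemma field_diagonal_quotient:
  assumes F: "field (diagonal_ring D n)" and J: "J n n = {\<zero>\<^bsub>E n n\<^esub>}"
  shows "field (diagonal_ring Q n)"
proof -
  interpret F: field "diagonal_ring D n" by (rule F)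
  have inj: "inj_on (cl n n) (carrier (E n n))"
  proof (rule inj_onI)
    fix a b assume ab: "a \<in> carrier (E n n)" "b \<in> carrier (E n n)" "cl n n a = cl n n b"
    then show "a = b" using cl_eqD[OF ab] diff_zeroD J by auto
  qed
  have "cl n n \<in> ring_iso (diagonal_ring D n) (diagonal_ring Q n)"
    by (rule ring_iso_memI) (use inj in \<open>auto simp: bij_betw_def carrier_zmod_quotient cl_mult cl_add unit_quotient\<close>)
  from F.ring_iso_imp_img_field[OF this] show ?thesis
    by (simp add: diagonal_ring_def zero_quotient[unfolded zmod_simps] unit_quotient zmod_simps)
qed

end

section \<open>Exactness in the quotient by the canonical elements\<close>

context tensor_like
begin

text \<open>The rule \<open>step\<close> reaches degree zero only from coefficients in
  \<open>T_(n,n-1)\<close> and \<open>T_(n,n-2)\<close>, which are trivial. The diagonal fields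
  therefore survive in the quotient.\<close>

lemma rels_diagonal: "{a. rels n n a} = {\<zero>\<^bsub>E n n\<^esub>}"
proof (intro Set.set_eqI iffI)
  fix a assume "a \<in> {a. rels n n a}"
  then have "rels n (n - 1 + 1) a" by simp
  then obtain r s z where *: "rels n (n - 1) r" "rels n (n - 1) s" "z \<in> carrier (E n (n - 1 - 1))"
    "a = (mu n (n - 1) (n - 1 + 1) r (x' (n - 1)) \<oplus>\<^bsub>E n (n - 1 + 1)\<^esub> mu n (n - 1) (n - 1 + 1) s (y' (n - 1)))
      \<oplus>\<^bsub>E n (n - 1 + 1)\<^esub> mu n (n - 1 - 1) (n - 1 + 1) z (w (n - 1))"
    using rels_inv by blast
  have "r = \<zero>\<^bsub>E n (n - 1)\<^esub>" "s = \<zero>\<^bsub>E n (n - 1)\<^esub>" "z = \<zero>\<^bsub>E n (n - 1 - 1)\<^esub>"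
    using rels_closed[OF *(1)] rels_closed[OF *(2)] *(3) below[of "n - 1" n] below[of "n - 1 - 1" n] by auto
  then show "a \<in> {\<zero>\<^bsub>E n n\<^esub>}"
    using *(4) gens_closed(3)[of "n - 1"] gens_closed(4)[of "n - 1"] w_closed[of "n - 1"] by simp
qed (use rels.zero in auto)

text \<open>The family \<open>S\<close> may lie anywhere between the canonical elements and the
  ideal they generate, because the quadratic relations also include the left multiples of the
  canonical elements.\<close>

lemma generated_zideal_rels:
  assumes "\<And>i j. S i j \<subseteq> {a. rels i j a}" and "\<And>n. w n \<in> S (n - 1) (n + 1)"
  shows "generated_zideal T S = (\<lambda>i j. {a. rels i j a})"
proof (intro ext Set.set_eqI iffI)
  fix i j a assume "a \<in> generated_zideal T S i j"
  then show "a \<in> {a. rels i j a}"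
    unfolding generated_zideal_def using rels_ideal assms(1) by blast
next
  fix i j a assume "a \<in> {a. rels i j a}"
  then show "a \<in> generated_zideal T S i j"
    unfolding generated_zideal_def using rels_least assms(2) by blast
qed

text \<open>Generation is inherited by cosets. For exactness, a relation between cosets is a
  relation modulo \<open>rels\<close> between representatives, and \<open>rels_exact\<close> or its
  left version corrects these by the multiple of \<open>z\<close> that was sought.\<close>

lemma ncs_quotient:
  assumes S: "\<And>i j. S i j \<subseteq> {a. rels i j a}" "\<And>n. w n \<in> S (n - 1) (n + 1)"
  shows "\<exists>x y x' y'. ncs_algebra (quotient_zalg T (generated_zideal T S)) x y x' y'"
proof -
  define J where "J = (\<lambda>i j. {a. rels i j a})"
  have gen: "generated_zideal T S = J" unfolding J_def by (rule generated_zideal_rels[OF S])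
  interpret Z: zquotient T J by unfold_locales (simp add: J_def rels_ideal)
  note Q = Z.carrier_zmod_quotient
  have "ncs_algebra Z.Q (\<lambda>n. Z.cl (n - 1) n (x n)) (\<lambda>n. Z.cl (n - 1) n (y n))
    (\<lambda>n. Z.cl n (n + 1) (x' n)) (\<lambda>n. Z.cl n (n + 1) (y' n))"
  proof (intro ncs_algebra.intro Z.z_algebra_quotient ncs_algebra_axioms.intro)
    show "field (diagonal_ring Z.Q n)" for n
      by (rule Z.field_diagonal_quotient[OF field_diag]) (simp add: J_def rels_diagonal)
  next
    fix i j :: int assume "j < i"
    then show "carrier (zmod Z.Q i j) = {\<zero>\<^bsub>zmod Z.Q i j\<^esub>}"
      using below[of j i] by (simp add: Q Z.zero_quotient)
  next
    fix n
    show "zmult Z.Q (n - 1) n (n + 1) (Z.cl (n - 1) n (x n)) (Z.cl n (n + 1) (x' n)) \<oplus>\<^bsub>zmod Z.Q (n - 1) (n + 1)\<^esub>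
      zmult Z.Q (n - 1) n (n + 1) (Z.cl (n - 1) n (y n)) (Z.cl n (n + 1) (y' n)) = \<zero>\<^bsub>zmod Z.Q (n - 1) (n + 1)\<^esub>"
    proof -
      have "w n \<in> J (n - 1) (n + 1)" using rels_w by (simp add: J_def)
      then show ?thesis by (simp add: Z.cl_mult Z.cl_add Z.cl_zero_iff w_def)
    qed
  next
    fix i n :: int and c assume "i \<le> n" "c \<in> carrier (zmod Z.Q i (n + 1))"
    then obtain c' where c': "c' \<in> carrier (E i (n + 1))" "c = Z.cl i (n + 1) c'" by (auto simp: Q)
    obtain a b where "a \<in> carrier (E i n)" "b \<in> carrier (E i n)"
      "c' = mu i n (n + 1) a (x' n) \<oplus>\<^bsub>E i (n + 1)\<^esub> mu i n (n + 1) b (y' n)"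
      using right_gen[OF \<open>i \<le> n\<close> c'(1)] by blast
    then show "\<exists>a\<in>carrier (zmod Z.Q i n). \<exists>b\<in>carrier (zmod Z.Q i n).
        c = zmult Z.Q i n (n + 1) a (Z.cl n (n + 1) (x' n)) \<oplus>\<^bsub>zmod Z.Q i (n + 1)\<^esub>
          zmult Z.Q i n (n + 1) b (Z.cl n (n + 1) (y' n))"
      using c'(2) by (intro bexI[of _ "Z.cl i n a"] bexI[of _ "Z.cl i n b"]) (simp_all add: Z.cl_mult Z.cl_add)
  next
    fix n m :: int and c assume "n \<le> m" "c \<in> carrier (zmod Z.Q (n - 1) m)"
    then obtain c' where c': "c' \<in> carrier (E (n - 1) m)" "c = Z.cl (n - 1) m c'" by (auto simp: Q)
    obtain a b where "a \<in> carrier (E n m)" "b \<in> carrier (E n m)"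
      "c' = mu (n - 1) n m (x n) a \<oplus>\<^bsub>E (n - 1) m\<^esub> mu (n - 1) n m (y n) b"
      using left_gen[OF \<open>n \<le> m\<close> c'(1)] by blast
    then show "\<exists>a\<in>carrier (zmod Z.Q n m). \<exists>b\<in>carrier (zmod Z.Q n m).
        c = zmult Z.Q (n - 1) n m (Z.cl (n - 1) n (x n)) a \<oplus>\<^bsub>zmod Z.Q (n - 1) m\<^esub>
          zmult Z.Q (n - 1) n m (Z.cl (n - 1) n (y n)) b"
      using c'(2) by (intro bexI[of _ "Z.cl n m a"] bexI[of _ "Z.cl n m b"]) (simp_all add: Z.cl_mult Z.cl_add)
  next
    fix a i n b
    assume "a \<in> carrier (zmod Z.Q i n)" "b \<in> carrier (zmod Z.Q i n)"
      and eq: "zmult Z.Q i n (n + 1) a (Z.cl n (n + 1) (x' n)) \<oplus>\<^bsub>zmod Z.Q i (n + 1)\<^esub>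
          zmult Z.Q i n (n + 1) b (Z.cl n (n + 1) (y' n)) = \<zero>\<^bsub>zmod Z.Q i (n + 1)\<^esub>"
    then obtain a' b' where ab: "a' \<in> carrier (E i n)" "b' \<in> carrier (E i n)" "a = Z.cl i n a'" "b = Z.cl i n b'"
      by (auto simp: Q)
    have "(mu i n (n + 1) a' (x' n) \<oplus>\<^bsub>E i (n + 1)\<^esub> mu i n (n + 1) b' (y' n)) \<in> J i (n + 1)"
      using eq ab by (simp add: Z.cl_mult Z.cl_add Z.cl_zero_iff)
    then have "rels i (n + 1) (mu i n (n + 1) a' (x' n) \<oplus>\<^bsub>E i (n + 1)\<^esub> mu i n (n + 1) b' (y' n))" by (simp add: J_def)
    then obtain z where z: "z \<in> carrier (E i (n - 1))"
      "rels i n (a' \<oplus>\<^bsub>E i n\<^esub> \<ominus>\<^bsub>E i n\<^esub> mu i (n - 1) n z (x n))"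
      "rels i n (b' \<oplus>\<^bsub>E i n\<^esub> \<ominus>\<^bsub>E i n\<^esub> mu i (n - 1) n z (y n))"
      using rels_exact[OF ab(1,2)] by blast
    then have "a = Z.cl i n (mu i (n - 1) n z (x n))" "b = Z.cl i n (mu i (n - 1) n z (y n))"
      unfolding ab(3,4) using ab(1,2) by - (rule Z.cl_eqI; simp add: J_def)+
    then show "\<exists>z\<in>carrier (zmod Z.Q i (n - 1)). a = zmult Z.Q i (n - 1) n z (Z.cl (n - 1) n (x n)) \<and>
        b = zmult Z.Q i (n - 1) n z (Z.cl (n - 1) n (y n))"
      using z(1) by (intro bexI[of _ "Z.cl i (n - 1) z"]) (simp_all add: Z.cl_mult)
  next
    fix a n m b
    assume "a \<in> carrier (zmod Z.Q n m)" "b \<in> carrier (zmod Z.Q n m)"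
      and eq: "zmult Z.Q (n - 1) n m (Z.cl (n - 1) n (x n)) a \<oplus>\<^bsub>zmod Z.Q (n - 1) m\<^esub>
          zmult Z.Q (n - 1) n m (Z.cl (n - 1) n (y n)) b = \<zero>\<^bsub>zmod Z.Q (n - 1) m\<^esub>"
    then obtain a' b' where ab: "a' \<in> carrier (E n m)" "b' \<in> carrier (E n m)" "a = Z.cl n m a'" "b = Z.cl n m b'"
      by (auto simp: Q)
    have "(mu (n - 1) n m (x n) a' \<oplus>\<^bsub>E (n - 1) m\<^esub> mu (n - 1) n m (y n) b') \<in> J (n - 1) m"
      using eq ab by (simp add: Z.cl_mult Z.cl_add Z.cl_zero_iff)
    then have "rels (n - 1) m (mu (n - 1) n m (x n) a' \<oplus>\<^bsub>E (n - 1) m\<^esub> mu (n - 1) n m (y n) b')" by (simp add: J_def)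
    then obtain z where z: "z \<in> carrier (E (n + 1) m)"
      "rels n m (a' \<oplus>\<^bsub>E n m\<^esub> \<ominus>\<^bsub>E n m\<^esub> mu n (n + 1) m (x' n) z)"
      "rels n m (b' \<oplus>\<^bsub>E n m\<^esub> \<ominus>\<^bsub>E n m\<^esub> mu n (n + 1) m (y' n) z)"
      using rels_left_exact[OF ab(1,2)] by blast
    then have "a = Z.cl n m (mu n (n + 1) m (x' n) z)" "b = Z.cl n m (mu n (n + 1) m (y' n) z)"
      unfolding ab(3,4) using ab(1,2) by - (rule Z.cl_eqI; simp add: J_def)+
    then show "\<exists>z\<in>carrier (zmod Z.Q (n + 1) m). a = zmult Z.Q n (n + 1) m (Z.cl n (n + 1) (x' n)) z \<and>
        b = zmult Z.Q n (n + 1) m (Z.cl n (n + 1) (y' n)) z"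
      using z(1) by (intro bexI[of _ "Z.cl (n + 1) m z"]) (simp_all add: Z.cl_mult)
  qed auto
  then show ?thesis unfolding gen by blast
qed

end

section \<open>The tensor algebra of a sequence of bimodules\<close>

lemma words_Nil [simp]: "[] \<in> words W i j \<longleftrightarrow> i = j"
  by (auto simp: words_def)

lemma words_Cons [simp]: "v # ts \<in> words W i j \<longleftrightarrow> v \<in> carrier (W i) \<and> ts \<in> words W (i + 1) j"
  by (auto simp: words_def All_less_Suc2 add_ac)

lemma words_length: "ws \<in> words W i j \<Longrightarrow> j = i + int (length ws)"
  by (auto simp: words_def)

lemma words_append [simp]:
  "us @ ws \<in> words W i j \<longleftrightarrow> us \<in> words W i (i + int (length us)) \<and> ws \<in> words W (i + int (length us)) j"
  by (induction us arbitrary: i) (auto simp: add.assoc add.commute)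

lemma words_le: "ws \<in> words W i j \<Longrightarrow> i \<le> j"
  by (auto dest: words_length)

lemma words_same: "ws \<in> words W i i \<longleftrightarrow> ws = []"
  by (cases ws) (auto dest: words_length)

lemma words_snoc_ex:
  assumes "ws \<in> words W i (n + 1)" "i \<le> n"
  obtains us v where "ws = us @ [v]" "us \<in> words W i n" "v \<in> carrier (W n)"
proof -
  from assms have "ws \<noteq> []" by auto
  then obtain us v where ws: "ws = us @ [v]" by (meson rev_exhaust)
  have "n = i + int (length us)" using words_length[OF assms(1)] ws by simp
  then show ?thesis using that[OF ws] assms(1) ws by simp
qed

lemma words_cons_ex:
  assumes "ws \<in> words W i j" "i < j"
  obtains v us where "ws = v # us" "us \<in> words W (i + 1) j" "v \<in> carrier (W i)"
  using assms by (cases ws) auto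

lemma scale_last_snoc [simp]: "scale_last U (ws @ [v]) b = ws @ [rsmult U v b]"
  by (simp add: scale_last_def)

lemma scale_first_append: "us \<noteq> [] \<Longrightarrow> scale_first U a (us @ ws) = scale_first U a us @ ws"
  by (cases us) auto

text \<open>Products in the tensor algebra are computed on all representatives and then saturated by
  the kernel; an additive map that respects the kernels turns this set into the coset of one
  image.\<close>

lemma set_mult_coset_image:
  assumes add: "\<And>f g. \<phi> (f + g) = \<phi> f + \<phi> g" and N: "\<And>f. f \<in> N \<Longrightarrow> \<phi> f \<in> N'"
    and z: "0 \<in> N" and plus: "\<And>f g. f \<in> N' \<Longrightarrow> g \<in> N' \<Longrightarrow> f + g \<in> N'"
  shows "N' <#>\<^bsub>free_Abelian_group S'\<^esub> {\<phi> g' | g'. g' \<in> N #>\<^bsub>free_Abelian_group S\<^esub> g} =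
    N' #>\<^bsub>free_Abelian_group S'\<^esub> \<phi> g"
proof (intro Set.set_eqI iffI)
  fix t assume "t \<in> N' <#>\<^bsub>free_Abelian_group S'\<^esub> {\<phi> g' | g'. g' \<in> N #>\<^bsub>free_Abelian_group S\<^esub> g}"
  then obtain r s where rs: "r \<in> N'" "s \<in> N" "t = r + \<phi> (s + g)"
    by (auto simp: set_mult_def r_coset_def)
  then have "t = (r + \<phi> s) + \<phi> g" by (simp add: add algebra_simps)
  then show "t \<in> N' #>\<^bsub>free_Abelian_group S'\<^esub> \<phi> g"
    using plus[OF rs(1) N[OF rs(2)]] by (auto simp: r_coset_def)
next
  fix t assume "t \<in> N' #>\<^bsub>free_Abelian_group S'\<^esub> \<phi> g"
  then obtain r where r: "r \<in> N'" "t = r + \<phi> g" by (auto simp: r_coset_def)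
  have "g \<in> N #>\<^bsub>free_Abelian_group S\<^esub> g" using z by (force simp: r_coset_def)
  then show "t \<in> N' <#>\<^bsub>free_Abelian_group S'\<^esub> {\<phi> g' | g'. g' \<in> N #>\<^bsub>free_Abelian_group S\<^esub> g}"
    using r by (auto simp: set_mult_def)
qed

lemma set_mult_coset_image2:
  assumes add1: "\<And>f f' g. \<phi> (f + f') g = \<phi> f g + \<phi> f' g" and add2: "\<And>f g g'. \<phi> f (g + g') = \<phi> f g + \<phi> f g'"
    and N1: "\<And>f g. f \<in> N1 \<Longrightarrow> Poly_Mapping.keys g \<subseteq> S2 \<Longrightarrow> \<phi> f g \<in> N'"
    and N2: "\<And>f g. g \<in> N2 \<Longrightarrow> Poly_Mapping.keys f \<subseteq> S1 \<Longrightarrow> \<phi> f g \<in> N'"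
    and N2S: "\<And>g. g \<in> N2 \<Longrightarrow> Poly_Mapping.keys g \<subseteq> S2"
    and z: "0 \<in> N1" "0 \<in> N2" and plus: "\<And>f g. f \<in> N' \<Longrightarrow> g \<in> N' \<Longrightarrow> f + g \<in> N'"
    and f: "Poly_Mapping.keys f \<subseteq> S1" and g: "Poly_Mapping.keys g \<subseteq> S2"
  shows "N' <#>\<^bsub>free_Abelian_group S'\<^esub> {\<phi> f' g' | f' g'. f' \<in> N1 #>\<^bsub>free_Abelian_group S1\<^esub> f \<and>
      g' \<in> N2 #>\<^bsub>free_Abelian_group S2\<^esub> g} = N' #>\<^bsub>free_Abelian_group S'\<^esub> \<phi> f g"
    (is "?l = ?r")
proof (intro Set.set_eqI iffI)
  fix t assume "t \<in> ?l"
  then obtain r s u where *: "r \<in> N'" "s \<in> N1" "u \<in> N2" "t = r + \<phi> (s + f) (u + g)"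
    by (auto simp: set_mult_def r_coset_def)
  have k: "Poly_Mapping.keys (u + g) \<subseteq> S2" using N2S[OF *(3)] g keys_add[of u g] by auto
  have "t = ((r + \<phi> s (u + g)) + \<phi> f u) + \<phi> f g" using *(4) by (simp add: add1 add2 algebra_simps)
  moreover have "(r + \<phi> s (u + g)) + \<phi> f u \<in> N'"
    using plus[OF plus[OF *(1) N1[OF *(2) k]] N2[OF *(3) f]] .
  ultimately show "t \<in> ?r" by (auto simp: r_coset_def)
next
  fix t assume "t \<in> ?r"
  then obtain r where r: "r \<in> N'" "t = r + \<phi> f g" by (auto simp: r_coset_def)
  have "f \<in> N1 #>\<^bsub>free_Abelian_group S1\<^esub> f" "g \<in> N2 #>\<^bsub>free_Abelian_group S2\<^esub> g"
    using z by (force simp: r_coset_def)+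
  then show "t \<in> ?l" using r by (auto simp: set_mult_def)
qed

lemma frag_extend_zero [simp]: "frag_extend (\<lambda>_. 0) f = 0"
  by (rule frag_extend_eq_0) simp

text \<open>Additive maps on a free abelian group agree if they agree on generators. Differences
  rather than sums appear because the library's induction over formal sums is phrased with
  them.\<close>

lemma frag_ext:
  assumes "Poly_Mapping.keys f \<subseteq> S" and "\<phi> 0 = 0" and "\<psi> 0 = 0"
    and "\<And>a b. \<phi> (a - b) = \<phi> a - \<phi> b" and "\<And>a b. \<psi> (a - b) = \<psi> a - \<psi> b"
    and "\<And>w. w \<in> S \<Longrightarrow> \<phi> (frag_of w) = \<psi> (frag_of w)"
  shows "\<phi> f = \<psi> f"
  using assms(1)
  by (rule free_Abelian_group_induct) (simp_all add: assms)

lemma frag_mem: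
  assumes "Poly_Mapping.keys f \<subseteq> S" and "\<phi> 0 = 0" and "\<And>a b. \<phi> (a - b) = \<phi> a - \<phi> b"
    and "0 \<in> N" and "\<And>a b. a \<in> N \<Longrightarrow> b \<in> N \<Longrightarrow> a - b \<in> N"
    and "\<And>w. w \<in> S \<Longrightarrow> \<phi> (frag_of w) \<in> N"
  shows "\<phi> f \<in> N"
  using assms(1)
  by (rule free_Abelian_group_induct) (simp_all add: assms)

lemma right_mod_simps [simp]:
  "carrier (right_mod U) = carrier U" "\<zero>\<^bsub>right_mod U\<^esub> = \<zero>\<^bsub>U\<^esub>"
  "v \<oplus>\<^bsub>right_mod U\<^esub> w = v \<oplus>\<^bsub>U\<^esub> w" "a \<odot>\<^bsub>right_mod U\<^esub> v = rsmult U v a"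
  by (simp_all add: right_mod_def)

section \<open>The kernel of the tensor product and the components of the tensor algebra\<close>

locale bimodule_seq =
  fixes K :: "int \<Rightarrow> 'k ring" and W :: "int \<Rightarrow> ('k, 'w) bimodule"
  assumes field_K: "field (K n)" and bimodule_W: "bimodule (K n) (K (n + 1)) (W n)"
begin

abbreviation FA where "FA i j \<equiv> free_Abelian_group (words W i j)"
abbreviation Kr where "Kr \<equiv> tensor_kernel K W"
abbreviation rl where "rl \<equiv> tensor_relations K W"

lemma K_cring: "cring (K n)" using field_K[of n] by (simp add: field_def domain_def)
lemma left_mod: "module (K n) (W n)" using bimodule_W bimodule.left_module by blast
lemma right_mod: "module (K (n + 1)) (right_mod (W n))" using bimodule_W bimodule.right_module by blast

lemma W_add [simp, intro]: "v \<in> carrier (W n) \<Longrightarrow> v' \<in> carrier (W n) \<Longrightarrow> v \<oplus>\<^bsub>W n\<^esub> v' \<in> carrier (W n)"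
  using left_mod[of n] by (simp add: module_def abelian_group_def abelian_monoid.a_closed)

lemma W_smult [simp, intro]: "a \<in> carrier (K n) \<Longrightarrow> v \<in> carrier (W n) \<Longrightarrow> a \<odot>\<^bsub>W n\<^esub> v \<in> carrier (W n)"
  using module.smult_closed[OF left_mod[of n]] .

lemma W_rsmult [simp, intro]:
  "b \<in> carrier (K (n + 1)) \<Longrightarrow> v \<in> carrier (W n) \<Longrightarrow> rsmult (W n) v b \<in> carrier (W n)"
  using module.smult_closed[OF right_mod[of n]] by simp

lemma rl_carrier: "f \<in> rl i j \<Longrightarrow> Poly_Mapping.keys f \<subseteq> words W i j"
proof -
  have *: "Poly_Mapping.keys (frag_of a - frag_of b) \<subseteq> words W i j"
    if "a \<in> words W i j" "b \<in> words W i j" for a b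
    using that keys_diff[of "frag_of a" "frag_of b"] by auto
  have **: "Poly_Mapping.keys (frag_of a - frag_of b - frag_of c) \<subseteq> words W i j"
    if "a \<in> words W i j" "b \<in> words W i j" "c \<in> words W i j" for a b c
    using *[OF that(1,2)] that(3) keys_diff[of "frag_of a - frag_of b" "frag_of c"] by auto
  assume "f \<in> rl i j"
  then show ?thesis
    unfolding tensor_relations_def
    by (elim UnE CollectE exE conjE; simp only:; intro * **) auto
qed

lemma Kr_carrier: "f \<in> Kr i j \<Longrightarrow> Poly_Mapping.keys f \<subseteq> words W i j"
proof -
  have "rl i j \<subseteq> carrier (FA i j)" using rl_carrier by force
  from group.generate_in_carrier[OF group_free_Abelian_group this]
  show "f \<in> Kr i j \<Longrightarrow> Poly_Mapping.keys f \<subseteq> words W i j" by (simp add: tensor_kernel_def)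
qed

lemma Kr_subgroup: "subgroup (Kr i j) (FA i j)"
  unfolding tensor_kernel_def
  by (rule group.generate_is_subgroup[OF group_free_Abelian_group]) (auto dest: rl_carrier)

lemma Kr_zero [simp]: "0 \<in> Kr i j"
  using subgroup.one_closed[OF Kr_subgroup] by simp

lemma Kr_add: "f \<in> Kr i j \<Longrightarrow> g \<in> Kr i j \<Longrightarrow> f + g \<in> Kr i j"
  using subgroup.m_closed[OF Kr_subgroup] by fastforce

lemma Kr_neg: "f \<in> Kr i j \<Longrightarrow> - f \<in> Kr i j"
  using subgroup.m_inv_closed[OF Kr_subgroup] Kr_carrier inv_free_Abelian_group by metis

lemma Kr_diff: "f \<in> Kr i j \<Longrightarrow> g \<in> Kr i j \<Longrightarrow> f - g \<in> Kr i j"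
  using Kr_add[OF _ Kr_neg] by fastforce

lemma rl_Kr: "f \<in> rl i j \<Longrightarrow> f \<in> Kr i j"
  unfolding tensor_kernel_def by (rule generate.incl)

lemma Kr_additive:
  assumes "us @ v # ts \<in> words W i j" "us @ v' # ts \<in> words W i j"
  shows "frag_of (us @ (v \<oplus>\<^bsub>W (i + int (length us))\<^esub> v') # ts) - frag_of (us @ v # ts) - frag_of (us @ v' # ts)
    \<in> Kr i j"
  by (rule rl_Kr) (use assms in \<open>simp only: tensor_relations_def, blast\<close>)

lemma Kr_balanced:
  assumes "us @ v # w # ts \<in> words W i j" "b \<in> carrier (K (i + int (length us) + 1))"
  shows "frag_of (us @ rsmult (W (i + int (length us))) v b # w # ts) -
    frag_of (us @ v # (b \<odot>\<^bsub>W (i + int (length us) + 1)\<^esub> w) # ts) \<in> Kr i j"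
  by (rule rl_Kr) (use assms in \<open>simp only: tensor_relations_def, blast\<close>)

text \<open>The kernel is generated as a group, so an additive map carries it into a subgroup as
  soon as it does so for the additivity and the balancing relations. Scaling and concatenation are
  all treated in this way.\<close>

lemma Kr_induct:
  assumes "f \<in> Kr i j" and N: "0 \<in> N" "\<And>a b. a \<in> N \<Longrightarrow> b \<in> N \<Longrightarrow> a + b \<in> N" "\<And>a. a \<in> N \<Longrightarrow> - a \<in> N"
    and \<phi>: "\<phi> 0 = 0" "\<And>a b. \<phi> (a + b) = \<phi> a + \<phi> b" "\<And>a. \<phi> (- a) = - \<phi> a"
    and 1: "\<And>us v v' ts. us @ v # ts \<in> words W i j \<Longrightarrow> us @ v' # ts \<in> words W i j \<Longrightarrow>
      \<phi> (frag_of (us @ (v \<oplus>\<^bsub>W (i + int (length us))\<^esub> v') # ts) - frag_of (us @ v # ts) - frag_of (us @ v' # ts)) \<in> N"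
    and 2: "\<And>us v b w ts. us @ v # w # ts \<in> words W i j \<Longrightarrow> b \<in> carrier (K (i + int (length us) + 1)) \<Longrightarrow>
      \<phi> (frag_of (us @ rsmult (W (i + int (length us))) v b # w # ts) -
        frag_of (us @ v # (b \<odot>\<^bsub>W (i + int (length us) + 1)\<^esub> w) # ts)) \<in> N"
  shows "\<phi> f \<in> N"
proof -
  have rl: "\<phi> f \<in> N" if "f \<in> rl i j" for f
    using that 1 2 unfolding tensor_relations_def by blast
  show ?thesis
    using assms(1) unfolding tensor_kernel_def
  proof (induction rule: generate.induct)
    case (inv h)
    then show ?case using rl[OF inv] N(3) \<phi>(3) rl_carrier[OF inv] by simp
  next
    case (eng h1 h2)
    then show ?case using N(2) \<phi>(2) by simp
  qed (use rl N(1) \<phi>(1) in auto)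
qed

definition ct :: "int \<Rightarrow> int \<Rightarrow> ('w list \<Rightarrow>\<^sub>0 int) \<Rightarrow> ('k, 'w) tensor" where
  "ct i j f = Tensor (Kr i j #>\<^bsub>FA i j\<^esub> f)"

abbreviation T where "T \<equiv> tensor_zalg K W"

lemma zmult_T [simp]: "zmult T = tensor_mult K W" by (simp add: tensor_zalg_def)
lemma zunit_T [simp]: "zunit T i = Scalar \<one>\<^bsub>K i\<^esub>" by (simp add: tensor_zalg_def)

lemma Kr_normal: "normal (Kr i j) (FA i j)"
  by (rule comm_group.subgroup_imp_normal[OF abelian_free_Abelian_group Kr_subgroup])

lemma comp_diag [simp]:
  "carrier (component T i i) = Scalar ` carrier (K i)"
  "Scalar a \<otimes>\<^bsub>component T i i\<^esub> Scalar b = Scalar (a \<oplus>\<^bsub>K i\<^esub> b)"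
  "\<one>\<^bsub>component T i i\<^esub> = Scalar \<zero>\<^bsub>K i\<^esub>"
  by (simp_all add: tensor_zalg_def tensor_component_def)

lemma comp_off:
  assumes "i \<noteq> j"
  shows "carrier (component T i j) = ct i j ` carrier (FA i j)"
    "\<one>\<^bsub>component T i j\<^esub> = ct i j 0"
    "Poly_Mapping.keys f \<subseteq> words W i j \<Longrightarrow> Poly_Mapping.keys g \<subseteq> words W i j \<Longrightarrow>
      ct i j f \<otimes>\<^bsub>component T i j\<^esub> ct i j g = ct i j (f + g)"
proof -
  show "carrier (component T i j) = ct i j ` carrier (FA i j)"
    using assms by (auto simp: tensor_zalg_def tensor_component_def Let_def FactGroup_def RCOSETS_def ct_def)
  have "Kr i j #>\<^bsub>FA i j\<^esub> 0 = Kr i j" by (auto simp: r_coset_def)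
  then show "\<one>\<^bsub>component T i j\<^esub> = ct i j 0"
    using assms by (simp add: tensor_zalg_def tensor_component_def Let_def FactGroup_def ct_def)
  show "ct i j f \<otimes>\<^bsub>component T i j\<^esub> ct i j g = ct i j (f + g)"
    if "Poly_Mapping.keys f \<subseteq> words W i j" "Poly_Mapping.keys g \<subseteq> words W i j"
    using assms that normal.rcos_sum[OF Kr_normal, of f i j g]
    by (simp add: tensor_zalg_def tensor_component_def Let_def FactGroup_def ct_def)
qed

lemma ct_eq_iff: "ct i j f = ct i j g \<longleftrightarrow> f - g \<in> Kr i j"
proof
  assume "ct i j f = ct i j g"
  then have eq: "Kr i j #>\<^bsub>FA i j\<^esub> f = Kr i j #>\<^bsub>FA i j\<^esub> g" by (simp add: ct_def)
  have "f \<in> Kr i j #>\<^bsub>FA i j\<^esub> f" by (force simp: r_coset_def)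
  then show "f - g \<in> Kr i j" unfolding eq by (auto simp: r_coset_def)
next
  have *: "Kr i j #>\<^bsub>FA i j\<^esub> f \<subseteq> Kr i j #>\<^bsub>FA i j\<^esub> g" if "f - g \<in> Kr i j" for f g
  proof
    fix t assume "t \<in> Kr i j #>\<^bsub>FA i j\<^esub> f"
    then obtain r where r: "r \<in> Kr i j" "t = r + f" by (auto simp: r_coset_def)
    then have "t = (r + (f - g)) + g" by simp
    then show "t \<in> Kr i j #>\<^bsub>FA i j\<^esub> g"
      using Kr_add[OF r(1) that] unfolding r_coset_def mult_free_Abelian_group by blast
  qed
  assume "f - g \<in> Kr i j"
  then show "ct i j f = ct i j g" using *[of f g] *[of g f] Kr_neg[of "f - g" i j] by (auto simp: ct_def)
qed

section \<open>Left scaling, right scaling and concatenation on the free group\<close>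

abbreviation sf where "sf i a \<equiv> frag_extend (\<lambda>ws. frag_of (scale_first (W i) a ws))"
abbreviation sl where "sl l b \<equiv> frag_extend (\<lambda>ws. frag_of (scale_last (W (l - 1)) ws b))"
abbreviation cc where "cc \<equiv> \<lambda>f g. frag_extend (\<lambda>us. frag_extend (\<lambda>ws. frag_of (us @ ws)) g) f"

lemma sf_word:
  assumes "ws \<in> words W i l" "i < l" "a \<in> carrier (K i)"
  shows "scale_first (W i) a ws \<in> words W i l"
  using assms by (cases ws) auto

lemma sl_word:
  assumes "ws \<in> words W i l" "i < l" "b \<in> carrier (K l)"
  shows "scale_last (W (l - 1)) ws b \<in> words W i l"
proof -
  have "ws \<in> words W i ((l - 1) + 1)" "i \<le> l - 1" using assms by auto
  then obtain us v where *: "ws = us @ [v]" "us \<in> words W i (l - 1)" "v \<in> carrier (W (l - 1))"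
    by (rule words_snoc_ex)
  then have "l - 1 = i + int (length us)" using words_length by blast
  then show ?thesis using * assms(3) W_rsmult[of b "l - 1" v] by (simp add: algebra_simps)
qed

lemma keys_extend:
  assumes "Poly_Mapping.keys f \<subseteq> S" "\<And>w. w \<in> S \<Longrightarrow> F w \<in> S'"
  shows "Poly_Mapping.keys (frag_extend (\<lambda>w. frag_of (F w)) f) \<subseteq> S'"
  using keys_frag_extend[of "\<lambda>w. frag_of (F w)" f] assms by auto

lemma sf_carrier:
  "Poly_Mapping.keys g \<subseteq> words W i l \<Longrightarrow> i \<noteq> l \<Longrightarrow> a \<in> carrier (K i) \<Longrightarrow>
    Poly_Mapping.keys (sf i a g) \<subseteq> words W i l"
  using words_le by (intro keys_extend[of g "words W i l"] sf_word) (auto simp: le_less)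

lemma sl_carrier:
  "Poly_Mapping.keys g \<subseteq> words W i l \<Longrightarrow> i \<noteq> l \<Longrightarrow> b \<in> carrier (K l) \<Longrightarrow>
    Poly_Mapping.keys (sl l b g) \<subseteq> words W i l"
  using words_le by (intro keys_extend[of g "words W i l"] sl_word) (auto simp: le_less)

lemma cc_carrier:
  assumes "Poly_Mapping.keys f \<subseteq> words W i j" "Poly_Mapping.keys g \<subseteq> words W j l"
  shows "Poly_Mapping.keys (cc f g) \<subseteq> words W i l"
proof -
  have "Poly_Mapping.keys (frag_extend (\<lambda>ws. frag_of (us @ ws)) g) \<subseteq> words W i l" if "us \<in> Poly_Mapping.keys f" for us
  proof (rule keys_extend[OF assms(2)])
    fix ws assume "ws \<in> words W j l"
    moreover have "us \<in> words W i j" using that assms(1) by auto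
    ultimately show "us @ ws \<in> words W i l" using words_length[of us W i j] by auto
  qed
  then show ?thesis using keys_frag_extend[of "\<lambda>us. frag_extend (\<lambda>ws. frag_of (us @ ws)) g" f] by blast
qed

text \<open>A relation is carried to a relation. If the scaled letter is itself the one that is
  split or balanced, this rests on distributivity or on \<open>(a v) b = a (v b)\<close>; otherwise
  the scaled letter is a mere spectator.\<close>

lemma sf_Kr:
  assumes f: "f \<in> Kr i l" and a: "a \<in> carrier (K i)"
  shows "sf i a f \<in> Kr i l"
proof (rule Kr_induct[OF f Kr_zero Kr_add Kr_neg, where \<phi> = "sf i a"])
  fix us v v' ts assume *: "us @ v # ts \<in> words W i l" "us @ v' # ts \<in> words W i l"
  show "sf i a (frag_of (us @ (v \<oplus>\<^bsub>W (i + int (length us))\<^esub> v') # ts) - frag_of (us @ v # ts) - frag_of (us @ v' # ts))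
    \<in> Kr i l"
  proof (cases us)
    case Nil
    then show ?thesis using * a Kr_additive[of "[]" "a \<odot>\<^bsub>W i\<^esub> v" ts i l "a \<odot>\<^bsub>W i\<^esub> v'"]
      by (simp add: frag_extend_diff module.smult_r_distr[OF left_mod])
  next
    case (Cons u us')
    then show ?thesis using * a Kr_additive[of "(a \<odot>\<^bsub>W i\<^esub> u) # us'" v ts i l v']
      by (simp add: frag_extend_diff)
  qed
next
  fix us v b w ts assume *: "us @ v # w # ts \<in> words W i l" "b \<in> carrier (K (i + int (length us) + 1))"
  show "sf i a (frag_of (us @ rsmult (W (i + int (length us))) v b # w # ts) -
        frag_of (us @ v # (b \<odot>\<^bsub>W (i + int (length us) + 1)\<^esub> w) # ts)) \<in> Kr i l"
  proof (cases us)
    case Nil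
    then show ?thesis using * a Kr_balanced[of "[]" "a \<odot>\<^bsub>W i\<^esub> v" w ts i l b]
      by (simp add: frag_extend_diff bimodule.smult_rsmult[OF bimodule_W])
  next
    case (Cons u us')
    then show ?thesis using * a Kr_balanced[of "(a \<odot>\<^bsub>W i\<^esub> u) # us'" v w ts i l b]
      by (simp add: frag_extend_diff)
  qed
qed (simp_all add: frag_extend_add frag_extend_minus)

lemma sl_Kr:
  assumes f: "f \<in> Kr i l" and b: "b \<in> carrier (K l)"
  shows "sl l b f \<in> Kr i l"
proof (rule Kr_induct[OF f Kr_zero Kr_add Kr_neg, where \<phi> = "sl l b"])
  fix us v v' ts assume *: "us @ v # ts \<in> words W i l" "us @ v' # ts \<in> words W i l"
  show "sl l b (frag_of (us @ (v \<oplus>\<^bsub>W (i + int (length us))\<^esub> v') # ts) - frag_of (us @ v # ts) - frag_of (us @ v' # ts))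
    \<in> Kr i l"
  proof (cases ts rule: rev_cases)
    case Nil
    then have l: "l - 1 = i + int (length us)" "l = i + int (length us) + 1" using words_length[OF *(1)] by auto
    then show ?thesis using * Nil b Kr_additive[of us "rsmult (W (l - 1)) v b" "[]" i l "rsmult (W (l - 1)) v' b"]
        module.smult_r_distr[OF right_mod[of "l - 1"], of b v v'] W_rsmult[of b "l - 1"]
      by (simp add: frag_extend_diff)
  next
    case (snoc ts' t)
    then have t: "l - 1 = i + int (length us) + 1 + int (length ts')" using words_length[OF *(1)] by auto
    have sl: "scale_last (W (l - 1)) (us @ z # ts) b = us @ z # (ts' @ [rsmult (W (l - 1)) t b])" for z
      using snoc scale_last_snoc[of "W (l - 1)" "us @ z # ts'" t b] by simp
    have "us @ z # ts' @ [rsmult (W (l - 1)) t b] \<in> words W i l" if "us @ z # ts \<in> words W i l" for z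
      using sl_word[OF that _ b] sl[of z] words_length[OF that] by simp
    then show ?thesis using * Kr_additive[of us v "ts' @ [rsmult (W (l - 1)) t b]" i l v']
      by (simp add: frag_extend_diff sl)
  qed
next
  fix us v c w ts assume *: "us @ v # w # ts \<in> words W i l" "c \<in> carrier (K (i + int (length us) + 1))"
  show "sl l b (frag_of (us @ rsmult (W (i + int (length us))) v c # w # ts) -
        frag_of (us @ v # (c \<odot>\<^bsub>W (i + int (length us) + 1)\<^esub> w) # ts)) \<in> Kr i l"
  proof (cases ts rule: rev_cases)
    case Nil
    then have l: "l - 1 = i + int (length us) + 1" using words_length[OF *(1)] by auto
    have sl: "scale_last (W (l - 1)) (us @ z # [z']) b = us @ z # [rsmult (W (l - 1)) z' b]" for z z'
      using scale_last_snoc[of "W (l - 1)" "us @ [z]" z' b] by simp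
    have lw: "W (i + int (length us) + 1) = W (l - 1)" unfolding l ..
    have w: "w \<in> carrier (W (l - 1))" "c \<in> carrier (K (l - 1))" unfolding l using *(1,2) by simp_all
    \<comment> \<open>The scaled last letter is the right member of the balanced pair, so the two
      actions on it have to commute.\<close>
    have "rsmult (W (l - 1)) (c \<odot>\<^bsub>W (l - 1)\<^esub> w) b = c \<odot>\<^bsub>W (l - 1)\<^esub> rsmult (W (l - 1)) w b"
      using bimodule.smult_rsmult[OF bimodule_W[of "l - 1"]] w b by simp
    moreover have "us @ v # [rsmult (W (l - 1)) w b] \<in> words W i l"
      using sl_word[OF *(1) _ b] sl[of v w] words_length[OF *(1)] Nil by simp
    ultimately show ?thesis using Nil * Kr_balanced[of us v "rsmult (W (l - 1)) w b" "[]" i l c]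
      by (simp add: frag_extend_diff sl lw)
  next
    case (snoc ts' t)
    have sl: "scale_last (W (l - 1)) (us @ z # z' # ts) b = us @ z # z' # (ts' @ [rsmult (W (l - 1)) t b])" for z z'
      using snoc scale_last_snoc[of "W (l - 1)" "us @ z # z' # ts'" t b] by simp
    have "us @ v # w # ts' @ [rsmult (W (l - 1)) t b] \<in> words W i l"
      using sl_word[OF *(1) _ b] sl[of v w] words_length[OF *(1)] by simp
    then show ?thesis using * Kr_balanced[of us v w "ts' @ [rsmult (W (l - 1)) t b]" i l c]
      by (simp add: frag_extend_diff sl)
  qed
qed (simp_all add: frag_extend_add frag_extend_minus)

lemma cc_add [simp]: "cc (f + f') g = cc f g + cc f' g" "cc f (g + g') = cc f g + cc f g'"
proof -
  show "cc (f + f') g = cc f g + cc f' g" by (simp add: frag_extend_add)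
  have "cc f (g + g') = cc f g + cc f g'"
    by (rule frag_ext[where S = UNIV and \<phi> = "\<lambda>f. cc f (g + g')" and \<psi> = "\<lambda>f. cc f g + cc f g'"])
      (simp_all add: frag_extend_add frag_extend_diff)
  then show "cc f (g + g') = cc f g + cc f g'" .
qed

lemma cc_minus [simp]: "cc (- f) g = - cc f g" "cc f (- g) = - cc f g"
proof -
  show "cc (- f) g = - cc f g" by (simp add: frag_extend_minus)
  have "cc f g + cc f (- g) = cc f (g + (- g))" by (simp only: cc_add)
  also have "\<dots> = 0" by (simp add: frag_extend_eq_0)
  finally show "cc f (- g) = - cc f g" by (metis add_eq_0_iff)
qed

lemma cc_diff [simp]: "cc (f - f') g = cc f g - cc f' g" "cc f (g - g') = cc f g - cc f g'"
proof -
  show "cc (f - f') g = cc f g - cc f' g" by (simp add: frag_extend_diff)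
  show "cc f (g - g') = cc f g - cc f g'"
    using cc_add(2)[where f = f and g = g and g' = "- g'"] unfolding cc_minus(2) by (simp only: add_uminus_conv_diff)
qed

lemma cc_Kr_left:
  assumes f: "f \<in> Kr i j" and g: "Poly_Mapping.keys g \<subseteq> words W j l"
  shows "cc f g \<in> Kr i l"
proof (rule frag_mem[OF g, where \<phi> = "cc f"])
  fix ws assume ws: "ws \<in> words W j l"
  show "cc f (frag_of ws) \<in> Kr i l"
  proof (rule Kr_induct[OF f Kr_zero Kr_add Kr_neg, where \<phi> = "\<lambda>f. cc f (frag_of ws)"])
    fix us v v' ts assume *: "us @ v # ts \<in> words W i j" "us @ v' # ts \<in> words W i j"
    then have "j = i + int (length us) + 1 + int (length ts)" using words_length[OF *(1)] by simp
    then show "cc (frag_of (us @ (v \<oplus>\<^bsub>W (i + int (length us))\<^esub> v') # ts) - frag_of (us @ v # ts) - frag_of (us @ v' # ts))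
      (frag_of ws) \<in> Kr i l"
      using * ws Kr_additive[of us v "ts @ ws" i l v'] by (simp add: frag_extend_diff)
  next
    fix us v c w ts assume *: "us @ v # w # ts \<in> words W i j" "c \<in> carrier (K (i + int (length us) + 1))"
    then have "j = i + int (length us) + 2 + int (length ts)" using words_length[OF *(1)] by simp
    then show "cc (frag_of (us @ rsmult (W (i + int (length us))) v c # w # ts) -
        frag_of (us @ v # (c \<odot>\<^bsub>W (i + int (length us) + 1)\<^esub> w) # ts)) (frag_of ws) \<in> Kr i l"
      using * ws Kr_balanced[of us v w "ts @ ws" i l c] by (simp add: frag_extend_diff add.assoc)
  qed (simp_all add: frag_extend_add frag_extend_minus)
qed (simp_all add: Kr_diff)

lemma cc_Kr_right:
  assumes f: "Poly_Mapping.keys f \<subseteq> words W i j" and g: "g \<in> Kr j l"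
  shows "cc f g \<in> Kr i l"
proof (rule frag_mem[OF f, where \<phi> = "\<lambda>f. cc f g"])
  fix ps assume ps: "ps \<in> words W i j"
  have j: "j = i + int (length ps)" using words_length[OF ps] .
  show "cc (frag_of ps) g \<in> Kr i l"
  proof (rule Kr_induct[OF g Kr_zero Kr_add Kr_neg, where \<phi> = "\<lambda>g. cc (frag_of ps) g"])
    fix us v v' ts assume *: "us @ v # ts \<in> words W j l" "us @ v' # ts \<in> words W j l"
    then show "cc (frag_of ps) (frag_of (us @ (v \<oplus>\<^bsub>W (j + int (length us))\<^esub> v') # ts) - frag_of (us @ v # ts) - frag_of (us @ v' # ts))
      \<in> Kr i l"
      using ps Kr_additive[of "ps @ us" v "ts" i l v'] by (simp add: frag_extend_diff j add.assoc)
  next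
    fix us v c w ts assume *: "us @ v # w # ts \<in> words W j l" "c \<in> carrier (K (j + int (length us) + 1))"
    then show "cc (frag_of ps) (frag_of (us @ rsmult (W (j + int (length us))) v c # w # ts) -
        frag_of (us @ v # (c \<odot>\<^bsub>W (j + int (length us) + 1)\<^esub> w) # ts)) \<in> Kr i l"
      using ps Kr_balanced[of "ps @ us" v w "ts" i l c] by (simp add: frag_extend_diff j add.assoc)
  qed (simp_all add: frag_extend_add frag_extend_minus)
qed (simp_all add: Kr_diff)

lemma mult_scalar_ct:
  assumes "a \<in> carrier (K i)"
  shows "tensor_mult K W i j l (Scalar a) (ct i l g) = ct i l (sf i a g)"
proof -
  have "Kr i l <#>\<^bsub>FA i l\<^esub> {sf i a g' | g'. g' \<in> Kr i l #>\<^bsub>FA i l\<^esub> g} = Kr i l #>\<^bsub>FA i l\<^esub> sf i a g"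
    by (rule set_mult_coset_image) (use assms in \<open>auto simp: frag_extend_add sf_Kr Kr_add\<close>)
  then show ?thesis by (simp add: ct_def)
qed

lemma mult_ct_scalar:
  assumes "b \<in> carrier (K l)"
  shows "tensor_mult K W i j l (ct i l g) (Scalar b) = ct i l (sl l b g)"
proof -
  have "Kr i l <#>\<^bsub>FA i l\<^esub> {sl l b g' | g'. g' \<in> Kr i l #>\<^bsub>FA i l\<^esub> g} = Kr i l #>\<^bsub>FA i l\<^esub> sl l b g"
    by (rule set_mult_coset_image) (use assms in \<open>auto simp: frag_extend_add sl_Kr Kr_add\<close>)
  then show ?thesis by (simp add: ct_def)
qed

lemma mult_ct_ct:
  assumes "i \<noteq> l" "Poly_Mapping.keys f \<subseteq> words W i j" "Poly_Mapping.keys g \<subseteq> words W j l"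
  shows "tensor_mult K W i j l (ct i j f) (ct j l g) = ct i l (cc f g)"
proof -
  have "Kr i l <#>\<^bsub>FA i l\<^esub> {cc f' g' | f' g'. f' \<in> Kr i j #>\<^bsub>FA i j\<^esub> f \<and> g' \<in> Kr j l #>\<^bsub>FA j l\<^esub> g} =
      Kr i l #>\<^bsub>FA i l\<^esub> cc f g"
    by (rule set_mult_coset_image2)
      (use assms in \<open>auto simp del: frag_extend_0 intro: cc_Kr_left cc_Kr_right Kr_add dest: Kr_carrier\<close>)
  then show ?thesis using assms(1) by (simp add: ct_def)
qed

lemma K_closed [simp, intro]:
  "a \<in> carrier (K n) \<Longrightarrow> b \<in> carrier (K n) \<Longrightarrow> a \<oplus>\<^bsub>K n\<^esub> b \<in> carrier (K n)"
  "a \<in> carrier (K n) \<Longrightarrow> b \<in> carrier (K n) \<Longrightarrow> a \<otimes>\<^bsub>K n\<^esub> b \<in> carrier (K n)"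
  "\<zero>\<^bsub>K n\<^esub> \<in> carrier (K n)" "\<one>\<^bsub>K n\<^esub> \<in> carrier (K n)"
  by (simp_all add: cring.cring_simprules[OF K_cring])

lemma K_neutral [simp]:
  "a \<in> carrier (K n) \<Longrightarrow> \<zero>\<^bsub>K n\<^esub> \<oplus>\<^bsub>K n\<^esub> a = a" "a \<in> carrier (K n) \<Longrightarrow> a \<oplus>\<^bsub>K n\<^esub> \<zero>\<^bsub>K n\<^esub> = a"
  "a \<in> carrier (K n) \<Longrightarrow> \<one>\<^bsub>K n\<^esub> \<otimes>\<^bsub>K n\<^esub> a = a" "a \<in> carrier (K n) \<Longrightarrow> a \<otimes>\<^bsub>K n\<^esub> \<one>\<^bsub>K n\<^esub> = a"
  "a \<in> carrier (K n) \<Longrightarrow> \<zero>\<^bsub>K n\<^esub> \<otimes>\<^bsub>K n\<^esub> a = \<zero>\<^bsub>K n\<^esub>" "a \<in> carrier (K n) \<Longrightarrow> a \<otimes>\<^bsub>K n\<^esub> \<zero>\<^bsub>K n\<^esub> = \<zero>\<^bsub>K n\<^esub>"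
proof -
  interpret R: cring "K n" by (rule K_cring)
  assume "a \<in> carrier (K n)"
  then show "\<zero>\<^bsub>K n\<^esub> \<oplus>\<^bsub>K n\<^esub> a = a" "a \<oplus>\<^bsub>K n\<^esub> \<zero>\<^bsub>K n\<^esub> = a"
    "\<one>\<^bsub>K n\<^esub> \<otimes>\<^bsub>K n\<^esub> a = a" "a \<otimes>\<^bsub>K n\<^esub> \<one>\<^bsub>K n\<^esub> = a" "\<zero>\<^bsub>K n\<^esub> \<otimes>\<^bsub>K n\<^esub> a = \<zero>\<^bsub>K n\<^esub>"
    "a \<otimes>\<^bsub>K n\<^esub> \<zero>\<^bsub>K n\<^esub> = \<zero>\<^bsub>K n\<^esub>"
    by simp_all
qed

lemmas K_simps = cring.cring_simprules[OF K_cring]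

section \<open>The axioms of an indexed algebra for the tensor algebra\<close>

lemma T_cases:
  assumes "t \<in> carrier (component T i j)"
  obtains (diag) a where "i = j" "a \<in> carrier (K i)" "t = Scalar a"
  | (off) f where "i \<noteq> j" "Poly_Mapping.keys f \<subseteq> words W i j" "t = ct i j f"
  using assms comp_off(1)[of i j] by (cases "i = j") auto

lemma ct_closed [simp]:
  "i \<noteq> j \<Longrightarrow> Poly_Mapping.keys f \<subseteq> words W i j \<Longrightarrow> ct i j f \<in> carrier (component T i j)"
  by (simp add: comp_off)

lemma below_trivial:
  assumes "j < i" "t \<in> carrier (component T i j)"
  shows "t = \<one>\<^bsub>component T i j\<^esub>"
  using assms(2)
proof (cases rule: T_cases)
  case (off f)
  have "words W i j = {}" using words_le[of _ W i j] assms(1) by fastforce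
  then have "f = 0" using off(2) by (metis keys_eq_empty subset_empty)
  then show ?thesis using off comp_off(2) by simp
qed (use assms in simp)

lemma keys_plus: "Poly_Mapping.keys f \<subseteq> S \<Longrightarrow> Poly_Mapping.keys g \<subseteq> S \<Longrightarrow> Poly_Mapping.keys (f + g) \<subseteq> S"
  using keys_add[of f g] by blast

lemma comm_group_T: "comm_group (component T i j)"
proof (cases "i = j")
  case True
  interpret R: cring "K i" by (rule K_cring)
  show ?thesis unfolding True[symmetric]
  proof (rule comm_groupI)
    fix t assume "t \<in> carrier (component T i i)"
    then obtain a where "a \<in> carrier (K i)" "t = Scalar a" by auto
    then show "\<exists>u\<in>carrier (component T i i). u \<otimes>\<^bsub>component T i i\<^esub> t = \<one>\<^bsub>component T i i\<^esub>"
      by (intro bexI[of _ "Scalar (\<ominus>\<^bsub>K i\<^esub> a)"]) (auto simp: R.l_neg)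
  qed (auto simp: R.a_ac)
next
  case False
  show ?thesis
  proof (rule comm_groupI)
    fix t assume "t \<in> carrier (component T i j)"
    then obtain f where "Poly_Mapping.keys f \<subseteq> words W i j" "t = ct i j f"
      using False by (auto simp: comp_off)
    then show "\<exists>u\<in>carrier (component T i j). u \<otimes>\<^bsub>component T i j\<^esub> t = \<one>\<^bsub>component T i j\<^esub>"
      using False by (intro bexI[of _ "ct i j (- f)"]) (simp_all add: comp_off)
  qed (use False in \<open>auto simp: comp_off keys_plus add_ac\<close>)
qed

lemma mult_ct_ct_same [simp]: "tensor_mult K W i j i (ct i j f) (ct j i g) = Scalar \<zero>\<^bsub>K i\<^esub>"
  by (simp add: ct_def)

lemma T_mult_closed:
  assumes t: "t \<in> carrier (component T i j)" and u: "u \<in> carrier (component T j l)"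
  shows "zmult T i j l t u \<in> carrier (component T i l)"
  using t
proof (cases rule: T_cases)
  case t: (diag a)
  from u show ?thesis
    by (cases rule: T_cases) (use t in \<open>auto simp: mult_scalar_ct sf_carrier\<close>)
next
  case t: (off f)
  from u show ?thesis
  proof (cases rule: T_cases)
    case (off g)
    then show ?thesis using t by (cases "i = l") (auto simp: mult_ct_ct cc_carrier)
  qed (use t in \<open>auto simp: mult_ct_scalar sl_carrier\<close>)
qed

text \<open>In the free group the word starting with \<open>(a + a') v\<close> is a new generator,
  so additivity in the scalar holds only modulo the kernel.\<close>

lemma sf_add_scalar:
  assumes "Poly_Mapping.keys g \<subseteq> words W i l" "i \<noteq> l" "a \<in> carrier (K i)" "a' \<in> carrier (K i)"
  shows "sf i (a \<oplus>\<^bsub>K i\<^esub> a') g - (sf i a g + sf i a' g) \<in> Kr i l"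
proof (rule frag_mem[OF assms(1), where \<phi> = "\<lambda>g. sf i (a \<oplus>\<^bsub>K i\<^esub> a') g - (sf i a g + sf i a' g)"])
  fix ws assume ws: "ws \<in> words W i l"
  have "i < l" using words_le[OF ws] assms(2) by simp
  then obtain v ts where "ws = v # ts" "ts \<in> words W (i + 1) l" "v \<in> carrier (W i)"
    by (rule words_cons_ex[OF ws])
  then show "sf i (a \<oplus>\<^bsub>K i\<^esub> a') (frag_of ws) - (sf i a (frag_of ws) + sf i a' (frag_of ws)) \<in> Kr i l"
    using Kr_additive[of "[]" "a \<odot>\<^bsub>W i\<^esub> v" ts i l "a' \<odot>\<^bsub>W i\<^esub> v"] assms(3,4)
    by (simp add: module.smult_l_distr[OF left_mod] diff_diff_eq)
qed (simp_all add: frag_extend_diff Kr_diff)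

lemma sl_add_scalar:
  assumes "Poly_Mapping.keys g \<subseteq> words W i l" "i \<noteq> l" "b \<in> carrier (K l)" "b' \<in> carrier (K l)"
  shows "sl l (b \<oplus>\<^bsub>K l\<^esub> b') g - (sl l b g + sl l b' g) \<in> Kr i l"
proof (rule frag_mem[OF assms(1), where \<phi> = "\<lambda>g. sl l (b \<oplus>\<^bsub>K l\<^esub> b') g - (sl l b g + sl l b' g)"])
  fix ws assume ws: "ws \<in> words W i l"
  have "ws \<in> words W i ((l - 1) + 1)" "i \<le> l - 1" using ws words_le[OF ws] assms(2) by auto
  then obtain us v where *: "ws = us @ [v]" "us \<in> words W i (l - 1)" "v \<in> carrier (W (l - 1))"
    by (rule words_snoc_ex)
  have l: "l - 1 = i + int (length us)" "l = i + int (length us) + 1" using words_length[OF *(2)] by auto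
  have rd: "rsmult (W (l - 1)) v (b \<oplus>\<^bsub>K l\<^esub> b') = rsmult (W (l - 1)) v b \<oplus>\<^bsub>W (l - 1)\<^esub> rsmult (W (l - 1)) v b'"
    using module.smult_l_distr[OF right_mod[of "l - 1"], of b b' v] *(3) assms(3,4) by simp
  have "rsmult (W (l - 1)) v b \<in> carrier (W (l - 1))" "rsmult (W (l - 1)) v b' \<in> carrier (W (l - 1))"
    using W_rsmult[of _ "l - 1" v] *(3) assms(3,4) by simp_all
  then show "sl l (b \<oplus>\<^bsub>K l\<^esub> b') (frag_of ws) - (sl l b (frag_of ws) + sl l b' (frag_of ws)) \<in> Kr i l"
    using Kr_additive[of us "rsmult (W (l - 1)) v b" "[]" i l "rsmult (W (l - 1)) v b'"] *(1,2)
    by (simp add: rd diff_diff_eq l(1)[symmetric])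
qed (simp_all add: frag_extend_diff Kr_diff)

lemma T_mult_add_left:
  assumes t: "t \<in> carrier (component T i j)" and t': "t' \<in> carrier (component T i j)"
    and u: "u \<in> carrier (component T j l)"
  shows "zmult T i j l (t \<otimes>\<^bsub>component T i j\<^esub> t') u =
    zmult T i j l t u \<otimes>\<^bsub>component T i l\<^esub> zmult T i j l t' u"
  using t
proof (cases rule: T_cases)
  case t: (diag a)
  from t' t obtain a' where a': "a' \<in> carrier (K i)" "t' = Scalar a'" by auto
  from u show ?thesis
  proof (cases rule: T_cases)
    case (off g)
    then show ?thesis using t a' ct_eq_iff[of i l "sf i (a \<oplus>\<^bsub>K i\<^esub> a') g" "sf i a g + sf i a' g"]
      by (auto simp: mult_scalar_ct sf_carrier comp_off sf_add_scalar)
  qed (use t a' in \<open>auto simp: K_simps\<close>)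
next
  case t: (off f)
  from t' t obtain f' where f': "Poly_Mapping.keys f' \<subseteq> words W i j" "t' = ct i j f'"
    by (auto simp: comp_off)
  from u show ?thesis
  proof (cases rule: T_cases)
    case (off g)
    then show ?thesis using t f'
      by (cases "i = l") (auto simp: mult_ct_ct cc_carrier comp_off keys_plus)
  qed (use t f' in \<open>auto simp: mult_ct_scalar sl_carrier comp_off frag_extend_add\<close>)
qed

lemma T_mult_add_right:
  assumes t: "t \<in> carrier (component T i j)" and u: "u \<in> carrier (component T j l)"
    and u': "u' \<in> carrier (component T j l)"
  shows "zmult T i j l t (u \<otimes>\<^bsub>component T j l\<^esub> u') =
    zmult T i j l t u \<otimes>\<^bsub>component T i l\<^esub> zmult T i j l t u'"
  using u
proof (cases rule: T_cases)
  case u: (diag b)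
  from u' u obtain b' where b': "b' \<in> carrier (K j)" "u' = Scalar b'" by auto
  from t show ?thesis
  proof (cases rule: T_cases)
    case (off f)
    then show ?thesis using u b' ct_eq_iff[of i l "sl l (b \<oplus>\<^bsub>K l\<^esub> b') f" "sl l b f + sl l b' f"]
      by (auto simp: mult_ct_scalar sl_carrier comp_off sl_add_scalar)
  qed (use u b' in \<open>auto simp: K_simps\<close>)
next
  case u: (off g)
  from u' u obtain g' where g': "Poly_Mapping.keys g' \<subseteq> words W j l" "u' = ct j l g'"
    by (auto simp: comp_off)
  from t show ?thesis
  proof (cases rule: T_cases)
    case (off f)
    then show ?thesis using u g'
      by (cases "i = l") (auto simp: mult_ct_ct cc_carrier comp_off keys_plus)
  qed (use u g' in \<open>auto simp: mult_scalar_ct sf_carrier comp_off frag_extend_add\<close>)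
qed

lemma T_mult_one:
  "u \<in> carrier (component T j l) \<Longrightarrow> zmult T i j l \<one>\<^bsub>component T i j\<^esub> u = \<one>\<^bsub>component T i l\<^esub>"
  "t \<in> carrier (component T i j) \<Longrightarrow> zmult T i j l t \<one>\<^bsub>component T j l\<^esub> = \<one>\<^bsub>component T i l\<^esub>"
proof -
  interpret A: comm_group "component T i j" by (rule comm_group_T)
  interpret B: comm_group "component T j l" by (rule comm_group_T)
  interpret C: comm_group "component T i l" by (rule comm_group_T)
  show "zmult T i j l \<one>\<^bsub>component T i j\<^esub> u = \<one>\<^bsub>component T i l\<^esub>" if "u \<in> carrier (component T j l)"
    using T_mult_add_left[OF A.one_closed A.one_closed that] T_mult_closed[OF A.one_closed that] by simp
  show "zmult T i j l t \<one>\<^bsub>component T j l\<^esub> = \<one>\<^bsub>component T i l\<^esub>" if "t \<in> carrier (component T i j)"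
    using T_mult_add_right[OF that B.one_closed B.one_closed] T_mult_closed[OF that B.one_closed] by simp
qed

text \<open>In contrast to additivity in the scalar, this holds already in the free group, since
  both sides send a word to a single word. The next compatibilities are of the same kind.\<close>

lemma sf_sf:
  assumes "Poly_Mapping.keys h \<subseteq> words W i m" "i \<noteq> m" "a \<in> carrier (K i)" "b \<in> carrier (K i)"
  shows "sf i (a \<otimes>\<^bsub>K i\<^esub> b) h = sf i a (sf i b h)"
proof (rule frag_ext[OF assms(1), where \<phi> = "sf i (a \<otimes>\<^bsub>K i\<^esub> b)" and \<psi> = "\<lambda>h. sf i a (sf i b h)"])
  fix ws assume "ws \<in> words W i m"
  then show "sf i (a \<otimes>\<^bsub>K i\<^esub> b) (frag_of ws) = sf i a (sf i b (frag_of ws))"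
    using assms(2-4) by (cases ws) (auto simp: module.smult_assoc1[OF left_mod])
qed (simp_all add: frag_extend_diff)

lemma words_snoc:
  assumes ws: "ws \<in> words W i l" and "i \<noteq> l"
  obtains us v where "ws = us @ [v]" "us \<in> words W i (l - 1)" "v \<in> carrier (W (l - 1))"
proof -
  have "ws \<in> words W i ((l - 1) + 1)" "i \<le> l - 1" using ws words_le[OF ws] assms(2) by auto
  then show ?thesis using that by (rule words_snoc_ex)
qed

lemma sl_sl:
  assumes "Poly_Mapping.keys f \<subseteq> words W i l" "i \<noteq> l" "b \<in> carrier (K l)" "c \<in> carrier (K l)"
  shows "sl l c (sl l b f) = sl l (b \<otimes>\<^bsub>K l\<^esub> c) f"
proof (rule frag_ext[OF assms(1), where \<phi> = "\<lambda>f. sl l c (sl l b f)" and \<psi> = "sl l (b \<otimes>\<^bsub>K l\<^esub> c)"])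
  fix ws assume "ws \<in> words W i l"
  then obtain us v where "ws = us @ [v]" "us \<in> words W i (l - 1)" "v \<in> carrier (W (l - 1))"
    using words_snoc assms(2) by blast
  then show "sl l c (sl l b (frag_of ws)) = sl l (b \<otimes>\<^bsub>K l\<^esub> c) (frag_of ws)"
    using module.smult_assoc1[OF right_mod[of "l - 1"], of c b v] assms(3,4) by (simp add: K_simps(14))
qed (simp_all add: frag_extend_diff)

lemma sl_sf:
  assumes "Poly_Mapping.keys f \<subseteq> words W i l" "i \<noteq> l" "a \<in> carrier (K i)" "c \<in> carrier (K l)"
  shows "sl l c (sf i a f) = sf i a (sl l c f)"
proof (rule frag_ext[OF assms(1), where \<phi> = "\<lambda>f. sl l c (sf i a f)" and \<psi> = "\<lambda>f. sf i a (sl l c f)"])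
  fix ws assume "ws \<in> words W i l"
  then obtain us v where *: "ws = us @ [v]" "us \<in> words W i (l - 1)" "v \<in> carrier (W (l - 1))"
    using words_snoc assms(2) by blast
  show "sl l c (sf i a (frag_of ws)) = sf i a (sl l c (frag_of ws))"
  proof (cases us)
    case Nil
    then have "i = l - 1" "l - 1 + 1 = l" using * by simp_all
    then show ?thesis using * Nil assms(3,4) bimodule.smult_rsmult[OF bimodule_W[of "l - 1"], of a c v]
      by (simp add: scale_last_def)
  next
    case (Cons u us')
    then show ?thesis using * scale_last_snoc[of "W (l - 1)" "u # us'" v c]
        scale_last_snoc[of "W (l - 1)" "(a \<odot>\<^bsub>W i\<^esub> u) # us'" v c] by simp
  qed
qed (simp_all add: frag_extend_diff)

lemma cc_sf:
  assumes "Poly_Mapping.keys f \<subseteq> words W i l" "i \<noteq> l" "a \<in> carrier (K i)"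
  shows "cc (sf i a f) g = sf i a (cc f g)"
proof (rule frag_ext[OF assms(1), where \<phi> = "\<lambda>f. cc (sf i a f) g" and \<psi> = "\<lambda>f. sf i a (cc f g)"])
  fix us assume us: "us \<in> words W i l"
  then have ne: "us \<noteq> []" using assms(2) by auto
  show "cc (sf i a (frag_of us)) g = sf i a (cc (frag_of us) g)"
    by (rule frag_ext[where S = UNIV and \<phi> = "\<lambda>g. cc (sf i a (frag_of us)) g" and \<psi> = "\<lambda>g. sf i a (cc (frag_of us) g)"])
      (simp_all add: frag_extend_diff scale_first_append[OF ne])
qed (simp_all add: frag_extend_diff)

lemma cc_sl:
  assumes "Poly_Mapping.keys g \<subseteq> words W j l" "j \<noteq> l"
  shows "sl l c (cc f g) = cc f (sl l c g)"
proof (rule frag_ext[OF assms(1), where \<phi> = "\<lambda>g. sl l c (cc f g)" and \<psi> = "\<lambda>g. cc f (sl l c g)"])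
  fix ws assume "ws \<in> words W j l"
  then obtain us v where ws: "ws = us @ [v]" using words_snoc assms(2) by blast
  have sn: "scale_last (W (l - 1)) (ps @ us @ [v]) c = ps @ us @ [rsmult (W (l - 1)) v c]" for ps
    using scale_last_snoc[of "W (l - 1)" "ps @ us" v c] by simp
  show "sl l c (cc f (frag_of ws)) = cc f (sl l c (frag_of ws))"
    by (rule frag_ext[where S = UNIV and \<phi> = "\<lambda>f. sl l c (cc f (frag_of ws))" and \<psi> = "\<lambda>f. cc f (sl l c (frag_of ws))"])
      (simp_all add: frag_extend_diff ws sn)
qed (simp_all only: cc_diff frag_extend_0 frag_extend_zero frag_extend_diff[of "\<lambda>ws. frag_of (scale_last (W (l - 1)) ws c)"])

lemma cc_cc: "cc (cc f g) h = cc f (cc g h)"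
proof (rule frag_ext[where S = UNIV and \<phi> = "\<lambda>f. cc (cc f g) h" and \<psi> = "\<lambda>f. cc f (cc g h)"])
  fix us
  show "cc (cc (frag_of us) g) h = cc (frag_of us) (cc g h)"
  proof (rule frag_ext[where S = UNIV and \<phi> = "\<lambda>g. cc (cc (frag_of us) g) h" and \<psi> = "\<lambda>g. cc (frag_of us) (cc g h)"])
    fix vs
    show "cc (cc (frag_of us) (frag_of vs)) h = cc (frag_of us) (cc (frag_of vs) h)"
      by (rule frag_ext[where S = UNIV and \<phi> = "\<lambda>h. cc (cc (frag_of us) (frag_of vs)) h"
            and \<psi> = "\<lambda>h. cc (frag_of us) (cc (frag_of vs) h)"]) (simp_all add: frag_extend_diff)
  qed (simp_all add: frag_extend_diff)
qed (simp_all add: frag_extend_diff)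

text \<open>Associativity with a scalar in the middle is precisely the balancing relation of the
  tensor product, and so again an identity modulo the kernel.\<close>

lemma cc_balanced:
  assumes f: "Poly_Mapping.keys f \<subseteq> words W i j" and g: "Poly_Mapping.keys g \<subseteq> words W j l"
    and "i \<noteq> j" "j \<noteq> l" and b: "b \<in> carrier (K j)"
  shows "cc (sl j b f) g - cc f (sf j b g) \<in> Kr i l"
proof (rule frag_mem[OF f, where \<phi> = "\<lambda>f. cc (sl j b f) g - cc f (sf j b g)"])
  fix us assume us: "us \<in> words W i j"
  then obtain us' v where u: "us = us' @ [v]" "us' \<in> words W i (j - 1)" "v \<in> carrier (W (j - 1))"
    using words_snoc assms(3) by blast
  have j: "j - 1 = i + int (length us')" "j = i + int (length us') + 1" using words_length[OF u(2)] by auto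
  show "cc (sl j b (frag_of us)) g - cc (frag_of us) (sf j b g) \<in> Kr i l"
  proof (rule frag_mem[OF g, where \<phi> = "\<lambda>g. cc (sl j b (frag_of us)) g - cc (frag_of us) (sf j b g)"])
    fix ws assume ws: "ws \<in> words W j l"
    have "j < l" using words_le[OF ws] assms(4) by simp
    then obtain w ts where w: "ws = w # ts" "ts \<in> words W (j + 1) l" "w \<in> carrier (W j)"
      by (rule words_cons_ex[OF ws])
    have "us' @ v # w # ts \<in> words W i l" using u w j by simp
    from Kr_balanced[OF this, of b]
    show "cc (sl j b (frag_of us)) (frag_of ws) - cc (frag_of us) (sf j b (frag_of ws)) \<in> Kr i l"
      using b u(1) w(1) j by simp
  qed (simp_all add: frag_extend_diff Kr_diff)
qed (simp_all add: frag_extend_diff Kr_diff)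

lemma T_mult_assoc:
  assumes t: "t \<in> carrier (component T i j)" and u: "u \<in> carrier (component T j l)"
    and s: "s \<in> carrier (component T l m)"
  shows "zmult T i l m (zmult T i j l t u) s = zmult T i j m t (zmult T j l m u s)"
\<comment> \<open>Without this order some factor lies in a trivial component. With it, no product of
  off-diagonal factors lands on the diagonal, so the default value in \<open>tensor_mult\<close>
  never interferes.\<close>
proof (cases "i \<le> j \<and> j \<le> l \<and> l \<le> m")
  case False
  then have "t = \<one>\<^bsub>component T i j\<^esub> \<or> u = \<one>\<^bsub>component T j l\<^esub> \<or> s = \<one>\<^bsub>component T l m\<^esub>"
    using below_trivial t u s by (meson not_le)
  then show ?thesis using T_mult_one T_mult_closed t u s by metis
next
  case True
  from t show ?thesis
  proof (cases rule: T_cases)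
    case t: (diag a)
    from u show ?thesis
    proof (cases rule: T_cases)
      case u: (diag b)
      from s show ?thesis
        by (cases rule: T_cases) (use t u in \<open>auto simp: mult_scalar_ct K_simps(11) sf_sf\<close>)
    next
      case u: (off g)
      from s show ?thesis
      proof (cases rule: T_cases)
        case (diag c)
        then show ?thesis using t u by (simp add: mult_scalar_ct mult_ct_scalar sl_sf)
      next
        case (off h)
        then have "j \<noteq> m" using u True by auto
        then show ?thesis using t u off
          by (simp add: mult_scalar_ct mult_ct_ct sf_carrier cc_sf)
      qed
    qed
  next
    case t: (off f)
    from u show ?thesis
    proof (cases rule: T_cases)
      case u: (diag b)
      from s show ?thesis
      proof (cases rule: T_cases)
        case (diag c)
        then show ?thesis using t u by (simp add: mult_ct_scalar sl_sl)
      next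
        case (off h)
        then have "i \<noteq> m" using t u True by auto
        then show ?thesis using t u off cc_balanced[of f i j h m b]
          by (simp add: mult_ct_scalar mult_scalar_ct mult_ct_ct sl_carrier sf_carrier ct_eq_iff)
      qed
    next
      case u: (off g)
      have il: "i \<noteq> l" using t u True by auto
      from s show ?thesis
      proof (cases rule: T_cases)
        case (diag c)
        then show ?thesis using t u il by (simp add: mult_ct_ct mult_ct_scalar sl_carrier cc_sl)
      next
        case (off h)
        then have "i \<noteq> m" "j \<noteq> m" using t u True by auto
        then show ?thesis using t u off il by (simp add: mult_ct_ct cc_carrier cc_cc)
      qed
    qed
  qed
qed

lemma T_unit:
  assumes t: "t \<in> carrier (component T i j)"
  shows "zmult T i i j (zunit T i) t = t" "zmult T i j j t (zunit T j) = t"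
proof -
  show "zmult T i i j (zunit T i) t = t"
    using t
  proof (cases rule: T_cases)
    case (off f)
    have "sf i \<one>\<^bsub>K i\<^esub> f = f"
    proof (rule frag_ext[OF off(2), where \<phi> = "sf i \<one>\<^bsub>K i\<^esub>" and \<psi> = "\<lambda>f. f"])
      fix ws assume "ws \<in> words W i j"
      then show "sf i \<one>\<^bsub>K i\<^esub> (frag_of ws) = frag_of ws"
        by (cases ws) (auto simp: module.smult_one[OF left_mod])
    qed (simp_all add: frag_extend_diff)
    then show ?thesis using off by (simp add: mult_scalar_ct)
  qed simp
  show "zmult T i j j t (zunit T j) = t"
    using t
  proof (cases rule: T_cases)
    case (off f)
    have "sl j \<one>\<^bsub>K j\<^esub> f = f"
    proof (rule frag_ext[OF off(2), where \<phi> = "sl j \<one>\<^bsub>K j\<^esub>" and \<psi> = "\<lambda>f. f"])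
      fix ws assume "ws \<in> words W i j"
      then obtain us v where "ws = us @ [v]" "v \<in> carrier (W (j - 1))"
        using words_snoc off(1) by blast
      then show "sl j \<one>\<^bsub>K j\<^esub> (frag_of ws) = frag_of ws"
        using module.smult_one[OF right_mod[of "j - 1"], of v] by simp
    qed (simp_all add: frag_extend_diff)
    then show ?thesis using off by (simp add: mult_ct_scalar)
  qed simp
qed

lemma z_algebra_T: "z_algebra T"
proof (rule z_algebra.intro)
  show "zunit T i \<in> carrier (component T i i)" for i
    using cring.cring_simprules(6)[OF K_cring[of i]] by simp
qed (rule comm_group_T T_mult_closed T_mult_add_left T_mult_add_right T_mult_assoc T_unit; assumption)+

section \<open>Monomials and the universal property\<close>

sublocale TA: z_algebra T by (rule z_algebra_T)

declare zmult_T [simp del] zunit_T [simp del] comp_diag [simp del]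

text \<open>Pure tensors, with the unit as value on the diagonal. The empty word thereby behaves as
  a product of no factors, and concatenation needs no separate treatment of the scalars.\<close>

definition mon :: "int \<Rightarrow> int \<Rightarrow> 'w list \<Rightarrow> ('k, 'w) tensor" where
  "mon i j ws = (if i = j then Scalar \<one>\<^bsub>K i\<^esub> else ct i j (frag_of ws))"

lemma mon_Nil [simp]: "mon i i ws = zunit T i" by (simp add: mon_def zunit_T)

lemma pure_tensor_mon: "i \<noteq> j \<Longrightarrow> pure_tensor K W i j ws = mon i j ws"
  by (simp add: mon_def pure_tensor_def ct_def)

lemma zmod_T_diag:
  "carrier (zmod T i i) = Scalar ` carrier (K i)"
  "Scalar a \<oplus>\<^bsub>zmod T i i\<^esub> Scalar b = Scalar (a \<oplus>\<^bsub>K i\<^esub> b)"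
  "\<zero>\<^bsub>zmod T i i\<^esub> = Scalar \<zero>\<^bsub>K i\<^esub>"
  "zmult T i i i (Scalar a) (Scalar b) = Scalar (a \<otimes>\<^bsub>K i\<^esub> b)"
  by (simp_all add: zmod_simps comp_diag zmult_T)

lemma Scalar_closed [simp]: "a \<in> carrier (K i) \<Longrightarrow> Scalar a \<in> carrier (zmod T i i)"
  by (simp add: zmod_T_diag)

lemma mon_closed [simp]: "ws \<in> words W i j \<Longrightarrow> mon i j ws \<in> carrier (zmod T i j)"
  by (cases "i = j") (simp_all add: mon_def zmod_simps comp_off comp_diag zunit_T)

lemma mon_mult:
  assumes "us \<in> words W i j" "ws \<in> words W j l"
  shows "zmult T i j l (mon i j us) (mon j l ws) = mon i l (us @ ws)"
proof (cases "i = j \<or> j = l")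
  case True
  then show ?thesis using assms by (auto simp: words_same)
next
  case False
  then have "i \<noteq> l" using words_le[OF assms(1)] words_le[OF assms(2)] by auto
  then show ?thesis using False assms by (simp add: mon_def zmult_T mult_ct_ct)
qed

lemma mon_scale_left:
  assumes "v # ts \<in> words W i j" "a \<in> carrier (K i)"
  shows "zmult T i i j (Scalar a) (mon i j (v # ts)) = mon i j ((a \<odot>\<^bsub>W i\<^esub> v) # ts)"
proof -
  have "i \<noteq> j" using words_length[OF assms(1)] by auto
  then show ?thesis using assms by (simp add: mon_def zmult_T mult_scalar_ct)
qed

lemma mon_scale_right:
  assumes "us @ [v] \<in> words W i j" "b \<in> carrier (K j)"
  shows "zmult T i j j (mon i j (us @ [v])) (Scalar b) = mon i j (us @ [rsmult (W (j - 1)) v b])"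
proof -
  have "i \<noteq> j" using words_length[OF assms(1)] by auto
  then show ?thesis using assms by (simp add: mon_def zmult_T mult_ct_scalar)
qed

lemma mon_add:
  assumes "us @ v # ts \<in> words W i j" "us @ v' # ts \<in> words W i j"
  shows "mon i j (us @ (v \<oplus>\<^bsub>W (i + int (length us))\<^esub> v') # ts) =
    mon i j (us @ v # ts) \<oplus>\<^bsub>zmod T i j\<^esub> mon i j (us @ v' # ts)"
proof -
  have ij: "i \<noteq> j" using words_length[OF assms(1)] by auto
  have "ct i j (frag_of (us @ v # ts)) \<otimes>\<^bsub>component T i j\<^esub> ct i j (frag_of (us @ v' # ts)) =
      ct i j (frag_of (us @ v # ts) + frag_of (us @ v' # ts))"
    using assms by (intro comp_off(3)[OF ij]) simp_all
  then show ?thesis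
    using ij Kr_additive[OF assms] by (simp add: mon_def zmod_simps ct_eq_iff diff_diff_eq)
qed

lemma mon_balanced:
  assumes "us @ v # w # ts \<in> words W i j" "b \<in> carrier (K (i + int (length us) + 1))"
  shows "mon i j (us @ rsmult (W (i + int (length us))) v b # w # ts) =
    mon i j (us @ v # (b \<odot>\<^bsub>W (i + int (length us) + 1)\<^esub> w) # ts)"
proof -
  have "i \<noteq> j" using words_length[OF assms(1)] by auto
  then show ?thesis using Kr_balanced[OF assms] by (simp add: mon_def ct_eq_iff)
qed

lemma neg_ct:
  assumes "i \<noteq> j" "Poly_Mapping.keys f \<subseteq> words W i j"
  shows "\<ominus>\<^bsub>zmod T i j\<^esub> ct i j f = ct i j (- f)"
  by (rule TA.neg_unique[symmetric]) (use assms in \<open>simp_all add: zmod_simps comp_off\<close>)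

lemma T_induct:
  assumes "i \<noteq> j" "t \<in> carrier (zmod T i j)"
    and mon: "\<And>ws. ws \<in> words W i j \<Longrightarrow> P (mon i j ws)" and zero: "P \<zero>\<^bsub>zmod T i j\<^esub>"
    and diff: "\<And>a b. a \<in> carrier (zmod T i j) \<Longrightarrow> b \<in> carrier (zmod T i j) \<Longrightarrow> P a \<Longrightarrow> P b \<Longrightarrow>
      P (a \<oplus>\<^bsub>zmod T i j\<^esub> \<ominus>\<^bsub>zmod T i j\<^esub> b)"
  shows "P t"
proof -
  obtain f where f: "Poly_Mapping.keys f \<subseteq> words W i j" and t: "t = ct i j f"
    using assms(1,2) by (auto simp: zmod_simps comp_off)
  have "P (ct i j f)"
  proof (rule free_Abelian_group_induct[OF f, where P = "\<lambda>f. P (ct i j f)"])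
    show "P (ct i j 0)" using zero assms(1) by (simp add: zmod_simps comp_off)
  next
    fix f g assume fg: "Poly_Mapping.keys f \<subseteq> words W i j" "Poly_Mapping.keys g \<subseteq> words W i j"
      "P (ct i j f)" "P (ct i j g)"
    have c: "ct i j f \<in> carrier (zmod T i j)" "ct i j g \<in> carrier (zmod T i j)"
      using fg(1,2) assms(1) by (simp_all add: zmod_simps comp_off)
    have "Poly_Mapping.keys (- g) \<subseteq> words W i j" using fg(2) by simp
    then have "ct i j f \<oplus>\<^bsub>zmod T i j\<^esub> \<ominus>\<^bsub>zmod T i j\<^esub> ct i j g = ct i j (f - g)"
      using comp_off(3)[OF assms(1) fg(1), of "- g"] fg(2) by (simp add: neg_ct[OF assms(1)] zmod_simps)
    then show "P (ct i j (f - g))" using diff[OF c fg(3,4)] by simp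
  next
    fix ws assume "ws \<in> words W i j"
    then show "P (ct i j (frag_of ws))" using mon[of ws] assms(1) by (simp add: mon_def)
  qed
  then show ?thesis using t by simp
qed

text \<open>The universal property of an iterated tensor product. The map is defined on the free
  group, vanishes on both families of relations, hence on the group they generate, and descends; the
  functionals that detect freeness are obtained from it.\<close>

lemma T_universal:
  assumes ij: "i \<noteq> j" and f: "\<And>ws. ws \<in> words W i j \<Longrightarrow> f ws \<in> carrier (zmod T k m)"
    and add: "\<And>us v v' ts. us @ v # ts \<in> words W i j \<Longrightarrow> us @ v' # ts \<in> words W i j \<Longrightarrow>
      f (us @ (v \<oplus>\<^bsub>W (i + int (length us))\<^esub> v') # ts) = f (us @ v # ts) \<oplus>\<^bsub>zmod T k m\<^esub> f (us @ v' # ts)"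
    and bal: "\<And>us v b w ts. us @ v # w # ts \<in> words W i j \<Longrightarrow> b \<in> carrier (K (i + int (length us) + 1)) \<Longrightarrow>
      f (us @ rsmult (W (i + int (length us))) v b # w # ts) =
        f (us @ v # (b \<odot>\<^bsub>W (i + int (length us) + 1)\<^esub> w) # ts)"
  shows "\<exists>h. (\<forall>t\<in>carrier (zmod T i j). h t \<in> carrier (zmod T k m)) \<and>
    (\<forall>t\<in>carrier (zmod T i j). \<forall>u\<in>carrier (zmod T i j). h (t \<oplus>\<^bsub>zmod T i j\<^esub> u) = h t \<oplus>\<^bsub>zmod T k m\<^esub> h u) \<and>
    (\<forall>ws\<in>words W i j. h (mon i j ws) = f ws)"
proof -
  let ?C = "component T k m"
  interpret C: comm_group ?C by (rule comm_group_T)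
  have "f ` words W i j \<subseteq> carrier ?C" using f by (auto simp: zmod_simps)
  then obtain h0 where h0: "h0 \<in> hom (FA i j) ?C" "\<And>ws. ws \<in> words W i j \<Longrightarrow> h0 (frag_of ws) = f ws"
    by (rule C.free_Abelian_group_universal) blast
  interpret h0: group_hom "FA i j" ?C h0
    by (simp add: group_hom_def group_hom_axioms_def h0(1) C.is_group)
  have sum: "h0 (g + g') = h0 g \<otimes>\<^bsub>?C\<^esub> h0 g'"
    if "Poly_Mapping.keys g \<subseteq> words W i j" "Poly_Mapping.keys g' \<subseteq> words W i j" for g g'
    using h0.hom_mult[of g g'] that by simp
  have cl: "h0 g \<in> carrier ?C" if "Poly_Mapping.keys g \<subseteq> words W i j" for g
    using h0.hom_closed[of g] that by simp
  have kd: "Poly_Mapping.keys (g - g') \<subseteq> words W i j"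
    if "Poly_Mapping.keys g \<subseteq> words W i j" "Poly_Mapping.keys g' \<subseteq> words W i j" for g g'
    using that keys_diff[of g g'] by blast
  have word: "Poly_Mapping.keys (frag_of ws) \<subseteq> words W i j" if "ws \<in> words W i j" for ws
    using that by simp
  have ker1: "h0 (frag_of (us @ (v \<oplus>\<^bsub>W (i + int (length us))\<^esub> v') # ts) - frag_of (us @ v # ts) -
      frag_of (us @ v' # ts)) = \<one>\<^bsub>?C\<^esub>"
    if 1: "us @ v # ts \<in> words W i j" "us @ v' # ts \<in> words W i j" for us v v' ts
  proof -
    let ?a = "us @ (v \<oplus>\<^bsub>W (i + int (length us))\<^esub> v') # ts" and ?b = "us @ v # ts" and ?c = "us @ v' # ts"
    let ?g = "frag_of ?a - frag_of ?b - frag_of ?c"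
    have a: "?a \<in> words W i j" using 1 by simp
    note k = word[OF a] word[OF 1(1)] word[OF 1(2)]
    have gk: "Poly_Mapping.keys ?g \<subseteq> words W i j" by (intro kd k)
    have "?g + (frag_of ?b + frag_of ?c) = frag_of ?a" by simp
    then have "h0 ?g \<otimes>\<^bsub>?C\<^esub> (f ?b \<otimes>\<^bsub>?C\<^esub> f ?c) = f ?a"
      using sum[OF gk keys_plus[OF k(2,3)]] sum[OF k(2,3)] h0(2)[OF a] h0(2)[OF 1(1)] h0(2)[OF 1(2)] by metis
    also have "f ?a = f ?b \<otimes>\<^bsub>?C\<^esub> f ?c" using add[OF 1] by (simp only: zmod_simps)
    finally show ?thesis
      using cl[OF gk] cl[OF k(2)] cl[OF k(3)] unfolding h0(2)[OF 1(1)] h0(2)[OF 1(2)] by simp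
  qed
  have ker2: "h0 (frag_of (us @ rsmult (W (i + int (length us))) v b # w # ts) -
      frag_of (us @ v # (b \<odot>\<^bsub>W (i + int (length us) + 1)\<^esub> w) # ts)) = \<one>\<^bsub>?C\<^esub>"
    if 2: "us @ v # w # ts \<in> words W i j" "b \<in> carrier (K (i + int (length us) + 1))" for us v b w ts
  proof -
    let ?a = "us @ rsmult (W (i + int (length us))) v b # w # ts"
    let ?b = "us @ v # (b \<odot>\<^bsub>W (i + int (length us) + 1)\<^esub> w) # ts"
    let ?g = "frag_of ?a - frag_of ?b"
    have a: "?a \<in> words W i j" "?b \<in> words W i j" using 2 by simp_all
    note k = word[OF a(1)] word[OF a(2)]
    have gk: "Poly_Mapping.keys ?g \<subseteq> words W i j" by (intro kd k)
    have "?g + frag_of ?b = frag_of ?a" by simp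
    then have "h0 ?g \<otimes>\<^bsub>?C\<^esub> f ?b = f ?a" using sum[OF gk k(2)] h0(2)[OF a(1)] h0(2)[OF a(2)] by metis
    then show ?thesis unfolding bal[OF 2] using cl[OF gk] cl[OF k(2)] unfolding h0(2)[OF a(2)] by simp
  qed
  have ker: "h0 g = \<one>\<^bsub>?C\<^esub>" if "g \<in> rl i j" for g
    using that ker1 ker2 unfolding tensor_relations_def by blast
  have kerK: "h0 g = \<one>\<^bsub>?C\<^esub>" if "g \<in> Kr i j" for g
    using that unfolding tensor_kernel_def
  proof (induction rule: generate.induct)
    case one
    then show ?case using h0.hom_one by simp
  next
    case (incl g)
    then show ?case by (rule ker)
  next
    case (inv g)
    then have "Poly_Mapping.keys g \<subseteq> words W i j" by (rule rl_carrier)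
    then show ?case using h0.hom_inv[of g] ker[OF inv] by simp
  next
    case (eng g g')
    then have "g \<in> Kr i j" "g' \<in> Kr i j" by (simp_all add: tensor_kernel_def)
    then show ?case using eng sum[OF Kr_carrier Kr_carrier] by simp
  qed
  \<comment> \<open>The choice of representative is immaterial because two of them differ by an
    element of the kernel, on which \<open>h0\<close> vanishes.\<close>
  define h where "h t = h0 (SOME g. Poly_Mapping.keys g \<subseteq> words W i j \<and> t = ct i j g)" for t
  have h: "h (ct i j g) = h0 g" if g: "Poly_Mapping.keys g \<subseteq> words W i j" for g
  proof -
    define g' where "g' = (SOME g'. Poly_Mapping.keys g' \<subseteq> words W i j \<and> ct i j g = ct i j g')"
    have g': "Poly_Mapping.keys g' \<subseteq> words W i j" "ct i j g = ct i j g'"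
      using someI[of "\<lambda>g'. Poly_Mapping.keys g' \<subseteq> words W i j \<and> ct i j g = ct i j g'" g] g
      unfolding g'_def by auto
    then have "h0 (g - g') = \<one>\<^bsub>?C\<^esub>" using kerK ct_eq_iff by blast
    moreover have "h0 g = h0 (g - g') \<otimes>\<^bsub>?C\<^esub> h0 g'" using sum[OF kd[OF g g'(1)] g'(1)] by simp
    ultimately show ?thesis using cl[OF g'(1)] by (simp add: h_def g'_def[symmetric])
  qed
  show ?thesis
  proof (intro exI[of _ h] conjI ballI)
    fix t assume "t \<in> carrier (zmod T i j)"
    then show "h t \<in> carrier (zmod T k m)" using ij by (auto simp: zmod_simps comp_off h cl)
  next
    fix t u assume "t \<in> carrier (zmod T i j)" "u \<in> carrier (zmod T i j)"
    then show "h (t \<oplus>\<^bsub>zmod T i j\<^esub> u) = h t \<oplus>\<^bsub>zmod T k m\<^esub> h u"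
      using ij by (auto simp: zmod_simps comp_off h sum keys_plus)
  next
    fix ws assume "ws \<in> words W i j"
    then show "h (mon i j ws) = f ws" using ij by (simp add: mon_def h h0(2))
  qed
qed

lemma field_diagonal_T: "field (diagonal_ring T n)"
proof -
  interpret F: field "K n" by (rule field_K)
  have "Scalar \<in> ring_iso (K n) (diagonal_ring T n)"
    by (rule ring_iso_memI) (auto simp: bij_betw_def inj_on_def zmod_T_diag zunit_T)
  from F.ring_iso_imp_img_field[OF this] show ?thesis
    by (simp add: diagonal_ring_def zunit_T comp_diag)
qed

lemma below_T:
  assumes "j < i"
  shows "carrier (zmod T i j) = {\<zero>\<^bsub>zmod T i j\<^esub>}"
proof (intro equalityI subsetI)
  fix t assume "t \<in> carrier (zmod T i j)"
  then show "t \<in> {\<zero>\<^bsub>zmod T i j\<^esub>}" using below_trivial[OF assms, of t] by (simp add: zmod_simps)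
qed simp

text \<open>
  A left-linear functional \<open>\<kappa>\<close> on \<open>W n\<close> extends to \<open>T\<^sub>i\<^sub>,\<^sub>n\<^sub>+\<^sub>1 = T\<^sub>i\<^sub>n \<otimes> W n\<close>, and symmetrically on the left;
  coordinates with respect to a basis of \<open>W n\<close> thus show that the tensor algebra is free.
\<close>

lemma right_functional:
  assumes i: "i \<le> n" and \<kappa>: "\<And>v. v \<in> carrier (W n) \<Longrightarrow> \<kappa> v \<in> carrier (K n)"
    and add: "\<And>v v'. v \<in> carrier (W n) \<Longrightarrow> v' \<in> carrier (W n) \<Longrightarrow> \<kappa> (v \<oplus>\<^bsub>W n\<^esub> v') = \<kappa> v \<oplus>\<^bsub>K n\<^esub> \<kappa> v'"
    and smult: "\<And>b v. b \<in> carrier (K n) \<Longrightarrow> v \<in> carrier (W n) \<Longrightarrow> \<kappa> (b \<odot>\<^bsub>W n\<^esub> v) = b \<otimes>\<^bsub>K n\<^esub> \<kappa> v"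
  shows "\<exists>h. (\<forall>t\<in>carrier (zmod T i (n + 1)). h t \<in> carrier (zmod T i n)) \<and>
    (\<forall>t\<in>carrier (zmod T i (n + 1)). \<forall>u\<in>carrier (zmod T i (n + 1)).
      h (t \<oplus>\<^bsub>zmod T i (n + 1)\<^esub> u) = h t \<oplus>\<^bsub>zmod T i n\<^esub> h u) \<and>
    (\<forall>t\<in>carrier (zmod T i n). \<forall>v\<in>carrier (W n).
      h (zmult T i n (n + 1) t (mon n (n + 1) [v])) = zmult T i n n t (Scalar (\<kappa> v)))"
proof -
  \<comment> \<open>Contraction of the last letter: a word \<open>us\<close> followed by
    \<open>v\<close> goes to \<open>us\<close> times \<open>\<kappa> v\<close>.\<close>
  define f where "f ws = zmult T i n n (mon i n (butlast ws)) (Scalar (\<kappa> (last ws)))" for ws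
  have ne: "i \<noteq> n + 1" using i by simp
  have ex: "\<exists>h. (\<forall>t\<in>carrier (zmod T i (n + 1)). h t \<in> carrier (zmod T i n)) \<and>
    (\<forall>t\<in>carrier (zmod T i (n + 1)). \<forall>u\<in>carrier (zmod T i (n + 1)).
      h (t \<oplus>\<^bsub>zmod T i (n + 1)\<^esub> u) = h t \<oplus>\<^bsub>zmod T i n\<^esub> h u) \<and>
    (\<forall>ws\<in>words W i (n + 1). h (mon i (n + 1) ws) = f ws)"
  proof (rule T_universal[OF ne])
    fix ws assume ws: "ws \<in> words W i (n + 1)"
    obtain us v where "ws = us @ [v]" "us \<in> words W i n" "v \<in> carrier (W n)"
      using ws i by (rule words_snoc_ex)
    then show "f ws \<in> carrier (zmod T i n)" using \<kappa> by (simp add: f_def)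
  next
    fix us v v' ts assume *: "us @ v # ts \<in> words W i (n + 1)" "us @ v' # ts \<in> words W i (n + 1)"
    show "f (us @ (v \<oplus>\<^bsub>W (i + int (length us))\<^esub> v') # ts) = f (us @ v # ts) \<oplus>\<^bsub>zmod T i n\<^esub> f (us @ v' # ts)"
    proof (cases ts rule: rev_cases)
      case Nil
      then have n: "i + int (length us) = n" using words_length[OF *(1)] by simp
      have us: "us \<in> words W i n" and v: "v \<in> carrier (W n)" "v' \<in> carrier (W n)" using * n Nil by simp_all
      have "Scalar (\<kappa> (v \<oplus>\<^bsub>W n\<^esub> v')) = Scalar (\<kappa> v) \<oplus>\<^bsub>zmod T n n\<^esub> Scalar (\<kappa> v')"
        using v by (simp add: add zmod_T_diag)
      then show ?thesis using Nil us v \<kappa> unfolding n by (simp add: f_def TA.mu_add)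
    next
      case (snoc ts' u)
      then have "us @ v # ts' \<in> words W i n" "us @ v' # ts' \<in> words W i n" "u \<in> carrier (W n)"
        using * words_length[OF *(1)] words_snoc_ex[OF *(1) i] words_snoc_ex[OF *(2) i]
        by (auto simp: add_ac)
      then show ?thesis using snoc \<kappa> by (simp add: f_def mon_add butlast_append TA.mu_add)
    qed
  next
    fix us v b w ts assume *: "us @ v # w # ts \<in> words W i (n + 1)" "b \<in> carrier (K (i + int (length us) + 1))"
    show "f (us @ rsmult (W (i + int (length us))) v b # w # ts) =
        f (us @ v # (b \<odot>\<^bsub>W (i + int (length us) + 1)\<^esub> w) # ts)"
    proof (cases ts rule: rev_cases)
      case Nil
      then have n: "i + int (length us) = n - 1" using words_length[OF *(1)] by simp
      have us: "us @ [v] \<in> words W i n" and w: "w \<in> carrier (W n)" and b: "b \<in> carrier (K n)"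
        using * n Nil by simp_all
      \<comment> \<open>Left linearity of \<open>\<kappa>\<close> is used for balancing across the
        contracted letter: \<open>(v b) \<kappa>(w) = v \<kappa>(b w)\<close>.\<close>
      have "zmult T i n n (mon i n (us @ [rsmult (W (n - 1)) v b])) (Scalar (\<kappa> w)) =
          zmult T i n n (mon i n (us @ [v])) (zmult T n n n (Scalar b) (Scalar (\<kappa> w)))"
        using us b \<kappa>[OF w] by (simp add: mon_scale_right[symmetric] TA.mu_assoc del: words_append)
      then show ?thesis using Nil w b unfolding n
        by (simp add: f_def butlast_append smult zmod_T_diag)
    next
      case (snoc ts' u)
      have "us @ v # w # ts' \<in> words W i n"
      proof -
        obtain us' v' where "us @ v # w # ts = us' @ [v']" "us' \<in> words W i n"
          using *(1) i by (rule words_snoc_ex)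
        then show ?thesis using snoc by (metis append_assoc append_Cons butlast_snoc)
      qed
      then show ?thesis using snoc *(2) by (simp add: f_def mon_balanced butlast_append)
    qed
  qed
  then obtain h where h: "\<forall>t\<in>carrier (zmod T i (n + 1)). h t \<in> carrier (zmod T i n)"
    "\<forall>t\<in>carrier (zmod T i (n + 1)). \<forall>u\<in>carrier (zmod T i (n + 1)).
      h (t \<oplus>\<^bsub>zmod T i (n + 1)\<^esub> u) = h t \<oplus>\<^bsub>zmod T i n\<^esub> h u"
    "\<forall>ws\<in>words W i (n + 1). h (mon i (n + 1) ws) = f ws" by blast
  have h0: "h \<zero>\<^bsub>zmod T i (n + 1)\<^esub> = \<zero>\<^bsub>zmod T i n\<^esub>"
  proof (rule TA.add_cancel_zero)
    show "h \<zero>\<^bsub>zmod T i (n + 1)\<^esub> = h \<zero>\<^bsub>zmod T i (n + 1)\<^esub> \<oplus>\<^bsub>zmod T i n\<^esub> h \<zero>\<^bsub>zmod T i (n + 1)\<^esub>"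
      using h(2) TA.zero_closed[of i "n + 1"] TA.add_zero(1)[OF TA.zero_closed[of i "n + 1"]] by metis
  qed (use h(1) in blast)
  have hneg: "h (\<ominus>\<^bsub>zmod T i (n + 1)\<^esub> t) = \<ominus>\<^bsub>zmod T i n\<^esub> h t" if "t \<in> carrier (zmod T i (n + 1))" for t
  proof (rule TA.neg_unique)
    show "h t \<oplus>\<^bsub>zmod T i n\<^esub> h (\<ominus>\<^bsub>zmod T i (n + 1)\<^esub> t) = \<zero>\<^bsub>zmod T i n\<^esub>"
      using h(2) that h0 by (metis TA.add_neg(1) TA.neg_closed)
  qed (use h(1) that in auto)
  have val: "h (zmult T i n (n + 1) t (mon n (n + 1) [v])) = zmult T i n n t (Scalar (\<kappa> v))"
    if t: "t \<in> carrier (zmod T i n)" and v: "v \<in> carrier (W n)" for t v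
  proof (cases "i = n")
    case True
    then obtain a where a: "a \<in> carrier (K n)" "t = Scalar a" using t by (auto simp: zmod_T_diag)
    then show ?thesis using True v h(3) \<kappa>[OF v]
      by (simp add: mon_scale_left f_def smult zmod_T_diag)
  next
    case False
    show ?thesis
    proof (rule T_induct[OF False t])
      fix ws assume ws: "ws \<in> words W i n"
      then have "ws @ [v] \<in> words W i (n + 1)" using v words_length[OF ws] by simp
      then show "h (zmult T i n (n + 1) (mon i n ws) (mon n (n + 1) [v])) = zmult T i n n (mon i n ws) (Scalar (\<kappa> v))"
        using ws v h(3) by (simp add: mon_mult f_def)
    next
      fix a b assume "a \<in> carrier (zmod T i n)" "b \<in> carrier (zmod T i n)"
        "h (zmult T i n (n + 1) a (mon n (n + 1) [v])) = zmult T i n n a (Scalar (\<kappa> v))"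
        "h (zmult T i n (n + 1) b (mon n (n + 1) [v])) = zmult T i n n b (Scalar (\<kappa> v))"
      then show "h (zmult T i n (n + 1) (a \<oplus>\<^bsub>zmod T i n\<^esub> \<ominus>\<^bsub>zmod T i n\<^esub> b) (mon n (n + 1) [v])) =
          zmult T i n n (a \<oplus>\<^bsub>zmod T i n\<^esub> \<ominus>\<^bsub>zmod T i n\<^esub> b) (Scalar (\<kappa> v))"
        using v \<kappa>[OF v] h(2) by (simp add: TA.mu_add TA.mu_neg hneg)
    qed (use v \<kappa>[OF v] h0 in simp)
  qed
  then show ?thesis using h(1,2) by blast
qed

lemma left_functional:
  assumes i: "n \<le> m" and \<kappa>: "\<And>v. v \<in> carrier (W (n - 1)) \<Longrightarrow> \<kappa> v \<in> carrier (K n)"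
    and add: "\<And>v v'. v \<in> carrier (W (n - 1)) \<Longrightarrow> v' \<in> carrier (W (n - 1)) \<Longrightarrow>
      \<kappa> (v \<oplus>\<^bsub>W (n - 1)\<^esub> v') = \<kappa> v \<oplus>\<^bsub>K n\<^esub> \<kappa> v'"
    and rsmult: "\<And>b v. b \<in> carrier (K n) \<Longrightarrow> v \<in> carrier (W (n - 1)) \<Longrightarrow>
      \<kappa> (rsmult (W (n - 1)) v b) = \<kappa> v \<otimes>\<^bsub>K n\<^esub> b"
  shows "\<exists>h. (\<forall>t\<in>carrier (zmod T (n - 1) m). h t \<in> carrier (zmod T n m)) \<and>
    (\<forall>t\<in>carrier (zmod T (n - 1) m). \<forall>u\<in>carrier (zmod T (n - 1) m).
      h (t \<oplus>\<^bsub>zmod T (n - 1) m\<^esub> u) = h t \<oplus>\<^bsub>zmod T n m\<^esub> h u) \<and>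
    (\<forall>t\<in>carrier (zmod T n m). \<forall>v\<in>carrier (W (n - 1)).
      h (zmult T (n - 1) n m (mon (n - 1) n [v]) t) = zmult T n n m (Scalar (\<kappa> v)) t)"
proof -
  define f where "f ws = zmult T n n m (Scalar (\<kappa> (hd ws))) (mon n m (tl ws))" for ws
  have ne: "n - 1 \<noteq> m" using i by simp
  have lt: "n - 1 < m" using i by simp
  have ex: "\<exists>h. (\<forall>t\<in>carrier (zmod T (n - 1) m). h t \<in> carrier (zmod T n m)) \<and>
    (\<forall>t\<in>carrier (zmod T (n - 1) m). \<forall>u\<in>carrier (zmod T (n - 1) m).
      h (t \<oplus>\<^bsub>zmod T (n - 1) m\<^esub> u) = h t \<oplus>\<^bsub>zmod T n m\<^esub> h u) \<and>
    (\<forall>ws\<in>words W (n - 1) m. h (mon (n - 1) m ws) = f ws)"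
  proof (rule T_universal[OF ne])
    fix ws assume ws: "ws \<in> words W (n - 1) m"
    obtain v us where "ws = v # us" "us \<in> words W (n - 1 + 1) m" "v \<in> carrier (W (n - 1))"
      using ws lt by (rule words_cons_ex)
    then show "f ws \<in> carrier (zmod T n m)" using \<kappa> by (simp add: f_def)
  next
    fix us v v' ts assume *: "us @ v # ts \<in> words W (n - 1) m" "us @ v' # ts \<in> words W (n - 1) m"
    show "f (us @ (v \<oplus>\<^bsub>W (n - 1 + int (length us))\<^esub> v') # ts) = f (us @ v # ts) \<oplus>\<^bsub>zmod T n m\<^esub> f (us @ v' # ts)"
    proof (cases us)
      case Nil
      have ts: "ts \<in> words W n m" and v: "v \<in> carrier (W (n - 1))" "v' \<in> carrier (W (n - 1))" using * Nil by simp_all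
      have "Scalar (\<kappa> (v \<oplus>\<^bsub>W (n - 1)\<^esub> v')) = Scalar (\<kappa> v) \<oplus>\<^bsub>zmod T n n\<^esub> Scalar (\<kappa> v')"
        using v by (simp add: add zmod_T_diag)
      then show ?thesis using Nil ts v \<kappa> by (simp add: f_def TA.mu_add)
    next
      case (Cons u us')
      have eq: "n - 1 + int (length us) = n + int (length us')" using Cons by simp
      have "us' @ v # ts \<in> words W n m" "us' @ v' # ts \<in> words W n m" "u \<in> carrier (W (n - 1))"
        using * Cons by (simp_all add: add_ac)
      then show ?thesis unfolding eq using Cons \<kappa> by (simp add: f_def mon_add TA.mu_add)
    qed
  next
    fix us v b w ts assume *: "us @ v # w # ts \<in> words W (n - 1) m" "b \<in> carrier (K (n - 1 + int (length us) + 1))"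
    show "f (us @ rsmult (W (n - 1 + int (length us))) v b # w # ts) =
        f (us @ v # (b \<odot>\<^bsub>W (n - 1 + int (length us) + 1)\<^esub> w) # ts)"
    proof (cases us)
      case Nil
      have ts: "w # ts \<in> words W n m" and v: "v \<in> carrier (W (n - 1))" and b: "b \<in> carrier (K n)"
        using * Nil by simp_all
      have "zmult T n n m (zmult T n n n (Scalar (\<kappa> v)) (Scalar b)) (mon n m (w # ts)) =
          zmult T n n m (Scalar (\<kappa> v)) (mon n m ((b \<odot>\<^bsub>W n\<^esub> w) # ts))"
        using ts b \<kappa>[OF v] by (simp add: mon_scale_left[symmetric] TA.mu_assoc del: words_Cons)
      then show ?thesis using Nil v b by (simp add: f_def rsmult zmod_T_diag)
    next
      case (Cons u us')
      have eq: "n - 1 + int (length us) = n + int (length us')" using Cons by simp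
      have "us' @ v # w # ts \<in> words W n m" "b \<in> carrier (K (n + int (length us') + 1))"
        using * Cons by (simp_all add: add_ac)
      then show ?thesis unfolding eq using Cons by (simp add: f_def mon_balanced)
    qed
  qed
  then obtain h where h: "\<forall>t\<in>carrier (zmod T (n - 1) m). h t \<in> carrier (zmod T n m)"
    "\<forall>t\<in>carrier (zmod T (n - 1) m). \<forall>u\<in>carrier (zmod T (n - 1) m).
      h (t \<oplus>\<^bsub>zmod T (n - 1) m\<^esub> u) = h t \<oplus>\<^bsub>zmod T n m\<^esub> h u"
    "\<forall>ws\<in>words W (n - 1) m. h (mon (n - 1) m ws) = f ws" by blast
  have h0: "h \<zero>\<^bsub>zmod T (n - 1) m\<^esub> = \<zero>\<^bsub>zmod T n m\<^esub>"
  proof (rule TA.add_cancel_zero)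
    show "h \<zero>\<^bsub>zmod T (n - 1) m\<^esub> = h \<zero>\<^bsub>zmod T (n - 1) m\<^esub> \<oplus>\<^bsub>zmod T n m\<^esub> h \<zero>\<^bsub>zmod T (n - 1) m\<^esub>"
      using h(2) TA.zero_closed[of "n - 1" m] TA.add_zero(1)[OF TA.zero_closed[of "n - 1" m]] by metis
  qed (use h(1) in blast)
  have hneg: "h (\<ominus>\<^bsub>zmod T (n - 1) m\<^esub> t) = \<ominus>\<^bsub>zmod T n m\<^esub> h t" if "t \<in> carrier (zmod T (n - 1) m)" for t
  proof (rule TA.neg_unique)
    show "h t \<oplus>\<^bsub>zmod T n m\<^esub> h (\<ominus>\<^bsub>zmod T (n - 1) m\<^esub> t) = \<zero>\<^bsub>zmod T n m\<^esub>"
      using h(2) that h0 by (metis TA.add_neg(1) TA.neg_closed)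
  qed (use h(1) that in auto)
  have val: "h (zmult T (n - 1) n m (mon (n - 1) n [v]) t) = zmult T n n m (Scalar (\<kappa> v)) t"
    if t: "t \<in> carrier (zmod T n m)" and v: "v \<in> carrier (W (n - 1))" for t v
  proof (cases "n = m")
    case True
    then obtain a where a: "a \<in> carrier (K n)" "t = Scalar a" using t by (auto simp: zmod_T_diag)
    have "rsmult (W (n - 1)) v a \<in> carrier (W (n - 1))" using W_rsmult[of a "n - 1" v] a v by simp
    then show ?thesis using True a v h(3) \<kappa>[OF v] mon_scale_right[of "[]" v "n - 1" n a] rsmult[OF a(1) v]
      by (simp add: f_def zmod_T_diag)
  next
    case False
    show ?thesis
    proof (rule T_induct[OF False t])
      fix ws assume ws: "ws \<in> words W n m"
      then show "h (zmult T (n - 1) n m (mon (n - 1) n [v]) (mon n m ws)) = zmult T n n m (Scalar (\<kappa> v)) (mon n m ws)"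
        using v h(3) by (simp add: mon_mult f_def)
    next
      fix a b assume "a \<in> carrier (zmod T n m)" "b \<in> carrier (zmod T n m)"
        "h (zmult T (n - 1) n m (mon (n - 1) n [v]) a) = zmult T n n m (Scalar (\<kappa> v)) a"
        "h (zmult T (n - 1) n m (mon (n - 1) n [v]) b) = zmult T n n m (Scalar (\<kappa> v)) b"
      then show "h (zmult T (n - 1) n m (mon (n - 1) n [v]) (a \<oplus>\<^bsub>zmod T n m\<^esub> \<ominus>\<^bsub>zmod T n m\<^esub> b)) =
          zmult T n n m (Scalar (\<kappa> v)) (a \<oplus>\<^bsub>zmod T n m\<^esub> \<ominus>\<^bsub>zmod T n m\<^esub> b)"
        using v \<kappa>[OF v] h(2) by (simp add: TA.mu_add TA.mu_neg hneg)
    qed (use v \<kappa>[OF v] h0 in simp)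
  qed
  then show ?thesis using h(1,2) by blast
qed

end

section \<open>Dual bases and the quadratic relations\<close>

text \<open>The data are indexed by the vertex \<open>n\<close> between \<open>W (n - 1)\<close> and
  \<open>W n\<close>, whose field \<open>K n\<close> is where \<open>p n\<close> takes its values;
  the pairing with index \<open>n - 1\<close> thus becomes \<open>p n\<close>.
  \<open>K_periodic\<close> makes a scalar at \<open>n - 1\<close> also a scalar at
  \<open>n + 1\<close>, as needed to move it across the canonical element.\<close>

locale dual_bases = bimodule_seq K W for K :: "int \<Rightarrow> 'k ring" and W :: "int \<Rightarrow> ('k, 'w) bimodule" +
  fixes p :: "int \<Rightarrow> 'w \<Rightarrow> 'w \<Rightarrow> 'k" and x y x' y' :: "int \<Rightarrow> 'w"
  assumes K_periodic: "K (n + 1) = K (n - 1)"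
    and p_closed [simp]: "\<lbrakk>v \<in> carrier (W (n - 1)); \<psi> \<in> carrier (W n)\<rbrakk> \<Longrightarrow> p n v \<psi> \<in> carrier (K n)"
    and p_add_left: "\<lbrakk>v \<in> carrier (W (n - 1)); v' \<in> carrier (W (n - 1)); \<psi> \<in> carrier (W n)\<rbrakk> \<Longrightarrow>
      p n (v \<oplus>\<^bsub>W (n - 1)\<^esub> v') \<psi> = p n v \<psi> \<oplus>\<^bsub>K n\<^esub> p n v' \<psi>"
    and p_add_right: "\<lbrakk>v \<in> carrier (W (n - 1)); \<psi> \<in> carrier (W n); \<psi>' \<in> carrier (W n)\<rbrakk> \<Longrightarrow>
      p n v (\<psi> \<oplus>\<^bsub>W n\<^esub> \<psi>') = p n v \<psi> \<oplus>\<^bsub>K n\<^esub> p n v \<psi>'"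
    and p_rsmult: "\<lbrakk>v \<in> carrier (W (n - 1)); \<psi> \<in> carrier (W n); b \<in> carrier (K n)\<rbrakk> \<Longrightarrow>
      p n (rsmult (W (n - 1)) v b) \<psi> = p n v \<psi> \<otimes>\<^bsub>K n\<^esub> b"
    and p_smult: "\<lbrakk>v \<in> carrier (W (n - 1)); \<psi> \<in> carrier (W n); b \<in> carrier (K n)\<rbrakk> \<Longrightarrow>
      p n v (b \<odot>\<^bsub>W n\<^esub> \<psi>) = b \<otimes>\<^bsub>K n\<^esub> p n v \<psi>"
    and p_middle: "\<lbrakk>v \<in> carrier (W (n - 1)); \<psi> \<in> carrier (W n); a \<in> carrier (K (n - 1))\<rbrakk> \<Longrightarrow>
      p n (a \<odot>\<^bsub>W (n - 1)\<^esub> v) \<psi> = p n v (rsmult (W n) \<psi> a)"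
    and bases_closed [simp]: "x n \<in> carrier (W (n - 1))" "y n \<in> carrier (W (n - 1))"
      "x' n \<in> carrier (W n)" "y' n \<in> carrier (W n)"
    and expand_right: "v \<in> carrier (W (n - 1)) \<Longrightarrow>
      v = rsmult (W (n - 1)) (x n) (p n v (x' n)) \<oplus>\<^bsub>W (n - 1)\<^esub> rsmult (W (n - 1)) (y n) (p n v (y' n))"
    and expand_left: "\<psi> \<in> carrier (W n) \<Longrightarrow>
      \<psi> = (p n (x n) \<psi> \<odot>\<^bsub>W n\<^esub> x' n) \<oplus>\<^bsub>W n\<^esub> (p n (y n) \<psi> \<odot>\<^bsub>W n\<^esub> y' n)"
    and dual [simp]: "p n (x n) (x' n) = \<one>\<^bsub>K n\<^esub>" "p n (x n) (y' n) = \<zero>\<^bsub>K n\<^esub>"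
      "p n (y n) (x' n) = \<zero>\<^bsub>K n\<^esub>" "p n (y n) (y' n) = \<one>\<^bsub>K n\<^esub>"
begin

section \<open>Freeness of the tensor algebra and centrality of its canonical elements\<close>

abbreviation X where "X n \<equiv> mon (n - 1) n [x n]"
abbreviation Y where "Y n \<equiv> mon (n - 1) n [y n]"
abbreviation X' where "X' n \<equiv> mon n (n + 1) [x' n]"
abbreviation Y' where "Y' n \<equiv> mon n (n + 1) [y' n]"

lemma rsmult_pred [simp]:
  "v \<in> carrier (W (n - 1)) \<Longrightarrow> b \<in> carrier (K n) \<Longrightarrow> rsmult (W (n - 1)) v b \<in> carrier (W (n - 1))"
  using W_rsmult[of b "n - 1" v] by simp

lemma mon1_closed [simp]:
  "v \<in> carrier (W (n - 1)) \<Longrightarrow> mon (n - 1) n [v] \<in> carrier (zmod T (n - 1) n)"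
  "\<psi> \<in> carrier (W n) \<Longrightarrow> mon n (n + 1) [\<psi>] \<in> carrier (zmod T n (n + 1))"
  by simp_all

lemma mon1_add:
  "v \<in> carrier (W (n - 1)) \<Longrightarrow> v' \<in> carrier (W (n - 1)) \<Longrightarrow>
    mon (n - 1) n [v \<oplus>\<^bsub>W (n - 1)\<^esub> v'] = mon (n - 1) n [v] \<oplus>\<^bsub>zmod T (n - 1) n\<^esub> mon (n - 1) n [v']"
  "\<psi> \<in> carrier (W n) \<Longrightarrow> \<psi>' \<in> carrier (W n) \<Longrightarrow>
    mon n (n + 1) [\<psi> \<oplus>\<^bsub>W n\<^esub> \<psi>'] = mon n (n + 1) [\<psi>] \<oplus>\<^bsub>zmod T n (n + 1)\<^esub> mon n (n + 1) [\<psi>']"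
  using mon_add[of "[]" v "[]" "n - 1" n v'] mon_add[of "[]" \<psi> "[]" n "n + 1" \<psi>'] by simp_all

lemma mon1_rsmult:
  "v \<in> carrier (W (n - 1)) \<Longrightarrow> b \<in> carrier (K n) \<Longrightarrow>
    mon (n - 1) n [rsmult (W (n - 1)) v b] = zmult T (n - 1) n n (mon (n - 1) n [v]) (Scalar b)"
  using mon_scale_right[of "[]" v "n - 1" n b] by simp

lemma mon1_smult:
  "\<psi> \<in> carrier (W n) \<Longrightarrow> b \<in> carrier (K n) \<Longrightarrow>
    mon n (n + 1) [b \<odot>\<^bsub>W n\<^esub> \<psi>] = zmult T n n (n + 1) (Scalar b) (mon n (n + 1) [\<psi>])"
  using mon_scale_left[of \<psi> "[]" n "n + 1" b] by simp

lemma mon_expand_right: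
  assumes v: "v \<in> carrier (W (n - 1))"
  shows "mon (n - 1) n [v] = zmult T (n - 1) n n (X n) (Scalar (p n v (x' n))) \<oplus>\<^bsub>zmod T (n - 1) n\<^esub>
    zmult T (n - 1) n n (Y n) (Scalar (p n v (y' n)))"
  by (subst expand_right[OF v]) (use v in \<open>simp add: mon1_add mon1_rsmult\<close>)

lemma mon_expand_left:
  assumes v: "\<psi> \<in> carrier (W n)"
  shows "mon n (n + 1) [\<psi>] = zmult T n n (n + 1) (Scalar (p n (x n) \<psi>)) (X' n) \<oplus>\<^bsub>zmod T n (n + 1)\<^esub>
    zmult T n n (n + 1) (Scalar (p n (y n) \<psi>)) (Y' n)"
  by (subst expand_left[OF v]) (use v in \<open>simp add: mon1_add mon1_smult\<close>)

definition \<omega> :: "int \<Rightarrow> ('k, 'w) tensor" where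
  "\<omega> n = zmult T (n - 1) n (n + 1) (X n) (X' n) \<oplus>\<^bsub>zmod T (n - 1) (n + 1)\<^esub>
    zmult T (n - 1) n (n + 1) (Y n) (Y' n)"

text \<open>Both sides expand into the same double sum over the two bases. The coefficients of
  \<open>a x\<close> in the basis \<open>x\<close>, \<open>y\<close> are values of
  \<open>p n (a x)\<close>, those of \<open>x' a\<close> in the basis \<open>x'\<close>,
  \<open>y'\<close> are values of \<open>p n\<close> at \<open>x' a\<close>, and
  \<open>p_middle\<close> says that \<open>a\<close> may sit in either argument.\<close>

lemma central:
  assumes a: "a \<in> carrier (K (n - 1))"
  shows "zmult T (n - 1) (n - 1) (n + 1) (Scalar a) (\<omega> n) = zmult T (n - 1) (n + 1) (n + 1) (\<omega> n) (Scalar a)"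
proof -
  have a': "a \<in> carrier (K (n + 1))" using a by (simp add: K_periodic)
  have left: "zmult T (n - 1) (n - 1) n (Scalar a) (mon (n - 1) n [v]) =
      zmult T (n - 1) n n (X n) (Scalar (p n (a \<odot>\<^bsub>W (n - 1)\<^esub> v) (x' n))) \<oplus>\<^bsub>zmod T (n - 1) n\<^esub>
      zmult T (n - 1) n n (Y n) (Scalar (p n (a \<odot>\<^bsub>W (n - 1)\<^esub> v) (y' n)))"
    if v: "v \<in> carrier (W (n - 1))" for v
    using mon_expand_right[of "a \<odot>\<^bsub>W (n - 1)\<^esub> v" n] mon_scale_left[of v "[]" "n - 1" n a] a v by simp
  have right: "zmult T n (n + 1) (n + 1) (mon n (n + 1) [\<psi>]) (Scalar a) =
      zmult T n n (n + 1) (Scalar (p n (a \<odot>\<^bsub>W (n - 1)\<^esub> x n) \<psi>)) (X' n) \<oplus>\<^bsub>zmod T n (n + 1)\<^esub>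
      zmult T n n (n + 1) (Scalar (p n (a \<odot>\<^bsub>W (n - 1)\<^esub> y n) \<psi>)) (Y' n)"
    if \<psi>: "\<psi> \<in> carrier (W n)" for \<psi>
    using mon_expand_left[of "rsmult (W n) \<psi> a" n] mon_scale_right[of "[]" \<psi> n "n + 1" a] a a' \<psi>
    by (simp add: p_middle)
  have s: "Scalar a \<in> carrier (zmod T (n - 1) (n - 1))" "Scalar a \<in> carrier (zmod T (n + 1) (n + 1))"
    using a a' by simp_all
  have c: "p n (a \<odot>\<^bsub>W (n - 1)\<^esub> v) \<psi> \<in> carrier (K n)"
    if "v \<in> carrier (W (n - 1))" "\<psi> \<in> carrier (W n)" for v \<psi> using a that by simp
  have l: "zmult T (n - 1) (n - 1) (n + 1) (Scalar a) (zmult T (n - 1) n (n + 1) (mon (n - 1) n [v]) t) =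
      zmult T (n - 1) n (n + 1) (zmult T (n - 1) (n - 1) n (Scalar a) (mon (n - 1) n [v])) t"
    if "v \<in> carrier (W (n - 1))" "t \<in> carrier (zmod T n (n + 1))" for v t
    using TA.mu_assoc[OF s(1) mon1_closed(1)[OF that(1)] that(2)] by simp
  have r: "zmult T (n - 1) (n + 1) (n + 1) (zmult T (n - 1) n (n + 1) t (mon n (n + 1) [\<psi>])) (Scalar a) =
      zmult T (n - 1) n (n + 1) t (zmult T n (n + 1) (n + 1) (mon n (n + 1) [\<psi>]) (Scalar a))"
    if "\<psi> \<in> carrier (W n)" "t \<in> carrier (zmod T (n - 1) n)" for \<psi> t
    using TA.mu_assoc[OF that(2) mon1_closed(2)[OF that(1)] s(2)] by simp
  show ?thesis
    using s c unfolding \<omega>_def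
    by (simp add: TA.mu_add l r left right TA.mu_assoc TA.add_ac del: mon_closed)
qed

lemma right_gen_T:
  assumes i: "i \<le> n" and c: "c \<in> carrier (zmod T i (n + 1))"
  shows "\<exists>a\<in>carrier (zmod T i n). \<exists>b\<in>carrier (zmod T i n).
    c = zmult T i n (n + 1) a (X' n) \<oplus>\<^bsub>zmod T i (n + 1)\<^esub> zmult T i n (n + 1) b (Y' n)"
proof -
  have ne: "i \<noteq> n + 1" using i by simp
  show ?thesis
  proof (rule T_induct[OF ne c])
    fix ws assume "ws \<in> words W i (n + 1)"
    then obtain us v where ws: "ws = us @ [v]" "us \<in> words W i n" "v \<in> carrier (W n)"
      using i by (rule words_snoc_ex)
    have "[v] \<in> words W n (n + 1)" using ws by simp
    then have "mon i (n + 1) ws = zmult T i n (n + 1) (mon i n us) (mon n (n + 1) [v])"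
      using ws(1) mon_mult[OF ws(2)] by simp
    also have "\<dots> = zmult T i n (n + 1) (zmult T i n n (mon i n us) (Scalar (p n (x n) v))) (X' n)
        \<oplus>\<^bsub>zmod T i (n + 1)\<^esub> zmult T i n (n + 1) (zmult T i n n (mon i n us) (Scalar (p n (y n) v))) (Y' n)"
      unfolding mon_expand_left[OF ws(3)] using ws(2,3) by (simp add: TA.mu_add TA.mu_assoc)
    finally have eq: "mon i (n + 1) ws = zmult T i n (n + 1) (zmult T i n n (mon i n us) (Scalar (p n (x n) v))) (X' n)
        \<oplus>\<^bsub>zmod T i (n + 1)\<^esub> zmult T i n (n + 1) (zmult T i n n (mon i n us) (Scalar (p n (y n) v))) (Y' n)" .
    show "\<exists>a\<in>carrier (zmod T i n). \<exists>b\<in>carrier (zmod T i n).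
        mon i (n + 1) ws = zmult T i n (n + 1) a (X' n) \<oplus>\<^bsub>zmod T i (n + 1)\<^esub> zmult T i n (n + 1) b (Y' n)"
      by (rule bexI[of _ "zmult T i n n (mon i n us) (Scalar (p n (x n) v))"],
          rule bexI[of _ "zmult T i n n (mon i n us) (Scalar (p n (y n) v))"], rule eq) (use ws(2,3) in simp_all)
  next
    show "\<exists>a\<in>carrier (zmod T i n). \<exists>b\<in>carrier (zmod T i n).
        \<zero>\<^bsub>zmod T i (n + 1)\<^esub> = zmult T i n (n + 1) a (X' n) \<oplus>\<^bsub>zmod T i (n + 1)\<^esub> zmult T i n (n + 1) b (Y' n)"
      by (intro bexI[of _ "\<zero>\<^bsub>zmod T i n\<^esub>"]) simp_all
  next
    fix c d
    assume "\<exists>a\<in>carrier (zmod T i n). \<exists>b\<in>carrier (zmod T i n).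
        c = zmult T i n (n + 1) a (X' n) \<oplus>\<^bsub>zmod T i (n + 1)\<^esub> zmult T i n (n + 1) b (Y' n)"
      "\<exists>a\<in>carrier (zmod T i n). \<exists>b\<in>carrier (zmod T i n).
        d = zmult T i n (n + 1) a (X' n) \<oplus>\<^bsub>zmod T i (n + 1)\<^esub> zmult T i n (n + 1) b (Y' n)"
    then obtain a b a' b' where *: "a \<in> carrier (zmod T i n)" "b \<in> carrier (zmod T i n)"
      "a' \<in> carrier (zmod T i n)" "b' \<in> carrier (zmod T i n)"
      "c = zmult T i n (n + 1) a (X' n) \<oplus>\<^bsub>zmod T i (n + 1)\<^esub> zmult T i n (n + 1) b (Y' n)"
      "d = zmult T i n (n + 1) a' (X' n) \<oplus>\<^bsub>zmod T i (n + 1)\<^esub> zmult T i n (n + 1) b' (Y' n)" by blast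
    show "\<exists>a\<in>carrier (zmod T i n). \<exists>b\<in>carrier (zmod T i n).
        c \<oplus>\<^bsub>zmod T i (n + 1)\<^esub> \<ominus>\<^bsub>zmod T i (n + 1)\<^esub> d =
          zmult T i n (n + 1) a (X' n) \<oplus>\<^bsub>zmod T i (n + 1)\<^esub> zmult T i n (n + 1) b (Y' n)"
      by (rule bexI[of _ "a \<oplus>\<^bsub>zmod T i n\<^esub> \<ominus>\<^bsub>zmod T i n\<^esub> a'"], rule bexI[of _ "b \<oplus>\<^bsub>zmod T i n\<^esub> \<ominus>\<^bsub>zmod T i n\<^esub> b'"])
        (use * in \<open>simp_all add: TA.mu_add TA.mu_neg TA.neg_add TA.add_ac\<close>)
  qed
qed

lemma left_gen_T:
  assumes i: "n \<le> m" and c: "c \<in> carrier (zmod T (n - 1) m)"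
  shows "\<exists>a\<in>carrier (zmod T n m). \<exists>b\<in>carrier (zmod T n m).
    c = zmult T (n - 1) n m (X n) a \<oplus>\<^bsub>zmod T (n - 1) m\<^esub> zmult T (n - 1) n m (Y n) b"
proof -
  have ne: "n - 1 \<noteq> m" and lt: "n - 1 < m" using i by simp_all
  show ?thesis
  proof (rule T_induct[OF ne c])
    fix ws assume "ws \<in> words W (n - 1) m"
    then obtain v us where ws': "ws = v # us" "us \<in> words W (n - 1 + 1) m" "v \<in> carrier (W (n - 1))"
      using lt by (rule words_cons_ex)
    then have ws: "ws = v # us" "us \<in> words W n m" "v \<in> carrier (W (n - 1))" by simp_all
    have "[v] \<in> words W (n - 1) n" using ws by simp
    then have "mon (n - 1) m ws = zmult T (n - 1) n m (mon (n - 1) n [v]) (mon n m us)"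
      using ws(1) mon_mult[OF _ ws(2)] by simp
    also have "\<dots> = zmult T (n - 1) n m (X n) (zmult T n n m (Scalar (p n v (x' n))) (mon n m us))
        \<oplus>\<^bsub>zmod T (n - 1) m\<^esub> zmult T (n - 1) n m (Y n) (zmult T n n m (Scalar (p n v (y' n))) (mon n m us))"
      unfolding mon_expand_right[OF ws(3)] using ws(2,3) by (simp add: TA.mu_add TA.mu_assoc)
    finally have eq: "mon (n - 1) m ws = zmult T (n - 1) n m (X n) (zmult T n n m (Scalar (p n v (x' n))) (mon n m us))
        \<oplus>\<^bsub>zmod T (n - 1) m\<^esub> zmult T (n - 1) n m (Y n) (zmult T n n m (Scalar (p n v (y' n))) (mon n m us))" .
    show "\<exists>a\<in>carrier (zmod T n m). \<exists>b\<in>carrier (zmod T n m).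
        mon (n - 1) m ws = zmult T (n - 1) n m (X n) a \<oplus>\<^bsub>zmod T (n - 1) m\<^esub> zmult T (n - 1) n m (Y n) b"
      by (rule bexI[of _ "zmult T n n m (Scalar (p n v (x' n))) (mon n m us)"],
          rule bexI[of _ "zmult T n n m (Scalar (p n v (y' n))) (mon n m us)"], rule eq) (use ws(2,3) in simp_all)
  next
    show "\<exists>a\<in>carrier (zmod T n m). \<exists>b\<in>carrier (zmod T n m).
        \<zero>\<^bsub>zmod T (n - 1) m\<^esub> = zmult T (n - 1) n m (X n) a \<oplus>\<^bsub>zmod T (n - 1) m\<^esub> zmult T (n - 1) n m (Y n) b"
      by (intro bexI[of _ "\<zero>\<^bsub>zmod T n m\<^esub>"]) simp_all
  next
    fix c d
    assume "\<exists>a\<in>carrier (zmod T n m). \<exists>b\<in>carrier (zmod T n m).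
        c = zmult T (n - 1) n m (X n) a \<oplus>\<^bsub>zmod T (n - 1) m\<^esub> zmult T (n - 1) n m (Y n) b"
      "\<exists>a\<in>carrier (zmod T n m). \<exists>b\<in>carrier (zmod T n m).
        d = zmult T (n - 1) n m (X n) a \<oplus>\<^bsub>zmod T (n - 1) m\<^esub> zmult T (n - 1) n m (Y n) b"
    then obtain a b a' b' where *: "a \<in> carrier (zmod T n m)" "b \<in> carrier (zmod T n m)"
      "a' \<in> carrier (zmod T n m)" "b' \<in> carrier (zmod T n m)"
      "c = zmult T (n - 1) n m (X n) a \<oplus>\<^bsub>zmod T (n - 1) m\<^esub> zmult T (n - 1) n m (Y n) b"
      "d = zmult T (n - 1) n m (X n) a' \<oplus>\<^bsub>zmod T (n - 1) m\<^esub> zmult T (n - 1) n m (Y n) b'" by blast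
    show "\<exists>a\<in>carrier (zmod T n m). \<exists>b\<in>carrier (zmod T n m).
        c \<oplus>\<^bsub>zmod T (n - 1) m\<^esub> \<ominus>\<^bsub>zmod T (n - 1) m\<^esub> d =
          zmult T (n - 1) n m (X n) a \<oplus>\<^bsub>zmod T (n - 1) m\<^esub> zmult T (n - 1) n m (Y n) b"
      by (rule bexI[of _ "a \<oplus>\<^bsub>zmod T n m\<^esub> \<ominus>\<^bsub>zmod T n m\<^esub> a'"], rule bexI[of _ "b \<oplus>\<^bsub>zmod T n m\<^esub> \<ominus>\<^bsub>zmod T n m\<^esub> b'"])
        (use * in \<open>simp_all add: TA.mu_add TA.mu_neg TA.neg_add TA.add_ac\<close>)
  qed
qed

lemma zero_closed_T: "\<zero>\<^bsub>zmod T n n\<^esub> = Scalar \<zero>\<^bsub>K n\<^esub>" "zunit T n = Scalar \<one>\<^bsub>K n\<^esub>"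
  by (simp_all add: zmod_T_diag zunit_T)

lemma Scalar_mult [simp]:
  "t \<in> carrier (zmod T i n) \<Longrightarrow> zmult T i n n t (Scalar \<one>\<^bsub>K n\<^esub>) = t"
  "t \<in> carrier (zmod T i n) \<Longrightarrow> zmult T i n n t (Scalar \<zero>\<^bsub>K n\<^esub>) = \<zero>\<^bsub>zmod T i n\<^esub>"
  "u \<in> carrier (zmod T n m) \<Longrightarrow> zmult T n n m (Scalar \<one>\<^bsub>K n\<^esub>) u = u"
  "u \<in> carrier (zmod T n m) \<Longrightarrow> zmult T n n m (Scalar \<zero>\<^bsub>K n\<^esub>) u = \<zero>\<^bsub>zmod T n m\<^esub>"
  unfolding zero_closed_T[symmetric] by simp_all

text \<open>Contracting the last letter with \<open>p n v\<close> sends the relation to a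
  combination of \<open>a\<close> and \<open>b\<close> with coefficients \<open>p n v (x' n)\<close>
  and \<open>p n v (y' n)\<close>. For \<open>v = x n\<close> and \<open>v = y n\<close> duality
  isolates \<open>a\<close> and \<open>b\<close>.\<close>

lemma right_free_T:
  assumes a: "a \<in> carrier (zmod T i n)" and b: "b \<in> carrier (zmod T i n)"
    and eq: "zmult T i n (n + 1) a (X' n) \<oplus>\<^bsub>zmod T i (n + 1)\<^esub> zmult T i n (n + 1) b (Y' n) = \<zero>\<^bsub>zmod T i (n + 1)\<^esub>"
  shows "a = \<zero>\<^bsub>zmod T i n\<^esub> \<and> b = \<zero>\<^bsub>zmod T i n\<^esub>"
proof (cases "i \<le> n")
  case False
  then show ?thesis using a b below_T[of n i] by auto
next
  case True
  have *: "zmult T i n n a (Scalar (p n v (x' n))) \<oplus>\<^bsub>zmod T i n\<^esub> zmult T i n n b (Scalar (p n v (y' n))) = \<zero>\<^bsub>zmod T i n\<^esub>"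
    if v: "v \<in> carrier (W (n - 1))" for v
  proof -
    obtain h where h: "\<forall>t\<in>carrier (zmod T i (n + 1)). h t \<in> carrier (zmod T i n)"
      "\<forall>t\<in>carrier (zmod T i (n + 1)). \<forall>u\<in>carrier (zmod T i (n + 1)).
        h (t \<oplus>\<^bsub>zmod T i (n + 1)\<^esub> u) = h t \<oplus>\<^bsub>zmod T i n\<^esub> h u"
      "\<forall>t\<in>carrier (zmod T i n). \<forall>\<psi>\<in>carrier (W n).
        h (zmult T i n (n + 1) t (mon n (n + 1) [\<psi>])) = zmult T i n n t (Scalar (p n v \<psi>))"
      using right_functional[OF True, of "p n v"] v p_add_right p_smult by auto
    have "h \<zero>\<^bsub>zmod T i (n + 1)\<^esub> = \<zero>\<^bsub>zmod T i n\<^esub>"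
    proof (rule TA.add_cancel_zero)
      show "h \<zero>\<^bsub>zmod T i (n + 1)\<^esub> = h \<zero>\<^bsub>zmod T i (n + 1)\<^esub> \<oplus>\<^bsub>zmod T i n\<^esub> h \<zero>\<^bsub>zmod T i (n + 1)\<^esub>"
        using h(2) TA.zero_closed[of i "n + 1"] TA.add_zero(1)[OF TA.zero_closed[of i "n + 1"]] by metis
    qed (use h(1) in blast)
    moreover have "h (zmult T i n (n + 1) a (X' n) \<oplus>\<^bsub>zmod T i (n + 1)\<^esub> zmult T i n (n + 1) b (Y' n)) =
        zmult T i n n a (Scalar (p n v (x' n))) \<oplus>\<^bsub>zmod T i n\<^esub> zmult T i n n b (Scalar (p n v (y' n)))"
      using h(2,3) a b by simp
    ultimately show ?thesis using eq by simp
  qed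
  show ?thesis using *[of "x n"] *[of "y n"] a b by simp
qed

lemma left_free_T:
  assumes a: "a \<in> carrier (zmod T n m)" and b: "b \<in> carrier (zmod T n m)"
    and eq: "zmult T (n - 1) n m (X n) a \<oplus>\<^bsub>zmod T (n - 1) m\<^esub> zmult T (n - 1) n m (Y n) b = \<zero>\<^bsub>zmod T (n - 1) m\<^esub>"
  shows "a = \<zero>\<^bsub>zmod T n m\<^esub> \<and> b = \<zero>\<^bsub>zmod T n m\<^esub>"
proof (cases "n \<le> m")
  case False
  then show ?thesis using a b below_T[of m n] by auto
next
  case True
  have *: "zmult T n n m (Scalar (p n (x n) \<psi>)) a \<oplus>\<^bsub>zmod T n m\<^esub> zmult T n n m (Scalar (p n (y n) \<psi>)) b = \<zero>\<^bsub>zmod T n m\<^esub>"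
    if \<psi>: "\<psi> \<in> carrier (W n)" for \<psi>
  proof -
    obtain h where h: "\<forall>t\<in>carrier (zmod T (n - 1) m). h t \<in> carrier (zmod T n m)"
      "\<forall>t\<in>carrier (zmod T (n - 1) m). \<forall>u\<in>carrier (zmod T (n - 1) m).
        h (t \<oplus>\<^bsub>zmod T (n - 1) m\<^esub> u) = h t \<oplus>\<^bsub>zmod T n m\<^esub> h u"
      "\<forall>t\<in>carrier (zmod T n m). \<forall>v\<in>carrier (W (n - 1)).
        h (zmult T (n - 1) n m (mon (n - 1) n [v]) t) = zmult T n n m (Scalar (p n v \<psi>)) t"
      using left_functional[OF True, of "\<lambda>v. p n v \<psi>"] \<psi> p_add_left p_rsmult by auto
    have "h \<zero>\<^bsub>zmod T (n - 1) m\<^esub> = \<zero>\<^bsub>zmod T n m\<^esub>"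
    proof (rule TA.add_cancel_zero)
      show "h \<zero>\<^bsub>zmod T (n - 1) m\<^esub> = h \<zero>\<^bsub>zmod T (n - 1) m\<^esub> \<oplus>\<^bsub>zmod T n m\<^esub> h \<zero>\<^bsub>zmod T (n - 1) m\<^esub>"
        using h(2) TA.zero_closed[of "n - 1" m] TA.add_zero(1)[OF TA.zero_closed[of "n - 1" m]] by metis
    qed (use h(1) in blast)
    moreover have "h (zmult T (n - 1) n m (X n) a \<oplus>\<^bsub>zmod T (n - 1) m\<^esub> zmult T (n - 1) n m (Y n) b) =
        zmult T n n m (Scalar (p n (x n) \<psi>)) a \<oplus>\<^bsub>zmod T n m\<^esub> zmult T n n m (Scalar (p n (y n) \<psi>)) b"
      using h(2,3) a b by simp
    ultimately show ?thesis using eq by simp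
  qed
  show ?thesis using *[of "x' n"] *[of "y' n"] a b by simp
qed

lemma tensor_like_T: "tensor_like T X Y X' Y'"
proof (intro tensor_like.intro z_algebra_T tensor_like_axioms.intro)
  fix n a assume "a \<in> carrier (zmod T (n - 1) (n - 1))"
  then obtain k where k: "k \<in> carrier (K (n - 1))" "a = Scalar k" by (auto simp: zmod_T_diag)
  then have "k \<in> carrier (K (n + 1))" by (simp add: K_periodic)
  then show "\<exists>b\<in>carrier (zmod T (n + 1) (n + 1)).
      zmult T (n - 1) (n - 1) (n + 1) a
       (zmult T (n - 1) n (n + 1) (X n) (X' n) \<oplus>\<^bsub>zmod T (n - 1) (n + 1)\<^esub> zmult T (n - 1) n (n + 1) (Y n) (Y' n)) =
      zmult T (n - 1) (n + 1) (n + 1)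
       (zmult T (n - 1) n (n + 1) (X n) (X' n) \<oplus>\<^bsub>zmod T (n - 1) (n + 1)\<^esub> zmult T (n - 1) n (n + 1) (Y n) (Y' n)) b"
    using central[OF k(1)] k(2) unfolding \<omega>_def by (intro bexI[of _ "Scalar k"]) simp_all
next
  fix n b assume "b \<in> carrier (zmod T (n + 1) (n + 1))"
  then obtain k where k: "k \<in> carrier (K (n + 1))" "b = Scalar k" by (auto simp: zmod_T_diag)
  then have k': "k \<in> carrier (K (n - 1))" by (simp add: K_periodic)
  then show "\<exists>a\<in>carrier (zmod T (n - 1) (n - 1)).
      zmult T (n - 1) (n - 1) (n + 1) a
       (zmult T (n - 1) n (n + 1) (X n) (X' n) \<oplus>\<^bsub>zmod T (n - 1) (n + 1)\<^esub> zmult T (n - 1) n (n + 1) (Y n) (Y' n)) =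
      zmult T (n - 1) (n + 1) (n + 1)
       (zmult T (n - 1) n (n + 1) (X n) (X' n) \<oplus>\<^bsub>zmod T (n - 1) (n + 1)\<^esub> zmult T (n - 1) n (n + 1) (Y n) (Y' n)) b"
    using central[OF k'] k(2) unfolding \<omega>_def by (intro bexI[of _ "Scalar k"]) simp_all
qed (rule field_diagonal_T below_T right_gen_T right_free_T left_gen_T left_free_T mon1_closed bases_closed; assumption?)+

section \<open>The quadratic relations as multiples of the canonical elements\<close>

lemma W_module_zero:
  "\<zero>\<^bsub>W n\<^esub> \<in> carrier (W n)" "v \<in> carrier (W n) \<Longrightarrow> \<zero>\<^bsub>W n\<^esub> \<oplus>\<^bsub>W n\<^esub> v = v"
  "v \<in> carrier (W n) \<Longrightarrow> v \<oplus>\<^bsub>W n\<^esub> \<zero>\<^bsub>W n\<^esub> = v"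
  using left_mod[of n]
  by (simp_all add: module_def abelian_group_def abelian_monoid.zero_closed abelian_monoid.l_zero abelian_monoid.r_zero)

lemma mon1_zero: "mon (n - 1) n [\<zero>\<^bsub>W (n - 1)\<^esub>] = \<zero>\<^bsub>zmod T (n - 1) n\<^esub>"
  by (rule TA.add_cancel_zero) (simp_all add: W_module_zero mon1_add[symmetric])

lemma p_zero:
  assumes "\<psi> \<in> carrier (W n)"
  shows "p n \<zero>\<^bsub>W (n - 1)\<^esub> \<psi> = \<zero>\<^bsub>K n\<^esub>"
proof -
  interpret R: cring "K n" by (rule K_cring)
  have "p n \<zero>\<^bsub>W (n - 1)\<^esub> \<psi> \<oplus>\<^bsub>K n\<^esub> p n \<zero>\<^bsub>W (n - 1)\<^esub> \<psi> = p n \<zero>\<^bsub>W (n - 1)\<^esub> \<psi>"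
    using p_add_left[of "\<zero>\<^bsub>W (n - 1)\<^esub>" n "\<zero>\<^bsub>W (n - 1)\<^esub>" \<psi>] assms by (simp add: W_module_zero)
  then show ?thesis using assms W_module_zero(1)[of "n - 1"] by (metis R.add.l_cancel_one p_closed)
qed

lemma right_module_pred: "module (K n) (right_mod (W (n - 1)))"
  using right_mod[of "n - 1"] by simp

text \<open>Partial sums up to \<open>k \<le> m\<close> are considered so that the induction on
  \<open>k\<close> leaves the hypotheses on the families untouched. Closure of the sum is carried
  along because additivity of \<open>p\<close> requires it.\<close>

lemma p_finsum:
  fixes k m :: nat
  assumes b: "b \<in> {..<m} \<rightarrow> carrier (W (n - 1))" and c: "c \<in> {..<m} \<rightarrow> carrier (K n)" and \<psi>: "\<psi> \<in> carrier (W n)"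
  shows "k \<le> m \<Longrightarrow> (\<Oplus>\<^bsub>right_mod (W (n - 1))\<^esub>s\<in>{..<k}. rsmult (W (n - 1)) (b s) (c s)) \<in> carrier (W (n - 1)) \<and>
    p n (\<Oplus>\<^bsub>right_mod (W (n - 1))\<^esub>s\<in>{..<k}. rsmult (W (n - 1)) (b s) (c s)) \<psi> =
    (\<Oplus>\<^bsub>K n\<^esub>s\<in>{..<k}. p n (b s) \<psi> \<otimes>\<^bsub>K n\<^esub> c s)"
proof (induction k)
  interpret R: module "K n" "right_mod (W (n - 1))" by (rule right_module_pred)
  case 0
  then show ?case using \<psi> R.M.zero_closed by (simp add: p_zero)
next
  interpret R: module "K n" "right_mod (W (n - 1))" by (rule right_module_pred)
  case (Suc k)
  have bc: "b s \<in> carrier (W (n - 1))" "c s \<in> carrier (K n)" if "s \<le> k" for s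
    using that Suc.prems b c by auto
  have "(\<Oplus>\<^bsub>right_mod (W (n - 1))\<^esub>s\<in>{..<Suc k}. rsmult (W (n - 1)) (b s) (c s)) =
      rsmult (W (n - 1)) (b k) (c k) \<oplus>\<^bsub>W (n - 1)\<^esub>
      (\<Oplus>\<^bsub>right_mod (W (n - 1))\<^esub>s\<in>{..<k}. rsmult (W (n - 1)) (b s) (c s))"
    unfolding lessThan_Suc by (subst R.M.finsum_insert) (use bc in \<open>auto simp: less_imp_le\<close>)
  moreover have "(\<Oplus>\<^bsub>K n\<^esub>s\<in>{..<Suc k}. p n (b s) \<psi> \<otimes>\<^bsub>K n\<^esub> c s) =
      p n (b k) \<psi> \<otimes>\<^bsub>K n\<^esub> c k \<oplus>\<^bsub>K n\<^esub> (\<Oplus>\<^bsub>K n\<^esub>s\<in>{..<k}. p n (b s) \<psi> \<otimes>\<^bsub>K n\<^esub> c s)"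
    unfolding lessThan_Suc by (subst R.R.finsum_insert) (use bc \<psi> in \<open>auto simp: less_imp_le\<close>)
  ultimately show ?case
    using Suc bc[of k] \<psi> W_add[of _ "n - 1"] by (simp add: p_add_left p_rsmult)
qed

text \<open>Independence of the canonical element from the basis. Expanding each \<open>b' s\<close>
  in \<open>x'\<close>, \<open>y'\<close> and moving the coefficients to the left factor collects
  the sums of \<open>b s p(x, b' s)\<close> and of \<open>b s p(y, b' s)\<close>; since
  \<open>b\<close> and \<open>b'\<close> are dual, these are \<open>x\<close> and
  \<open>y\<close>.\<close>

lemma quadratic_element:
  assumes a: "a \<in> carrier (K (n - 1))"
    and basis: "is_basis (K n) (right_mod (W (n - 1))) m b" and b': "b' \<in> {..<m} \<rightarrow> carrier (W n)"
    and dual': "\<And>s t. s < m \<Longrightarrow> t < m \<Longrightarrow> p n (b s) (b' t) = (if s = t then \<one>\<^bsub>K n\<^esub> else \<zero>\<^bsub>K n\<^esub>)"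
  shows "(\<Otimes>\<^bsub>component T (n - 1) (n + 1)\<^esub>s\<in>{..<m}. mon (n - 1) (n + 1) [a \<odot>\<^bsub>W (n - 1)\<^esub> b s, b' s]) =
    zmult T (n - 1) (n - 1) (n + 1) (Scalar a) (\<omega> n)"
proof -
  interpret C: comm_group "component T (n - 1) (n + 1)" by (rule comm_group_T)
  interpret R: module "K n" "right_mod (W (n - 1))" by (rule right_module_pred)
  have b: "b \<in> {..<m} \<rightarrow> carrier (W (n - 1))" using basis by (simp add: is_basis_def)
  define d where "d s = p n (x n) (b' s)" for s
  define e where "e s = p n (y n) (b' s)" for s
  have de: "d \<in> {..<m} \<rightarrow> carrier (K n)" "e \<in> {..<m} \<rightarrow> carrier (K n)" using b' by (auto simp: d_def e_def Pi_def)
  \<comment> \<open>\<open>F c k\<close> is a partial linear combination of the basis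
    \<open>b\<close>. With the coefficients \<open>d\<close> and \<open>e\<close> the full
    combinations will be recognized as \<open>x n\<close> and \<open>y n\<close>.\<close>
  define F where "F c k = (\<Oplus>\<^bsub>right_mod (W (n - 1))\<^esub>s\<in>{..<k}. rsmult (W (n - 1)) (b s) (c s))" for c and k :: nat
  have F_closed: "F c k \<in> carrier (W (n - 1))" if "c \<in> {..<m} \<rightarrow> carrier (K n)" "k \<le> m" for c k
    using p_finsum[OF b that(1) bases_closed(3) that(2)] by (simp add: F_def)
  have F_Suc: "F c (Suc k) = rsmult (W (n - 1)) (b k) (c k) \<oplus>\<^bsub>W (n - 1)\<^esub> F c k"
    if c: "c \<in> {..<m} \<rightarrow> carrier (K n)" and k: "Suc k \<le> m" for c k
  proof -
    have bc: "b s \<in> carrier (W (n - 1))" "c s \<in> carrier (K n)" if "s \<le> k" for s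
      using that k b c by auto
    show ?thesis unfolding F_def lessThan_Suc
      by (subst R.M.finsum_insert) (use bc in \<open>auto simp: less_imp_le\<close>)
  qed
  let ?Z = "zmod T (n - 1) (n + 1)"
  let ?G = "\<lambda>k. zmult T (n - 1) (n - 1) (n + 1) (Scalar a)
    (zmult T (n - 1) n (n + 1) (mon (n - 1) n [F d k]) (X' n) \<oplus>\<^bsub>?Z\<^esub>
     zmult T (n - 1) n (n + 1) (mon (n - 1) n [F e k]) (Y' n))"
  have term_eq: "mon (n - 1) (n + 1) [a \<odot>\<^bsub>W (n - 1)\<^esub> b s, b' s] = zmult T (n - 1) (n - 1) (n + 1) (Scalar a)
    (zmult T (n - 1) n (n + 1) (mon (n - 1) n [rsmult (W (n - 1)) (b s) (d s)]) (X' n) \<oplus>\<^bsub>?Z\<^esub>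
     zmult T (n - 1) n (n + 1) (mon (n - 1) n [rsmult (W (n - 1)) (b s) (e s)]) (Y' n))" if s: "s < m" for s
  proof -
    have bs: "b s \<in> carrier (W (n - 1))" "b' s \<in> carrier (W n)" "d s \<in> carrier (K n)" "e s \<in> carrier (K n)"
      using s b b' de by auto
    have "mon (n - 1) (n + 1) [a \<odot>\<^bsub>W (n - 1)\<^esub> b s, b' s] =
        zmult T (n - 1) n (n + 1) (mon (n - 1) n [a \<odot>\<^bsub>W (n - 1)\<^esub> b s]) (mon n (n + 1) [b' s])"
      using mon_mult[of "[a \<odot>\<^bsub>W (n - 1)\<^esub> b s]" "n - 1" n "[b' s]" "n + 1"] bs a by simp
    also have "mon (n - 1) n [a \<odot>\<^bsub>W (n - 1)\<^esub> b s] = zmult T (n - 1) (n - 1) n (Scalar a) (mon (n - 1) n [b s])"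
      using mon_scale_left[of "b s" "[]" "n - 1" n a] bs a by simp
    also have "mon n (n + 1) [b' s] = zmult T n n (n + 1) (Scalar (d s)) (X' n) \<oplus>\<^bsub>zmod T n (n + 1)\<^esub>
        zmult T n n (n + 1) (Scalar (e s)) (Y' n)"
      unfolding d_def e_def by (rule mon_expand_left[OF bs(2)])
    finally show ?thesis using bs a by (simp add: mon1_rsmult TA.mu_add TA.mu_assoc)
  qed
  have closed: "mon (n - 1) (n + 1) [a \<odot>\<^bsub>W (n - 1)\<^esub> b s, b' s] \<in> carrier (component T (n - 1) (n + 1))"
    if s: "s < m" for s
  proof -
    have "[a \<odot>\<^bsub>W (n - 1)\<^esub> b s, b' s] \<in> words W (n - 1) (n + 1)" using s b b' a by auto
    then show ?thesis using mon_closed by (simp add: zmod_simps)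
  qed
  have "k \<le> m \<Longrightarrow> (\<Otimes>\<^bsub>component T (n - 1) (n + 1)\<^esub>s\<in>{..<k}. mon (n - 1) (n + 1) [a \<odot>\<^bsub>W (n - 1)\<^esub> b s, b' s]) = ?G k" for k
  proof (induction k)
    case 0
    have "F c 0 = \<zero>\<^bsub>W (n - 1)\<^esub>" for c by (simp add: F_def)
    then show ?case using a by (simp add: mon1_zero zmod_simps(3)[symmetric])
  next
    case (Suc k)
    have bk: "b k \<in> carrier (W (n - 1))" "d k \<in> carrier (K n)" "e k \<in> carrier (K n)" using Suc.prems b de by auto
    have Fk: "F d k \<in> carrier (W (n - 1))" "F e k \<in> carrier (W (n - 1))" using F_closed de Suc.prems by auto
    have "(\<Otimes>\<^bsub>component T (n - 1) (n + 1)\<^esub>s\<in>{..<Suc k}. mon (n - 1) (n + 1) [a \<odot>\<^bsub>W (n - 1)\<^esub> b s, b' s]) =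
        mon (n - 1) (n + 1) [a \<odot>\<^bsub>W (n - 1)\<^esub> b k, b' k] \<oplus>\<^bsub>?Z\<^esub> ?G k"
      unfolding lessThan_Suc
      by (subst C.finprod_insert) (use Suc closed in \<open>auto simp: zmod_simps(2)\<close>)
    also have "\<dots> = ?G (Suc k)"
      using term_eq[of k] Suc.prems bk Fk a
      by (simp add: F_Suc[OF de(1)] F_Suc[OF de(2)] mon1_add TA.mu_add TA.add_ac)
    finally show ?case .
  qed
  then have "(\<Otimes>\<^bsub>component T (n - 1) (n + 1)\<^esub>s\<in>{..<m}. mon (n - 1) (n + 1) [a \<odot>\<^bsub>W (n - 1)\<^esub> b s, b' s]) = ?G m"
    by simp
  \<comment> \<open>Applying \<open>p n\<close> with second argument \<open>b' t\<close> to an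
    expansion of \<open>v\<close> in the basis \<open>b\<close> leaves only the coordinate number
    \<open>t\<close>.\<close>
  moreover have "F (\<lambda>s. p n v (b' s)) m = v" if v: "v \<in> carrier (W (n - 1))" for v
  proof -
    obtain c where c: "c \<in> {..<m} \<rightarrow>\<^sub>E carrier (K n)" "v = F c m"
      using basis v unfolding is_basis_def F_def by auto
    have c': "c \<in> {..<m} \<rightarrow> carrier (K n)" using c(1) by auto
    have "p n v (b' t) = c t" if t: "t < m" for t
    proof -
      have "p n v (b' t) = (\<Oplus>\<^bsub>K n\<^esub>s\<in>{..<m}. p n (b s) (b' t) \<otimes>\<^bsub>K n\<^esub> c s)"
        using p_finsum[OF b c', of "b' t" m] t b' by (auto simp: c(2) F_def)
      also have "\<dots> = (\<Oplus>\<^bsub>K n\<^esub>s\<in>{..<m}. if t = s then c s else \<zero>\<^bsub>K n\<^esub>)"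
        by (rule R.R.finsum_cong') (use c' t dual' in \<open>auto dest: Pi_mem\<close>)
      also have "\<dots> = c t" using t c' by (intro R.R.finsum_singleton) auto
      finally show ?thesis .
    qed
    then have "F (\<lambda>s. p n v (b' s)) m = F c m" unfolding F_def
      by (intro R.M.finsum_cong' refl) (auto intro!: rsmult_pred Pi_mem[OF b] Pi_mem[OF c'])
    then show ?thesis using c(2) by simp
  qed
  ultimately show ?thesis unfolding \<omega>_def d_def e_def by simp
qed

text \<open>With \<open>a = 1\<close> and this basis, the canonical element itself appears among the
  quadratic relations; together with \<open>quadratic_element\<close> this places them where
  \<open>ncs_quotient\<close> requires.\<close>

lemma is_basis_pair: "is_basis (K n) (right_mod (W (n - 1))) 2 (\<lambda>s. if s = 0 then x n else y n)"
  unfolding is_basis_def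
proof (intro conjI ballI)
  interpret R: module "K n" "right_mod (W (n - 1))" by (rule right_module_pred)
  have two: "{..<2::nat} = {0, 1::nat}" by auto
  show "(\<lambda>s. if s = 0 then x n else y n) \<in> {..<2::nat} \<rightarrow> carrier (right_mod (W (n - 1)))" by auto
  have sum: "(\<Oplus>\<^bsub>right_mod (W (n - 1))\<^esub>s\<in>{..<2::nat}. c s \<odot>\<^bsub>right_mod (W (n - 1))\<^esub> (if s = 0 then x n else y n)) =
      rsmult (W (n - 1)) (x n) (c 0) \<oplus>\<^bsub>W (n - 1)\<^esub> rsmult (W (n - 1)) (y n) (c 1)"
    if c: "c \<in> {..<2::nat} \<rightarrow> carrier (K n)" for c
  proof -
    have "c 0 \<in> carrier (K n)" "c 1 \<in> carrier (K n)" using c by auto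
    then show ?thesis unfolding two by (subst R.M.finsum_insert) (auto simp: R.M.finsum_insert W_module_zero)
  qed
  fix v assume "v \<in> carrier (right_mod (W (n - 1)))"
  then have v: "v \<in> carrier (W (n - 1))" by simp
  let ?c = "\<lambda>s\<in>{..<2::nat}. if s = 0 then p n v (x' n) else p n v (y' n)"
  have c: "?c \<in> {..<2::nat} \<rightarrow>\<^sub>E carrier (K n)" using v by auto
  show "\<exists>!c. c \<in> {..<2::nat} \<rightarrow>\<^sub>E carrier (K n) \<and>
    v = (\<Oplus>\<^bsub>right_mod (W (n - 1))\<^esub>s\<in>{..<2::nat}. c s \<odot>\<^bsub>right_mod (W (n - 1))\<^esub> (if s = 0 then x n else y n))"
  proof (rule ex1I[of _ ?c], intro conjI c)
    have "?c \<in> {..<2::nat} \<rightarrow> carrier (K n)" using c by (auto simp: PiE_def)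
    then show "v = (\<Oplus>\<^bsub>right_mod (W (n - 1))\<^esub>s\<in>{..<2::nat}. ?c s \<odot>\<^bsub>right_mod (W (n - 1))\<^esub> (if s = 0 then x n else y n))"
      unfolding sum[OF \<open>?c \<in> {..<2::nat} \<rightarrow> carrier (K n)\<close>] using expand_right[OF v] by simp
  next
    fix c assume c: "c \<in> {..<2::nat} \<rightarrow>\<^sub>E carrier (K n) \<and>
      v = (\<Oplus>\<^bsub>right_mod (W (n - 1))\<^esub>s\<in>{..<2::nat}. c s \<odot>\<^bsub>right_mod (W (n - 1))\<^esub> (if s = 0 then x n else y n))"
    then have cc: "c \<in> {..<2::nat} \<rightarrow> carrier (K n)" by auto
    have veq: "v = rsmult (W (n - 1)) (x n) (c 0) \<oplus>\<^bsub>W (n - 1)\<^esub> rsmult (W (n - 1)) (y n) (c 1)"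
      using c sum[OF cc] by simp
    have c01: "c 0 \<in> carrier (K n)" "c 1 \<in> carrier (K n)" using cc by auto
    have "p n v (x' n) = c 0" "p n v (y' n) = c 1"
      using c01 unfolding veq by (simp_all add: p_add_left p_rsmult)
    then show "c = ?c" using c by (intro ext) (auto simp: PiE_def extensional_def less_2_cases_iff)
  qed
qed

lemma \<omega>_eq:
  "\<omega> \<equiv> \<lambda>n. zmult T (n - 1) n (n + 1) (X n) (X' n) \<oplus>\<^bsub>zmod T (n - 1) (n + 1)\<^esub>
    zmult T (n - 1) n (n + 1) (Y n) (Y' n)"
  by (rule eq_reflection, simp add: \<omega>_def fun_eq_iff)

theorem ncs_algebra_nc_symmetric:
  assumes p: "\<And>n v \<psi>. p n v \<psi> = pairing \<theta> (n - 1) v \<psi>"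
  shows "\<exists>x y x' y'. ncs_algebra (nc_symmetric_algebra K W \<theta>) x y x' y'"
proof -
  interpret TL: tensor_like T X Y X' Y' \<omega>
    by (rule tensor_like_T) (rule \<omega>_eq)
  have elem: "t \<in> quadratic_relations K W \<theta> i \<longleftrightarrow> (\<exists>a m b b'. a \<in> carrier (K i) \<and>
      is_basis (K (i + 1)) (right_mod (W i)) m b \<and> b' \<in> {..<m} \<rightarrow> carrier (W (i + 1)) \<and>
      (\<forall>s<m. \<forall>t<m. p (i + 1) (b s) (b' t) = (if s = t then \<one>\<^bsub>K (i + 1)\<^esub> else \<zero>\<^bsub>K (i + 1)\<^esub>)) \<and>
      t = (\<Otimes>\<^bsub>component T i (i + 2)\<^esub>s\<in>{..<m}. mon i (i + 2) [a \<odot>\<^bsub>W i\<^esub> b s, b' s]))" for t i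
    unfolding quadratic_relations_def mem_Collect_eq
    by (intro iff_exI) (auto simp: p pure_tensor_mon tensor_zalg_def)
  have val: "(\<Otimes>\<^bsub>component T i (i + 2)\<^esub>s\<in>{..<m}. mon i (i + 2) [a \<odot>\<^bsub>W i\<^esub> b s, b' s]) =
      zmult T i i (i + 2) (Scalar a) (\<omega> (i + 1))"
    if "a \<in> carrier (K i)" "is_basis (K (i + 1)) (right_mod (W i)) m b" "b' \<in> {..<m} \<rightarrow> carrier (W (i + 1))"
      "\<forall>s<m. \<forall>t<m. p (i + 1) (b s) (b' t) = (if s = t then \<one>\<^bsub>K (i + 1)\<^esub> else \<zero>\<^bsub>K (i + 1)\<^esub>)" for a m b b' i
    using quadratic_element[of a "i + 1" m b b'] that by (simp add: add.commute[of 2 i])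
  let ?S = "\<lambda>i j. if j = i + 2 then quadratic_relations K W \<theta> i else {}"
  have "?S i j \<subseteq> {t. TL.rels i j t}" for i j
  proof
    fix t assume "t \<in> ?S i j"
    then have j: "j = i + 2" and tq: "t \<in> quadratic_relations K W \<theta> i" by (auto split: if_splits)
    obtain a m b b' where h: "a \<in> carrier (K i)" "is_basis (K (i + 1)) (right_mod (W i)) m b"
      "b' \<in> {..<m} \<rightarrow> carrier (W (i + 1))"
      "\<forall>s<m. \<forall>t<m. p (i + 1) (b s) (b' t) = (if s = t then \<one>\<^bsub>K (i + 1)\<^esub> else \<zero>\<^bsub>K (i + 1)\<^esub>)"
      "t = (\<Otimes>\<^bsub>component T i (i + 2)\<^esub>s\<in>{..<m}. mon i (i + 2) [a \<odot>\<^bsub>W i\<^esub> b s, b' s])"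
      using tq[unfolded elem] by (elim exE conjE) (rule that; assumption)
    have a: "a \<in> carrier (K i)" "t = zmult T i i (i + 2) (Scalar a) (\<omega> (i + 1))"
      using h(1) h(5)[unfolded val[OF h(1-4)]] .
    have "TL.rels i (i + 2) (\<omega> (i + 1))" using TL.rels_w[of "i + 1"] by (simp add: add.commute[of 2 i])
    then show "t \<in> {t. TL.rels i j t}" using TL.rels_mult_left[of i "i + 2" "\<omega> (i + 1)" "Scalar a" i] a j by simp
  qed
  moreover have "\<omega> n \<in> ?S (n - 1) (n + 1)" for n
  proof -
    have one: "\<one>\<^bsub>K (n - 1)\<^esub> \<in> carrier (K (n - 1))" by simp
    have "\<omega> n = zmult T (n - 1) (n - 1) (n + 1) (Scalar \<one>\<^bsub>K (n - 1)\<^esub>) (\<omega> n)"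
      using TL.w_closed[of n] by simp
    also have "\<dots> = (\<Otimes>\<^bsub>component T (n - 1) (n + 1)\<^esub>s\<in>{..<2::nat}. mon (n - 1) (n + 1)
        [\<one>\<^bsub>K (n - 1)\<^esub> \<odot>\<^bsub>W (n - 1)\<^esub> (if s = 0 then x n else y n), (if s = 0 then x' n else y' n)])"
      by (rule quadratic_element[OF one is_basis_pair, symmetric]) auto
    finally have eq: "\<omega> n = (\<Otimes>\<^bsub>component T (n - 1) (n + 1)\<^esub>s\<in>{..<2::nat}. mon (n - 1) (n + 1)
        [\<one>\<^bsub>K (n - 1)\<^esub> \<odot>\<^bsub>W (n - 1)\<^esub> (if s = 0 then x n else y n), (if s = 0 then x' n else y' n)])" .
    have idx: "n - 1 + 1 = n" "n - 1 + 2 = n + 1" by simp_all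
    have "\<omega> n \<in> quadratic_relations K W \<theta> (n - 1)"
      by (rule elem[THEN iffD2], unfold idx, rule exI[of _ "\<one>\<^bsub>K (n - 1)\<^esub>"], rule exI[of _ 2],
          rule exI[of _ "\<lambda>s. if s = 0 then x n else y n"], rule exI[of _ "\<lambda>s. if s = 0 then x' n else y' n"],
          intro conjI one is_basis_pair eq)
        (auto simp: less_2_cases_iff)
    then show ?thesis by simp
  qed
  ultimately show ?thesis
    unfolding nc_symmetric_algebra_def by (rule TL.ncs_quotient)
qed

end

section \<open>Duals of bimodules of rank two\<close>

text \<open>In rank two an explicit pair with two coefficients replaces families over
  \<open>{..<2}\<close>, so that the arguments on duals run without finite sums.\<close>

definition is_pair_basis ::
  "('k, 'c) ring_scheme \<Rightarrow> ('k, 'v, 'd) module_scheme \<Rightarrow> 'v \<Rightarrow> 'v \<Rightarrow> bool" where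
  "is_pair_basis R M x y \<longleftrightarrow> x \<in> carrier M \<and> y \<in> carrier M \<and>
     (\<forall>v\<in>carrier M. \<exists>a\<in>carrier R. \<exists>b\<in>carrier R. v = a \<odot>\<^bsub>M\<^esub> x \<oplus>\<^bsub>M\<^esub> b \<odot>\<^bsub>M\<^esub> y) \<and>
     (\<forall>a\<in>carrier R. \<forall>b\<in>carrier R. a \<odot>\<^bsub>M\<^esub> x \<oplus>\<^bsub>M\<^esub> b \<odot>\<^bsub>M\<^esub> y = \<zero>\<^bsub>M\<^esub> \<longrightarrow> a = \<zero>\<^bsub>R\<^esub> \<and> b = \<zero>\<^bsub>R\<^esub>)"

context fspace
begin

text \<open>A vector outside the span of \<open>x\<close> and \<open>y\<close> would extend their
  flag to length three inside a space of dimension two.\<close>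

lemma len_2_is_pair_basis:
  assumes len: "len R M (carrier M) 2" and x: "x \<in> carrier M" "x \<noteq> \<zero>\<^bsub>M\<^esub>"
    and y: "y \<in> carrier M" "\<And>a. a \<in> carrier R \<Longrightarrow> y \<noteq> a \<odot>\<^bsub>M\<^esub> x"
  shows "is_pair_basis R M x y"
proof -
  let ?X = "{a \<odot>\<^bsub>M\<^esub> x | a. a \<in> carrier R}"
  have X1: "len R M ?X 1" by (rule len_line[OF x])
  have X: "subsp R M ?X" by (rule len_subsp[OF X1])
  have yX: "y \<notin> ?X" using y(2) by auto
  have A2: "len R M (adjoin R M ?X y) (Suc 1)" by (rule len.step[OF X1 y(1) yX])
  have sub: "adjoin R M ?X y \<subseteq> carrier M" using subspD(1)[OF len_subsp[OF A2]] by blast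
  have "carrier M \<subseteq> adjoin R M ?X y"
  proof
    fix e assume e: "e \<in> carrier M"
    show "e \<in> adjoin R M ?X y"
    proof (rule ccontr)
      assume ne: "e \<notin> adjoin R M ?X y"
      have "Suc (Suc 1) \<le> 2"
        by (rule len_mono[OF len len.step[OF A2 e ne] adjoin_least[OF subsp_carrier sub e]])
      then show False by simp
    qed
  qed
  then have span: "\<exists>a\<in>carrier R. \<exists>b\<in>carrier R. v = a \<odot>\<^bsub>M\<^esub> x \<oplus>\<^bsub>M\<^esub> b \<odot>\<^bsub>M\<^esub> y" if "v \<in> carrier M" for v
    using that by (fastforce simp: adjoin_iff)
  have "a = \<zero> \<and> b = \<zero>" if a: "a \<in> carrier R" and b: "b \<in> carrier R"
    and eq: "a \<odot>\<^bsub>M\<^esub> x \<oplus>\<^bsub>M\<^esub> b \<odot>\<^bsub>M\<^esub> y = \<zero>\<^bsub>M\<^esub>" for a b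
  proof -
    have aX: "a \<odot>\<^bsub>M\<^esub> x \<in> ?X" using a by blast
    have "a \<odot>\<^bsub>M\<^esub> x \<oplus>\<^bsub>M\<^esub> b \<odot>\<^bsub>M\<^esub> y \<in> ?X" unfolding eq by (rule subspD(2)[OF X])
    then have "b \<odot>\<^bsub>M\<^esub> y \<in> ?X" by (rule subsp_cancel[OF X aX smult_closed[OF b y(1)]])
    then have b0: "b = \<zero>" using subsp_smultD[OF X b _ y(1)] yX by blast
    then have "a \<odot>\<^bsub>M\<^esub> x = \<zero>\<^bsub>M\<^esub>" using eq a x(1) y(1) by simp
    then have "a = \<zero>" using subsp_smultD[OF subsp_zero a _ x(1)] x(2) by auto
    then show ?thesis using b0 by simp
  qed
  then show ?thesis unfolding is_pair_basis_def using x(1) y(1) span by blast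
qed

lemma is_pair_basis_nonzero:
  assumes b: "is_pair_basis R M x y"
  shows "x \<noteq> \<zero>\<^bsub>M\<^esub>" "a \<in> carrier R \<Longrightarrow> y \<noteq> a \<odot>\<^bsub>M\<^esub> x"
proof -
  have xy: "x \<in> carrier M" "y \<in> carrier M" using b by (auto simp: is_pair_basis_def)
  have indep: "a = \<zero> \<and> b = \<zero>"
    if "a \<in> carrier R" "b \<in> carrier R" "a \<odot>\<^bsub>M\<^esub> x \<oplus>\<^bsub>M\<^esub> b \<odot>\<^bsub>M\<^esub> y = \<zero>\<^bsub>M\<^esub>" for a b
    using b that by (auto simp: is_pair_basis_def)
  show "x \<noteq> \<zero>\<^bsub>M\<^esub>" using indep[of \<one> \<zero>] xy by auto
  show "y \<noteq> a \<odot>\<^bsub>M\<^esub> x" if a: "a \<in> carrier R"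
  proof
    assume "y = a \<odot>\<^bsub>M\<^esub> x"
    then have "(\<ominus> a) \<odot>\<^bsub>M\<^esub> x \<oplus>\<^bsub>M\<^esub> \<one> \<odot>\<^bsub>M\<^esub> y = \<zero>\<^bsub>M\<^esub>"
      using xy a by (simp add: smult_l_minus M.l_neg)
    then show False using indep[of "\<ominus> a" \<one>] a by auto
  qed
qed

lemma is_pair_basis_len_2:
  assumes b: "is_pair_basis R M x y"
  shows "len R M (carrier M) 2"
proof -
  let ?X = "{a \<odot>\<^bsub>M\<^esub> x | a. a \<in> carrier R}"
  have xy: "x \<in> carrier M" "y \<in> carrier M" using b by (auto simp: is_pair_basis_def)
  have X1: "len R M ?X 1" by (rule len_line[OF xy(1) is_pair_basis_nonzero(1)[OF b]])
  have yX: "y \<notin> ?X" using is_pair_basis_nonzero(2)[OF b] by blast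
  have A2: "len R M (adjoin R M ?X y) (Suc 1)" by (rule len.step[OF X1 xy(2) yX])
  have "adjoin R M ?X y \<subseteq> carrier M" using subspD(1)[OF len_subsp[OF A2]] by blast
  moreover have "carrier M \<subseteq> adjoin R M ?X y"
    using b unfolding is_pair_basis_def adjoin_iff subset_eq by blast
  ultimately have "adjoin R M ?X y = carrier M" by (rule equalityI)
  then show ?thesis using A2 by (simp add: numeral_2_eq_2)
qed

lemma is_pair_basis_exchange:
  assumes "is_pair_basis R M x y" "v \<in> carrier M" "v \<noteq> \<zero>\<^bsub>M\<^esub>" "w \<in> carrier M"
    "\<And>a. a \<in> carrier R \<Longrightarrow> w \<noteq> a \<odot>\<^bsub>M\<^esub> v"
  shows "is_pair_basis R M v w"
  using len_2_is_pair_basis[OF is_pair_basis_len_2[OF assms(1)] assms(2-5)] .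

lemma is_pair_basis_unique:
  assumes b: "is_pair_basis R M x y" and c: "a \<in> carrier R" "b \<in> carrier R" "a' \<in> carrier R" "b' \<in> carrier R"
    and eq: "a \<odot>\<^bsub>M\<^esub> x \<oplus>\<^bsub>M\<^esub> b \<odot>\<^bsub>M\<^esub> y = a' \<odot>\<^bsub>M\<^esub> x \<oplus>\<^bsub>M\<^esub> b' \<odot>\<^bsub>M\<^esub> y"
  shows "a = a' \<and> b = b'"
proof -
  have xy: "x \<in> carrier M" "y \<in> carrier M" using b by (auto simp: is_pair_basis_def)
  have "(a \<ominus> a') \<odot>\<^bsub>M\<^esub> x \<oplus>\<^bsub>M\<^esub> (b \<ominus> b') \<odot>\<^bsub>M\<^esub> y =
      (a \<odot>\<^bsub>M\<^esub> x \<oplus>\<^bsub>M\<^esub> b \<odot>\<^bsub>M\<^esub> y) \<oplus>\<^bsub>M\<^esub> \<ominus>\<^bsub>M\<^esub> (a' \<odot>\<^bsub>M\<^esub> x \<oplus>\<^bsub>M\<^esub> b' \<odot>\<^bsub>M\<^esub> y)"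
    using c xy by (simp add: R.minus_eq smult_l_distr smult_l_minus M.minus_add M.a_ac)
  also have "\<dots> = \<zero>\<^bsub>M\<^esub>" unfolding eq using c xy by (simp add: M.r_neg)
  finally have "a \<ominus> a' = \<zero> \<and> b \<ominus> b' = \<zero>" using b c by (auto simp: is_pair_basis_def)
  moreover have "s = (s \<ominus> t) \<oplus> t" if "s \<in> carrier R" "t \<in> carrier R" for s t
    using that by (simp add: R.minus_eq R.a_assoc R.l_neg)
  ultimately show ?thesis using c R.l_zero by metis
qed

lemma has_dimension_2_is_pair_basis:
  assumes "has_dimension R M 2"
  shows "\<exists>x y. is_pair_basis R M x y"
proof -
  obtain e where e: "e \<in> {..<2::nat} \<rightarrow> carrier M" and
    uniq: "\<And>v. v \<in> carrier M \<Longrightarrow> \<exists>!c. c \<in> {..<2::nat} \<rightarrow>\<^sub>E carrier R \<and> v = (\<Oplus>\<^bsub>M\<^esub>s\<in>{..<2::nat}. c s \<odot>\<^bsub>M\<^esub> e s)"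
    using assms unfolding has_dimension_def is_basis_def by auto
  have two: "{..<2::nat} = {0, 1}" by auto
  have e01: "e 0 \<in> carrier M" "e 1 \<in> carrier M" using e by auto
  have sum: "(\<Oplus>\<^bsub>M\<^esub>s\<in>{..<2::nat}. c s \<odot>\<^bsub>M\<^esub> e s) = c 0 \<odot>\<^bsub>M\<^esub> e 0 \<oplus>\<^bsub>M\<^esub> c 1 \<odot>\<^bsub>M\<^esub> e 1"
    if "c \<in> {..<2::nat} \<rightarrow> carrier R" for c
  proof -
    have "c 0 \<in> carrier R" "c 1 \<in> carrier R" using that by auto
    then show ?thesis unfolding two using e01 by (subst M.finsum_insert) (auto simp: M.finsum_insert)
  qed
  have "is_pair_basis R M (e 0) (e 1)" unfolding is_pair_basis_def
  proof (intro conjI ballI impI e01)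
    fix v assume "v \<in> carrier M"
    then obtain c where c: "c \<in> {..<2::nat} \<rightarrow>\<^sub>E carrier R" "v = (\<Oplus>\<^bsub>M\<^esub>s\<in>{..<2::nat}. c s \<odot>\<^bsub>M\<^esub> e s)"
      using uniq by blast
    have c': "c \<in> {..<2::nat} \<rightarrow> carrier R" using c(1) by auto
    then have "c 0 \<in> carrier R" "c 1 \<in> carrier R" by auto
    then show "\<exists>a\<in>carrier R. \<exists>b\<in>carrier R. v = a \<odot>\<^bsub>M\<^esub> e 0 \<oplus>\<^bsub>M\<^esub> b \<odot>\<^bsub>M\<^esub> e 1"
      using c(2) sum[OF c'] by blast
  next
    fix a b assume ab: "a \<in> carrier R" "b \<in> carrier R" and eq: "a \<odot>\<^bsub>M\<^esub> e 0 \<oplus>\<^bsub>M\<^esub> b \<odot>\<^bsub>M\<^esub> e 1 = \<zero>\<^bsub>M\<^esub>"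
    define c where "c = (\<lambda>s\<in>{..<2::nat}. if s = 0 then a else b)"
    define d where "d = (\<lambda>s\<in>{..<2::nat}. \<zero>)"
    have cd: "c \<in> {..<2::nat} \<rightarrow>\<^sub>E carrier R" "d \<in> {..<2::nat} \<rightarrow>\<^sub>E carrier R"
      using ab by (auto simp: c_def d_def)
    then have cd': "c \<in> {..<2::nat} \<rightarrow> carrier R" "d \<in> {..<2::nat} \<rightarrow> carrier R" by auto
    have vals: "c 0 = a" "c 1 = b" "d 0 = \<zero>" "d 1 = \<zero>" by (simp_all add: c_def d_def)
    have "\<zero>\<^bsub>M\<^esub> = (\<Oplus>\<^bsub>M\<^esub>s\<in>{..<2::nat}. c s \<odot>\<^bsub>M\<^esub> e s)" "\<zero>\<^bsub>M\<^esub> = (\<Oplus>\<^bsub>M\<^esub>s\<in>{..<2::nat}. d s \<odot>\<^bsub>M\<^esub> e s)"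
      using sum[OF cd'(1)] sum[OF cd'(2)] eq e01 by (simp_all add: vals[unfolded One_nat_def])
    then have "c = d" using uniq[OF M.zero_closed] cd by blast
    then show "a = \<zero>" "b = \<zero>" using vals by simp_all
  qed
  then show ?thesis by blast
qed

end

section \<open>Pairings of bimodules and dual bases\<close>

locale bimodule_fields = bimodule L M V + L: field L + M: field M for L M :: "'k ring" and V :: "('k, 'v) bimodule"
begin

sublocale l: fspace L V by (rule fspace.intro[OF left_module L.field_axioms])

lemma right_fspace: "fspace M (right_mod V)" by (rule fspace.intro[OF right_module M.field_axioms])

lemma rs_closed [simp]: "v \<in> carrier V \<Longrightarrow> b \<in> carrier M \<Longrightarrow> rsmult V v b \<in> carrier V"
  using module.smult_closed[OF right_module] by simp

lemma rs_zero_one [simp]: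
  "v \<in> carrier V \<Longrightarrow> rsmult V v \<one>\<^bsub>M\<^esub> = v" "v \<in> carrier V \<Longrightarrow> rsmult V v \<zero>\<^bsub>M\<^esub> = \<zero>\<^bsub>V\<^esub>"
  "b \<in> carrier M \<Longrightarrow> rsmult V \<zero>\<^bsub>V\<^esub> b = \<zero>\<^bsub>V\<^esub>"
  using module.smult_one[OF right_module] module.smult_l_null[OF right_module] module.smult_r_null[OF right_module]
  by simp_all

lemma rs_assoc: "v \<in> carrier V \<Longrightarrow> a \<in> carrier M \<Longrightarrow> b \<in> carrier M \<Longrightarrow>
    rsmult V (rsmult V v a) b = rsmult V v (a \<otimes>\<^bsub>M\<^esub> b)"
  using module.smult_assoc1[OF right_module, of b a v] by (simp add: M.m_comm)

lemma rs_add: "v \<in> carrier V \<Longrightarrow> w \<in> carrier V \<Longrightarrow> b \<in> carrier M \<Longrightarrow>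
    rsmult V (v \<oplus>\<^bsub>V\<^esub> w) b = rsmult V v b \<oplus>\<^bsub>V\<^esub> rsmult V w b"
  using module.smult_r_distr[OF right_module, of b v w] by simp

lemma rs_add_scalar: "v \<in> carrier V \<Longrightarrow> a \<in> carrier M \<Longrightarrow> b \<in> carrier M \<Longrightarrow>
    rsmult V v (a \<oplus>\<^bsub>M\<^esub> b) = rsmult V v a \<oplus>\<^bsub>V\<^esub> rsmult V v b"
  using module.smult_l_distr[OF right_module, of a b v] by simp

end

locale bimodule_pairing = V: bimodule_fields L M V + U: bimodule_fields M L U
  for L M :: "'k ring" and V :: "('k, 'v) bimodule" and U :: "('k, 'u) bimodule" +
  fixes p :: "'v \<Rightarrow> 'u \<Rightarrow> 'k"
  assumes p_closed [simp]: "v \<in> carrier V \<Longrightarrow> u \<in> carrier U \<Longrightarrow> p v u \<in> carrier M"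
    and p_add_left: "\<lbrakk>v \<in> carrier V; v' \<in> carrier V; u \<in> carrier U\<rbrakk> \<Longrightarrow>
      p (v \<oplus>\<^bsub>V\<^esub> v') u = p v u \<oplus>\<^bsub>M\<^esub> p v' u"
    and p_add_right: "\<lbrakk>v \<in> carrier V; u \<in> carrier U; u' \<in> carrier U\<rbrakk> \<Longrightarrow>
      p v (u \<oplus>\<^bsub>U\<^esub> u') = p v u \<oplus>\<^bsub>M\<^esub> p v u'"
    and p_rsmult: "\<lbrakk>v \<in> carrier V; u \<in> carrier U; b \<in> carrier M\<rbrakk> \<Longrightarrow> p (rsmult V v b) u = p v u \<otimes>\<^bsub>M\<^esub> b"
    and p_smult: "\<lbrakk>v \<in> carrier V; u \<in> carrier U; b \<in> carrier M\<rbrakk> \<Longrightarrow> p v (b \<odot>\<^bsub>U\<^esub> u) = b \<otimes>\<^bsub>M\<^esub> p v u"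
    and p_middle: "\<lbrakk>v \<in> carrier V; u \<in> carrier U; a \<in> carrier L\<rbrakk> \<Longrightarrow> p (a \<odot>\<^bsub>V\<^esub> v) u = p v (rsmult U u a)"

text \<open>Dual bases for the pairing express at once that \<open>U\<close> is the right dual of
  \<open>V\<close> and \<open>V\<close> the left dual of \<open>U\<close>. This formulation does not
  prefer either side and so is stable under flipping.\<close>

locale dual_pair = bimodule_pairing +
  fixes x y x' y'
  assumes bases_closed [simp]: "x \<in> carrier V" "y \<in> carrier V" "x' \<in> carrier U" "y' \<in> carrier U"
    and expand_right: "v \<in> carrier V \<Longrightarrow> v = rsmult V x (p v x') \<oplus>\<^bsub>V\<^esub> rsmult V y (p v y')"
    and expand_left: "u \<in> carrier U \<Longrightarrow> u = p x u \<odot>\<^bsub>U\<^esub> x' \<oplus>\<^bsub>U\<^esub> p y u \<odot>\<^bsub>U\<^esub> y'"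
    and dual [simp]: "p x x' = \<one>\<^bsub>M\<^esub>" "p x y' = \<zero>\<^bsub>M\<^esub>" "p y x' = \<zero>\<^bsub>M\<^esub>" "p y y' = \<one>\<^bsub>M\<^esub>"

text \<open>The coordinate functions of the basis \<open>x\<close>, \<open>y\<close> are right
  linear, hence represented by elements \<open>x'\<close>, \<open>y'\<close> of \<open>U\<close>.
  The expansion of an arbitrary \<open>u\<close> is then checked as an equality of
  functionals.\<close>

lemma (in bimodule_pairing) dual_pairI:
  assumes represent: "\<And>f. \<lbrakk>\<And>v. v \<in> carrier V \<Longrightarrow> f v \<in> carrier M;
      \<And>v w. v \<in> carrier V \<Longrightarrow> w \<in> carrier V \<Longrightarrow> f (v \<oplus>\<^bsub>V\<^esub> w) = f v \<oplus>\<^bsub>M\<^esub> f w;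
      \<And>v b. v \<in> carrier V \<Longrightarrow> b \<in> carrier M \<Longrightarrow> f (rsmult V v b) = f v \<otimes>\<^bsub>M\<^esub> b\<rbrakk> \<Longrightarrow>
      \<exists>u\<in>carrier U. \<forall>v\<in>carrier V. p v u = f v"
    and faithful: "\<And>u u'. \<lbrakk>u \<in> carrier U; u' \<in> carrier U; \<And>v. v \<in> carrier V \<Longrightarrow> p v u = p v u'\<rbrakk> \<Longrightarrow> u = u'"
    and basis: "is_pair_basis M (right_mod V) x y"
  shows "\<exists>x' y'. dual_pair L M V U p x y x' y'"
proof -
  interpret r: fspace M "right_mod V" by (rule V.right_fspace)
  have xy [simp]: "x \<in> carrier V" "y \<in> carrier V" using basis by (auto simp: is_pair_basis_def)
  have "\<forall>v\<in>carrier V. \<exists>c. fst c \<in> carrier M \<and> snd c \<in> carrier M \<and> v = rsmult V x (fst c) \<oplus>\<^bsub>V\<^esub> rsmult V y (snd c)"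
    using basis by (fastforce simp: is_pair_basis_def)
  then obtain c where c: "\<forall>v\<in>carrier V. fst (c v) \<in> carrier M \<and> snd (c v) \<in> carrier M \<and>
      v = rsmult V x (fst (c v)) \<oplus>\<^bsub>V\<^esub> rsmult V y (snd (c v))"
    by (rule bchoice[THEN exE])
  define f g where "f v = fst (c v)" and "g v = snd (c v)" for v
  have fg [simp]: "f v \<in> carrier M" "g v \<in> carrier M" if "v \<in> carrier V" for v
    using c that by (simp_all add: f_def g_def)
  have ex: "rsmult V x (f v) \<oplus>\<^bsub>V\<^esub> rsmult V y (g v) = v" if "v \<in> carrier V" for v
    using c that by (simp add: f_def g_def)
  have uniq: "f v = a \<and> g v = b" if "a \<in> carrier M" "b \<in> carrier M" "v = rsmult V x a \<oplus>\<^bsub>V\<^esub> rsmult V y b" for a b v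
  proof -
    have v: "v \<in> carrier V" using that by simp
    show ?thesis using r.is_pair_basis_unique[OF basis fg[OF v] that(1,2)] ex[OF v] that(3) by simp
  qed
  have add: "f (v \<oplus>\<^bsub>V\<^esub> w) = f v \<oplus>\<^bsub>M\<^esub> f w \<and> g (v \<oplus>\<^bsub>V\<^esub> w) = g v \<oplus>\<^bsub>M\<^esub> g w"
    if v: "v \<in> carrier V" "w \<in> carrier V" for v w
  proof (rule uniq)
    have "v \<oplus>\<^bsub>V\<^esub> w = (rsmult V x (f v) \<oplus>\<^bsub>V\<^esub> rsmult V y (g v)) \<oplus>\<^bsub>V\<^esub> (rsmult V x (f w) \<oplus>\<^bsub>V\<^esub> rsmult V y (g w))"
      using v by (simp add: ex)
    also have "\<dots> = rsmult V x (f v \<oplus>\<^bsub>M\<^esub> f w) \<oplus>\<^bsub>V\<^esub> rsmult V y (g v \<oplus>\<^bsub>M\<^esub> g w)"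
      using v by (simp add: V.rs_add_scalar V.l.M.a_ac)
    finally show "v \<oplus>\<^bsub>V\<^esub> w = rsmult V x (f v \<oplus>\<^bsub>M\<^esub> f w) \<oplus>\<^bsub>V\<^esub> rsmult V y (g v \<oplus>\<^bsub>M\<^esub> g w)" .
  qed (use v in auto)
  have scale: "f (rsmult V v b) = f v \<otimes>\<^bsub>M\<^esub> b \<and> g (rsmult V v b) = g v \<otimes>\<^bsub>M\<^esub> b"
    if v: "v \<in> carrier V" "b \<in> carrier M" for v b
  proof (rule uniq)
    have "rsmult V v b = rsmult V (rsmult V x (f v) \<oplus>\<^bsub>V\<^esub> rsmult V y (g v)) b" using v by (simp add: ex)
    also have "\<dots> = rsmult V x (f v \<otimes>\<^bsub>M\<^esub> b) \<oplus>\<^bsub>V\<^esub> rsmult V y (g v \<otimes>\<^bsub>M\<^esub> b)"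
      using v by (simp add: V.rs_add V.rs_assoc)
    finally show "rsmult V v b = rsmult V x (f v \<otimes>\<^bsub>M\<^esub> b) \<oplus>\<^bsub>V\<^esub> rsmult V y (g v \<otimes>\<^bsub>M\<^esub> b)" .
  qed (use v in auto)
  obtain x' where x': "x' \<in> carrier U" "\<forall>v\<in>carrier V. p v x' = f v" using represent[of f] add scale by auto
  obtain y' where y': "y' \<in> carrier U" "\<forall>v\<in>carrier V. p v y' = g v" using represent[of g] add scale by auto
  have fx: "f x = \<one>\<^bsub>M\<^esub> \<and> g x = \<zero>\<^bsub>M\<^esub>" by (rule uniq) simp_all
  have fy: "f y = \<zero>\<^bsub>M\<^esub> \<and> g y = \<one>\<^bsub>M\<^esub>" by (rule uniq) simp_all
  have "dual_pair L M V U p x y x' y'"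
  proof unfold_locales
    fix u assume u: "u \<in> carrier U"
    show "u = p x u \<odot>\<^bsub>U\<^esub> x' \<oplus>\<^bsub>U\<^esub> p y u \<odot>\<^bsub>U\<^esub> y'"
    proof (rule faithful)
      fix v assume v: "v \<in> carrier V"
      have "p v u = p (rsmult V x (f v) \<oplus>\<^bsub>V\<^esub> rsmult V y (g v)) u" using v by (simp add: ex)
      also have "\<dots> = p v (p x u \<odot>\<^bsub>U\<^esub> x' \<oplus>\<^bsub>U\<^esub> p y u \<odot>\<^bsub>U\<^esub> y')"
        using u v x' y' by (simp add: p_add_left p_add_right p_rsmult p_smult)
      finally show "p v u = p v (p x u \<odot>\<^bsub>U\<^esub> x' \<oplus>\<^bsub>U\<^esub> p y u \<odot>\<^bsub>U\<^esub> y')" .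
    qed (use u x' y' in simp_all)
  qed (use x' y' fx fy ex in simp_all)
  then show ?thesis by blast
qed

context dual_pair
begin

lemma represent:
  assumes f: "\<And>v. v \<in> carrier V \<Longrightarrow> f v \<in> carrier M"
      "\<And>v w. v \<in> carrier V \<Longrightarrow> w \<in> carrier V \<Longrightarrow> f (v \<oplus>\<^bsub>V\<^esub> w) = f v \<oplus>\<^bsub>M\<^esub> f w"
      "\<And>v b. v \<in> carrier V \<Longrightarrow> b \<in> carrier M \<Longrightarrow> f (rsmult V v b) = f v \<otimes>\<^bsub>M\<^esub> b"
  shows "\<exists>u\<in>carrier U. \<forall>v\<in>carrier V. p v u = f v"
proof (intro bexI ballI)
  fix v assume v: "v \<in> carrier V"
  have "f v = f (rsmult V x (p v x') \<oplus>\<^bsub>V\<^esub> rsmult V y (p v y'))" using expand_right[OF v] by simp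
  also have "\<dots> = p v (f x \<odot>\<^bsub>U\<^esub> x' \<oplus>\<^bsub>U\<^esub> f y \<odot>\<^bsub>U\<^esub> y')" using v by (simp add: f p_add_right p_smult)
  finally show "p v (f x \<odot>\<^bsub>U\<^esub> x' \<oplus>\<^bsub>U\<^esub> f y \<odot>\<^bsub>U\<^esub> y') = f v" by (rule sym)
qed (use f(1) in simp)

lemma faithful:
  assumes u: "u \<in> carrier U" "u' \<in> carrier U" and "p x u = p x u'" "p y u = p y u'"
  shows "u = u'"
  using expand_left[OF u(1)] expand_left[OF u(2)] assms(3,4) by simp

lemma right_basis: "is_pair_basis M (right_mod V) x y"
  unfolding is_pair_basis_def
proof (intro conjI ballI impI)
  fix v assume "v \<in> carrier (right_mod V)"
  then have v: "v \<in> carrier V" by simp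
  show "\<exists>a\<in>carrier M. \<exists>b\<in>carrier M. v = a \<odot>\<^bsub>right_mod V\<^esub> x \<oplus>\<^bsub>right_mod V\<^esub> b \<odot>\<^bsub>right_mod V\<^esub> y"
    by (intro bexI[of _ "p v x'"] bexI[of _ "p v y'"]) (use expand_right[OF v] v in simp_all)
next
  fix a b assume ab: "a \<in> carrier M" "b \<in> carrier M"
    and "a \<odot>\<^bsub>right_mod V\<^esub> x \<oplus>\<^bsub>right_mod V\<^esub> b \<odot>\<^bsub>right_mod V\<^esub> y = \<zero>\<^bsub>right_mod V\<^esub>"
  then have eq: "rsmult V x a \<oplus>\<^bsub>V\<^esub> rsmult V y b = \<zero>\<^bsub>V\<^esub>" by simp
  have z: "p \<zero>\<^bsub>V\<^esub> u = \<zero>\<^bsub>M\<^esub>" if "u \<in> carrier U" for u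
    using p_rsmult[of x u "\<zero>\<^bsub>M\<^esub>"] that by simp
  show "a = \<zero>\<^bsub>M\<^esub>" "b = \<zero>\<^bsub>M\<^esub>"
    using arg_cong[OF eq, of "\<lambda>v. p v x'"] arg_cong[OF eq, of "\<lambda>v. p v y'"] ab
    by (simp_all add: z p_add_left p_rsmult)
qed simp_all

lemma left_basis: "is_pair_basis M U x' y'"
  unfolding is_pair_basis_def
proof (intro conjI ballI impI)
  fix u assume u: "u \<in> carrier U"
  show "\<exists>a\<in>carrier M. \<exists>b\<in>carrier M. u = a \<odot>\<^bsub>U\<^esub> x' \<oplus>\<^bsub>U\<^esub> b \<odot>\<^bsub>U\<^esub> y'"
    by (intro bexI[of _ "p x u"] bexI[of _ "p y u"]) (use expand_left[OF u] u in simp_all)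
next
  fix a b assume ab: "a \<in> carrier M" "b \<in> carrier M"
    and eq: "a \<odot>\<^bsub>U\<^esub> x' \<oplus>\<^bsub>U\<^esub> b \<odot>\<^bsub>U\<^esub> y' = \<zero>\<^bsub>U\<^esub>"
  have z: "p v \<zero>\<^bsub>U\<^esub> = \<zero>\<^bsub>M\<^esub>" if "v \<in> carrier V" for v
    using p_smult[of v x' "\<zero>\<^bsub>M\<^esub>"] that by simp
  show "a = \<zero>\<^bsub>M\<^esub>" "b = \<zero>\<^bsub>M\<^esub>"
    using arg_cong[OF eq, of "p x"] arg_cong[OF eq, of "p y"] ab
    by (simp_all add: z p_add_right p_smult)
qed simp_all

text \<open>Representability and faithfulness are properties of the pairing alone, so any right
  basis of \<open>V\<close> has a dual basis.\<close>

lemma change_basis: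
  assumes "is_pair_basis M (right_mod V) v w"
  shows "\<exists>v' w'. dual_pair L M V U p v w v' w'"
  by (rule dual_pairI[OF represent _ assms]) (auto intro: faithful)

end

text \<open>If \<open>z\<close> could not be completed, every vector would be a multiple of
  \<open>z\<close>, and then \<open>y\<close> would be a multiple of \<open>x\<close>.\<close>

lemma (in fspace) is_pair_basis_extend:
  assumes b: "is_pair_basis R M x y" and z: "z \<in> carrier M" "z \<noteq> \<zero>\<^bsub>M\<^esub>"
  shows "\<exists>w. is_pair_basis R M z w"
proof (rule ccontr)
  assume none: "\<nexists>w. is_pair_basis R M z w"
  have xy: "x \<in> carrier M" "y \<in> carrier M" using b by (auto simp: is_pair_basis_def)
  have mult: "\<exists>a\<in>carrier R. v = a \<odot>\<^bsub>M\<^esub> z" if "v \<in> carrier M" for v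
    using is_pair_basis_exchange[OF b z that] none by blast
  obtain a c where a: "a \<in> carrier R" "x = a \<odot>\<^bsub>M\<^esub> z" and c: "c \<in> carrier R" "y = c \<odot>\<^bsub>M\<^esub> z"
    using mult[OF xy(1)] mult[OF xy(2)] by blast
  have a0: "a \<noteq> \<zero>" using is_pair_basis_nonzero(1)[OF b] a z by auto
  then have ia: "inv a \<in> carrier R" using a field_Units by auto
  have "y = (c \<otimes> inv a) \<odot>\<^bsub>M\<^esub> x" using smult_cancel[OF a(1) a0 z(1)] a c ia xy by (simp add: smult_assoc1)
  then show False using is_pair_basis_nonzero(2)[OF b, of "c \<otimes> inv a"] c ia by simp
qed

section \<open>The right dimension of the right dual\<close>

context dual_pair
begin

lemma one_neq_zero: "\<one>\<^bsub>M\<^esub> \<noteq> \<zero>\<^bsub>M\<^esub>" by simp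

lemma p_zero_left [simp]: "u \<in> carrier U \<Longrightarrow> p \<zero>\<^bsub>V\<^esub> u = \<zero>\<^bsub>M\<^esub>"
  using p_rsmult[of x u "\<zero>\<^bsub>M\<^esub>"] by simp

lemma p_zero_right [simp]: "v \<in> carrier V \<Longrightarrow> p v \<zero>\<^bsub>U\<^esub> = \<zero>\<^bsub>M\<^esub>"
  using p_smult[of v x' "\<zero>\<^bsub>M\<^esub>"] by simp

lemma x_nonzero: "x \<noteq> \<zero>\<^bsub>V\<^esub>"
  using dual(1) by (metis one_neq_zero p_zero_left bases_closed(3))

lemma y_not_multiple: "c \<in> carrier M \<Longrightarrow> y \<noteq> rsmult V x c"
  using dual(4) p_rsmult[of x y' c] by (metis dual(2) V.M.l_null one_neq_zero bases_closed)

text \<open>Since \<open>L x\<close> lies in \<open>x M\<close>, on which \<open>y'\<close>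
  vanishes, the action of \<open>L\<close> is triangular with respect to \<open>x\<close>,
  \<open>y\<close>. The coefficients of \<open>u = x' a + y' b\<close> can then be solved for one
  after the other, first by evaluating at \<open>x\<close> and then at \<open>y\<close>.\<close>

lemma right_basis_dual_stable_line:
  assumes left: "is_pair_basis L V s t"
    and stable: "\<And>a. a \<in> carrier L \<Longrightarrow> \<exists>c\<in>carrier M. a \<odot>\<^bsub>V\<^esub> x = rsmult V x c"
  shows "is_pair_basis L (right_mod U) x' y'"
proof -
  have xy': "p (a \<odot>\<^bsub>V\<^esub> x) y' = \<zero>\<^bsub>M\<^esub>" if "a \<in> carrier L" for a
    using stable[OF that] by (auto simp: p_rsmult)
  have nm: "y \<noteq> a \<odot>\<^bsub>V\<^esub> x" if "a \<in> carrier L" for a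
    using stable[OF that] y_not_multiple by auto
  have basis: "is_pair_basis L V x y"
    by (rule V.l.is_pair_basis_exchange[OF left bases_closed(1) x_nonzero bases_closed(2) nm])
  have span: "\<exists>a\<in>carrier L. \<exists>b\<in>carrier L. v = a \<odot>\<^bsub>V\<^esub> x \<oplus>\<^bsub>V\<^esub> b \<odot>\<^bsub>V\<^esub> y" if "v \<in> carrier V" for v
    using basis that unfolding is_pair_basis_def by blast
  \<comment> \<open>The reverse inclusion \<open>x M \<subseteq> L x\<close>: otherwise
    \<open>x\<close> and \<open>x c\<close> would be a left basis inside the stable line
    \<open>x M\<close>, and \<open>y'\<close> would vanish on all of \<open>V\<close>, in particular
    at \<open>y\<close>.\<close>
  have onto: "\<exists>a\<in>carrier L. rsmult V x c = a \<odot>\<^bsub>V\<^esub> x" if c: "c \<in> carrier M" for c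
  proof (rule ccontr)
    assume "\<not> ?thesis"
    then have "is_pair_basis L V x (rsmult V x c)"
      using c by (intro V.l.is_pair_basis_exchange[OF left bases_closed(1) x_nonzero]) auto
    then obtain a b where ab: "a \<in> carrier L" "b \<in> carrier L"
      "y = a \<odot>\<^bsub>V\<^esub> x \<oplus>\<^bsub>V\<^esub> b \<odot>\<^bsub>V\<^esub> rsmult V x c"
      unfolding is_pair_basis_def using bases_closed(2) by blast
    have "b \<odot>\<^bsub>V\<^esub> rsmult V x c = rsmult V (b \<odot>\<^bsub>V\<^esub> x) c" using V.smult_rsmult ab c by simp
    then have "p y y' = \<zero>\<^bsub>M\<^esub>"
      using ab c by (simp add: p_add_left p_rsmult xy')
    then show False by simp
  qed
  show ?thesis unfolding is_pair_basis_def
  proof (intro conjI ballI impI)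
    fix u assume "u \<in> carrier (right_mod U)"
    then have u: "u \<in> carrier U" by simp
    obtain a where a: "a \<in> carrier L" "rsmult V x (p x u) = a \<odot>\<^bsub>V\<^esub> x" using onto[of "p x u"] u by auto
    \<comment> \<open>The coefficient \<open>a\<close> is fixed by the value at \<open>x\<close>;
      \<open>e\<close> is what \<open>y' b\<close> must still contribute at \<open>y\<close>. The
      \<open>y\<close>-coordinate \<open>b\<close> of \<open>y e\<close> in the left basis achieves
      this, because \<open>y'\<close> kills the \<open>x\<close>-part.\<close>
    define e where "e = p y u \<ominus>\<^bsub>M\<^esub> p (a \<odot>\<^bsub>V\<^esub> y) x'"
    have e: "e \<in> carrier M" using u a by (simp add: e_def)
    have "rsmult V y e \<in> carrier V" using e by simp
    then obtain a1 b where b: "a1 \<in> carrier L" "b \<in> carrier L" "rsmult V y e = a1 \<odot>\<^bsub>V\<^esub> x \<oplus>\<^bsub>V\<^esub> b \<odot>\<^bsub>V\<^esub> y"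
      using span by blast
    have "p (rsmult V y e) y' = p (b \<odot>\<^bsub>V\<^esub> y) y'" using b by (simp add: p_add_left xy')
    then have eb: "p (b \<odot>\<^bsub>V\<^esub> y) y' = e" using e by (simp add: p_rsmult)
    have "u = rsmult U x' a \<oplus>\<^bsub>U\<^esub> rsmult U y' b"
    proof (rule faithful)
      show "p x u = p x (rsmult U x' a \<oplus>\<^bsub>U\<^esub> rsmult U y' b)"
        using u a b by (simp add: p_add_right p_middle[symmetric] xy') (simp add: a(2)[symmetric] p_rsmult)
      have "p (a \<odot>\<^bsub>V\<^esub> y) x' \<oplus>\<^bsub>M\<^esub> e = p y u"
        using u a by (simp add: e_def V.M.minus_eq V.M.a_ac V.M.r_neg2 V.M.l_neg V.M.r_neg)
      then show "p y u = p y (rsmult U x' a \<oplus>\<^bsub>U\<^esub> rsmult U y' b)"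
        using u a b by (simp add: p_add_right p_middle[symmetric] eb)
    qed (use u a b in simp_all)
    then show "\<exists>a\<in>carrier L. \<exists>b\<in>carrier L. u = a \<odot>\<^bsub>right_mod U\<^esub> x' \<oplus>\<^bsub>right_mod U\<^esub> b \<odot>\<^bsub>right_mod U\<^esub> y'"
      using a b by auto
  next
    fix a b assume ab: "a \<in> carrier L" "b \<in> carrier L"
      and "a \<odot>\<^bsub>right_mod U\<^esub> x' \<oplus>\<^bsub>right_mod U\<^esub> b \<odot>\<^bsub>right_mod U\<^esub> y' = \<zero>\<^bsub>right_mod U\<^esub>"
    then have eq: "rsmult U x' a \<oplus>\<^bsub>U\<^esub> rsmult U y' b = \<zero>\<^bsub>U\<^esub>" by simp
    obtain c where c: "c \<in> carrier M" "a \<odot>\<^bsub>V\<^esub> x = rsmult V x c" using stable[OF ab(1)] by blast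
    have "p (a \<odot>\<^bsub>V\<^esub> x) x' = \<zero>\<^bsub>M\<^esub>"
      using arg_cong[OF eq, of "p x"] ab by (simp add: p_add_right p_middle[symmetric] xy')
    then have "c = \<zero>\<^bsub>M\<^esub>" using c by (simp add: p_rsmult)
    then have "a \<odot>\<^bsub>V\<^esub> x \<oplus>\<^bsub>V\<^esub> \<zero>\<^bsub>L\<^esub> \<odot>\<^bsub>V\<^esub> y = \<zero>\<^bsub>V\<^esub>" using c by simp
    then show a0: "a = \<zero>\<^bsub>L\<^esub>" using basis ab unfolding is_pair_basis_def by blast
    have b0: "p (b \<odot>\<^bsub>V\<^esub> y) y' = \<zero>\<^bsub>M\<^esub>"
      using arg_cong[OF eq, of "p y"] ab a0 by (simp add: p_add_right p_middle[symmetric])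
    have bV: "b \<odot>\<^bsub>V\<^esub> y \<in> carrier V" using ab by simp
    \<comment> \<open>So \<open>b y\<close> lies in \<open>x M = L x\<close>, and left independence
      of \<open>x\<close> and \<open>y\<close> forces \<open>b = 0\<close>.\<close>
    have by': "b \<odot>\<^bsub>V\<^esub> y = rsmult V x (p (b \<odot>\<^bsub>V\<^esub> y) x')" using expand_right[OF bV] b0 bV by simp
    obtain a2 where a2: "a2 \<in> carrier L" "rsmult V x (p (b \<odot>\<^bsub>V\<^esub> y) x') = a2 \<odot>\<^bsub>V\<^esub> x"
      using onto[of "p (b \<odot>\<^bsub>V\<^esub> y) x'"] bV by auto
    have "b = \<zero>\<^bsub>L\<^esub> \<and> a2 = \<zero>\<^bsub>L\<^esub>"
      using V.l.is_pair_basis_unique[OF basis, of "\<zero>\<^bsub>L\<^esub>" b a2 "\<zero>\<^bsub>L\<^esub>"] ab a2 by' by simp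
    then show "b = \<zero>\<^bsub>L\<^esub>" by simp
  qed simp_all
qed

text \<open>
  If no line \<open>z M\<close> is stable under \<open>L\<close>, choose \<open>h\<close> with \<open>x h\<close> not in \<open>L x\<close>. The element \<open>x' b + (h x') c\<close> of the
  dual is \<open>x'\<close> composed with the bimodule endomorphism \<open>v \<mapsto> b v + c v h\<close> of \<open>V\<close>. A non-zero endomorphism
  is onto, because its image is stable under \<open>L\<close> and no line is, so these elements are independent. They
  span because they form a left \<open>M\<close>-subspace containing the independent \<open>x'\<close> and \<open>x' g\<close>.
\<close>

lemma right_basis_dual_unstable:
  assumes left: "is_pair_basis L V s t" and g: "g \<in> carrier L" "y = g \<odot>\<^bsub>V\<^esub> x"
    and unstable: "\<And>z. z \<in> carrier V \<Longrightarrow> z \<noteq> \<zero>\<^bsub>V\<^esub> \<Longrightarrow>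
      \<exists>a\<in>carrier L. \<forall>c\<in>carrier M. a \<odot>\<^bsub>V\<^esub> z \<noteq> rsmult V z c"
  shows "\<exists>h. is_pair_basis L (right_mod U) x' (h \<odot>\<^bsub>U\<^esub> x')"
proof -
  interpret r: fspace M "right_mod V" by (rule V.right_fspace)
  \<comment> \<open>If \<open>x M\<close> were contained in \<open>L x\<close>, then
    \<open>y M = g x M\<close> would be as well, so \<open>V = x M + y M\<close> would be contained
    in \<open>L x\<close>, against its left dimension two.\<close>
  have "\<exists>h\<in>carrier M. \<forall>a\<in>carrier L. rsmult V x h \<noteq> a \<odot>\<^bsub>V\<^esub> x"
  proof (rule ccontr)
    assume "\<not> ?thesis"
    then have st: "\<exists>a\<in>carrier L. rsmult V x h = a \<odot>\<^bsub>V\<^esub> x" if "h \<in> carrier M" for h using that by blast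
    obtain w where w: "is_pair_basis L V x w"
      using V.l.is_pair_basis_extend[OF left bases_closed(1) x_nonzero] by blast
    then have wV: "w \<in> carrier V" by (simp add: is_pair_basis_def)
    obtain a b where ab: "a \<in> carrier L" "rsmult V x (p w x') = a \<odot>\<^bsub>V\<^esub> x"
      "b \<in> carrier L" "rsmult V x (p w y') = b \<odot>\<^bsub>V\<^esub> x"
      using st[of "p w x'"] st[of "p w y'"] wV by auto
    have "rsmult V y (p w y') = g \<odot>\<^bsub>V\<^esub> rsmult V x (p w y')"
      using V.smult_rsmult[of g "p w y'" x] g wV by simp
    then have "w = (a \<oplus>\<^bsub>L\<^esub> g \<otimes>\<^bsub>L\<^esub> b) \<odot>\<^bsub>V\<^esub> x"
      using expand_right[OF wV] ab g(1) by (simp add: V.l.smult_l_distr V.l.smult_assoc1)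
    then show False using V.l.is_pair_basis_nonzero(2)[OF w, of "a \<oplus>\<^bsub>L\<^esub> g \<otimes>\<^bsub>L\<^esub> b"] ab g by simp
  qed
  then obtain h where h: "h \<in> carrier M" "\<And>a. a \<in> carrier L \<Longrightarrow> rsmult V x h \<noteq> a \<odot>\<^bsub>V\<^esub> x" by blast
  have basis: "is_pair_basis L V x (rsmult V x h)"
    by (rule V.l.is_pair_basis_exchange[OF left bases_closed(1) x_nonzero _ h(2)]) (use h in simp_all)
  define R where "R b c v = b \<odot>\<^bsub>V\<^esub> v \<oplus>\<^bsub>V\<^esub> c \<odot>\<^bsub>V\<^esub> rsmult V v h" for b c v
  define E where "E b c = rsmult U x' b \<oplus>\<^bsub>U\<^esub> rsmult U (h \<odot>\<^bsub>U\<^esub> x') c" for b c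
  have span: "\<forall>v\<in>carrier V. \<exists>b\<in>carrier L. \<exists>c\<in>carrier L. v = R b c x"
    using basis by (simp add: is_pair_basis_def R_def)
  have R_closed [simp]: "R b c v \<in> carrier V" if "b \<in> carrier L" "c \<in> carrier L" "v \<in> carrier V" for b c v
    using that h by (simp add: R_def)
  have E_closed [simp]: "E b c \<in> carrier U" if "b \<in> carrier L" "c \<in> carrier L" for b c
    using that h by (simp add: E_def)
  have pE: "p v (E b c) = p (R b c v) x'" if "b \<in> carrier L" "c \<in> carrier L" "v \<in> carrier V" for b c v
    using that h V.smult_rsmult[of c h v, symmetric]
    by (simp add: E_def R_def p_add_left p_add_right p_middle[symmetric] p_smult p_rsmult V.M.m_comm)
  have R_smult: "R b c (a \<odot>\<^bsub>V\<^esub> v) = a \<odot>\<^bsub>V\<^esub> R b c v"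
    if "a \<in> carrier L" "b \<in> carrier L" "c \<in> carrier L" "v \<in> carrier V" for a b c v
    using that h V.smult_rsmult[of a h v]
    by (simp add: R_def V.l.smult_r_distr V.l.smult_assoc1[symmetric] V.L.m_comm)
  have indep: "b = \<zero>\<^bsub>L\<^esub> \<and> c = \<zero>\<^bsub>L\<^esub>" if bc: "b \<in> carrier L" "c \<in> carrier L" and eq: "E b c = \<zero>\<^bsub>U\<^esub>" for b c
  proof -
    have pR: "p (R b c v) x' = \<zero>\<^bsub>M\<^esub>" if "v \<in> carrier V" for v using pE[OF bc that] eq that by simp
    have "R b c x = \<zero>\<^bsub>V\<^esub>"
    proof (rule ccontr)
      assume ne: "R b c x \<noteq> \<zero>\<^bsub>V\<^esub>"
      obtain a where a: "a \<in> carrier L" "\<forall>m\<in>carrier M. a \<odot>\<^bsub>V\<^esub> R b c x \<noteq> rsmult V (R b c x) m"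
        using unstable[OF _ ne] bc by auto
      have "is_pair_basis M (right_mod V) (R b c x) (a \<odot>\<^bsub>V\<^esub> R b c x)"
        by (rule r.is_pair_basis_exchange[OF right_basis]) (use a bc ne in auto)
      then have "\<forall>v\<in>carrier V. \<exists>m\<in>carrier M. \<exists>n\<in>carrier M.
          v = rsmult V (R b c x) m \<oplus>\<^bsub>V\<^esub> rsmult V (a \<odot>\<^bsub>V\<^esub> R b c x) n"
        by (simp add: is_pair_basis_def)
      then obtain m n where mn: "m \<in> carrier M" "n \<in> carrier M"
        "x = rsmult V (R b c x) m \<oplus>\<^bsub>V\<^esub> rsmult V (a \<odot>\<^bsub>V\<^esub> R b c x) n"
        using bases_closed(1) by blast
      have "p x x' = p (R b c x) x' \<otimes>\<^bsub>M\<^esub> m \<oplus>\<^bsub>M\<^esub> p (a \<odot>\<^bsub>V\<^esub> R b c x) x' \<otimes>\<^bsub>M\<^esub> n"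
        by (subst mn(3)) (use mn(1,2) a bc in \<open>simp add: p_add_left p_rsmult\<close>)
      also have "\<dots> = \<zero>\<^bsub>M\<^esub>"
        using mn(1,2) a bc pR[of x] pR[of "a \<odot>\<^bsub>V\<^esub> x"] by (simp add: R_smult)
      finally show False by simp
    qed
    then show ?thesis using basis bc unfolding is_pair_basis_def R_def by blast
  qed
  have E_add: "E b c \<oplus>\<^bsub>U\<^esub> E b' c' = E (b \<oplus>\<^bsub>L\<^esub> b') (c \<oplus>\<^bsub>L\<^esub> c')"
    if "b \<in> carrier L" "c \<in> carrier L" "b' \<in> carrier L" "c' \<in> carrier L" for b c b' c'
    using that h by (simp add: E_def U.rs_add_scalar U.l.M.a_ac)
  \<comment> \<open>The coefficients \<open>b'\<close>, \<open>c'\<close> are chosen from the value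
    at \<open>x\<close>, using that \<open>x\<close> and \<open>x h\<close> span \<open>V\<close>
    over \<open>L\<close>. They are right at \<open>y = g x\<close> too because \<open>R\<close>
    commutes with \<open>L\<close>, and two functionals agreeing at \<open>x\<close> and
    \<open>y\<close> are equal.\<close>
  have E_smult: "\<exists>b'\<in>carrier L. \<exists>c'\<in>carrier L. m \<odot>\<^bsub>U\<^esub> E b c = E b' c'"
    if bc: "b \<in> carrier L" "c \<in> carrier L" and m: "m \<in> carrier M" for m b c
  proof -
    have "rsmult V (R b c x) m \<in> carrier V" using bc m by simp
    then obtain b' c' where bc': "b' \<in> carrier L" "c' \<in> carrier L" "rsmult V (R b c x) m = R b' c' x"
      using span by blast
    have "rsmult V (R b c y) m = g \<odot>\<^bsub>V\<^esub> rsmult V (R b c x) m"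
      using V.smult_rsmult[of g m "R b c x"] bc m g(1) by (simp add: g(2) R_smult)
    then have y: "rsmult V (R b c y) m = R b' c' y" using bc' g by (simp add: R_smult)
    have "p v (m \<odot>\<^bsub>U\<^esub> E b c) = p (rsmult V (R b c v) m) x'" if "v \<in> carrier V" for v
      using that bc m by (simp add: p_smult pE p_rsmult V.M.m_comm)
    then have "m \<odot>\<^bsub>U\<^esub> E b c = E b' c'"
      using bc bc' m y by (intro faithful) (simp_all add: pE)
    then show ?thesis using bc' by blast
  qed
  have E1: "E \<one>\<^bsub>L\<^esub> \<zero>\<^bsub>L\<^esub> = x'" "E g \<zero>\<^bsub>L\<^esub> = rsmult U x' g" using h g(1) by (simp_all add: E_def)
  \<comment> \<open>\<open>x' g\<close> vanishes at \<open>x\<close>, where its value is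
    \<open>p (g x) x' = p y x' = 0\<close>, and equals \<open>e\<close> at \<open>y\<close>. Once
    \<open>e \<noteq> 0\<close> is known, \<open>y'\<close> is a left multiple of
    \<open>x' g\<close>, so the stable family \<open>E\<close> contains a left basis of
    \<open>U\<close>.\<close>
  define e where "e = p (g \<odot>\<^bsub>V\<^esub> y) x'"
  have e: "e \<in> carrier M" using g(1) by (simp add: e_def)
  have vals: "p x (rsmult U x' g) = \<zero>\<^bsub>M\<^esub>" "p y (rsmult U x' g) = e"
    using g(1) by (simp_all add: p_middle[symmetric] g(2)[symmetric] e_def)
  have e0: "e \<noteq> \<zero>\<^bsub>M\<^esub>"
  proof
    assume "e = \<zero>\<^bsub>M\<^esub>"
    then have z: "rsmult U x' g = \<zero>\<^bsub>U\<^esub>" using vals g(1) by (intro faithful) simp_all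
    have g0: "g \<noteq> \<zero>\<^bsub>L\<^esub>" using g(2) y_not_multiple[of "\<zero>\<^bsub>M\<^esub>"] by auto
    then have ig: "inv\<^bsub>L\<^esub> g \<in> carrier L" "inv\<^bsub>L\<^esub> g \<otimes>\<^bsub>L\<^esub> g = \<one>\<^bsub>L\<^esub>" using g V.L.field_Units by auto
    have "p x x' = p ((g \<otimes>\<^bsub>L\<^esub> inv\<^bsub>L\<^esub> g) \<odot>\<^bsub>V\<^esub> x) x'" using ig g(1) by (simp add: V.L.m_comm)
    also have "\<dots> = p (inv\<^bsub>L\<^esub> g \<odot>\<^bsub>V\<^esub> x) (rsmult U x' g)"
      using ig(1) g(1) by (simp add: V.l.smult_assoc1 p_middle)
    also have "\<dots> = \<zero>\<^bsub>M\<^esub>" using z ig(1) by simp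
    finally show False by simp
  qed
  then have ie: "inv\<^bsub>M\<^esub> e \<in> carrier M" "inv\<^bsub>M\<^esub> e \<otimes>\<^bsub>M\<^esub> e = \<one>\<^bsub>M\<^esub>" using e V.M.field_Units by auto
  have y': "y' = inv\<^bsub>M\<^esub> e \<odot>\<^bsub>U\<^esub> E g \<zero>\<^bsub>L\<^esub>"
    unfolding E1 by (rule faithful) (use ie g(1) in \<open>simp_all add: p_smult vals\<close>)
  have "is_pair_basis L (right_mod U) x' (h \<odot>\<^bsub>U\<^esub> x')" unfolding is_pair_basis_def
  proof (intro conjI ballI impI)
    fix u assume "u \<in> carrier (right_mod U)"
    then have u: "u \<in> carrier U" by simp
    have "u = p x u \<odot>\<^bsub>U\<^esub> E \<one>\<^bsub>L\<^esub> \<zero>\<^bsub>L\<^esub> \<oplus>\<^bsub>U\<^esub> (p y u \<otimes>\<^bsub>M\<^esub> inv\<^bsub>M\<^esub> e) \<odot>\<^bsub>U\<^esub> E g \<zero>\<^bsub>L\<^esub>"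
      using expand_left[OF u] ie(1) g(1) u y' by (simp add: E1(1) U.l.smult_assoc1)
    moreover obtain b c where "b \<in> carrier L" "c \<in> carrier L" "p x u \<odot>\<^bsub>U\<^esub> E \<one>\<^bsub>L\<^esub> \<zero>\<^bsub>L\<^esub> = E b c"
      using E_smult[of "\<one>\<^bsub>L\<^esub>" "\<zero>\<^bsub>L\<^esub>" "p x u"] u by auto
    moreover obtain b' c' where "b' \<in> carrier L" "c' \<in> carrier L"
      "(p y u \<otimes>\<^bsub>M\<^esub> inv\<^bsub>M\<^esub> e) \<odot>\<^bsub>U\<^esub> E g \<zero>\<^bsub>L\<^esub> = E b' c'"
      using E_smult[of g "\<zero>\<^bsub>L\<^esub>" "p y u \<otimes>\<^bsub>M\<^esub> inv\<^bsub>M\<^esub> e"] u ie(1) g(1) by auto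
    ultimately have "u = E (b \<oplus>\<^bsub>L\<^esub> b') (c \<oplus>\<^bsub>L\<^esub> c')" "b \<oplus>\<^bsub>L\<^esub> b' \<in> carrier L" "c \<oplus>\<^bsub>L\<^esub> c' \<in> carrier L"
      by (simp_all add: E_add)
    then show "\<exists>a\<in>carrier L. \<exists>b\<in>carrier L.
        u = a \<odot>\<^bsub>right_mod U\<^esub> x' \<oplus>\<^bsub>right_mod U\<^esub> b \<odot>\<^bsub>right_mod U\<^esub> (h \<odot>\<^bsub>U\<^esub> x')"
      unfolding E_def by auto
  next
    fix b c assume "b \<in> carrier L" "c \<in> carrier L"
      "b \<odot>\<^bsub>right_mod U\<^esub> x' \<oplus>\<^bsub>right_mod U\<^esub> c \<odot>\<^bsub>right_mod U\<^esub> (h \<odot>\<^bsub>U\<^esub> x') = \<zero>\<^bsub>right_mod U\<^esub>"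
    then show "b = \<zero>\<^bsub>L\<^esub>" "c = \<zero>\<^bsub>L\<^esub>" using indep[of b c] by (simp_all add: E_def)
  qed (use h in simp_all)
  then show ?thesis by blast
qed

end

text \<open>Duality over \<open>M\<close> provides a left basis of \<open>U\<close> but says nothing
  about the right action of \<open>L\<close>, which reaches \<open>U\<close> only through the left
  action on \<open>V\<close>. The cases are whether or not some line \<open>z M\<close> is stable
  under \<open>L\<close>; in both, \<open>x\<close> is first moved to a suitable position by
  \<open>change_basis\<close>.\<close>

lemma (in dual_pair) right_basis_dual:
  assumes left: "is_pair_basis L V s t"
  shows "\<exists>u w. is_pair_basis L (right_mod U) u w"
proof (cases "\<exists>z\<in>carrier V. z \<noteq> \<zero>\<^bsub>V\<^esub> \<and> (\<forall>a\<in>carrier L. \<exists>c\<in>carrier M. a \<odot>\<^bsub>V\<^esub> z = rsmult V z c)")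
  case True
  then obtain z where z: "z \<in> carrier V" "z \<noteq> \<zero>\<^bsub>V\<^esub>"
    "\<And>a. a \<in> carrier L \<Longrightarrow> \<exists>c\<in>carrier M. a \<odot>\<^bsub>V\<^esub> z = rsmult V z c" by blast
  obtain w where "is_pair_basis M (right_mod V) z w"
    using fspace.is_pair_basis_extend[OF V.right_fspace right_basis] z by auto
  then obtain z' w' where "dual_pair L M V U p z w z' w'" using change_basis by blast
  then have "is_pair_basis L (right_mod U) z' w'"
    by (rule dual_pair.right_basis_dual_stable_line[OF _ left z(3)])
  then show ?thesis by blast
next
  case False
  then have unstable: "\<And>z. z \<in> carrier V \<Longrightarrow> z \<noteq> \<zero>\<^bsub>V\<^esub> \<Longrightarrow>
      \<exists>a\<in>carrier L. \<forall>c\<in>carrier M. a \<odot>\<^bsub>V\<^esub> z \<noteq> rsmult V z c" by blast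
  obtain g where g: "g \<in> carrier L" "\<forall>c\<in>carrier M. g \<odot>\<^bsub>V\<^esub> x \<noteq> rsmult V x c"
    using unstable[OF bases_closed(1) x_nonzero] by blast
  have "is_pair_basis M (right_mod V) x (g \<odot>\<^bsub>V\<^esub> x)"
    by (rule fspace.is_pair_basis_exchange[OF V.right_fspace right_basis]) (use g x_nonzero in auto)
  then obtain v' w' where dp: "dual_pair L M V U p x (g \<odot>\<^bsub>V\<^esub> x) v' w'" using change_basis by blast
  have "\<exists>h. is_pair_basis L (right_mod U) v' (h \<odot>\<^bsub>U\<^esub> v')"
    by (rule dual_pair.right_basis_dual_unstable[OF dp left g(1) refl]) (rule unstable)
  then show ?thesis by blast
qed

text \<open>Exchanging the two sides of a bimodule turns left duals into right duals.\<close>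

definition flip :: "('k, 'v) bimodule \<Rightarrow> ('k, 'v) bimodule" where
  "flip V = V\<lparr>module.smult := (\<lambda>b v. rsmult V v b), rsmult := (\<lambda>v a. a \<odot>\<^bsub>V\<^esub> v)\<rparr>"

lemma flip_sel [simp]:
  "carrier (flip V) = carrier V" "\<zero>\<^bsub>flip V\<^esub> = \<zero>\<^bsub>V\<^esub>" "v \<oplus>\<^bsub>flip V\<^esub> w = v \<oplus>\<^bsub>V\<^esub> w"
  "a \<odot>\<^bsub>flip V\<^esub> v = rsmult V v a" "rsmult (flip V) v a = a \<odot>\<^bsub>V\<^esub> v"
  by (simp_all add: flip_def)

lemma flip_flip [simp]: "flip (flip V) = V"
  by (simp add: flip_def)

text \<open>The module axioms see only the carrier, the zero, the addition and the scalar action,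
  and flipped records agree with known modules in these fields.\<close>

lemma module_cong:
  assumes "module R N" and "carrier N' = carrier N" "zero N' = zero N" "add N' = add N"
    "module.smult N' = module.smult N"
  shows "module R N'"
proof -
  interpret module R N by (rule assms(1))
  have "\<exists>y\<in>carrier N. y \<oplus>\<^bsub>N\<^esub> x = \<zero>\<^bsub>N\<^esub>" if "x \<in> carrier N" for x
    using M.l_neg[OF that] that by (intro bexI[of _ "\<ominus>\<^bsub>N\<^esub> x"]) simp_all
  then show ?thesis
    by (intro moduleI abelian_groupI R.cring_axioms)
      (simp_all add: assms(2-5) M.a_ac smult_l_distr smult_r_distr smult_assoc1)
qed

lemma bimodule_fields_flip:
  assumes "bimodule_fields L M V"
  shows "bimodule_fields M L (flip V)"
proof -
  interpret bimodule_fields L M V by (rule assms)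
  show ?thesis
  proof (intro bimodule_fields.intro bimodule.intro)
    show "module M (flip V)"
      by (rule module_cong[OF right_module]) (simp_all add: flip_def right_mod_def)
    show "module L (right_mod (flip V))"
      by (rule module_cong[OF left_module]) (simp_all add: flip_def right_mod_def)
  qed (simp_all add: smult_rsmult L.field_axioms M.field_axioms)
qed

lemma bimodule_pairing_flip:
  assumes "bimodule_pairing L M V U p"
  shows "bimodule_pairing L M (flip U) (flip V) (\<lambda>u v. p v u)"
proof -
  interpret bimodule_pairing L M V U p by (rule assms)
  show ?thesis
    by (intro bimodule_pairing.intro bimodule_fields_flip U.bimodule_fields_axioms V.bimodule_fields_axioms
        bimodule_pairing_axioms.intro)
      (simp_all add: p_add_left p_add_right p_rsmult p_smult p_middle V.M.m_comm)
qed

text \<open>The symmetry by which \<open>right_basis_dual\<close> also yields left bases, one step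
  further down the sequence of duals.\<close>

lemma dual_pair_flip:
  assumes "dual_pair L M V U p x y x' y'"
  shows "dual_pair L M (flip U) (flip V) (\<lambda>u v. p v u) x' y' x y"
proof -
  interpret dual_pair L M V U p x y x' y' by (rule assms)
  show ?thesis
    by (intro dual_pair.intro bimodule_pairing_flip bimodule_pairing_axioms dual_pair_axioms.intro)
      (simp_all add: expand_left[symmetric] expand_right[symmetric])
qed

lemma is_pair_basis_flip [simp]:
  "is_pair_basis R (right_mod (flip V)) = is_pair_basis R V" "is_pair_basis R (flip V) = is_pair_basis R (right_mod V)"
  by (simp_all add: is_pair_basis_def fun_eq_iff)

text \<open>Surjectivity of the isomorphism onto the right dual gives representability, and its
  injectivity, functionals being extensional, gives faithfulness.\<close>

lemma dual_pair_right_dual: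
  assumes V: "bimodule_fields L M V" and U: "bimodule_fields M L U"
    and iso: "bimodule_iso M L U (right_dual L M V) f" and basis: "is_pair_basis M (right_mod V) x y"
  shows "\<exists>x' y'. dual_pair L M V U (\<lambda>v u. f u v) x y x' y'"
proof -
  interpret V: bimodule_fields L M V by (rule V)
  interpret U: bimodule_fields M L U by (rule U)
  have f: "bij_betw f (carrier U) (carrier (right_dual L M V))" using iso by (simp add: bimodule_iso_def)
  have mem: "f u \<in> carrier (right_dual L M V)" if "u \<in> carrier U" for u using f that by (rule bij_betwE[rule_format])
  have memM: "f u v \<in> carrier M" if "u \<in> carrier U" "v \<in> carrier V" for u v
    using mem[OF that(1)] that(2) by (auto simp: right_dual_def)
  interpret bimodule_pairing L M V U "\<lambda>v u. f u v"
  proof (intro bimodule_pairing.intro V U bimodule_pairing_axioms.intro)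
  qed (use iso mem memM in \<open>auto simp: bimodule_iso_def right_dual_def\<close>)
  show ?thesis
  proof (rule dual_pairI[OF _ _ basis])
    fix g assume g: "\<And>v. v \<in> carrier V \<Longrightarrow> g v \<in> carrier M"
      "\<And>v w. v \<in> carrier V \<Longrightarrow> w \<in> carrier V \<Longrightarrow> g (v \<oplus>\<^bsub>V\<^esub> w) = g v \<oplus>\<^bsub>M\<^esub> g w"
      "\<And>v b. v \<in> carrier V \<Longrightarrow> b \<in> carrier M \<Longrightarrow> g (rsmult V v b) = g v \<otimes>\<^bsub>M\<^esub> b"
    have "restrict g (carrier V) \<in> carrier (right_dual L M V)" by (simp add: right_dual_def g)
    then obtain u where "u \<in> carrier U" "f u = restrict g (carrier V)"
      using f by (metis bij_betw_imp_surj_on imageE)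
    then show "\<exists>u\<in>carrier U. \<forall>v\<in>carrier V. f u v = g v" by (intro bexI[of _ u]) auto
  next
    fix u u' assume u: "u \<in> carrier U" "u' \<in> carrier U" and eq: "\<And>v. v \<in> carrier V \<Longrightarrow> f u v = f u' v"
    have "f u \<in> extensional (carrier V)" "f u' \<in> extensional (carrier V)"
      using mem[OF u(1)] mem[OF u(2)] by (auto simp: right_dual_def PiE_def)
    then have "f u = f u'" using eq by (rule extensionalityI)
    then show "u = u'" using f u by (auto dest: bij_betw_imp_inj_on inj_onD)
  qed
qed

text \<open>Over a commutative field \<open>c \<phi>(v)\<close> and \<open>\<phi>(v) c\<close>
  coincide, so the left dual of \<open>U\<close> is the flipped right dual of the flipped
  \<open>U\<close>, and the case of right duals applies.\<close>

lemma dual_pair_left_dual: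
  assumes V: "bimodule_fields L M V" and U: "bimodule_fields M L U"
    and iso: "bimodule_iso L M V (left_dual M L U) f" and basis: "is_pair_basis M U x' y'"
  shows "\<exists>x y. dual_pair L M V U f x y x' y'"
proof -
  interpret V: bimodule_fields L M V by (rule V)
  interpret U: bimodule_fields M L U by (rule U)
  have dual: "left_dual M L U = flip (right_dual L M (flip U))"
  proof -
    have "{\<phi> \<in> carrier U \<rightarrow>\<^sub>E carrier M. (\<forall>v\<in>carrier U. \<forall>w\<in>carrier U. \<phi> (v \<oplus>\<^bsub>U\<^esub> w) = \<phi> v \<oplus>\<^bsub>M\<^esub> \<phi> w) \<and>
          (\<forall>v\<in>carrier U. \<forall>c\<in>carrier M. \<phi> (c \<odot>\<^bsub>U\<^esub> v) = c \<otimes>\<^bsub>M\<^esub> \<phi> v)} =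
        {\<phi> \<in> carrier U \<rightarrow>\<^sub>E carrier M. (\<forall>v\<in>carrier U. \<forall>w\<in>carrier U. \<phi> (v \<oplus>\<^bsub>U\<^esub> w) = \<phi> v \<oplus>\<^bsub>M\<^esub> \<phi> w) \<and>
          (\<forall>v\<in>carrier U. \<forall>c\<in>carrier M. \<phi> (c \<odot>\<^bsub>U\<^esub> v) = \<phi> v \<otimes>\<^bsub>M\<^esub> c)}"
      by (rule Collect_cong) (auto simp: PiE_iff V.M.m_comm)
    then show ?thesis by (simp add: left_dual_def right_dual_def flip_def)
  qed
  have "bimodule_iso M L (flip V) (right_dual L M (flip U)) f"
    using iso unfolding dual bimodule_iso_def by simp
  from dual_pair_right_dual[OF bimodule_fields_flip[OF U] bimodule_fields_flip[OF V] this, of x' y'] basis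
  obtain x y where "dual_pair L M (flip U) (flip V) (\<lambda>u v. f v u) x' y' x y" by auto
  from dual_pair_flip[OF this] show ?thesis by auto
qed

text \<open>Left and right bases of every \<open>W n\<close> are carried along simultaneously. Going
  up, a right basis of \<open>W n\<close> gives the dual pair at \<open>n\<close>, which has a left
  basis of \<open>W (n + 1)\<close> built in, and \<open>right_basis_dual\<close> adds a right
  basis. Going down, the roles of left and right are exchanged by flipping.\<close>

lemma dual_sequence_dual_pair:
  fixes K :: "int \<Rightarrow> 'k ring" and V :: "('k, 'w) bimodule"
  assumes K: "\<And>n. field (K n)" "\<And>n. K (n + 2) = K n"
    and rank: "rank_two_bimodule (K 0) (K 1) V" and seq: "dual_sequence K V W \<theta>"
  shows "\<exists>x y x' y'. dual_pair (K n) (K (n + 1)) (W n) (W (n + 1)) (pairing \<theta> n) x y x' y'"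
proof -
  interpret dual_sequence K V W \<theta> by (rule seq)
  have W: "bimodule_fields (K n) (K (n + 1)) (W n)" for n
    by (intro bimodule_fields.intro bimodules K(1))
  have K_next: "K (n + 1 + 1) = K n" for n using K(2)[of n] by (simp add: add.commute[of 2 n])
  have W': "bimodule_fields (K (n + 1)) (K n) (W (n + 1))" for n
    using W[of "n + 1"] unfolding K_next .
  define left where "left n \<longleftrightarrow> (\<exists>s t. is_pair_basis (K n) (W n) s t)" for n
  define right where "right n \<longleftrightarrow> (\<exists>s t. is_pair_basis (K (n + 1)) (right_mod (W n)) s t)" for n
  define D where "D n \<longleftrightarrow> (\<exists>x y x' y'. dual_pair (K n) (K (n + 1)) (W n) (W (n + 1)) (pairing \<theta> n) x y x' y')" for n
  have D_bases: "left (n + 1) \<and> right n" if D: "D n" for n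
  proof -
    obtain x y x' y' where dp: "dual_pair (K n) (K (n + 1)) (W n) (W (n + 1)) (pairing \<theta> n) x y x' y'"
      using D unfolding D_def by blast
    show ?thesis unfolding left_def right_def using dual_pair.left_basis[OF dp] dual_pair.right_basis[OF dp] by blast
  qed
  have D_up: "right (n + 1)" if D: "D n" and left: "left n" for n
  proof -
    obtain s t where st: "is_pair_basis (K n) (W n) s t" using left unfolding left_def by blast
    obtain x y x' y' where "dual_pair (K n) (K (n + 1)) (W n) (W (n + 1)) (pairing \<theta> n) x y x' y'"
      using D unfolding D_def by blast
    from dual_pair.right_basis_dual[OF this st] show ?thesis unfolding right_def K_next .
  qed
  have D_down: "left n" if D: "D n" and right: "right (n + 1)" for n
  proof -
    obtain s t where st: "is_pair_basis (K n) (flip (W (n + 1))) s t" using right unfolding right_def K_next by auto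
    obtain x y x' y' where "dual_pair (K n) (K (n + 1)) (W n) (W (n + 1)) (pairing \<theta> n) x y x' y'"
      using D unfolding D_def by blast
    from dual_pair.right_basis_dual[OF dual_pair_flip[OF this] st] show ?thesis unfolding left_def by simp
  qed
  have pos: "D n" if n: "n \<ge> 0" and b: "right n" for n
  proof -
    have eq: "pairing \<theta> n = (\<lambda>v u. \<theta> n u v)" using n by (simp add: pairing_def fun_eq_iff)
    obtain x y where "is_pair_basis (K (n + 1)) (right_mod (W n)) x y" using b unfolding right_def by blast
    from dual_pair_right_dual[OF W W' right_duals[OF n] this] show ?thesis unfolding D_def eq by blast
  qed
  have neg: "D n" if n: "n < 0" and b: "left (n + 1)" for n
  proof -
    have eq: "pairing \<theta> n = \<theta> n" using n by (simp add: pairing_def fun_eq_iff)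
    obtain x y where "is_pair_basis (K (n + 1)) (W (n + 1)) x y" using b unfolding left_def by blast
    from dual_pair_left_dual[OF W W' left_duals[OF n] this] show ?thesis unfolding D_def eq by blast
  qed
  have "left 0" "right 0"
    using fspace.has_dimension_2_is_pair_basis[OF bimodule_fields.right_fspace[OF W[of 0]]]
      fspace.has_dimension_2_is_pair_basis[of "K 0" "W 0"] rank_two_bimodule.left_dimension[OF rank]
      rank_two_bimodule.right_dimension[OF rank] start bimodule.left_module[OF bimodules[of 0]] K(1)
    unfolding left_def right_def by (auto simp: fspace_def)
  then have up: "left (int m) \<and> right (int m)" for m
  proof (induction m)
    case (Suc m)
    have D: "D (int m)" by (rule pos) (use Suc in simp_all)
    have "int (Suc m) = int m + 1" by simp
    then show ?case using D_bases[OF D] D_up[OF D] Suc by metis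
  qed simp
  have down: "left (- int m) \<and> right (- int m)" for m
  proof (induction m)
    case (Suc m)
    \<comment> \<open>For negative indices the dual pair at \<open>n\<close> is built from a left
      basis of \<open>W (n + 1)\<close>, the bimodule reached one step before.\<close>
    have eq: "- int (Suc m) + 1 = - int m" by simp
    have D: "D (- int (Suc m))" by (rule neg, simp, unfold eq) (use Suc in simp)
    show ?case using D_bases[OF D] D_down[OF D] Suc unfolding eq by blast
  qed (use \<open>left 0\<close> \<open>right 0\<close> in simp)
  have "D n"
  proof (cases "n \<ge> 0")
    case True
    then show ?thesis using pos[of n] up[of "nat n"] by simp
  next
    case False
    then have eq: "- int (nat (- n - 1)) = n + 1" by simp
    show ?thesis using neg[of n] down[of "nat (- n - 1)"] False unfolding eq by simp
  qed
  then show ?thesis unfolding D_def .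
qed

text \<open>A choice of dual bases at every vertex, with the index of the pairing lowered by one so
  that the bases are numbered by the vertex at which they meet.\<close>

lemma dual_sequence_dual_bases:
  fixes K :: "int \<Rightarrow> 'k ring" and V :: "('k, 'w) bimodule"
  assumes K: "\<And>n. field (K n)" "\<And>n. K (n + 2) = K n"
    and rank: "rank_two_bimodule (K 0) (K 1) V" and seq: "dual_sequence K V W \<theta>"
  shows "\<exists>x y x' y'. dual_bases K W (\<lambda>n. pairing \<theta> (n - 1)) x y x' y'"
proof -
  have "\<forall>n. \<exists>q. dual_pair (K (n - 1)) (K n) (W (n - 1)) (W n) (pairing \<theta> (n - 1))
      (fst q) (fst (snd q)) (fst (snd (snd q))) (snd (snd (snd q)))"
  proof
    fix n
    obtain x y x' y' where "dual_pair (K (n - 1)) (K n) (W (n - 1)) (W n) (pairing \<theta> (n - 1)) x y x' y'"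
      using dual_sequence_dual_pair[OF K rank seq, of "n - 1"] by auto
    then show "\<exists>q. dual_pair (K (n - 1)) (K n) (W (n - 1)) (W n) (pairing \<theta> (n - 1))
      (fst q) (fst (snd q)) (fst (snd (snd q))) (snd (snd (snd q)))"
      by (intro exI[of _ "(x, y, x', y')"]) simp
  qed
  then obtain q where "\<forall>n. dual_pair (K (n - 1)) (K n) (W (n - 1)) (W n) (pairing \<theta> (n - 1))
      (fst (q n)) (fst (snd (q n))) (fst (snd (snd (q n)))) (snd (snd (snd (q n))))"
    by (rule choice[THEN exE])
  then have q: "dual_pair (K (n - 1)) (K n) (W (n - 1)) (W n) (pairing \<theta> (n - 1))
      (fst (q n)) (fst (snd (q n))) (fst (snd (snd (q n)))) (snd (snd (snd (q n))))" for n
    by (rule spec)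
  then have P: "\<And>n. bimodule_pairing (K (n - 1)) (K n) (W (n - 1)) (W n) (pairing \<theta> (n - 1))"
    by (rule dual_pair.axioms(1))
  have "dual_bases K W (\<lambda>n. pairing \<theta> (n - 1)) (\<lambda>n. fst (q n)) (\<lambda>n. fst (snd (q n)))
      (\<lambda>n. fst (snd (snd (q n)))) (\<lambda>n. snd (snd (snd (q n))))"
  proof (intro dual_bases.intro bimodule_seq.intro dual_bases_axioms.intro K(1) dual_sequence.bimodules[OF seq])
    show "K (n + 1) = K (n - 1)" for n using K(2)[of "n - 1"] by (simp add: add.commute[of 1 n])
  qed (rule bimodule_pairing.p_closed[OF P] bimodule_pairing.p_add_left[OF P] bimodule_pairing.p_add_right[OF P]
      bimodule_pairing.p_rsmult[OF P] bimodule_pairing.p_smult[OF P] bimodule_pairing.p_middle[OF P]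
      dual_pair.bases_closed[OF q] dual_pair.expand_right[OF q] dual_pair.expand_left[OF q] dual_pair.dual[OF q];
      assumption?)+
  then show ?thesis by blast
qed

theorem theorem6p2:
  fixes K0 K1 :: "'k ring" and V :: "('k, 'w) bimodule"
    and W :: "int \<Rightarrow> ('k, 'w) bimodule" and \<theta> :: "int \<Rightarrow> 'w \<Rightarrow> 'w \<Rightarrow> 'k"
  assumes "field K0" and "field K1"
    and "\<one>\<^bsub>K0\<^esub> \<oplus>\<^bsub>K0\<^esub> \<one>\<^bsub>K0\<^esub> \<noteq> \<zero>\<^bsub>K0\<^esub>" and "\<one>\<^bsub>K1\<^esub> \<oplus>\<^bsub>K1\<^esub> \<one>\<^bsub>K1\<^esub> \<noteq> \<zero>\<^bsub>K1\<^esub>"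
    and "rank_two_bimodule K0 K1 V"
    and "dual_sequence (field_seq K0 K1) V W \<theta>"
  defines "A \<equiv> nc_symmetric_algebra (field_seq K0 K1) W \<theta>"
  shows "(\<forall>i. pure_zmodule A (principal_zmodule A i) 2 \<and>
         critical_zmodule A (principal_zmodule A i) \<and>
         uniform_zmodule A (principal_zmodule A i)) \<and>
    z_domain A \<and>
    has_ring_of_fractions A"
proof -
  have "\<exists>x y x' y'. dual_bases (field_seq K0 K1) W (\<lambda>n. pairing \<theta> (n - 1)) x y x' y'"
    using assms(1,2,5,6) by (intro dual_sequence_dual_bases) (simp_all add: field_seq_def)
  then obtain x y x' y' where "dual_bases (field_seq K0 K1) W (\<lambda>n. pairing \<theta> (n - 1)) x y x' y'" by blast
  then have "\<exists>x y x' y'. ncs_algebra A x y x' y'"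
    unfolding A_def by (rule dual_bases.ncs_algebra_nc_symmetric) (rule refl)
  then obtain u v u' v' where A: "ncs_algebra A u v u' v'" by blast
  show ?thesis
    using ncs_algebra.pure[OF A] ncs_algebra.critical[OF A] ncs_algebra.uniform[OF A]
      ncs_algebra.domain[OF A] ncs_algebra.ring_of_fractions[OF A] by blast
qed

end
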